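(* Let $L>0$, $\mu=\pi/L$, $a>0$, and let $m\ge 2$ be an integer. Consider, for real-valued functions $\omega(x,t),\theta(x,t)$ that are $L$-periodic in $x\in\mathbb{R}$, the system $$\omega_t+u\,\omega_x=\theta_x,\qquad \theta_t+u\,\theta_x=0,$$ with velocity $$u(x,t)=\frac{1}{2\pi}\int_0^L \omega(y,t)\Big(\log\big|\sin^2[\mu(x-y)]\big|-\log\big|\sin^2[\mu(x-y)]+a\big|\Big)\,dy .$$ There exist smooth $L$-periodic initial data $(\omega_0,\theta_0)$ with $\int_0^L\omega_0(x)\,dx=0$ such that the corresponding solution blows up in finite time; that is, its maximal time of existence $T^*$ is finite and $$\lim_{t\nearrow T^*}\int_0^t\|u_x(\cdot,\tau)\|_{L^\infty}\,d\tau=\infty .$$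
   Context: Let $\mathbb{S}^1=\mathbb{R}/L\mathbb{Z}$. The solution with initial data $(\omega_0,\theta_0)\in H^m(\mathbb{S}^1)\times H^{m+1}(\mathbb{S}^1)$, $m\ge 2$, means the unique classical solution $(\omega,\theta)$ with $(\omega,\theta)|_{t=0}=(\omega_0,\theta_0)$ and $(\omega,\theta)\in C([0,T];H^m(\mathbb{S}^1)\times H^{m+1}(\mathbb{S}^1))$ for every $T<T^*$, where $T^*\in(0,\infty]$ denotes the maximal time of existence of such a solution (the system is locally well-posed in this class). *)

theory Defs
  imports
    "HOL-Probability.Essential_Supremum"
    "HOL-Library.Periodic_Fun"
begin

definition smooth :: "(real \<Rightarrow> real) \<Rightarrow> bool" where
  "smooth f \<longleftrightarrow> (\<forall>n x. ((deriv ^^ n) f) differentiable (at x))"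

text \<open>Functions on the circle of length \<open>L\<close> are \<open>L\<close>-periodic functions on the reals,
  and integrals over the circle are taken over the period cell \<open>{0..L}\<close>.\<close>

abbreviation circle_integral :: "real \<Rightarrow> (real \<Rightarrow> real) \<Rightarrow> real" where
  "circle_integral L f \<equiv> integral\<^sup>L (lebesgue_on {0..L}) f"

definition smooth_periodic :: "real \<Rightarrow> (real \<Rightarrow> real) \<Rightarrow> bool" where
  "smooth_periodic L f \<longleftrightarrow> smooth f \<and> periodic_fun_simple f L"

definition square_integrable :: "real \<Rightarrow> (real \<Rightarrow> real) \<Rightarrow> bool" where
  "square_integrable L f \<longleftrightarrow>
     f \<in> borel_measurable (lebesgue_on {0..L}) \<and>
     integrable (lebesgue_on {0..L}) (\<lambda>x. (f x)\<^sup>2)"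

text \<open>The test functions live on the circle, so they need not vanish at \<open>0\<close> and \<open>L\<close>.\<close>

definition has_weak_deriv ::
  "real \<Rightarrow> nat \<Rightarrow> (real \<Rightarrow> real) \<Rightarrow> (real \<Rightarrow> real) \<Rightarrow> bool" where
  "has_weak_deriv L n f g \<longleftrightarrow> square_integrable L g \<and>
     (\<forall>\<phi>. smooth_periodic L \<phi> \<longrightarrow>
        circle_integral L (\<lambda>x. f x * (deriv ^^ n) \<phi> x) =
        (-1) ^ n * circle_integral L (\<lambda>x. g x * \<phi> x))"

definition sobolev :: "real \<Rightarrow> nat \<Rightarrow> (real \<Rightarrow> real) set" where
  "sobolev L m = {f. periodic_fun_simple f L \<and> square_integrable L f \<and>
     (\<forall>n\<le>m. \<exists>g. has_weak_deriv L n f g)}"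

text \<open>Weak derivatives are unique up to null sets in the period cell, so the norm below
  does not depend on the choice made here.\<close>

definition weak_deriv :: "real \<Rightarrow> nat \<Rightarrow> (real \<Rightarrow> real) \<Rightarrow> real \<Rightarrow> real" where
  "weak_deriv L n f = (SOME g. has_weak_deriv L n f g)"

definition sobolev_norm :: "real \<Rightarrow> nat \<Rightarrow> (real \<Rightarrow> real) \<Rightarrow> real" where
  "sobolev_norm L m f = sqrt (\<Sum>n\<le>m. circle_integral L (\<lambda>x. (weak_deriv L n f x)\<^sup>2))"

definition continuous_into_sobolev ::
  "real \<Rightarrow> nat \<Rightarrow> real set \<Rightarrow> (real \<Rightarrow> real \<Rightarrow> real) \<Rightarrow> bool" where
  "continuous_into_sobolev L m I f \<longleftrightarrow>
     (\<forall>t\<in>I. (\<lambda>x. f x t) \<in> sobolev L m) \<and>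
     (\<forall>t\<in>I. ((\<lambda>s. sobolev_norm L m (\<lambda>x. f x s - f x t)) \<longlongrightarrow> 0) (at t within I))"

text \<open>The kernel is singular at \<open>x - y \<in> L\<int>\<close>, where \<open>ln 0 = 0\<close>; this affects
  only a null set of \<open>y\<close>.\<close>

definition velocity :: "real \<Rightarrow> real \<Rightarrow> (real \<Rightarrow> real) \<Rightarrow> real \<Rightarrow> real" where
  "velocity L a w x = 1 / (2 * pi) *
     circle_integral L (\<lambda>y. w y *
       (ln \<bar>(sin (pi / L * (x - y)))\<^sup>2\<bar> - ln \<bar>(sin (pi / L * (x - y)))\<^sup>2 + a\<bar>))"

definition time_interval :: "ereal \<Rightarrow> real set" where
  "time_interval T = {t. 0 \<le> t \<and> ereal t < T}"

text \<open>A classical solution on \<open>[0,T)\<close> with \<open>0 < T \<le> \<infinity>\<close>; the functions of space and time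
  are written with the space variable first. At \<open>t = 0\<close> the time derivative is one-sided.\<close>

definition classical_solution ::
  "real \<Rightarrow> real \<Rightarrow> nat \<Rightarrow> (real \<Rightarrow> real) \<Rightarrow> (real \<Rightarrow> real) \<Rightarrow> ereal \<Rightarrow>
   (real \<Rightarrow> real \<Rightarrow> real) \<Rightarrow> (real \<Rightarrow> real \<Rightarrow> real) \<Rightarrow> bool" where
  "classical_solution L a m \<omega>0 \<theta>0 T \<omega> \<theta> \<longleftrightarrow>
     0 < T \<and>
     (\<forall>x. \<omega> x 0 = \<omega>0 x \<and> \<theta> x 0 = \<theta>0 x) \<and>
     continuous_into_sobolev L m (time_interval T) \<omega> \<and>
     continuous_into_sobolev L (Suc m) (time_interval T) \<theta> \<and>
     (\<forall>t\<in>time_interval T. \<forall>x.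
        (\<lambda>y. \<omega> y t) differentiable (at x) \<and>
        (\<lambda>y. \<theta> y t) differentiable (at x) \<and>
        ((\<lambda>s. \<omega> x s) has_real_derivative
           deriv (\<lambda>y. \<theta> y t) x - velocity L a (\<lambda>y. \<omega> y t) x * deriv (\<lambda>y. \<omega> y t) x)
          (at t within time_interval T) \<and>
        ((\<lambda>s. \<theta> x s) has_real_derivative
           - velocity L a (\<lambda>y. \<omega> y t) x * deriv (\<lambda>y. \<theta> y t) x)
          (at t within time_interval T))"

text \<open>\<open>(\<omega>, \<theta>)\<close> is the unique classical solution and \<open>T\<close> is its maximal time of existence:
  every classical solution with the same data lives on a shorter or equal time interval
  and coincides with \<open>(\<omega>, \<theta>)\<close> there.\<close>

definition maximal_solution ::
  "real \<Rightarrow> real \<Rightarrow> nat \<Rightarrow> (real \<Rightarrow> real) \<Rightarrow> (real \<Rightarrow> real) \<Rightarrow> ereal \<Rightarrow>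
   (real \<Rightarrow> real \<Rightarrow> real) \<Rightarrow> (real \<Rightarrow> real \<Rightarrow> real) \<Rightarrow> bool" where
  "maximal_solution L a m \<omega>0 \<theta>0 T \<omega> \<theta> \<longleftrightarrow>
     classical_solution L a m \<omega>0 \<theta>0 T \<omega> \<theta> \<and>
     (\<forall>T' \<omega>' \<theta>'. classical_solution L a m \<omega>0 \<theta>0 T' \<omega>' \<theta>' \<longrightarrow>
        T' \<le> T \<and>
        (\<forall>t\<in>time_interval T'. \<forall>x. \<omega>' x t = \<omega> x t \<and> \<theta>' x t = \<theta> x t))"

definition Linf_norm :: "(real \<Rightarrow> real) \<Rightarrow> ennreal" where
  "Linf_norm f = e2ennreal (esssup lebesgue (\<lambda>x. ereal \<bar>f x\<bar>))"

end

theory Submission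
  imports Defs "HOL-Complex_Analysis.Complex_Analysis" "HOL-Real_Asymp.Real_Asymp"
begin

text \<open>The data are \<open>\<omega>\<^sub>0 = 0\<close> and \<open>\<theta>\<^sub>0 = (1 - cos (K x)) / K\<close> with \<open>K = 2 \<pi> / L\<close>, so that \<open>\<omega>\<close> and
  \<open>\<rho> = \<theta>\<^sub>x\<close> are sine series. Their coefficients solve a quadratic system of ordinary differential
  equations; Galerkin truncation and energy estimates give smooth local solutions, an \<open>L\<^sup>2\<close> estimate for
  differences gives uniqueness in the Sobolev class, and a second order estimate shows that a solution can
  be continued as long as the time integral of \<open>sup |u\<^sub>x|\<close> is finite. On the half period \<open>[0, h]\<close> both
  \<open>\<omega>\<close> and \<open>\<rho>\<close> stay nonnegative. With the weight \<open>cot (\<pi> x / L)\<close>, the integrals \<open>I = \<integral> \<theta> cot\<close> and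
  \<open>J = \<integral> \<theta> \<omega> cot\<close> over \<open>[0, h]\<close> satisfy \<open>I' \<ge> c J\<close> and \<open>J' \<ge> c I\<^sup>2\<close>, which is impossible for all times.
  The first inequality is a pointwise lower bound for \<open>- u cot\<close>. The second one needs
  \<open>\<integral> (\<theta> \<omega>)\<^sub>x u cot \<le> 0\<close>: the derivative in \<open>e\<close> of the kernel \<open>ln (sin\<^sup>2 + e)\<close> is rational in
  \<open>cos (K x)\<close> and \<open>cos (K y)\<close>, and after integration by parts and symmetrisation in \<open>x\<close> and \<open>y\<close> the integrand
  is nonnegative because \<open>\<theta>\<close> is nondecreasing.\<close>

text \<open>The unknowns are \<omega> and \<rho> because both then carry the same number of
  derivatives: the source in the first equation costs nothing, and the second becomes \<rho>_t = -
  (u \<rho>)_x with a velocity one derivative smoother than \<omega>. Energy estimates close on this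
  pair without loss. The growth rate of every energy contains only quantities controlled by the
  second order one. The existence time therefore depends on a single number, and a bound on that
  number is what continuation needs. The obstacle throughout is the logarithmic singularity of the
  kernel. Replacing sin^2 by sin^2 + e makes the kernel bounded, and with e = (1 - r)^2 / (4 r) its
  Fourier coefficients become - r^|k| / |k|, so that both the multiplier of the velocity and the
  limit e -> 0 can be read off. That I' >= c J and J' >= c I^2 cannot last follows from the product:
  (I J)' >= c (J^2 + I^3) >= c (I J)^(6/5).\<close>

notation (input) abs ("|_|")

abbreviation has_real_deriv :: "(real => real) => real => real filter => bool" (infix "hrd" 50) where
 "f hrd d == f has_real_derivative d"

abbreviation wt :: "int => real" where "wt k == 1 + \<bar>of_int k\<bar>"

abbreviation isum :: "('a => 'b::{comm_monoid_add, t2_space}) => 'b" (binder "ISUM " 10) where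
 "isum f == infsum f UNIV"

abbreviation in0 :: "real => (real => 'a::real_normed_vector) => 'a" where "in0 l == integral {0..l}"

abbreviation wi :: "real => real => real filter" where "wi t s == at t within {0..s}"

abbreviation co :: "'a::topological_space set => ('a => 'b::topological_space) => bool" where
 "co == continuous_on"

abbreviation ci :: "real => (real => real) => real" where "ci == circle_integral"

lemmas cin = continuous_intros
lemmas dei = derivative_eq_intros
lemmas icr = integrable_continuous_real
lemmas hk_add = Henstock_Kurzweil_Integration.integral_add
lemmas hk_diff = Henstock_Kurzweil_Integration.integral_diff
lemmas hk_nonneg = Henstock_Kurzweil_Integration.integral_nonneg
lemmas hk_combine = Henstock_Kurzweil_Integration.integral_combine
lemmas mlm = mult_left_mono
lemmas mrm = mult_right_mono
lemmas hrv = has_real_derivative_iff_has_vector_derivative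
lemmas als = algebra_simps
lemmas fsi = field_simps
lemmas coc = continuous_on_compose2
lemmas p2q = power2_eq_square
lemmas mnn = mult_nonneg_nonneg
lemmas pmd = power_mult_distrib
lemmas scr = summable_on_cmult_right

section \<open>Finite-dimensional ordinary differential equations\<close>

text \<open>The weight \<open>exp (- l * t)\<close> makes the integral operator a contraction on the
  whole half-line at once, so a global solution comes without continuing local ones. The price is a
  globally bounded and Lipschitz \<open>F\<close>; the truncated system is brought into this form by
  clamping.\<close>

lemma picard_finite_system:
 fixes F :: "(int \<Rightarrow> 'v::banach) \<Rightarrow> int \<Rightarrow> 'v"
 assumes fin: "finite I"
 and bound: "\<And>y i. i \<in> I \<Longrightarrow> norm (F y i) \<le> B"
 and lip: "\<And>y z d i. i \<in> I \<Longrightarrow> (\<And>j. j \<in> I \<Longrightarrow> norm (y j - z j) \<le> d) \<Longrightarrow> norm (F y i - F z i) \<le> K * d"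
 and K: "K > 0" and B: "B \<ge> 0"
 obtains y where "\<And>i. i \<in> I \<Longrightarrow> y i (0::real) = y0 i"
 "\<And>i t. i \<in> I \<Longrightarrow> t \<ge> 0 \<Longrightarrow>
 (y i has_vector_derivative F (\<lambda>j. y j t) i) (at t within {0..})"
proof -
 define n where "n = real (card I) + 1"
 have n: "n > 0" by (simp add: n_def add_nonneg_pos)
 \<comment> \<open>The factor \<open>n\<close> compensates for the loss in \<open>hat_sum\<close>,
   where the hats of all indices are added; together with the 2 it leaves the contraction constant
   1/2.\<close>
 define l where "l = 2 * K * n"
 have l: "l > 0" using K n by (simp add: l_def)
 \<comment> \<open>The unknown \<open>y\<^sub>i(t)\<close> is the value at \<open>(i, t)\<close> of a continuous function on the plane,
 which interpolates between the indices by hat functions.\<close>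
 define hat where "hat = (\<lambda>x i. max 0 (1 - \<bar>x - of_int i :: real\<bar>))"
 have hat: "0 \<le> hat x i" "hat x i \<le> 1" "continuous_on S (\<lambda>p. hat (fst p) i)" for x i and S :: "(real \<times> real) set"
 by (auto simp: hat_def intro!: continuous_intros)
 have hat_int: "hat (of_int j) i = (if i = j then 1 else 0)" for i j
 proof (cases "i = j")
 case False
 then have "1 \<le> \<bar>of_int j - of_int i :: real\<bar>" by linarith
 then show ?thesis using False by (simp add: hat_def)
 qed (simp add: hat_def)
 have hat_sum: "norm (\<Sum>i\<in>I. hat x i *\<^sub>R g i) \<le> n * c" if "\<And>i. i \<in> I \<Longrightarrow> norm (g i) \<le> c" "c \<ge> 0" for x c and g :: "int \<Rightarrow> 'v"
 proof -
 have "norm (\<Sum>i\<in>I. hat x i *\<^sub>R g i) \<le> (\<Sum>i\<in>I. 1 * c)"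
 proof (rule sum_norm_le)
 fix i assume "i \<in> I"
 then show "norm (hat x i *\<^sub>R g i) \<le> 1 * c"
 unfolding norm_scaleR using hat(1,2)[of x i] that by (intro mult_mono) auto
 qed
 also have "\<dots> \<le> n * c" using that(2) by (simp add: n_def distrib_right)
 finally show ?thesis .
 qed
 define v where "v = (\<lambda>(h :: (real \<times> real) \<Rightarrow>\<^sub>C 'v) i s. F (\<lambda>j. exp (l * s) *\<^sub>R h (of_int j, s)) i)"
 have hc: "continuous_on UNIV (\<lambda>s. apply_bcontfun h (of_int j, s))" for h :: "(real \<times> real) \<Rightarrow>\<^sub>C 'v" and j
 by (rule continuous_on_compose2[OF continuous_on_apply_bcontfun[of UNIV h]]) (auto intro!: continuous_intros)
 have lipc: "continuous_on S (\<lambda>s. F (\<lambda>j. g j s) i)"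
 if g: "\<And>j. j \<in> I \<Longrightarrow> continuous_on S (g j)" and i: "i \<in> I" for S :: "real set" and g i
 unfolding continuous_on_iff
 proof (intro ballI allI impI)
 fix x and e :: real assume x: "x \<in> S" and e: "e > 0"
 define d where "d = e / (2 * K)"
 have d: "d > 0" using e K by (simp add: d_def)
 have "\<forall>j\<in>I. eventually (\<lambda>x'. dist (g j x') (g j x) < d) (at x within S)"
 using g x d by (auto simp: continuous_on_def tendsto_iff)
 then have "eventually (\<lambda>x'. \<forall>j\<in>I. dist (g j x') (g j x) < d) (at x within S)"
 using fin by (simp add: eventually_ball_finite_distrib)
 then obtain \<delta> where \<delta>: "\<delta> > 0" "\<And>x'. x' \<in> S \<Longrightarrow> x' \<noteq> x \<Longrightarrow> dist x' x < \<delta> \<Longrightarrow> \<forall>j\<in>I. dist (g j x') (g j x) < d"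
 unfolding eventually_at by blast
 show "\<exists>\<delta>>0. \<forall>x'\<in>S. dist x' x < \<delta> \<longrightarrow> dist (F (\<lambda>j. g j x') i) (F (\<lambda>j. g j x) i) < e"
 proof (intro exI conjI ballI impI)
 fix x' assume x': "x' \<in> S" "dist x' x < \<delta>"
 have "\<forall>j\<in>I. dist (g j x') (g j x) \<le> d"
 using \<delta>(2)[OF x'(1) _ x'(2)] d by (cases "x' = x") (auto intro: less_imp_le)
 then have "norm (F (\<lambda>j. g j x') i - F (\<lambda>j. g j x) i) \<le> K * d"
 by (intro lip i) (auto simp: dist_norm)
 also have "K * d < e" using e K by (simp add: d_def)
 finally show "dist (F (\<lambda>j. g j x') i) (F (\<lambda>j. g j x) i) < e" by (simp add: dist_norm)
 qed (rule \<delta>(1))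
 qed
 have vc: "continuous_on S (v h i)" if "i \<in> I" for S h i
 unfolding v_def
 by (rule lipc[OF _ that])
 (auto intro!: continuous_intros continuous_on_subset[OF hc])
 \<comment> \<open>Picard's integral operator for the rescaled unknown \<open>exp (- l * t)\<close>
   times y. Clamping at \<open>max 0 t\<close> extends it by a constant to negative times, which
   makes it continuous on the whole plane.\<close>
 define G where "G = (\<lambda>(h :: (real \<times> real) \<Rightarrow>\<^sub>C 'v) i t.
 if i \<in> I then exp (- l * max 0 t) *\<^sub>R (y0 i + integral {0..max 0 t} (v h i)) else 0)"
 have Gc: "continuous_on UNIV (G h i)" for h i
 proof (cases "i \<in> I")
 case True
 have "continuous_on UNIV (\<lambda>t. integral {0..max 0 t} (v h i))"
 proof (rule continuous_at_imp_continuous_on, rule ballI)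
 fix t :: real
 have "continuous_on {0..max 0 t + 1} (\<lambda>x. integral {0..x} (v h i))"
 by (intro indefinite_integral_continuous_1 integrable_continuous_real vc True)
 moreover have "continuous_on {t-1..t+1} (\<lambda>t::real. max 0 t)" by (intro continuous_intros)
 moreover have "(\<lambda>t::real. max 0 t) ` {t-1..t+1} \<subseteq> {0..max 0 t + 1}" by auto
 ultimately have "continuous_on {t-1..t+1} (\<lambda>t. integral {0..max 0 t} (v h i))"
 by (rule continuous_on_compose2)
 then show "isCont (\<lambda>t. integral {0..max 0 t} (v h i)) t"
 by (rule continuous_on_interior) auto
 qed
 then show ?thesis using True unfolding G_def by (auto intro!: continuous_intros)
 qed (simp add: G_def)
 \<comment> \<open>The integral grows at most linearly in time; the exponential weight turns this
   into the uniform bound that membership in \<open>bcontfun\<close> demands.\<close>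
 have te: "exp (- l * t) * t \<le> 1 / l" if "t \<ge> 0" for t :: real
 proof -
 have "l * t \<le> exp (l * t)" using exp_ge_add_one_self[of "l * t"] by linarith
 then show ?thesis using l by (simp add: exp_minus field_simps)
 qed
 have Gb: "norm (G h i t) \<le> (\<Sum>j\<in>I. norm (y0 j)) + B / l" for h i t
 proof (cases "i \<in> I")
 case True
 let ?t = "max 0 t"
 have "norm (integral {0..?t} (v h i)) \<le> B * (?t - 0)"
 by (intro integral_bound vc True) (auto simp: v_def intro: bound True)
 then have "exp (- l * ?t) * norm (integral {0..?t} (v h i)) \<le> exp (- l * ?t) * (B * ?t)"
 by (intro mult_left_mono) auto
 also have "\<dots> = B * (exp (- l * ?t) * ?t)" by simp
 also have "\<dots> \<le> B * (1 / l)" by (intro mult_left_mono te B) auto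
 finally have 1: "exp (- l * ?t) * norm (integral {0..?t} (v h i)) \<le> B / l" by simp
 have 2: "exp (- l * ?t) * norm (y0 i) \<le> 1 * norm (y0 i)"
 using l by (intro mult_right_mono) auto
 have 3: "norm (y0 i) \<le> (\<Sum>j\<in>I. norm (y0 j))" using True fin by (intro member_le_sum) auto
 have "norm (G h i t) \<le> exp (- l * ?t) * (norm (y0 i) + norm (integral {0..?t} (v h i)))"
 using True by (auto simp: G_def intro!: mult_left_mono norm_triangle_ineq)
 then show ?thesis using 1 2 3 by (simp add: distrib_left)
 next
 case False
 then show ?thesis using B l by (simp add: G_def sum_nonneg)
 qed
 define P where "P = (\<lambda>h. Bcontfun (\<lambda>p. \<Sum>i\<in>I. hat (fst p) i *\<^sub>R G h i (snd p)))"
 have Pin: "(\<lambda>p. \<Sum>i\<in>I. hat (fst p) i *\<^sub>R G h i (snd p)) \<in> bcontfun" for h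
 proof -
 have "continuous_on UNIV (\<lambda>p. \<Sum>i\<in>I. hat (fst p) i *\<^sub>R G h i (snd p))"
 by (intro continuous_intros hat continuous_on_compose2[OF Gc]) auto
 moreover have "norm (\<Sum>i\<in>I. hat (fst p) i *\<^sub>R G h i (snd p)) \<le> n * ((\<Sum>j\<in>I. norm (y0 j)) + B / l)" for p
 using B l by (intro hat_sum Gb) (auto intro!: add_nonneg_nonneg sum_nonneg)
 ultimately show ?thesis unfolding bcontfun_def
 by (auto simp: bounded_iff intro!: exI[of _ "n * ((\<Sum>j\<in>I. norm (y0 j)) + B / l)"])
 qed
 have Papp: "apply_bcontfun (P h) p = (\<Sum>i\<in>I. hat (fst p) i *\<^sub>R G h i (snd p))" for h p
 using Bcontfun_inverse[OF Pin] by (simp add: P_def)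
 have Papp_int: "apply_bcontfun (P h) (of_int i, t) = G h i t" if "i \<in> I" for h i t
 proof -
 have "apply_bcontfun (P h) (of_int i, t) = (\<Sum>j\<in>I. if j = i then G h j t else 0)"
 unfolding Papp by (intro sum.cong) (auto simp: hat_int)
 then show ?thesis using that fin by simp
 qed
 have "\<exists>!h. P h = h"
 proof (rule banach_fix_type[of "1/2"])
 show "\<forall>x y. dist (P x) (P y) \<le> 1 / 2 * dist x y"
 proof (intro allI dist_bound)
 fix x y :: "(real \<times> real) \<Rightarrow>\<^sub>C 'v" and p :: "real \<times> real"
 let ?t = "max 0 (snd p)"
 have "norm (G x i (snd p) - G y i (snd p)) \<le> dist x y / (2 * n)" if True: "i \<in> I" for i
 proof -
 have vd: "norm (v x i s - v y i s) \<le> K * (exp (l * s) * dist x y)" for s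
 unfolding v_def
 proof (rule lip[OF True])
 fix j
 have "norm (x (of_int j, s) - y (of_int j, s)) \<le> dist x y"
 using dist_bounded[of x "(of_int j, s)" y] by (simp add: dist_norm)
 then show "norm (exp (l * s) *\<^sub>R x (of_int j, s) - exp (l * s) *\<^sub>R y (of_int j, s)) \<le> exp (l * s) * dist x y"
 by (simp flip: scaleR_diff_right)
 qed
 have I: "((\<lambda>s. K * (exp (l * s) * dist x y)) has_integral
 (K * (exp (l * ?t) / l * dist x y) - K * (exp (l * 0) / l * dist x y))) {0..?t}"
 by (rule fundamental_theorem_of_calculus)
 (use l in \<open>auto intro!: derivative_eq_intros simp flip: has_real_derivative_iff_has_vector_derivative\<close>)
 have "norm (integral {0..?t} (v x i) - integral {0..?t} (v y i))
 = norm (integral {0..?t} (\<lambda>s. v x i s - v y i s))"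
 by (subst Henstock_Kurzweil_Integration.integral_diff) (auto intro!: integrable_continuous_real vc True)
 also have "\<dots> \<le> integral {0..?t} (\<lambda>s. K * (exp (l * s) * dist x y))"
 by (rule integral_norm_bound_integral)
 (use vd in \<open>auto intro!: integrable_continuous_real continuous_intros vc True\<close>)
 also have "\<dots> \<le> K * (exp (l * ?t) / l * dist x y)"
 unfolding integral_unique[OF I] using K l by (simp add: field_simps)
 also have "\<dots> = exp (l * ?t) * (dist x y / (2 * n))" using K by (simp add: l_def)
 finally have "exp (- l * ?t) * norm (integral {0..?t} (v x i) - integral {0..?t} (v y i))
 \<le> exp (- l * ?t) * (exp (l * ?t) * (dist x y / (2 * n)))"
 by (intro mult_left_mono) auto
 also have "\<dots> = dist x y / (2 * n)" by (simp add: exp_minus)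
 finally show ?thesis
 using True by (simp add: G_def flip: scaleR_diff_right)
 qed
 then have "norm (\<Sum>i\<in>I. hat (fst p) i *\<^sub>R (G x i (snd p) - G y i (snd p))) \<le> n * (dist x y / (2 * n))"
 using n by (intro hat_sum) auto
 then show "dist (P x p) (P y p) \<le> 1 / 2 * dist x y"
 using n by (simp add: Papp dist_norm scaleR_diff_right sum_subtractf)
 qed
 qed auto
 then obtain h where h: "P h = h" by blast
 define y where "y = (\<lambda>i t. exp (l * t) *\<^sub>R apply_bcontfun h (of_int i, t))"
 have yint: "y i t = y0 i + integral {0..t} (\<lambda>s. F (\<lambda>j. y j s) i)" if "i \<in> I" "t \<ge> 0" for i t
 proof -
 have "apply_bcontfun h (of_int i, t) = G h i t" using Papp_int[OF that(1), of h t] h by simp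
 then show ?thesis using that by (simp add: y_def G_def v_def exp_minus)
 qed
 have yc: "continuous_on S (\<lambda>s. F (\<lambda>j. y j s) i)" if "i \<in> I" for i S
 unfolding y_def by (rule lipc[OF _ that]) (auto intro!: continuous_intros continuous_on_subset[OF hc])
 show ?thesis
 proof
 show "y i 0 = y0 i" if "i \<in> I" for i using yint[OF that, of 0] by simp
 show "(y i has_vector_derivative F (\<lambda>j. y j t) i) (at t within {0..})" if "i \<in> I" "t \<ge> 0" for i t
 proof -
 have "((\<lambda>u. integral {0..u} (\<lambda>s. F (\<lambda>j. y j s) i)) has_vector_derivative F (\<lambda>j. y j t) i) (at t within {0..t+1})"
 by (rule integral_has_vector_derivative) (use that yc in auto)
 then have "((\<lambda>u. y0 i + integral {0..u} (\<lambda>s. F (\<lambda>j. y j s) i)) has_vector_derivative F (\<lambda>j. y j t) i) (at t within {0..t+1})"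
 by (auto intro!: derivative_eq_intros)
 then have "(y i has_vector_derivative F (\<lambda>j. y j t) i) (at t within {0..t+1})"
 by (rule has_vector_derivative_transform[rotated 2]) (use that yint in auto)
 moreover have "at t within {0..t+1} = at t within {0..}"
 by (rule at_within_nhd[of _ "{t-1<..<t+1}"]) auto
 ultimately show ?thesis by simp
 qed
 qed
qed

section \<open>Galerkin approximation of the coefficient system\<close>

lemma power_mult_le_sum_powers:
 fixes a b :: real
 assumes "a >= 0" "b >= 0"
 shows "a ^ i * b ^ j <= a ^ (i + j) + b ^ (i + j)"
proof (cases "a <= b")
 case True
 hence "a ^ i * b ^ j <= b ^ i * b ^ j" using assms by (intro mrm power_mono) auto
 moreover have "0 <= a ^ (i + j)" using assms by simp
 ultimately show ?thesis by (simp add: power_add)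
next
 case False
 hence "a ^ i * b ^ j <= a ^ i * a ^ j" using assms by (intro mlm power_mono) auto
 moreover have "0 <= b ^ (i + j)" using assms by simp
 ultimately show ?thesis by (simp add: power_add)
qed

lemma power_le_split:
 fixes x y z :: real
 assumes "0 <= x" "0 <= y" "0 <= z" "x <= y + z"
 shows "x ^ n <= 2 ^ n * (y ^ n + z ^ n)"
proof -
 have "x <= 2 * max y z" using assms by (cases "y <= z") (auto simp: max_def)
 hence "x ^ n <= (2 * max y z) ^ n" using assms by (intro power_mono) auto
 also have "... = 2 ^ n * max y z ^ n" by (rule pmd)
 also have "... <= 2 ^ n * (y ^ n + z ^ n)"
 using assms by (intro mlm) (auto simp: max_def)
 finally show ?thesis .
qed

text \<open>x, y, z play the roles of |k|, |l|, |k - l|. Of the p powers of x, s are kept and the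
  other p - s are moved to y and z. Every monomial of degree 2 s is thus reduced to the two shapes
  that an energy of order s can bound.\<close>

lemma mixed_power_bound:
 fixes x y z :: real
 assumes xyz: "0 <= x" "0 <= y" "0 <= z" "x <= y + z" and s: "s >= 1" and p: "s <= p" "p < 2 * s"
 shows "x ^ p * y ^ (2 * s - p) <= 2 ^ s * 2 * (x ^ s * y ^ s + z ^ (s - 1) * (x ^ s * y))"
proof -
 define i j where "i = p - s" and "j = 2 * s - p - 1"
 have ij: "i + j = s - 1" "p = s + i" "2 * s - p = Suc j" "i + Suc j = s" "i <= s"
 using assms by (auto simp: i_def j_def)
 have "x ^ i <= 2 ^ i * (y ^ i + z ^ i)" by (rule power_le_split[OF xyz])
 also have "... <= 2 ^ s * (y ^ i + z ^ i)"
 using ij xyz by (intro mrm power_increasing) auto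
 finally have "x ^ s * x ^ i * y ^ Suc j <= x ^ s * (2 ^ s * (y ^ i + z ^ i)) * y ^ Suc j"
 using xyz by (intro mrm mlm) auto
 also have "... = 2 ^ s * x ^ s * (y ^ (i + Suc j) + (z ^ i * y ^ j) * y)"
 by (simp add: als power_add)
 also have "... <= 2 ^ s * x ^ s * (y ^ s + (z ^ (s - 1) + y ^ (s - 1)) * y)"
 proof -
 have "z ^ i * y ^ j <= z ^ (s - 1) + y ^ (s - 1)"
 using power_mult_le_sum_powers[of z y i j] ij xyz by simp
 thus ?thesis using ij xyz by (intro mlm add_mono mrm) auto
 qed
 also have "... = 2 ^ s * (2 * (x ^ s * y ^ s) + z ^ (s - 1) * (x ^ s * y))"
 proof -
 have "y ^ (s - 1) * y = y ^ s" using s by (simp add: power_eq_if)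
 hence "x ^ s * (y ^ (s - 1) * y) = x ^ s * y ^ s" by simp
 thus ?thesis by (simp add: als)
 qed
 also have "... <= 2 ^ s * (2 * (x ^ s * y ^ s) + 2 * (z ^ (s - 1) * (x ^ s * y)))"
 using xyz by (intro mlm add_mono) auto
 finally show ?thesis using ij by (simp add: power_add als)
qed

text \<open>The difference equals x y (x^(2 s - 1) - y^(2 s - 1)) and hence contains the factor x -
  y. Multiplied by |x y|, each monomial of the remaining geometric sum has degree 2 s with both
  exponents positive, and the larger exponent decides in which order
  \<open>mixed_power_bound\<close> is applied.\<close>

lemma mult_power_diff_bound:
 fixes x y :: real
 assumes s: "s >= 1"
 shows "|x ^ (2 * s) * y - y ^ (2 * s) * x| <= real (2 * s) * 2 ^ s * 2 * |x - y| *
 ( |x| ^ s * |y| ^ s + |x - y| ^ (s - 1) * ( |x| ^ s * |y| + |y| ^ s * |x| ))" (is "_ <= ?R")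
proof -
 obtain n where n: "2 * s = Suc n" using s by (cases "2 * s") auto
 define X Y Z where XYZ: "X = |x|" "Y = |y|" "Z = |x - y|"
 have XYZ0: "0 <= X" "0 <= Y" "0 <= Z" "X <= Y + Z" "Y <= X + Z" unfolding XYZ by linarith+
 define Q where "Q = X ^ s * Y ^ s + Z ^ (s - 1) * (X ^ s * Y + Y ^ s * X)"
 have Q0: "0 <= Q" unfolding Q_def using XYZ0 by simp
 have Q1: "Y ^ s * X ^ s + Z ^ (s - 1) * (Y ^ s * X) <= Q" and Q2: "X ^ s * Y ^ s + Z ^ (s - 1) * (X ^ s * Y) <= Q"
 unfolding Q_def using XYZ0 by (simp_all add: distrib_left mult.commute[of "Y ^ s" "X ^ s"])
 have tm: "X * Y * |x ^ (n - Suc i) * y ^ i| <= 2 ^ s * 2 * Q" if i: "i < n" for i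
 proof -
 define p where "p = Suc i"
 have p: "p >= 1" "p < 2 * s" using i n by (auto simp: p_def)
 have "2 * s - p = Suc (n - Suc i)" using i n by (auto simp: p_def)
 hence e: "X * Y * |x ^ (n - Suc i) * y ^ i| = X ^ (2 * s - p) * Y ^ p"
 by (simp add: p_def abs_mult power_abs XYZ)
 show ?thesis
 proof (cases "s <= p")
 case True
 have "Y ^ p * X ^ (2 * s - p) <= 2 ^ s * 2 * (Y ^ s * X ^ s + Z ^ (s - 1) * (Y ^ s * X))"
 using XYZ0 by (intro mixed_power_bound s True p(2))
 also have "... <= 2 ^ s * 2 * Q" using Q1 by simp
 finally show ?thesis unfolding e by (simp only: mult.commute)
 next
 case False
 have "X ^ (2 * s - p) * Y ^ (2 * s - (2 * s - p)) <= 2 ^ s * 2 * (X ^ s * Y ^ s + Z ^ (s - 1) * (X ^ s * Y))"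
 using False p XYZ0 by (intro mixed_power_bound s) auto
 also have "... <= 2 ^ s * 2 * Q" using Q2 by simp
 finally show ?thesis using p by (simp add: e)
 qed
 qed
 have "x ^ (2 * s) * y - y ^ (2 * s) * x = x * y * (x ^ n - y ^ n)"
 unfolding n by (simp add: als)
 also have "x ^ n - y ^ n = (x - y) * (\<Sum>i<n. x ^ (n - Suc i) * y ^ i)"
 proof -
 have "x ^ n - y ^ n = - (y ^ n - x ^ n)" by simp
 also have "... = - ((y - x) * (\<Sum>i<n. x ^ (n - Suc i) * y ^ i))" by (simp only: power_diff_sumr2)
 finally show ?thesis by (simp only: mult_minus_left[symmetric] minus_diff_eq)
 qed
 also have "|x * y * ((x - y) * (\<Sum>i<n. x ^ (n - Suc i) * y ^ i)) |
 = Z * (X * Y * | \<Sum>i<n. x ^ (n - Suc i) * y ^ i| )" by (simp only: abs_mult XYZ mult_ac)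
 also have "... <= Z * (X * Y * (\<Sum>i<n. |x ^ (n - Suc i) * y ^ i| ))"
 using XYZ0(1-3) by (intro mlm sum_abs mnn)
 also have "... = Z * (\<Sum>i<n. X * Y * |x ^ (n - Suc i) * y ^ i| )"
 by (simp add: sum_distrib_left)
 also have "... <= Z * (\<Sum>i<n. 2 ^ s * 2 * Q)"
 using XYZ0 by (intro mlm sum_mono tm) auto
 also have "... <= Z * (real (2 * s) * (2 ^ s * 2 * Q))"
 proof -
 have "real n <= real (2 * s)" using n by linarith
 hence "real n * (2 ^ s * 2 * Q) <= real (2 * s) * (2 ^ s * 2 * Q)"
 by (rule mrm) (use Q0 in simp)
 thus ?thesis using XYZ0 by (intro mlm) simp_all
 qed
 finally show ?thesis unfolding Q_def XYZ by (simp only: mult_ac)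
qed

section \<open>Discrete Young inequalities on a frequency window\<close>

lemma sum_shift_le:
 fixes A :: "int => real"
 assumes "!!j. A j >= 0" "!!j. j \<notin> {-N..N} ==> A j = 0"
 shows "(SUM k:{-N..N}. A (k - l)) <= (SUM j:{-N..N}. A j)"
 and "(SUM k:{-N..N}. A (l - k)) <= (SUM j:{-N..N}. A j)"
proof -
 have *: "(SUM k:{-N..N}. A (g k)) <= (SUM j:{-N..N}. A j)" if "inj g" for g :: "int => int"
 proof -
 have "(SUM k:{-N..N}. A (g k)) = (SUM j:g ` {-N..N}. A j)"
 using that by (subst sum.reindex) (auto intro: inj_on_subset)
 also have "... = (SUM j:g ` {-N..N} \<inter> {-N..N}. A j)"
 by (rule sum.mono_neutral_right) (use assms in auto)
 also have "... <= (SUM j:{-N..N}. A j)"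
 by (rule sum_mono2) (use assms in auto)
 finally show ?thesis .
 qed
 show "(SUM k:{-N..N}. A (k - l)) <= (SUM j:{-N..N}. A j)"
 by (rule *[of "%k. k - l"]) (auto simp: inj_def)
 show "(SUM k:{-N..N}. A (l - k)) <= (SUM j:{-N..N}. A j)"
 by (rule *[of "%k. l - k"]) (auto simp: inj_def)
qed

lemma young_discrete:
 fixes A F :: "int => real"
 assumes A: "!!j. A j >= 0" "!!j. j \<notin> {-N..N} ==> A j = 0"
 shows "(SUM k:{-N..N}. SUM l:{-N..N}. A (k - l) * (F k * F l)) <=
 (SUM j:{-N..N}. A j) * (SUM k:{-N..N}. (F k)\<^sup>2)"
proof -
 let ?I = "{-N..N}"
 have "(SUM k:?I. SUM l:?I. A (k - l) * (F k * F l)) <=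
 (SUM k:?I. SUM l:?I. A (k - l) * (((F k)^2 + (F l)^2) / 2))"
 proof (intro sum_mono mlm A)
 fix k l
 have "0 <= (F k - F l)^2" by simp
 thus "F k * F l <= ((F k)^2 + (F l)^2) / 2" by (simp add: power2_diff)
 qed
 also have "... = (SUM k:?I. (SUM l:?I. A (k - l)) * (F k)^2 / 2) + (SUM k:?I. SUM l:?I. A (k - l) * (F l)^2 / 2)"
 by (simp add: distrib_left add_divide_distrib sum.distrib sum_distrib_right sum_divide_distrib)
 also have "(SUM k:?I. SUM l:?I. A (k - l) * (F l)^2 / 2) = (SUM l:?I. (SUM k:?I. A (k - l)) * (F l)^2 / 2)"
 by (subst sum.swap) (simp add: sum_distrib_right sum_divide_distrib)
 also have "(SUM k:?I. (SUM l:?I. A (k - l)) * (F k)^2 / 2) + (SUM l:?I. (SUM k:?I. A (k - l)) * (F l)^2 / 2)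
 <= (SUM k:?I. (SUM j:?I. A j) * (F k)^2 / 2) + (SUM l:?I. (SUM j:?I. A j) * (F l)^2 / 2)"
 by (intro add_mono sum_mono divide_right_mono mrm sum_shift_le A) auto
 also have "... = (SUM j:?I. A j) * (SUM k:?I. (F k)\<^sup>2)"
 by (simp add: sum_distrib_left flip: sum.distrib)
 finally show ?thesis .
qed

text \<open>Trilinear sums with one summable factor \<open>G\<close> and two square summable
  factors. They serve the terms in which the s powers fall on the difference frequency.\<close>

lemma young_discrete_l2:
 fixes D F G :: "int => real"
 assumes D: "!!j. D j >= 0" "!!j. j \<notin> {-N..N} ==> D j = 0"
 and G: "!!j. G j >= 0"
 shows "(SUM k:{-N..N}. SUM l:{-N..N}. D (k - l) * (F k * G l)) <=
 (SUM l:{-N..N}. G l) * ((SUM j:{-N..N}. (D j)\<^sup>2) + (SUM k:{-N..N}. (F k)\<^sup>2))"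
 "(SUM k:{-N..N}. SUM l:{-N..N}. D (k - l) * (F l * G k)) <=
 (SUM l:{-N..N}. G l) * ((SUM j:{-N..N}. (D j)\<^sup>2) + (SUM k:{-N..N}. (F k)\<^sup>2))"
proof -
 let ?I = "{-N..N}"
 have D2: "(SUM k:?I. (D (k - l))\<^sup>2) <= (SUM j:?I. (D j)\<^sup>2)" "(SUM k:?I. (D (l - k))\<^sup>2) <= (SUM j:?I. (D j)\<^sup>2)" for l
 using sum_shift_le[of "%j. (D j)\<^sup>2" N l] D by auto
 have p: "x * (y * g) <= g * (x^2 + y^2)" if "g >= 0" for x y g :: real
 proof -
 have "0 <= (x - y)^2 + x^2 + y^2" by simp
 hence "x * y <= x^2 + y^2" by (simp add: power2_diff)
 from mlm[OF this that] show ?thesis by (simp only: mult_ac)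
 qed
 have "(SUM k:?I. SUM l:?I. D (k - l) * (F k * G l)) <= (SUM k:?I. SUM l:?I. G l * ((D (k - l))^2 + (F k)^2))"
 by (intro sum_mono p G)
 also have "... = (SUM l:?I. G l * ((SUM k:?I. (D (k - l))\<^sup>2) + (SUM k:?I. (F k)\<^sup>2)))"
 by (subst sum.swap) (simp only: sum_distrib_left[symmetric] sum.distrib)
 also have "... <= (SUM l:?I. G l * ((SUM j:?I. (D j)\<^sup>2) + (SUM k:?I. (F k)\<^sup>2)))"
 by (intro sum_mono mlm add_mono D2 G order_refl)
 finally show "(SUM k:?I. SUM l:?I. D (k - l) * (F k * G l)) <=
 (SUM l:?I. G l) * ((SUM j:?I. (D j)\<^sup>2) + (SUM k:?I. (F k)\<^sup>2))"
 by (simp add: sum_distrib_right)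
 have "(SUM k:?I. SUM l:?I. D (k - l) * (F l * G k)) <= (SUM k:?I. SUM l:?I. G k * ((D (k - l))^2 + (F l)^2))"
 by (intro sum_mono p G)
 also have "... = (SUM k:?I. G k * ((SUM l:?I. (D (k - l))\<^sup>2) + (SUM l:?I. (F l)\<^sup>2)))"
 by (simp only: sum_distrib_left[symmetric] sum.distrib)
 also have "... <= (SUM k:?I. G k * ((SUM j:?I. (D j)\<^sup>2) + (SUM l:?I. (F l)\<^sup>2)))"
 by (intro sum_mono mlm add_mono D2 G order_refl)
 finally show "(SUM k:?I. SUM l:?I. D (k - l) * (F l * G k)) <=
 (SUM l:?I. G l) * ((SUM j:?I. (D j)\<^sup>2) + (SUM k:?I. (F k)\<^sup>2))"
 by (simp add: sum_distrib_right)
qed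

text \<open>Exchanging \<open>k\<close> and \<open>l\<close> and using that \<open>a\<close> is odd replaces the weight by
 \<open>(k\<^sup>2\<^sup>s l - l\<^sup>2\<^sup>s k) / 2\<close>, which gains a factor \<open>k - l\<close>.\<close>

lemma transport_energy_bound:
 fixes a f :: "int => real"
 assumes s: "s >= 1" and odd: "!!j. a (- j) = - a j" and a0: "!!j. j \<notin> {-N..N} ==> a j = 0"
 shows "|SUM k:{-N..N}. SUM l:{-N..N}. of_int k ^ (2 * s) * f k * (a (k - l) * (of_int l * f l)) | <=
 real (2 * s) * 2 ^ s * 2 * ((SUM j:{-N..N}. |of_int j * a j| ) * (SUM k:{-N..N}. of_int k ^ (2 * s) * (f k)^2)
 + 2 * (SUM l:{-N..N}. |of_int l * f l| ) *
 ((SUM j:{-N..N}. of_int j ^ (2 * s) * (a j)^2) + (SUM k:{-N..N}. of_int k ^ (2 * s) * (f k)^2)))"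
proof -
 let ?I = "{-N..N}"
 define g where "g = (%k l. of_int k ^ (2 * s) * f k * (a (k - l) * (of_int l * f l)))"
 define C where "C = real (2 * s) * 2 ^ s * 2"
 have C0: "C >= 0" by (simp add: C_def)
 define A where "A = (%j. |of_int j * a j| )"
 define D where "D = (%j. |of_int j| ^ s * |a j| )"
 define F where "F = (%j. |of_int j| ^ s * |f j| )"
 define G where "G = (%j. |of_int j * f j| )"
 have sq: "(D j)^2 = of_int j ^ (2 * s) * (a j)^2" "(F j)^2 = of_int j ^ (2 * s) * (f j)^2" for j
 by (simp_all add: D_def F_def pmd power_even_abs flip: power_mult)
 (simp_all add: mult.commute power_even_abs)
 define S where "S = (SUM k:?I. SUM l:?I. g k l)"
 have "S = (SUM k:?I. SUM l:?I. g l k)" unfolding S_def by (rule sum.swap)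
 hence "2 * S = (SUM k:?I. SUM l:?I. g k l + g l k)" by (simp add: S_def sum.distrib)
 hence "|2 * S| = |SUM k:?I. SUM l:?I. g k l + g l k|" by (rule arg_cong)
 also have "... <= (SUM k:?I. SUM l:?I. |g k l + g l k| )"
 by (intro order_trans[OF sum_abs] sum_mono sum_abs)
 finally have "2 * |S| <= (SUM k:?I. SUM l:?I. |g k l + g l k| )" by (simp add: abs_mult)
 also have "... <= (SUM k:?I. SUM l:?I. C * (A (k - l) * (F k * F l) + D (k - l) * (F k * G l) + D (k - l) * (F l * G k)))"
 proof (intro sum_mono)
 fix k l :: int
 have "a (l - k) = - a (k - l)" using odd[of "k - l"] by simp
 hence "g k l + g l k = (f k * f l * a (k - l)) * (of_int k ^ (2 * s) * of_int l - of_int l ^ (2 * s) * of_int k)"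
 by (simp add: g_def als)
 hence "|g k l + g l k| = |f k| * |f l| * |a (k - l) | * |of_int k ^ (2 * s) * of_int l - of_int l ^ (2 * s) * of_int k|"
 by (simp add: abs_mult)
 also have "... <= |f k| * |f l| * |a (k - l) | * (C * |of_int k - of_int l| *
 ( |of_int k| ^ s * |of_int l| ^ s + |of_int k - of_int l| ^ (s - 1) * ( |of_int k| ^ s * |of_int l| + |of_int l| ^ s * |of_int k| )))"
 unfolding C_def by (intro mlm mult_power_diff_bound s) auto
 also have "... = C * (A (k - l) * (F k * F l) + ( |of_int k - of_int l| * |of_int k - of_int l| ^ (s - 1) * |a (k - l) | ) * (F k * G l + F l * G k))"
 by (simp add: A_def F_def G_def abs_mult als)
 also have "|of_int k - of_int l| * |of_int k - of_int l| ^ (s - 1) * |a (k - l) | = D (k - l)"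
 using s by (simp add: D_def power_eq_if)
 finally show "|g k l + g l k| <= C * (A (k - l) * (F k * F l) + D (k - l) * (F k * G l) + D (k - l) * (F l * G k))"
 by (simp add: als)
 qed
 also have "... = C * ((SUM k:?I. SUM l:?I. A (k - l) * (F k * F l)) + (SUM k:?I. SUM l:?I. D (k - l) * (F k * G l))
 + (SUM k:?I. SUM l:?I. D (k - l) * (F l * G k)))"
 by (simp add: sum.distrib flip: sum_distrib_left)
 also have "... <= C * ((SUM j:?I. A j) * (SUM k:?I. (F k)\<^sup>2)
 + (SUM l:?I. G l) * ((SUM j:?I. (D j)\<^sup>2) + (SUM k:?I. (F k)\<^sup>2))
 + (SUM l:?I. G l) * ((SUM j:?I. (D j)\<^sup>2) + (SUM k:?I. (F k)\<^sup>2)))"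
 by (intro mlm add_mono young_discrete young_discrete_l2 C0)
 (auto simp: A_def D_def G_def a0)
 finally have "|S| <= C * ((SUM j:?I. A j) * (SUM k:?I. (F k)\<^sup>2)
 + 2 * (SUM l:?I. G l) * ((SUM j:?I. (D j)\<^sup>2) + (SUM k:?I. (F k)\<^sup>2)))" by (simp add: als)
 thus ?thesis by (simp only: S_def g_def sq C_def A_def G_def)
qed

text \<open>The derivative already sits on the factor \<open>a (k - l)\<close>, so no cancellation
  is called for: k^s is split by \<open>power_le_split\<close> into l^s and (k - l)^s. Since
  \<open>f 0 = 0\<close>, the plain |f l| is dominated by |l f l|, the same summable quantity as in
  the transport term.\<close>

lemma compression_energy_bound:
 fixes a f :: "int => real"
 assumes a0: "!!j. j \<notin> {-N..N} ==> a j = 0" and f0: "f 0 = 0"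
 shows "|SUM k:{-N..N}. SUM l:{-N..N}. of_int k ^ (2 * s) * f k * (of_int (k - l) * a (k - l) * f l) | <=
 2 ^ s * ((SUM j:{-N..N}. |of_int j * a j| ) * (SUM k:{-N..N}. of_int k ^ (2 * s) * (f k)^2)
 + (SUM l:{-N..N}. |of_int l * f l| ) *
 ((SUM j:{-N..N}. of_int j ^ (2 * s) * (of_int j * a j)^2) + (SUM k:{-N..N}. of_int k ^ (2 * s) * (f k)^2)))"
proof -
 let ?I = "{-N..N}"
 define A where "A = (%j. |of_int j * a j| )"
 define D where "D = (%j. |of_int j| ^ s * |of_int j * a j| )"
 define F where "F = (%j. |of_int j| ^ s * |f j| )"
 define G where "G = (%j. |of_int j * f j| )"
 have sq: "(D j)^2 = of_int j ^ (2 * s) * (of_int j * a j)^2" "(F j)^2 = of_int j ^ (2 * s) * (f j)^2" for j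
 by (simp_all add: D_def F_def pmd power_even_abs flip: power_mult)
 (simp_all add: mult.commute power_even_abs)
 have fG: "|f l| <= G l" for l
 proof (cases "l = 0")
 case False
 hence "1 <= |of_int l :: real|" by linarith
 hence "1 * |f l| <= |of_int l| * |f l|" by (intro mrm) auto
 thus ?thesis by (simp add: G_def abs_mult)
 qed (simp add: f0 G_def)
 have "|SUM k:?I. SUM l:?I. of_int k ^ (2 * s) * f k * (of_int (k - l) * a (k - l) * f l) |
 <= (SUM k:?I. SUM l:?I. |of_int k ^ (2 * s) * f k * (of_int (k - l) * a (k - l) * f l) | )"
 by (intro order_trans[OF sum_abs] sum_mono sum_abs)
 also have "... <= (SUM k:?I. SUM l:?I. 2 ^ s * (A (k - l) * (F k * F l) + D (k - l) * (F k * G l)))"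
 proof (intro sum_mono)
 fix k l :: int
 have "|of_int k ^ (2 * s) * f k * (of_int (k - l) * a (k - l) * f l) | = |of_int k| ^ s * (F k * A (k - l) * |f l| )"
 by (simp add: F_def A_def abs_mult power_abs mult_2 power_add)
 also have "... <= (2 ^ s * ( |of_int l| ^ s + |of_int k - of_int l| ^ s)) * (F k * A (k - l) * |f l| )"
 by (intro mrm power_le_split) (auto simp: F_def A_def)
 also have "... = 2 ^ s * (A (k - l) * (F k * F l) + D (k - l) * (F k * |f l| ))"
 by (simp add: F_def A_def D_def als)
 also have "... <= 2 ^ s * (A (k - l) * (F k * F l) + D (k - l) * (F k * G l))"
 by (intro mlm add_mono fG) (auto simp: F_def D_def A_def)
 finally show "|of_int k ^ (2 * s) * f k * (of_int (k - l) * a (k - l) * f l) | <= 2 ^ s * (A (k - l) * (F k * F l) + D (k - l) * (F k * G l))" .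
 qed
 also have "... = 2 ^ s * ((SUM k:?I. SUM l:?I. A (k - l) * (F k * F l)) + (SUM k:?I. SUM l:?I. D (k - l) * (F k * G l)))"
 by (simp add: sum.distrib flip: sum_distrib_left)
 also have "... <= 2 ^ s * ((SUM j:?I. A j) * (SUM k:?I. (F k)\<^sup>2)
 + (SUM l:?I. G l) * ((SUM j:?I. (D j)\<^sup>2) + (SUM k:?I. (F k)\<^sup>2)))"
 by (intro mlm add_mono young_discrete young_discrete_l2)
 (auto simp: A_def D_def G_def a0)
 finally show ?thesis by (simp only: sq A_def G_def)
qed

text \<open>Right-hand sides of the equations for the sine coefficients \<open>b\<close> of \<open>\<omega>\<close> and \<open>p\<close> of
 \<open>\<theta>\<^sub>x\<close>, truncated to the frequencies \<open>\<bar>k\<bar> \<le> N\<close>; the sine coefficients of the velocity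
 are \<open>- (L / \<pi>) \<alpha> b\<close>.\<close>

definition gal_b :: "(int => real) => int => (int => real) => (int => real) => int => real" where
 "gal_b al N b p k = (SUM l:{-N..N}. al (k - l) * b (k - l) * (of_int l * b l)) + p k"

definition gal_p :: "(int => real) => int => (int => real) => (int => real) => int => real" where
 "gal_p al N b p k = of_int k * (SUM l:{-N..N}. al (k - l) * b (k - l) * p l)"

section \<open>Energy growth of the truncated system\<close>

definition energy :: "nat => int => (int => real) => (int => real) => real" where
 "energy s N b p = (SUM k:{-N..N}. of_int k ^ (2 * s) * ((b k)^2 + (p k)^2))"

text \<open>The first two constants are those of \<open>transport_energy_bound\<close> and
  \<open>compression_energy_bound\<close>, the 1 accounts for the linear coupling \<open>p k\<close>
  in \<open>gal_b\<close>, and 16 collects numerical factors.\<close>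

definition rate :: "nat => real" where
 "rate s = 16 * (real (2 * s) * 2 ^ s * 2 + 2 ^ s + 1)"

lemma energy_nonneg: "energy s N b p >= 0"
 unfolding energy_def by (intro sum_nonneg mnn) auto

lemma sum_inverse_squares_int: "(SUM l:{-N..N::int}. 1 / (of_int l)^2) <= (4 :: real)"
proof -
 have set_eq: "{- int (Suc n)..int (Suc n)} = insert (int (Suc n)) (insert (- int (Suc n)) {- int n..int n})" for n
 by auto
 \<comment> \<open>The subtracted \<open>2 / real (Suc n)\<close> makes the induction telescope. The
   term l = 0 contributes \<open>1 / 0 = 0\<close>.\<close>
 have *: "(SUM l:{- int (Suc n)..int (Suc n)}. 1 / (of_int l)^2) <= 4 - 2 / real (Suc n)" for n
 proof (induction n)
 case 0
 show ?case unfolding set_eq by simp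
 next
 case (Suc n)
 have "2 / (real (Suc (Suc n)))^2 <= 2 / real (Suc n) - 2 / real (Suc (Suc n))"
 by (simp add: divide_simps p2q)
 moreover have "(- real n - 2)^2 = (real n + 2)^2" by (simp add: p2q als)
 ultimately show ?case unfolding set_eq[of "Suc n"] using Suc by (simp add: als)
 qed
 show ?thesis
 proof (cases "N <= 0")
 case True
 hence "{-N..N} \<subseteq> {0}" by auto
 hence "(SUM l:{-N..N::int}. 1 / (of_int l)^2) <= (SUM l:{0::int}. 1 / (of_int l)^2 :: real)"
 by (intro sum_mono2) auto
 thus ?thesis by simp
 next
 case False
 then obtain n where "N = int (Suc n)" by (metis not_le zero_less_imp_eq_int gr0_conv_Suc)
 moreover have "4 - 2 / real (Suc n) <= 4" by simp
 ultimately show ?thesis using order_trans[OF *[of n]] by blast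
 qed
qed

text \<open>Young's inequality for the product of 1 / |l| and l^2 |f l|. It bounds the absolute sums
  in the rate of every energy by the energy of order 2.\<close>

lemma sum_abs_le_weighted_squares:
 fixes f :: "int => real"
 shows "(SUM l:{-N..N}. |of_int l * f l| ) <= 4 + (SUM l:{-N..N}. of_int l ^ 4 * (f l)^2)"
proof -
 have "|of_int l * f l| <= 1 / (of_int l)^2 + of_int l ^ 4 * (f l)^2" for l :: int
 proof (cases "l = 0")
 case False
 define x y where "x = 1 / |of_int l :: real|" and "y = |of_int l| ^ 2 * |f l|"
 have "0 <= (x - y)^2 + x^2 + y^2" by simp
 hence "x * y <= x^2 + y^2" by (simp add: power2_diff)
 moreover have "x * y = |of_int l * f l|"
 using False unfolding x_def y_def p2q abs_mult by (simp only: mult.assoc) simp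
 moreover have "x^2 = 1 / (of_int l)^2" by (simp add: x_def power_divide)
 moreover have "y^2 = of_int l ^ 4 * (f l)^2" by (simp add: y_def pmd flip: power_mult)
 ultimately show ?thesis by simp
 qed simp
 hence "(SUM l:{-N..N}. |of_int l * f l| ) <= (SUM l:{-N..N}. 1 / (of_int l)^2 + of_int l ^ 4 * (f l)^2)"
 by (intro sum_mono)
 also have "... <= 4 + (SUM l:{-N..N}. of_int l ^ 4 * (f l)^2)"
 using sum_inverse_squares_int[of N] by (simp add: sum.distrib)
 finally show ?thesis .
qed

text \<open>The energy of order s is multiplied by absolute sums that do not depend on s; this lets
  one lifespan serve all orders. The bound of \<open>of_int j * al j\<close> by 1 expresses that the
  velocity is one derivative smoother than \<omega>, so its gradient costs no more than
  \<open>b\<close> itself.\<close>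

lemma galerkin_energy_rate:
 assumes al: "!!j. al (- j) = al j" "!!j. |al j| <= 1" "!!j. |of_int j * al j| <= 1"
 and odd: "!!j. b (- j) = - b j" "!!j. p (- j) = - p j"
 and b0: "!!j. j \<notin> {-N..N} ==> b j = 0"
 and s: "s >= 1"
 shows "|SUM k:{-N..N}. of_int k ^ (2 * s) * (2 * b k * gal_b al N b p k + 2 * p k * gal_p al N b p k) |
 <= rate s * (1 + (SUM l:{-N..N}. |of_int l * b l| ) + (SUM l:{-N..N}. |of_int l * p l| )) * energy s N b p"
proof -
 let ?I = "{-N..N}"
 define a where "a = (%j. al j * b j)"
 have a_odd: "a (- j) = - a j" for j by (simp add: a_def al odd)
 have a0: "a j = 0" if "j \<notin> {-N..N}" for j using b0[OF that] by (simp add: a_def)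
 have z0: "b 0 = 0" "p 0 = 0" using odd(1)[of 0] odd(2)[of 0] by auto
 define w where "w = (%k::int. (of_int k :: real) ^ (2 * s))"
 have w0: "w k >= 0" for k by (simp add: w_def)
 define B1 P1 eb ep where "B1 = (SUM l:?I. |of_int l * b l| )" and "P1 = (SUM l:?I. |of_int l * p l| )"
 and "eb = (SUM k:?I. w k * (b k)^2)" and "ep = (SUM k:?I. w k * (p k)^2)"
 have nn: "B1 >= 0" "P1 >= 0" "eb >= 0" "ep >= 0"
 unfolding B1_def P1_def eb_def ep_def by (auto intro!: sum_nonneg mnn w0)
 have E: "energy s N b p = eb + ep"
 by (simp add: energy_def eb_def ep_def w_def sum.distrib distrib_left)
 have ja: "|of_int j * a j| <= |b j|" for j
 using mrm[OF al(3)[of j] abs_ge_zero[of "b j"]] by (simp add: a_def abs_mult mult.assoc)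
 have aj: "|a j| <= |b j|" for j
 using mrm[OF al(2)[of j] abs_ge_zero[of "b j"]] by (simp add: a_def abs_mult)
 have bj: "|b j| <= |of_int j * b j|" for j
 proof (cases "j = 0")
 case False
 hence "1 <= |of_int j :: real|" by linarith
 from mrm[OF this abs_ge_zero[of "b j"]] show ?thesis by (simp add: abs_mult)
 qed (simp add: z0)
 have A1: "(SUM j:?I. |of_int j * a j| ) <= B1"
 unfolding B1_def by (intro sum_mono order_trans[OF ja bj])
 have D1: "(SUM j:?I. w j * (a j)^2) <= eb" "(SUM j:?I. w j * (of_int j * a j)^2) <= eb"
 unfolding eb_def by (intro sum_mono mlm w0; use aj ja in "simp add: abs_le_square_iff")+
 define C1 C2 where "C1 = real (2 * s) * 2 ^ s * 2" and "C2 = (2 :: real) ^ s"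
 have C: "C1 >= 0" "C2 >= 0" by (simp_all add: C1_def C2_def)
 have T: "|SUM k:?I. SUM l:?I. w k * f k * (a (k - l) * (of_int l * f l)) | <=
 C1 * (B1 * (SUM k:?I. w k * (f k)^2) + 2 * (SUM l:?I. |of_int l * f l| ) * (eb + (SUM k:?I. w k * (f k)^2)))" for f :: "int => real"
 proof -
 have "|SUM k:?I. SUM l:?I. w k * f k * (a (k - l) * (of_int l * f l)) | <=
 C1 * ((SUM j:?I. |of_int j * a j| ) * (SUM k:?I. w k * (f k)^2) + 2 * (SUM l:?I. |of_int l * f l| ) * ((SUM j:?I. w j * (a j)^2) + (SUM k:?I. w k * (f k)^2)))"
 unfolding w_def C1_def by (rule transport_energy_bound[where a=a and N=N, OF s a_odd a0])
 also have "... <= C1 * (B1 * (SUM k:?I. w k * (f k)^2) + 2 * (SUM l:?I. |of_int l * f l| ) * (eb + (SUM k:?I. w k * (f k)^2)))"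
 by (intro mlm add_mono mrm A1 D1 order_refl C)
 (auto intro!: sum_nonneg mnn w0)
 finally show ?thesis .
 qed
 have U: "|SUM k:?I. SUM l:?I. w k * p k * (of_int (k - l) * a (k - l) * p l) | <= C2 * (B1 * ep + P1 * (eb + ep))"
 proof -
 have "|SUM k:?I. SUM l:?I. w k * p k * (of_int (k - l) * a (k - l) * p l) | <=
 C2 * ((SUM j:?I. |of_int j * a j| ) * ep + P1 * ((SUM j:?I. w j * (of_int j * a j)^2) + ep))"
 unfolding w_def C2_def ep_def P1_def by (rule compression_energy_bound[where a=a and N=N and f=p, OF a0 z0(2)])
 also have "... <= C2 * (B1 * ep + P1 * (eb + ep))"
 by (intro mlm add_mono mrm A1 D1 order_refl C nn)
 finally show ?thesis .
 qed
 have V: "|SUM k:?I. w k * (b k * p k) | <= eb + ep"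
 proof -
 have "|SUM k:?I. w k * (b k * p k) | <= (SUM k:?I. w k * ((b k)^2 + (p k)^2))"
 proof (intro order_trans[OF sum_abs] sum_mono)
 fix k
 have "0 <= ( |b k| - |p k| )^2 + (b k)^2 + (p k)^2" by simp
 hence "|b k * p k| <= (b k)^2 + (p k)^2" by (simp add: power2_diff abs_mult)
 thus "|w k * (b k * p k) | <= w k * ((b k)^2 + (p k)^2)"
 using w0[of k] by (simp add: abs_mult mlm)
 qed
 thus ?thesis by (simp add: eb_def ep_def sum.distrib distrib_left)
 qed
 have "(SUM k:?I. w k * (2 * b k * gal_b al N b p k + 2 * p k * gal_p al N b p k)) =
 2 * ((SUM k:?I. SUM l:?I. w k * b k * (a (k - l) * (of_int l * b l))) + (SUM k:?I. w k * (b k * p k))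
 + (SUM k:?I. SUM l:?I. w k * p k * (a (k - l) * (of_int l * p l)))
 + (SUM k:?I. SUM l:?I. w k * p k * (of_int (k - l) * a (k - l) * p l)))"
 (is "?L = 2 * ?M")
 proof -
 have "w k * (2 * b k * gal_b al N b p k + 2 * p k * gal_p al N b p k) =
 2 * ((SUM l:?I. w k * b k * (a (k - l) * (of_int l * b l))) + w k * (b k * p k)
 + (SUM l:?I. w k * p k * (a (k - l) * (of_int l * p l)))
 + (SUM l:?I. w k * p k * (of_int (k - l) * a (k - l) * p l)))" for k
 proof -
 have "gal_b al N b p k = (SUM l:?I. a (k - l) * (of_int l * b l)) + p k"
 by (simp add: gal_b_def a_def)
 \<comment> \<open>The outer factor k of \<open>gal_p\<close> is written as l + (k - l): the first
   part is transport of \<open>p\<close>, the second is compression.\<close>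
 moreover have "gal_p al N b p k = (SUM l:?I. a (k - l) * (of_int l * p l)) + (SUM l:?I. of_int (k - l) * a (k - l) * p l)"
 by (simp add: gal_p_def a_def sum_distrib_left als flip: sum.distrib)
 ultimately show ?thesis by (simp only: sum_distrib_left[symmetric]) (simp add: als)
 qed
 thus ?thesis by (simp add: sum.distrib flip: sum_distrib_left)
 qed
 hence "| ?L| = 2 * | ?M|" by (simp only: abs_mult abs_numeral)
 also have "... <= 2 * (C1 * (B1 * eb + 2 * B1 * (eb + eb)) + (eb + ep) + C1 * (B1 * ep + 2 * P1 * (eb + ep)) + C2 * (B1 * ep + P1 * (eb + ep)))"
 proof -
 have abs4: "|x + y + z + w| <= x' + y' + z' + w'" if "|x| <= x'" "|y| <= y'" "|z| <= z'" "|w| <= w'"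
 for x y z w x' y' z' w' :: real using that by linarith
 show ?thesis
 by (rule mlm[OF abs4]; (rule T[of b, folded B1_def eb_def] T[of p, folded P1_def ep_def] U V | simp))
 qed
 also have "... <= rate s * (1 + B1 + P1) * (eb + ep)"
 proof -
 have r: "rate s = 16 * (C1 + C2 + 1)" by (simp add: rate_def C1_def C2_def)
 define Z where "Z = (C1 + C2 + 1) * (1 + B1 + P1)"
 have pp: "0 <= C1 * B1" "0 <= C1 * P1" "0 <= C2 * B1" "0 <= C2 * P1" using nn C by simp_all
 have "Z = C1 * B1 + C1 * P1 + C2 * B1 + C2 * P1 + 1 + (C1 + C2 + B1 + P1)" by (simp add: Z_def als)
 hence Z: "5 * (C1 * B1) + 1 + 2 * (C1 * P1) + C2 * P1 <= 5 * Z" "1 + C1 * B1 + 2 * (C1 * P1) + C2 * B1 + C2 * P1 <= 5 * Z"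
 using nn C pp by linarith+
 have "2 * (C1 * (B1 * eb + 2 * B1 * (eb + eb)) + (eb + ep) + C1 * (B1 * ep + 2 * P1 * (eb + ep)) + C2 * (B1 * ep + P1 * (eb + ep)))
 = 2 * (eb * (5 * (C1 * B1) + 1 + 2 * (C1 * P1) + C2 * P1) + ep * (1 + C1 * B1 + 2 * (C1 * P1) + C2 * B1 + C2 * P1))"
 by (simp add: als)
 also have "... <= 2 * (eb * (5 * Z) + ep * (5 * Z))"
 by (intro mlm add_mono Z nn) simp
 also have "... = 10 * (Z * (eb + ep))" by (simp add: als)
 also have "... <= 16 * (Z * (eb + ep))"
 using nn C by (intro mrm) (auto simp: Z_def)
 finally show ?thesis unfolding r Z_def by (simp only: mult.assoc)
 qed
 finally show ?thesis unfolding w_def B1_def P1_def E .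
qed

section \<open>Solving the truncated system on a common time interval\<close>

lemma gal_odd:
 assumes al: "!!j. al (- j) = al j" and odd: "!!j. b (- j) = - b j" "!!j. p (- j) = - p j"
 shows "gal_b al N b p (- k) = - gal_b al N b p k" "gal_p al N b p (- k) = - gal_p al N b p k"
proof -
 have r: "(SUM l:{-N..N}. f l) = (SUM l:{-N..N}. f (- l))" for f :: "int => real"
 by (rule sum.reindex_bij_witness[of _ uminus uminus]) auto
 have m: "al (l - k) = al (k - l)" "b (l - k) = - b (k - l)" for l
 using al[of "k - l"] odd(1)[of "k - l"] by simp_all
 have "(SUM l:{-N..N}. al (- k - l) * b (- k - l) * (of_int l * b l)) = (SUM l:{-N..N}. - (al (k - l) * b (k - l) * (of_int l * b l)))"
 by (subst r) (simp add: m odd)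
 thus "gal_b al N b p (- k) = - gal_b al N b p k"
 by (simp add: gal_b_def odd sum_negf)
 have "(SUM l:{-N..N}. al (- k - l) * b (- k - l) * p l) = (SUM l:{-N..N}. al (k - l) * b (k - l) * p l)"
 by (subst r) (simp add: m odd)
 thus "gal_p al N b p (- k) = - gal_p al N b p k"
 by (simp add: gal_p_def)
qed

text \<open>The quadratic right-hand sides become bounded and Lipschitz once every coefficient is
  clamped to [-R, R]. Only the frequencies 1..N are unknowns, the others follow by oddness. The
  truncated equations are asserted only at times when all coefficients lie within the clamp.\<close>

lemma galerkin_clamped_solution:
 assumes al: "!!j. al (- j) = al j" "!!j. |al j| <= 1" and N: "N >= 0" and R: "R > 0"
 and odd0: "!!j. b0 (- j) = - b0 j" "!!j. p0 (- j) = - p0 j"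
 obtains b p :: "int => real => real" where
 "!!j t. b (- j) t = - b j t" "!!j t. p (- j) t = - p j t"
 "!!j t. j \<notin> {-N..N} ==> b j t = 0 & p j t = 0"
 "!!j. j : {-N..N} ==> b j 0 = b0 j & p j 0 = p0 j"
 "!!j. co {0..} (b j)" "!!j. co {0..} (p j)"
 "!!j t. t >= 0 ==> (!!i. |b i t| <= R & |p i t| <= R) ==> j : {-N..N} ==>
 (b j hrd gal_b al N (%i. b i t) (%i. p i t) j) (at t within {0..}) &
 (p j hrd gal_p al N (%i. b i t) (%i. p i t) j) (at t within {0..})"
proof -
 define cl where "cl = (%x. max (- R) (min R x))"
 have cl: "|cl x| <= R" "|cl x - cl y| <= |x - y|" for x y using R by (auto simp: cl_def)
 have cl_id: "cl x = x" if "|x| <= R" for x using that by (auto simp: cl_def)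
 define ext where "ext = (%(f :: int => real) k. if 1 <= k & k <= N then f k else if - N <= k & k <= -1 then - f (- k) else 0)"
 have ext_odd: "ext f (- k) = - ext f k" for f k by (auto simp: ext_def)
 have ext_b: "|ext f k| <= R" if "!!k. |f k| <= R" for f k
 using that R by (auto simp: ext_def)
 have ext_d: "|ext f k - ext g k| <= d" if "!!j. j : {1..N} ==> |f j - g j| <= d" "d >= 0" for f g k d
 using that(1)[of k] that(1)[of "- k"] that(2) by (auto simp: ext_def abs_minus_commute)
 define B P where "B = (%(y :: int => real \<times> real). ext (%k. cl (fst (y k))))" and "P = (%(y :: int => real \<times> real). ext (%k. cl (snd (y k))))"
 define F where "F = (%y k. (gal_b al N (B y) (P y) k, gal_p al N (B y) (P y) k))"
 have BP: "|B y k| <= R" "|P y k| <= R" for y k unfolding B_def P_def by (auto intro!: ext_b cl)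
 have BPd: "|B y k - B z k| <= d" "|P y k - P z k| <= d" if "!!j. j : {1..N} ==> norm (y j - z j) <= d" "d >= 0" for y z d k
 proof -
 have "|fst (y j) - fst (z j) | <= d" "|snd (y j) - snd (z j) | <= d" if "j : {1..N}" for j
 using dist_fst_le[of "y j" "z j"] dist_snd_le[of "y j" "z j"] \<open>!!j. j : {1..N} ==> norm (y j - z j) <= d\<close>[OF that]
 unfolding dist_norm real_norm_def by linarith+
 thus "|B y k - B z k| <= d" "|P y k - P z k| <= d"
 unfolding B_def P_def using that(2) by (auto intro!: ext_d intro: order_trans[OF cl(2)])
 qed
 have card: "(SUM l:{-N..N}. c) = (2 * of_int N + 1) * c" for c :: real
 using N by simp
 have prod: "|al i * x * y| <= R * R" if "|x| <= R" "|y| <= R" for i x y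
 proof -
 have "|al i| * ( |x| * |y| ) <= 1 * (R * R)" using that R by (intro mult_mono al) auto
 thus ?thesis by (simp add: abs_mult mult.assoc)
 qed
 have prodd: "|al i * x * y - al i * x' * y' | <= 2 * R * d"
 if "|x| <= R" "|y' | <= R" "|x - x' | <= d" "|y - y' | <= d" for i x y x' y' d
 proof -
 have "|x * y - x' * y' | = |x * (y - y') + (x - x') * y' |" by (simp add: als)
 also have "... <= |x| * |y - y' | + |x - x' | * |y' |" by (metis abs_triangle_ineq abs_mult)
 also have "... <= R * d + d * R" using that R by (intro add_mono mult_mono) auto
 finally have "|al i| * |x * y - x' * y' | <= 1 * (2 * R * d)" by (intro mult_mono al) auto
 moreover have "al i * x * y - al i * x' * y' = al i * (x * y - x' * y')" by (simp add: als)
 ultimately show ?thesis by (simp add: abs_mult)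
 qed
 \<comment> \<open>There are 2 N + 1 terms, each with an integer factor of size at most N.\<close>
 define W where "W = (2 * of_int N + 1 :: real) * of_int N"
 have W: "W >= 0" using N by (simp add: W_def)
 obtain y where y0: "!!i. i : {1..N} ==> y i (0::real) = (b0 i, p0 i)"
 and yd: "!!i t. i : {1..N} ==> t >= 0 ==> (y i has_vector_derivative F (%j. y j t) i) (at t within {0..})"
 proof (rule picard_finite_system[of "{1..N}" F "W * (R * R) + R + W * (R * R)" "W * (2 * R) + 1 + W * (2 * R)" "%i. (b0 i, p0 i)"])
 show "finite {1..N}" by simp
 show "norm (F y i) <= W * (R * R) + R + W * (R * R)" if i: "i : {1..N}" for y i
 proof -
 have l: "|of_int l :: real| <= of_int N" if "l : {-N..N}" for l using that by auto
 have "|gal_b al N (B y) (P y) i| <= (SUM l:{-N..N}. |al (i - l) * B y (i - l) * (of_int l * B y l) | ) + R"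
 unfolding gal_b_def by (intro order_trans[OF abs_triangle_ineq] add_mono sum_abs BP)
 also have "(SUM l:{-N..N}. |al (i - l) * B y (i - l) * (of_int l * B y l) | ) = (SUM l:{-N..N}. |of_int l| * |al (i - l) * B y (i - l) * B y l| )"
 by (intro sum.cong) (auto simp: abs_mult)
 also have "... <= (SUM l:{-N..N}. of_int N * (R * R))" by (intro sum_mono mult_mono l prod BP) (use N in auto)
 finally have 1: "|gal_b al N (B y) (P y) i| <= W * (R * R) + R" unfolding card by (simp add: W_def)
 have "|gal_p al N (B y) (P y) i| <= of_int N * (SUM l:{-N..N}. R * R)"
 unfolding gal_p_def abs_mult[of "of_int i"]
 by (intro mult_mono order_trans[OF sum_abs] sum_mono prod BP) (use i N in auto)
 hence 2: "|gal_p al N (B y) (P y) i| <= W * (R * R)" unfolding card by (simp add: W_def mult_ac)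
 show ?thesis using norm_Pair_le[of "gal_b al N (B y) (P y) i" "gal_p al N (B y) (P y) i"] 1 2
 unfolding F_def real_norm_def by linarith
 qed
 show "norm (F y i - F z i) <= (W * (2 * R) + 1 + W * (2 * R)) * d"
 if i: "i : {1..N}" and d: "!!j. j : {1..N} ==> norm (y j - z j) <= d" for y z d i
 proof -
 have d0: "d >= 0" using d[OF i] norm_ge_zero order_trans by blast
 have D: "|B y k - B z k| <= d" "|P y k - P z k| <= d" for k
 by (rule BPd; use d d0 in blast)+
 have l: "|of_int l :: real| <= of_int N" if "l : {-N..N}" for l using that by auto
 define Db where "Db = (%l. al (i - l) * B y (i - l) * B y l - al (i - l) * B z (i - l) * B z l)"
 define Dp where "Dp = (%l. al (i - l) * B y (i - l) * P y l - al (i - l) * B z (i - l) * P z l)"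
 have Db: "|Db l| <= 2 * R * d" for l
 unfolding Db_def by (rule prodd[OF BP(1) BP(1) D(1) D(1)])
 have Dp: "|Dp l| <= 2 * R * d" for l
 unfolding Dp_def by (rule prodd[OF BP(1) BP(2) D(1) D(2)])
 have eb: "gal_b al N (B y) (P y) i - gal_b al N (B z) (P z) i = (SUM l:{-N..N}. of_int l * Db l) + (P y i - P z i)"
 by (simp add: gal_b_def Db_def sum_subtractf als)
 have "|SUM l:{-N..N}. of_int l * Db l| <= (SUM l:{-N..N}. of_int N * (2 * R * d))"
 proof (rule order_trans[OF sum_abs], rule sum_mono)
 fix l assume "l : {-N..N}"
 from l[OF this] show "|of_int l * Db l| <= of_int N * (2 * R * d)"
 unfolding abs_mult by (rule mult_mono) (use N Db in auto)
 qed
 hence "|SUM l:{-N..N}. of_int l * Db l| <= W * (2 * R) * d" unfolding card by (simp add: W_def mult_ac)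
 with D(2)[of i] have 1: "|gal_b al N (B y) (P y) i - gal_b al N (B z) (P z) i| <= W * (2 * R) * d + d"
 unfolding eb by linarith
 have ep: "gal_p al N (B y) (P y) i - gal_p al N (B z) (P z) i = of_int i * (SUM l:{-N..N}. Dp l)"
 by (simp add: gal_p_def Dp_def sum_subtractf als)
 have "|SUM l:{-N..N}. Dp l| <= (SUM l:{-N..N}. 2 * R * d)"
 by (rule order_trans[OF sum_abs], rule sum_mono) (rule Dp)
 hence "|of_int i| * |SUM l:{-N..N}. Dp l| <= of_int N * (SUM l:{-N..N}. 2 * R * d)"
 by (intro mult_mono) (use i N in auto)
 hence 2: "|gal_p al N (B y) (P y) i - gal_p al N (B z) (P z) i| <= W * (2 * R) * d"
 unfolding ep abs_mult card by (simp add: W_def mult_ac)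
 have e: "(W * (2 * R) + 1 + W * (2 * R)) * d = W * (2 * R) * d + d + W * (2 * R) * d" by (simp add: als)
 show ?thesis
 using norm_Pair_le[of "gal_b al N (B y) (P y) i - gal_b al N (B z) (P z) i" "gal_p al N (B y) (P y) i - gal_p al N (B z) (P z) i"] 1 2
 unfolding F_def diff_Pair e real_norm_def by linarith
 qed
 show "0 < W * (2 * R) + 1 + W * (2 * R)" "0 <= W * (R * R) + R + W * (R * R)" using W R by (simp_all add: add_nonneg_pos add_pos_nonneg)
 qed blast
 define b p where "b = (%k t. ext (%k. fst (y k t)) k)" and "p = (%k t. ext (%k. snd (y k t)) k)"
 have b_odd: "b (- j) t = - b j t" and p_odd: "p (- j) t = - p j t" for j t
 unfolding b_def p_def by (rule ext_odd)+
 have dfst: "((%t. fst (y i t)) hrd fst (F (%j. y j t) i)) (at t within {0..})"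
 and dsnd: "((%t. snd (y i t)) hrd snd (F (%j. y j t) i)) (at t within {0..})"
 if "i : {1..N}" "t >= 0" for i t
 using yd[OF that] unfolding hrv
 by (auto intro: bounded_linear.has_vector_derivative[OF bounded_linear_fst] bounded_linear.has_vector_derivative[OF bounded_linear_snd])
 have cf: "co {0..} (%t. fst (y i t))" "co {0..} (%t. snd (y i t))" if "i : {1..N}" for i
 by (rule DERIV_continuous_on[OF dfst[OF that]], simp) (rule DERIV_continuous_on[OF dsnd[OF that]], simp)
 show ?thesis
 proof
 show "b (- j) t = - b j t" "p (- j) t = - p j t" for j t by (rule b_odd p_odd)+
 show "b j t = 0 & p j t = 0" if "j \<notin> {-N..N}" for j t
 using that N by (auto simp: b_def p_def ext_def)
 have z: "b0 0 = 0" "p0 0 = 0" using odd0(1)[of 0] odd0(2)[of 0] by auto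
 show "b j 0 = b0 j & p j 0 = p0 j" if "j : {-N..N}" for j
 proof -
 consider "j = 0" | "1 <= j" | "j <= -1" by linarith
 thus ?thesis
 using that y0[of j] y0[of "- j"] odd0(1)[of j] odd0(2)[of j] z by cases (auto simp: b_def p_def ext_def)
 qed
 show "co {0..} (b j)" "co {0..} (p j)" for j
 unfolding b_def p_def ext_def using cf[of j] cf[of "- j"]
 by (cases "1 <= j & j <= N"; cases "- N <= j & j <= -1"; auto intro!: cin)+
 show "(b j hrd gal_b al N (%i. b i t) (%i. p i t) j) (at t within {0..}) &
 (p j hrd gal_p al N (%i. b i t) (%i. p i t) j) (at t within {0..})"
 if t: "t >= 0" and small: "!!i. |b i t| <= R & |p i t| <= R" and j: "j : {-N..N}" for j t
 proof -
 have small': "|fst (y i t) | <= R" "|snd (y i t) | <= R" if "i : {1..N}" for i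
 using small[of i] that by (auto simp: b_def p_def ext_def)
 have BPe: "B (%j. y j t) = (%i. b i t)" "P (%j. y j t) = (%i. p i t)"
 using small' by (auto simp: B_def P_def b_def p_def ext_def fun_eq_iff cl_id)
 have pos: "(b j hrd gal_b al N (%i. b i t) (%i. p i t) j) (at t within {0..})"
 "(p j hrd gal_p al N (%i. b i t) (%i. p i t) j) (at t within {0..})" if "j : {1..N}" for j
 using dfst[OF that t] dsnd[OF that t] that by (simp_all add: b_def p_def ext_def F_def BPe[unfolded b_def p_def ext_def])
 note o = gal_odd[where al=al and N=N and b="%i. b i t" and p="%i. p i t", OF al(1) b_odd p_odd]
 consider "j = 0" | "j : {1..N}" | "- j : {1..N}" using j by fastforce
 thus ?thesis
 proof cases
 case 1
 have "b 0 = (%t. 0)" "p 0 = (%t. 0)" by (auto simp: b_def p_def ext_def)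
 thus ?thesis using 1 o[of 0] by simp
 next
 case 3
 have e: "b j = (%t. - b (- j) t)" "p j = (%t. - p (- j) t)" by (auto simp: b_odd p_odd)
 show ?thesis
 using DERIV_minus[OF pos(1)[OF 3]] DERIV_minus[OF pos(2)[OF 3]]
 unfolding e[symmetric] o minus_minus by (rule conjI)
 qed (use pos in auto)
 qed
 qed
qed

text \<open>The integrating factor \<open>exp (- V)\<close> makes the product with \<open>E\<close>
  nonincreasing, whatever the sign of \<open>E\<close>.\<close>

lemma gronwall_exp:
 fixes E V :: "real => real"
 assumes "a <= b" and cE: "co {a..b} E" and cV: "co {a..b} V"
 and dE: "!!t. a < t ==> t < b ==> (E hrd E' t) (at t)"
 and dV: "!!t. a < t ==> t < b ==> (V hrd A t) (at t)"
 and le: "!!t. a < t ==> t < b ==> E' t <= A t * E t"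
 shows "E b <= E a * exp (V b - V a)"
proof (cases "a = b")
 case False
 hence "a < b" using assms by simp
 define g where "g = (%t. E t * exp (- V t))"
 have "g b <= g a"
 proof (rule DERIV_nonpos_imp_decreasing_open[OF assms(1)])
 fix t assume t: "a < t" "t < b"
 have "(g hrd (E' t - A t * E t) * exp (- V t)) (at t)"
 unfolding g_def by (rule dei dE[OF t] dV[OF t] refl | simp add: als)+
 thus "\<exists>y. (g hrd y) (at t) & y <= 0"
 using le[OF t] by (auto simp: mult_le_0_iff)
 next
 show "co {a..b} g" unfolding g_def by (intro cin cE cV)
 qed
 hence "g b * exp (V b) <= g a * exp (V b)" by (intro mrm) auto
 thus ?thesis by (simp add: g_def exp_minus exp_diff fsi)
qed simp

lemma energy_controls_coefficient:
 assumes "k : {-N..N}"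
 shows "of_int k ^ (2 * s) * (b k)^2 <= energy s N b p" "of_int k ^ (2 * s) * (p k)^2 <= energy s N b p"
proof -
 have "of_int k ^ (2 * s) * ((b k)^2 + (p k)^2) <= energy s N b p"
 unfolding energy_def
 by (rule member_le_sum[OF assms, of "%k. of_int k ^ (2 * s) * ((b k)^2 + (p k)^2)"]) auto
 moreover have "0 <= of_int k ^ (2 * s) * (b k)^2" "0 <= of_int k ^ (2 * s) * (p k)^2" by auto
 ultimately show "of_int k ^ (2 * s) * (b k)^2 <= energy s N b p" "of_int k ^ (2 * s) * (p k)^2 <= energy s N b p"
 unfolding distrib_left by linarith+
qed

text \<open>While the energy of order 2 stays below 2 M + 1,
  \<open>sum_abs_le_weighted_squares\<close>, applied to b and to p, gives 1 + 4 + 4 + (2 M + 1) =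
  10 + 2 M.\<close>

definition growth :: "nat => real => real" where
 "growth s M = rate s * (10 + 2 * M)"

text \<open>The time in which growth at the rate \<open>growth 2 M\<close> doubles the energy of
  order 2.\<close>

definition lifespan :: "real => real" where
 "lifespan M = ln 2 / growth 2 M"

lemma rate_pos: "rate s > 0"
 unfolding rate_def by (intro mult_pos_pos add_nonneg_pos) auto

lemma growth_pos: "M >= 0 ==> growth s M > 0"
 unfolding growth_def by (intro mult_pos_pos rate_pos) auto

lemma lifespan_pos: "M >= 0 ==> lifespan M > 0"
 unfolding lifespan_def by (simp add: growth_pos)

text \<open>A bootstrap on the energy of order 2: as long as it is at most Y = 2 M + 1 the clamp is
  inactive and Gronwall applies, and within the lifespan Gronwall gives at most 2 M < Y, so the
  threshold is never reached. The higher energies then grow on the same interval by factors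
  independent of N.\<close>

lemma galerkin_uniform_solution:
 assumes al: "!!j. al (- j) = al j" "!!j. |al j| <= 1" "!!j. |of_int j * al j| <= 1"
 and N: "N >= 0" and M: "M >= 0"
 and odd0: "!!j. b0 (- j) = - b0 j" "!!j. p0 (- j) = - p0 j"
 and E0: "energy 2 N b0 p0 <= M"
 obtains b p :: "int => real => real" where
 "!!j t. b (- j) t = - b j t" "!!j t. p (- j) t = - p j t"
 "!!j t. j \<notin> {-N..N} ==> b j t = 0 & p j t = 0"
 "!!j. j : {-N..N} ==> b j 0 = b0 j & p j 0 = p0 j"
 "!!j t. t : {0..lifespan M} ==> j : {-N..N} ==>
 (b j hrd gal_b al N (%i. b i t) (%i. p i t) j) (at t within {0..}) &
 (p j hrd gal_p al N (%i. b i t) (%i. p i t) j) (at t within {0..})"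
 "!!s t. s >= 1 ==> t : {0..lifespan M} ==>
 energy s N (%i. b i t) (%i. p i t) <= energy s N b0 p0 * exp (growth s M * lifespan M)"
proof -
 define Y where "Y = 2 * M + 1"
 have Y: "Y >= 1" using M by (simp add: Y_def)
 \<comment> \<open>Nonzero modes have |k| >= 1, so an energy of order 2 of at most Y confines every
   coefficient to [-R, R].\<close>
 define R where "R = sqrt Y"
 have R: "R > 0" using Y by (simp add: R_def)
 obtain b p :: "int => real => real" where
 odd: "!!j t. b (- j) t = - b j t" "!!j t. p (- j) t = - p j t"
 and zero: "!!j t. j \<notin> {-N..N} ==> b j t = 0 & p j t = 0"
 and init: "!!j. j : {-N..N} ==> b j 0 = b0 j & p j 0 = p0 j"
 and cont: "!!j. co {0..} (b j)" "!!j. co {0..} (p j)"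
 and der: "!!j t. t >= 0 ==> (!!i. |b i t| <= R & |p i t| <= R) ==> j : {-N..N} ==>
 (b j hrd gal_b al N (%i. b i t) (%i. p i t) j) (at t within {0..}) &
 (p j hrd gal_p al N (%i. b i t) (%i. p i t) j) (at t within {0..})"
 using galerkin_clamped_solution[where al=al and N=N and R=R and ?b0.0=b0 and ?p0.0=p0, OF al(1,2) N R odd0] by blast
 define e where "e = (%s t. energy s N (%i. b i t) (%i. p i t))"
 have e_init: "e s 0 = energy s N b0 p0" for s
 unfolding e_def energy_def by (intro sum.cong) (use init in auto)
 have ec: "co {0..} (e s)" for s
 unfolding e_def energy_def by (intro cin cont)
 have small: "|b i t| <= R & |p i t| <= R" if "e 2 t <= Y" for i t
 proof -
 consider "i \<notin> {-N..N}" | "i = 0" | "i : {-N..N}" "i ~= 0" by blast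
 thus ?thesis
 proof cases
 case 3
 have "1 <= |of_int i :: real|" using 3 by linarith
 hence "1 <= |of_int i :: real| ^ (2 * 2)" by (rule one_le_power)
 hence "1 <= (of_int i :: real) ^ (2 * 2)" by simp
 hence "(b i t)^2 <= Y" "(p i t)^2 <= Y"
 using energy_controls_coefficient(1)[of i N 2 "%i. b i t" "%i. p i t"]
 energy_controls_coefficient(2)[of i N 2 "%i. p i t" "%i. b i t"] 3(1) that
 mrm[of 1 "(of_int i :: real) ^ (2 * 2)" "(b i t)^2"]
 mrm[of 1 "(of_int i :: real) ^ (2 * 2)" "(p i t)^2"]
 by (auto simp: e_def)
 thus ?thesis unfolding R_def by (auto intro!: real_le_rsqrt)
 next
 case 1 thus ?thesis using zero[OF 1, of t] R by simp
 next
 case 2 thus ?thesis using odd(1)[of 0 t] odd(2)[of 0 t] R by simp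
 qed
 qed
 have ed: "\<exists>e'. (e s hrd e') (at t within {0..}) & e' <= growth s M * e s t"
 if t: "t >= 0" "e 2 t <= Y" and s: "s >= 1" for s t
 proof -
 let ?e' = "SUM k:{-N..N}. of_int k ^ (2 * s) * (2 * b k t * gal_b al N (%i. b i t) (%i. p i t) k + 2 * p k t * gal_p al N (%i. b i t) (%i. p i t) k)"
 have "(e s hrd ?e') (at t within {0..})"
 unfolding e_def energy_def
 proof (rule DERIV_sum)
 fix k assume k: "k : {-N..N}"
 note D = conjunct1[OF der[OF t(1) small[OF t(2)] k]] conjunct2[OF der[OF t(1) small[OF t(2)] k]]
 show "((%t. of_int k ^ (2 * s) * ((b k t)^2 + (p k t)^2)) has_real_derivative
 of_int k ^ (2 * s) * (2 * b k t * gal_b al N (%i. b i t) (%i. p i t) k + 2 * p k t * gal_p al N (%i. b i t) (%i. p i t) k))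
 (at t within {0..})"
 by (rule dei D refl | simp)+
 qed
 moreover have "?e' <= growth s M * e s t"
 proof -
 let ?B = "SUM l:{-N..N}. |of_int l * b l t|" and ?P = "SUM l:{-N..N}. |of_int l * p l t|"
 have "e 2 t = (SUM l:{-N..N}. of_int l ^ 4 * (b l t)^2) + (SUM l:{-N..N}. of_int l ^ 4 * (p l t)^2)"
 by (simp add: e_def energy_def distrib_left sum.distrib)
 hence "1 + ?B + ?P <= 10 + 2 * M"
 using sum_abs_le_weighted_squares[where N=N and f="%l. b l t"]
 sum_abs_le_weighted_squares[where N=N and f="%l. p l t"] t(2)
 by (simp add: Y_def)
 hence "rate s * (1 + ?B + ?P) * e s t <= growth s M * e s t"
 unfolding growth_def using rate_pos[of s]
 by (intro mrm mlm) (auto simp: e_def energy_nonneg)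
 moreover have "| ?e' | <= rate s * (1 + ?B + ?P) * energy s N (%i. b i t) (%i. p i t)"
 by (rule galerkin_energy_rate[OF al]) (use odd zero s in auto)
 ultimately show ?thesis unfolding e_def by linarith
 qed
 ultimately show ?thesis by blast
 qed
 have grow: "e s ta <= e s 0 * exp (growth s M * ta)"
 if "ta >= 0" and s: "s >= 1" and le: "!!t. 0 < t ==> t < ta ==> e 2 t <= Y" for s ta
 proof -
 have "\<exists>e'. \<forall>t. 0 < t & t < ta --> (e s hrd e' t) (at t) & e' t <= growth s M * e s t"
 proof (rule choice, rule allI)
 fix t
 show "\<exists>e'. 0 < t & t < ta --> (e s hrd e') (at t) & e' <= growth s M * e s t"
 using ed[of t s] le[of t] s by (cases "0 < t & t < ta") (auto simp: at_within_interior[of t "{0..}"])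
 qed
 then obtain e' where e': "!!t. 0 < t ==> t < ta ==> (e s hrd e' t) (at t)"
 "!!t. 0 < t ==> t < ta ==> e' t <= growth s M * e s t" by blast
 have "e s ta <= e s 0 * exp (growth s M * ta - growth s M * 0)"
 by (rule gronwall_exp[where E'=e' and A="%_. growth s M", OF \<open>0 <= ta\<close> continuous_on_subset[OF ec]])
 (use e' in "auto intro!: cin dei")
 thus ?thesis by simp
 qed
 have Yb: "e 2 t <= Y" if t: "t : {0..lifespan M}" for t
 proof (rule ccontr)
 assume "\<not> e 2 t <= Y"
 \<comment> \<open>The threshold times form a compact set; before its least element the bootstrap
   hypothesis holds, so Gronwall can be used up to that element.\<close>
 define S where "S = {t : {0..lifespan M}. Y <= e 2 t}"
 have "S = {0..lifespan M} \<inter> e 2 -` {Y..}" by (auto simp: S_def)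
 moreover have "closed ({0..lifespan M} \<inter> e 2 -` {Y..})"
 by (intro continuous_closed_preimage continuous_on_subset[OF ec]) auto
 ultimately have "compact S"
 unfolding compact_eq_bounded_closed by (auto intro: bounded_subset[of "{0..lifespan M}"])
 moreover have "t : S" using t \<open>\<not> e 2 t <= Y\<close> by (simp add: S_def)
 ultimately obtain ta where ta: "ta : S" "!!t. t : S ==> ta <= t"
 using compact_attains_inf[of S] by blast
 have "e 2 ta <= e 2 0 * exp (growth 2 M * ta)"
 proof (rule grow)
 show "e 2 t <= Y" if "0 < t" "t < ta" for t
 using ta(2)[of t] ta(1) that by (cases "Y <= e 2 t") (auto simp: S_def)
 qed (use ta in "auto simp: S_def")
 also have "... <= M * exp (ln 2)"
 proof (intro mult_mono)
 have "growth 2 M * ta <= growth 2 M * lifespan M"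
 using ta(1) growth_pos[OF M, of 2] by (intro mlm) (auto simp: S_def)
 thus "exp (growth 2 M * ta) <= exp (ln 2)"
 using growth_pos[OF M, of 2] unfolding exp_le_cancel_iff by (simp add: lifespan_def)
 qed (use E0 M in "auto simp: e_init")
 also have "... < Y" by (simp add: Y_def)
 finally show False using ta(1) by (simp add: S_def)
 qed
 show ?thesis
 proof (rule that[of b p])
 show "(b j hrd gal_b al N (%i. b i t) (%i. p i t) j) (at t within {0..}) &
 (p j hrd gal_p al N (%i. b i t) (%i. p i t) j) (at t within {0..})"
 if "t : {0..lifespan M}" "j : {-N..N}" for j t
 using that by (intro der small Yb) auto
 show "energy s N (%i. b i t) (%i. p i t) <= energy s N b0 p0 * exp (growth s M * lifespan M)"
 if "s >= 1" "t : {0..lifespan M}" for s t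
 proof -
 have "e s t <= e s 0 * exp (growth s M * t)"
 using that by (intro grow Yb) auto
 also have "... <= e s 0 * exp (growth s M * lifespan M)"
 using that growth_pos[OF M, of s] by (intro mlm) (auto simp: e_def energy_nonneg)
 finally show ?thesis by (simp add: e_init) (simp add: e_def)
 qed
 qed (use odd zero init in auto)
qed

section \<open>Passing to the limit in the truncation\<close>

lemma uniform_limit_dominated_sum:
 fixes f :: "nat => int => 'a => real"
 assumes lim: "!!l. uniform_limit S (%n. f n l) (g l) sequentially"
 and bound: "!!n l t. t : S ==> |f n l t| <= M l" and M: "M summable_on UNIV"
 and N: "filterlim N at_top sequentially"
 shows "uniform_limit S (%n t. SUM l:{- int (N n)..int (N n)}. f n l t) (%t. ISUM l. g l t) sequentially"
proof (cases "S = {}")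
 case False
 then obtain t0 where "t0 : S" by blast
 hence M0: "M l >= 0" for l using bound[of t0 0 l] by linarith
 have gb: "|g l t| <= M l" if "t : S" for l t
 by (rule LIMSEQ_le_const2[OF tendsto_rabs[OF tendsto_uniform_limitI[OF lim that]]]) (use bound that in auto)
 have gs: "(%l. g l t) summable_on A" if "t : S" for A t
 by (rule summable_on_subset_banach[OF abs_summable_summable[OF summable_on_comparison_test[OF M]]])
 (use gb that in auto)
 show ?thesis
 proof (rule uniform_limitI)
 fix e :: real assume e: "e > 0"
 \<comment> \<open>Tannery's argument: a finite set \<open>F\<close> carries all of the majorant but
   e'. The terms in \<open>F\<close> converge uniformly, and the tails of the partial sum and of the
   full sum cost less than e' each.\<close>
 define e' where "e' = e / 4"
 have e': "e' > 0" using e by (simp add: e'_def)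
 have "(sum M \<longlongrightarrow> infsum M UNIV) (finite_subsets_at_top UNIV)"
 using infsum_tendsto[OF M] .
 hence "eventually (%F. dist (sum M F) (infsum M UNIV) < e') (finite_subsets_at_top UNIV)"
 using e' by (rule tendstoD)
 then obtain F where F: "finite F" "dist (sum M F) (infsum M UNIV) < e'"
 by (auto simp: eventually_finite_subsets_at_top)
 have MA: "M summable_on A" for A using summable_on_subset_banach[OF M] by simp
 have "infsum M UNIV = infsum M F + infsum M (- F)"
 using infsum_Un_disjoint[OF MA[of F] MA[of "- F"]] by simp
 hence tail: "infsum M (- F) < e'" using F by (simp add: dist_real_def)
 have "eventually (%n. ALL l:F. ALL t:S. dist (f n l t) (g l t) < e' / (real (card F) + 1)) sequentially"
 unfolding eventually_ball_finite_distrib[OF F(1)]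
 using uniform_limitD[OF lim] e' by (auto intro!: divide_pos_pos add_nonneg_pos)
 moreover have "eventually (%n. F \<subseteq> {- int (N n)..int (N n)}) sequentially"
 proof -
 define m where "m = nat (SUM l:F. |l| )"
 have "|l| <= int m" if "l : F" for l
 using member_le_sum[OF that, of abs] F(1) by (simp add: m_def sum_nonneg)
 hence Fm: "F \<subseteq> {- int m..int m}" by force
 have "eventually (%n. m <= N n) sequentially" using N by (simp add: filterlim_at_top)
 thus ?thesis by eventually_elim (use Fm in force)
 qed
 ultimately show "eventually (%n. ALL t:S. dist (SUM l:{- int (N n)..int (N n)}. f n l t) (ISUM l. g l t) < e) sequentially"
 proof eventually_elim
 case (elim n)
 show ?case
 proof
 fix t assume t: "t : S"
 let ?I = "{- int (N n)..int (N n)}"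
 have 1: "(SUM l:?I. f n l t) = (SUM l:F. f n l t) + (SUM l:?I - F. f n l t)"
 using elim(2) by (simp add: sum.subset_diff[of F ?I])
 have 2: "(ISUM l. g l t) = (SUM l:F. g l t) + (\<Sum>\<^sub>\<infinity>l\<in>-F. g l t)"
 using infsum_Un_disjoint[OF gs[OF t, of F] gs[OF t, of "- F"]] F(1) by simp
 have 3: "|SUM l:?I - F. f n l t| <= infsum M (- F)"
 proof -
 have "|SUM l:?I - F. f n l t| <= (SUM l:?I - F. M l)"
 by (intro order_trans[OF sum_abs] sum_mono bound t)
 also have "... <= infsum M (- F)"
 by (rule finite_sum_le_infsum[OF MA]) (use M0 in auto)
 finally show ?thesis .
 qed
 have 4: "| \<Sum>\<^sub>\<infinity>l\<in>-F. g l t| <= infsum M (- F)"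
 using norm_infsum_le[OF has_sum_infsum[OF gs[OF t]] has_sum_infsum[OF MA], of "- F"] gb[OF t]
 by simp
 have "| (SUM l:F. f n l t) - (SUM l:F. g l t) | <= (SUM l:F. |f n l t - g l t| )"
 by (simp flip: sum_subtractf)
 also have "... <= (SUM l:F. e' / (real (card F) + 1))"
 using elim(1) t by (intro sum_mono) (auto simp: dist_real_def less_imp_le)
 also have "... = (real (card F) / (real (card F) + 1)) * e'" by simp
 also have "... <= 1 * e'" using e' by (intro mrm) auto
 finally have 5: "| (SUM l:F. f n l t) - (SUM l:F. g l t) | <= e'" by simp
 show "dist (SUM l:?I. f n l t) (ISUM l. g l t) < e"
 proof -
 have tri: "| (a + b) - (c + d) | < e" if "|a - c| <= e'" "|b| < e'" "|d| < e'" for a b c d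
 using that e'_def e' by linarith
 show ?thesis unfolding dist_real_def 1 2 by (rule tri) (use 3 4 5 tail in linarith)+
 qed
 qed
 qed
 qed
qed simp

lemma summable_inverse_weight: "(%l::int. 1 / (wt l)^2 :: real) summable_on UNIV"
proof (rule nonneg_bdd_above_summable_on)
 have "(SUM l:F. 1 / (wt l)^2 :: real) <= 5" if "finite F" for F :: "int set"
 proof -
 define N where "N = (SUM l:F. |l| )"
 have "|l| <= N" if "l : F" for l
 using member_le_sum[OF that, of abs] \<open>finite F\<close> by (simp add: N_def)
 hence F: "F \<subseteq> {-N..N}" by force
 have p: "1 / (wt l)^2 <= (if l = 0 then 1 else 1 / (of_int l)^2 :: real)" for l :: int
 proof (cases "l = 0")
 case False
 have "|of_int l :: real| <= |1 + |of_int l| |" by linarith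
 hence "(of_int l)^2 <= (wt l)^2" by (simp only: abs_le_square_iff)
 thus ?thesis using False by (simp add: divide_left_mono)
 qed simp
 have "(SUM l:F. 1 / (wt l)^2 :: real) <= (SUM l:{-N..N}. 1 / (wt l)^2 :: real)"
 using F by (intro sum_mono2) auto
 also have "... <= (SUM l:{-N..N}. (if l = 0 then 1 else 0) + 1 / (of_int l)^2 :: real)"
 by (intro sum_mono order_trans[OF p]) auto
 also have "... <= 1 + 4"
 unfolding sum.distrib by (intro add_mono sum_inverse_squares_int) (simp add: sum.delta)
 finally show ?thesis by simp
 qed
 thus "bdd_above (sum (%l::int. 1 / (wt l)^2 :: real) ` {F. F \<subseteq> UNIV & finite F})"
 by (auto intro!: bdd_aboveI[of _ 5])
qed auto

definition rhs_b :: "(int => real) => (int => real) => (int => real) => int => real" where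
 "rhs_b al b p k = (ISUM l. al (k - l) * b (k - l) * (of_int l * b l)) + p k"

definition rhs_p :: "(int => real) => (int => real) => (int => real) => int => real" where
 "rhs_p al b p k = of_int k * (ISUM l. al (k - l) * b (k - l) * p l)"

text \<open>The coefficient form of smoothness in x, with all bounds uniform in time on
  \<open>S\<close>.\<close>

definition rapid_on :: "real set => (int => real => real) => bool" where
 "rapid_on S b \<longleftrightarrow> (\<forall>s. \<exists>C. \<forall>k. ALL t:S. (wt k) ^ s * |b k t| <= C)"

definition coef_solution ::
 "(int => real) => real set => (int => real => real) => (int => real => real) => bool" where
 "coef_solution al S b p \<longleftrightarrow>
 (\<forall>k. ALL t:S. b (- k) t = - b k t & p (- k) t = - p k t) &
 (\<forall>k. ALL t:S. (b k hrd rhs_b al (%j. b j t) (%j. p j t) k) (at t within S) &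
 (p k hrd rhs_p al (%j. b j t) (%j. p j t) k) (at t within S))"

lemma weighted_coefficient_le:
 fixes x :: real
 assumes "of_int k ^ (2 * s) * x^2 <= C" "C >= 0" "k = 0 ==> x = 0"
 shows "(wt k) ^ s * |x| <= 2 ^ s * sqrt C"
proof (cases "k = 0")
 case False
 hence "1 <= |of_int k :: real|" by linarith
 hence "(wt k) ^ s <= (2 * |of_int k :: real| ) ^ s" by (intro power_mono) auto
 hence "(wt k) ^ s * |x| <= (2 * |of_int k| ) ^ s * |x|" by (intro mrm) auto
 also have "... = 2 ^ s * ( |of_int k| ^ s * |x| )" by (simp add: pmd)
 also have "|of_int k| ^ s * |x| <= sqrt C"
 proof (rule real_le_rsqrt)
 have "( |of_int k| ^ s * |x| )^2 = of_int k ^ (2 * s) * x^2"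
 by (simp add: pmd power_even_abs flip: power_mult)
 (simp add: mult.commute power_even_abs)
 thus "( |of_int k| ^ s * |x| )^2 <= C" using assms(1) by simp
 qed
 finally show ?thesis by (simp add: mlm)
qed (use assms in simp)

lemma rapid_energy_bounded:
 fixes b p :: "int => real"
 assumes "!!k. (wt k) ^ Suc s * |b k| <= C" "!!k. (wt k) ^ Suc s * |p k| <= C"
 and s: "s >= 1"
 shows "energy s N b p <= 2 * C^2 * 4"
proof -
 have *: "of_int k ^ (2 * s) * x^2 <= C^2 * (1 / (of_int k)^2)" if "(wt k) ^ Suc s * |x| <= C" for k :: int and x
 proof (cases "k = 0")
 case False
 have "|of_int k| ^ Suc s * |x| <= (wt k) ^ Suc s * |x|"
 by (intro mrm power_mono) auto
 hence "|of_int k| ^ Suc s * |x| <= C" using that by simp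
 hence e1: "( |of_int k| ^ Suc s * |x| )^2 <= C^2" by (intro power_mono) auto
 have e2: "( |of_int k| ^ Suc s * |x| )^2 = ( |of_int k| ^ s * |x| )^2 * (of_int k)^2"
 by (simp add: p2q)
 have e3: "( |of_int k| ^ s * |x| )^2 = of_int k ^ (2 * s) * x^2"
 by (simp add: pmd power_even_abs flip: power_mult)
 (simp add: mult.commute power_even_abs)
 have "of_int k ^ (2 * s) * x^2 * (of_int k)^2 <= C^2" using e1 unfolding e2 e3 .
 thus ?thesis using False by (simp add: pos_le_divide_eq)
 qed (use s in "simp add: power_0_left")
 have "energy s N b p <= (SUM k:{-N..N}. 2 * C^2 * (1 / (of_int k)^2))"
 unfolding energy_def
 proof (rule sum_mono)
 fix k
 show "of_int k ^ (2 * s) * ((b k)^2 + (p k)^2) <= 2 * C^2 * (1 / (of_int k)^2)"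
 using *[OF assms(1), of k] *[OF assms(2), of k] unfolding distrib_left by linarith
 qed
 also have "... = 2 * C^2 * (SUM k:{-N..N}. 1 / (of_int k)^2)" by (simp add: sum_distrib_left)
 also have "... <= 2 * C^2 * 4" by (intro mlm sum_inverse_squares_int) auto
 finally show ?thesis .
qed

text \<open>The family indexed by the truncation parameter is bounded and equi-Lipschitz in each
 coefficient, so a diagonal subsequence converges uniformly in each coefficient.\<close>

lemma diagonal_uniform_subsequence:
 fixes F :: "nat => nat => real => complex"
 assumes bound: "!!n i t. t : {0..T} ==> norm (F n i t) <= B i"
 and lip: "!!n i t s. t : {0..T} ==> s : {0..T} ==> norm (F n i t - F n i s) <= D i * |t - s|"
 obtains r g where "strict_mono r" "!!i. uniform_limit {0..T} (%n. F (r n) i) (g i) sequentially"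
proof -
 define P where "P = (%i (r :: nat => nat). \<exists>g. uniform_limit {0..T} (%n. F (r n) i) g sequentially)"
 obtain r where r: "strict_mono r" "!!i. P i (id \<circ> r)"
 proof (rule subsequence_diagonalization_lemma[of P id])
 show "\<exists>k. strict_mono k & P i (r \<circ> k)" for i and r :: "nat => nat"
 proof (rule Arzela_Ascoli[of "{0..T}" "%n. F (r n) i" "B i"])
 show "compact {0..T}" by simp
 show "norm (F (r n) i x) <= B i" if "x : {0..T}" for n x by (rule bound[OF that])
 show "\<exists>d>0. \<forall>n y. y : {0..T} & norm (x - y) < d --> norm (F (r n) i x - F (r n) i y) < e"
 if x: "x : {0..T}" and e: "0 < e" for x e
 proof (intro exI conjI allI impI)
 show "0 < e / ( |D i| + 1)" using e by (simp add: add_nonneg_pos)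
 fix n y assume y: "y : {0..T} & norm (x - y) < e / ( |D i| + 1)"
 have "norm (F (r n) i x - F (r n) i y) <= D i * |x - y|" using lip x y by blast
 also have "... <= |D i| * |x - y|" by (intro mrm) auto
 also have "... <= |D i| * (e / ( |D i| + 1))" using y by (intro mlm) auto
 also have "... < e" using e by (simp add: divide_simps add_nonneg_pos)
 finally show "norm (F (r n) i x - F (r n) i y) < e" .
 qed
 fix g k assume "co {0..T} g" "strict_mono (k :: nat => nat)"
 "!!e. 0 < e ==> \<exists>N. \<forall>n x. N <= n & x : {0..T} --> norm (F (r (k n)) i x - g x) < e"
 thus "\<exists>k. strict_mono k & P i (r \<circ> k)"
 unfolding P_def uniform_limit_sequentially_iff dist_norm o_def by blast
 qed
 show "P i (r \<circ> k2)" if "P i (r \<circ> k1)" "!!j. N <= j ==> \<exists>j'\<ge>j. k2 j = k1 j'" for i r k1 k2 N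
 proof -
 from that(1) obtain g where g: "!!e. e > 0 ==> \<exists>M. \<forall>n\<ge>M. ALL x:{0..T}. dist (F (r (k1 n)) i x) (g x) < e"
 unfolding P_def uniform_limit_sequentially_iff o_def by blast
 have "\<exists>M. \<forall>n\<ge>M. ALL x:{0..T}. dist (F (r (k2 n)) i x) (g x) < e" if e: "e > 0" for e
 proof -
 obtain M where M: "\<forall>n\<ge>M. ALL x:{0..T}. dist (F (r (k1 n)) i x) (g x) < e" using g[OF e] by blast
 show ?thesis
 proof (intro exI[of _ "max M N"] allI impI)
 fix n assume "max M N <= n"
 then obtain j' where "j' >= n" "k2 n = k1 j'" using \<open>!!j. N <= j ==> \<exists>j'\<ge>j. k2 j = k1 j'\<close>[of n] by auto
 thus "ALL x:{0..T}. dist (F (r (k2 n)) i x) (g x) < e" using M \<open>max M N <= n\<close> by auto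
 qed
 qed
 thus ?thesis unfolding P_def uniform_limit_sequentially_iff o_def by blast
 qed
 qed blast
 hence "\<forall>i. \<exists>g. uniform_limit {0..T} (%n. F (r n) i) g sequentially" by (simp add: P_def)
 then obtain g where "!!i. uniform_limit {0..T} (%n. F (r n) i) (g i) sequentially" by metis
 thus ?thesis using that r(1) by blast
qed

lemma uniform_limit_derivative:
 fixes f :: "nat => real => real"
 assumes cvx: "convex S" and "uniform_limit S f g sequentially"
 and "uniform_limit S f' g' sequentially"
 and der: "eventually (%n. ALL t:S. (f n hrd f' n t) (at t within S)) sequentially"
 and t: "t : S"
 shows "(g hrd g' t) (at t within S)"
proof -
 obtain m where m: "!!n t. n >= m ==> t : S ==> (f n hrd f' n t) (at t within S)"
 using der unfolding eventually_sequentially by blast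
 have "\<exists>h. ALL x:S. (%n. f (n + m) x) \<longlonglongrightarrow> h x & (h has_derivative (%u. u * g' x)) (at x within S)"
 proof (rule has_derivative_sequence[of "S" "%n. f (n + m)" "%n x u. u * f' (n + m) x" "%x u. u * g' x" t "g t"])
 show "((f (n + m)) has_derivative (%u. u * f' (n + m) x)) (at x within S)" if "x : S" for n x
 using m[of "n + m" x] that by (simp add: has_field_derivative_def mult_commute_abs)
 show "eventually (%n. ALL x:S. \<forall>h. norm (h * f' (n + m) x - h * g' x) <= e * norm h) sequentially" if "0 < e" for e
 proof -
 have "eventually (%n. ALL x:S. dist (f' n x) (g' x) < e) sequentially"
 using assms(3) that by (rule uniform_limitD)
 hence "eventually (%n. ALL x:S. dist (f' (n + m) x) (g' x) < e) sequentially"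
 by (subst eventually_sequentially_seg)
 thus ?thesis
 proof eventually_elim
 case (elim n)
 show ?case
 proof (intro ballI allI)
 fix x h assume "x : S"
 hence "|f' (n + m) x - g' x| <= e" using elim by (auto simp: dist_real_def less_imp_le)
 hence "|h| * |f' (n + m) x - g' x| <= |h| * e" by (intro mlm) auto
 thus "norm (h * f' (n + m) x - h * g' x) <= e * norm h"
 by (simp add: mult.commute abs_mult flip: right_diff_distrib)
 qed
 qed
 qed
 show "(%n. f (n + m) t) \<longlonglongrightarrow> g t"
 using tendsto_uniform_limitI[OF assms(2) t] by (rule LIMSEQ_ignore_initial_segment)
 qed (use t cvx in auto)
 then obtain h where h: "!!x. x : S ==> (%n. f (n + m) x) \<longlonglongrightarrow> h x"
 "!!x. x : S ==> (h has_derivative (%u. u * g' x)) (at x within S)" by blast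
 have "h x = g x" if "x : S" for x
 using h(1)[OF that] LIMSEQ_ignore_initial_segment[OF tendsto_uniform_limitI[OF assms(2) that]] LIMSEQ_unique by blast
 moreover have "(h hrd g' t) (at t within S)"
 using h(2)[OF t] by (simp add: has_field_derivative_def mult_commute_abs)
 ultimately show ?thesis using t by (auto intro: DERIV_cong_ev has_field_derivative_transform_within[of h "g' t" t "S" 1 g])
qed

text \<open>The energies of all orders bound the Galerkin coefficients and their time derivatives
  independently of n, which is what Arzela-Ascoli asks for in each coefficient. The right-hand sides
  converge uniformly because one summable majorant \<open>B\<close> dominates the terms of all
  convolutions, so the limit may be differentiated.\<close>

theorem coef_local_existence:
 assumes al: "!!j. al (- j) = al j" "!!j. |al j| <= 1" "!!j. |of_int j * al j| <= 1"
 and M: "M >= 0"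
 and odd0: "!!j. b0 (- j) = - b0 j" "!!j. p0 (- j) = - p0 j"
 and rapid0: "!!s. \<exists>C. \<forall>k. (wt k) ^ s * |b0 k| <= C" "!!s. \<exists>C. \<forall>k. (wt k) ^ s * |p0 k| <= C"
 and E0: "!!N. energy 2 N b0 p0 <= M"
 obtains b p where "coef_solution al {0..lifespan M} b p" "rapid_on {0..lifespan M} b" "rapid_on {0..lifespan M} p"
 "!!k. b k 0 = b0 k" "!!k. p k 0 = p0 k"
proof -
 define T where "T = lifespan M"
 have T: "T > 0" unfolding T_def by (rule lifespan_pos[OF M])
 define good where "good = (%n b p.
 (\<forall>j t. b (- j) t = - b j t & p (- j) t = - p j t) &
 (\<forall>j t. j \<notin> {- int n..int n} --> b j t = 0 & p j t = 0) &
 (ALL j:{- int n..int n}. b j 0 = b0 j & p j 0 = p0 j) &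
 (ALL t:{0..T}. ALL j:{- int n..int n}.
 (b j hrd gal_b al (int n) (%i. b i t) (%i. p i t) j) (at t within {0..}) &
 (p j hrd gal_p al (int n) (%i. b i t) (%i. p i t) j) (at t within {0..})) &
 (\<forall>s\<ge>1. ALL t:{0..T}. energy s (int n) (%i. b i t) (%i. p i t) <= energy s (int n) b0 p0 * exp (growth s M * T)))"
 have "\<exists>b p. good n b p" for n
 proof -
 obtain b p :: "int => real => real" where
 "!!j t. b (- j) t = - b j t" "!!j t. p (- j) t = - p j t"
 "!!j t. j \<notin> {- int n..int n} ==> b j t = 0 & p j t = 0"
 "!!j. j : {- int n..int n} ==> b j 0 = b0 j & p j 0 = p0 j"
 "!!j t. t : {0..lifespan M} ==> j : {- int n..int n} ==>
 (b j hrd gal_b al (int n) (%i. b i t) (%i. p i t) j) (at t within {0..}) &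
 (p j hrd gal_p al (int n) (%i. b i t) (%i. p i t) j) (at t within {0..})"
 "!!s t. s >= 1 ==> t : {0..lifespan M} ==>
 energy s (int n) (%i. b i t) (%i. p i t) <= energy s (int n) b0 p0 * exp (growth s M * lifespan M)"
 using galerkin_uniform_solution[where al=al and N="int n" and M=M and ?b0.0=b0 and ?p0.0=p0,
 OF al of_nat_0_le_iff M odd0 E0] by blast
 hence "good n b p" unfolding good_def T_def by blast
 thus ?thesis by blast
 qed
 then obtain bn pn where good: "!!n. good n (bn n) (pn n)" by metis
 have odd: "bn n (- j) t = - bn n j t" "pn n (- j) t = - pn n j t" for n j t
 using good[of n] by (simp_all add: good_def)
 have zero: "bn n j t = 0" "pn n j t = 0" if "j \<notin> {- int n..int n}" for n j t
 using good[of n] that unfolding good_def by blast+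
 have init: "bn n j 0 = b0 j" "pn n j 0 = p0 j" if "j : {- int n..int n}" for n j
 using good[of n] that unfolding good_def by blast+
 have der: "(bn n j hrd gal_b al (int n) (%i. bn n i t) (%i. pn n i t) j) (wi t T)"
 "(pn n j hrd gal_p al (int n) (%i. bn n i t) (%i. pn n i t) j) (wi t T)"
 if "t : {0..T}" "j : {- int n..int n}" for n j t
 using good[of n] that unfolding good_def by (auto intro: DERIV_subset[of _ _ _ "{0..}"])
 have en: "energy s (int n) (%i. bn n i t) (%i. pn n i t) <= energy s (int n) b0 p0 * exp (growth s M * T)"
 if "s >= 1" "t : {0..T}" for s n t
 using good[of n] that unfolding good_def by blast
 have "\<exists>C. \<forall>n k. ALL t:{0..T}. (wt k) ^ s * |bn n k t| <= C & (wt k) ^ s * |pn n k t| <= C" for s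
 proof -
 \<comment> \<open>The energy estimate concerns orders at least 1; going up by one order covers s =
   0 as well.\<close>
 define q where "q = Suc s"
 obtain C1 where C1: "!!k. (wt k) ^ Suc q * |b0 k| <= C1" using rapid0(1)[of "Suc q"] by blast
 obtain C2 where C2: "!!k. (wt k) ^ Suc q * |p0 k| <= C2" using rapid0(2)[of "Suc q"] by blast
 define C where "C = max C1 C2"
 define K where "K = 2 * C^2 * 4 * exp (growth q M * T)"
 have K0: "K >= 0" by (simp add: K_def)
 have eK: "energy q (int n) (%i. bn n i t) (%i. pn n i t) <= K" if "t : {0..T}" for n t
 proof -
 have "energy q (int n) b0 p0 <= 2 * C^2 * 4"
 proof (rule rapid_energy_bounded)
 show "(wt k) ^ Suc q * |b0 k| <= C" for k using C1[of k] unfolding C_def by (rule max.coboundedI1)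
 show "(wt k) ^ Suc q * |p0 k| <= C" for k using C2[of k] unfolding C_def by (rule max.coboundedI2)
 qed (simp add: q_def)
 hence "energy q (int n) b0 p0 * exp (growth q M * T) <= K"
 unfolding K_def by (intro mrm) auto
 thus ?thesis using en[of q t n] that by (simp add: q_def)
 qed
 have "(wt k) ^ q * |bn n k t| <= 2 ^ q * sqrt K & (wt k) ^ q * |pn n k t| <= 2 ^ q * sqrt K"
 if t: "t : {0..T}" for n k t
 proof (cases "k : {- int n..int n}")
 case True
 have "of_int k ^ (2 * q) * (bn n k t)^2 <= K" "of_int k ^ (2 * q) * (pn n k t)^2 <= K"
 using energy_controls_coefficient(1)[OF True, of q "%i. bn n i t" "%i. pn n i t"]
 energy_controls_coefficient(2)[OF True, of q "%i. pn n i t" "%i. bn n i t"] eK[OF t, of n] by linarith+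
 thus ?thesis
 using odd(1)[of n 0 t] odd(2)[of n 0 t] by (intro conjI weighted_coefficient_le K0) auto
 next
 case False
 thus ?thesis using zero[OF False] K0 by simp
 qed
 moreover have "(wt k) ^ s * |x| <= (wt k) ^ q * |x|" for k :: int and x :: real
 by (intro mrm power_increasing) (auto simp: q_def)
 ultimately show ?thesis by (meson order_trans)
 qed
 then obtain Cw where Cw: "!!s n k t. t : {0..T} ==> (wt k) ^ s * |bn n k t| <= Cw s"
 "!!s n k t. t : {0..T} ==> (wt k) ^ s * |pn n k t| <= Cw s" by metis
 have Cw0: "Cw s >= 0" for s
 proof -
 have "0 <= (wt 0) ^ s * |bn 0 0 0|" by simp
 also have "... <= Cw s" using T by (intro Cw) auto
 finally show ?thesis .
 qed
 have b1: "|bn n k t| <= Cw 0" "|pn n k t| <= Cw 0" if "t : {0..T}" for n k t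
 using Cw[OF that, of k 0 n] by simp_all
 \<comment> \<open>\<open>Cw 3\<close> serves |l b l| and \<open>Cw 2\<close> serves |p l|; either
   way two powers of the weight are left for summability in l. Neither n nor the shift
   enters.\<close>
 define B where "B = (%l::int. Cw 0 * (Cw 3 + Cw 2) * (1 / (wt l)^2))"
 have Bs: "B summable_on UNIV" unfolding B_def by (intro scr summable_inverse_weight)
 have B0: "B l >= 0" for l unfolding B_def by (intro mnn add_nonneg_nonneg Cw0) auto
 have prod_le: "|al i * x * y| <= Cw 0 * z" if "|x| <= Cw 0" "|y| <= z" for i x y z
 proof -
 have "|al i| * ( |x| * |y| ) <= 1 * (Cw 0 * z)" using that Cw0 by (intro mult_mono al) auto
 thus ?thesis by (simp add: abs_mult mult.assoc)
 qed
 have B1: "|al i * bn n j t * (of_int l * bn n l t) | <= B l" "|al i * bn n j t * pn n l t| <= B l" if t: "t : {0..T}" for i n j l t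
 proof -
 let ?w = "1 + |of_int l :: real|"
 have w: "?w > 0" by (simp add: add_pos_nonneg)
 have "?w^2 * |of_int l * bn n l t| <= ?w ^ 3 * |bn n l t|"
 proof -
 have e: "?w ^ 3 * |bn n l t| = ?w^2 * (?w * |bn n l t| )" by (simp add: power3_eq_cube p2q)
 have "|of_int l| * |bn n l t| <= ?w * |bn n l t|" by (intro mrm) auto
 thus ?thesis unfolding abs_mult e by (rule mlm) simp
 qed
 also have "... <= Cw 3" by (rule Cw[OF t])
 finally have "?w^2 * |of_int l * bn n l t| <= Cw 3 + Cw 2" using Cw0[of 2] by linarith
 hence 1: "|of_int l * bn n l t| <= (Cw 3 + Cw 2) * (1 / ?w^2)" using w by (simp add: fsi)
 have "?w^2 * |pn n l t| <= Cw 3 + Cw 2" using Cw(2)[OF t, of l 2 n] Cw0[of 3] by linarith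
 hence 2: "|pn n l t| <= (Cw 3 + Cw 2) * (1 / ?w^2)" using w by (simp add: fsi)
 show "|al i * bn n j t * (of_int l * bn n l t) | <= B l" "|al i * bn n j t * pn n l t| <= B l"
 using prod_le[OF b1(1)[OF t] 1] prod_le[OF b1(1)[OF t] 2] by (simp_all add: B_def mult.assoc)
 qed
 define D where "D = infsum B UNIV + Cw 0"
 have sumB: "(SUM l:F. B l) <= infsum B UNIV" if "finite F" for F
 by (rule finite_sum_le_infsum[OF Bs that]) (use B0 in auto)
 have inf0: "infsum B UNIV >= 0" by (rule infsum_nonneg) (rule B0)
 have galb: "|gal_b al (int n) (%i. bn n i t) (%i. pn n i t) k| <= D" if "t : {0..T}" for n t k
 proof -
 have "|SUM l:{- int n..int n}. al (k - l) * bn n (k - l) t * (of_int l * bn n l t) | <= (SUM l:{- int n..int n}. B l)"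
 by (intro order_trans[OF sum_abs] sum_mono B1 that)
 thus ?thesis unfolding gal_b_def D_def using sumB[OF finite_atLeastAtMost_int[of "- int n" "int n"]] b1(2)[OF that, of n k] by linarith
 qed
 have galp: "|gal_p al (int n) (%i. bn n i t) (%i. pn n i t) k| <= |of_int k| * D" if "t : {0..T}" for n t k
 proof -
 have "|SUM l:{- int n..int n}. al (k - l) * bn n (k - l) t * pn n l t| <= (SUM l:{- int n..int n}. B l)"
 by (intro order_trans[OF sum_abs] sum_mono B1 that)
 hence "|SUM l:{- int n..int n}. al (k - l) * bn n (k - l) t * pn n l t| <= D"
 unfolding D_def using sumB[OF finite_atLeastAtMost_int[of "- int n" "int n"]] Cw0[of 0] by simp
 thus ?thesis unfolding gal_p_def abs_mult by (intro mlm) auto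
 qed
 have D0: "D >= 0" using inf0 Cw0[of 0] by (simp add: D_def)
 have lip: "|bn n k t - bn n k s| <= D * |t - s|" "|pn n k t - pn n k s| <= |of_int k| * D * |t - s|"
 if ts: "t : {0..T}" "s : {0..T}" for n k t s
 proof (atomize (full), cases "k : {- int n..int n}")
 case True
 show "|bn n k t - bn n k s| <= D * |t - s| & |pn n k t - pn n k s| <= |of_int k| * D * |t - s|"
 using field_differentiable_bound[of "{0..T}" "bn n k", OF _ der(1)[OF _ True] _ ts, of D]
 field_differentiable_bound[of "{0..T}" "pn n k", OF _ der(2)[OF _ True] _ ts, of "|of_int k| * D"] galb galp
 by auto
 qed (use zero D0 in auto)
 \<comment> \<open>\<open>diagonal_uniform_subsequence\<close> is about complex functions indexed by
   naturals: \<open>bn\<close> and \<open>pn\<close> become real and imaginary part, and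
   \<open>int_decode\<close> enumerates the frequencies.\<close>
 define F where "F = (%n i t. Complex (bn n (int_decode i) t) (pn n (int_decode i) t))"
 obtain r g where r: "strict_mono r" and g: "!!i. uniform_limit {0..T} (%n. F (r n) i) (g i) sequentially"
 proof (rule diagonal_uniform_subsequence[of T F "%i. Cw 0 + Cw 0" "%i. D + |of_int (int_decode i) | * D"])
 show "norm (F n i t) <= Cw 0 + Cw 0" if "t : {0..T}" for n i t
 using cmod_le[of "F n i t"] b1[OF that, of n "int_decode i"] by (simp add: F_def)
 show "norm (F n i t - F n i s) <= (D + |of_int (int_decode i) | * D) * |t - s|"
 if "t : {0..T}" "s : {0..T}" for n i t s
 using cmod_le[of "F n i t - F n i s"] lip[OF that, of n "int_decode i"] by (simp add: F_def distrib_right)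
 qed blast
 define b p where "b = (%k t. Re (g (int_encode k) t))" and "p = (%k t. Im (g (int_encode k) t))"
 have ub: "uniform_limit {0..T} (%n. bn (r n) k) (b k) sequentially" for k
 using bounded_linear.uniform_limit[OF bounded_linear_Re g[of "int_encode k"]] by (simp add: F_def b_def)
 have up: "uniform_limit {0..T} (%n. pn (r n) k) (p k) sequentially" for k
 using bounded_linear.uniform_limit[OF bounded_linear_Im g[of "int_encode k"]] by (simp add: F_def p_def)
 have lb: "(%n. bn (r n) k t) \<longlonglongrightarrow> b k t" and lp: "(%n. pn (r n) k t) \<longlonglongrightarrow> p k t" if "t : {0..T}" for k t
 by (rule tendsto_uniform_limitI[OF ub that], rule tendsto_uniform_limitI[OF up that])
 have wb: "(wt k) ^ s * |b k t| <= Cw s" "(wt k) ^ s * |p k t| <= Cw s" if "t : {0..T}" for s k t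
 by (rule LIMSEQ_le_const2[OF tendsto_mult_left[OF tendsto_rabs[OF lb[OF that]]]], use Cw that in blast,
 rule LIMSEQ_le_const2[OF tendsto_mult_left[OF tendsto_rabs[OF lp[OF that]]]], use Cw that in blast)
 have bdd: "bounded (b k ` {0..T})" "bounded (p k ` {0..T})" for k
 unfolding bounded_iff using wb[of _ k 0] by (auto intro!: exI[of _ "Cw 0"])
 have rN: "filterlim r at_top sequentially" by (rule filterlim_subseq[OF r])
 have mult_lim: "uniform_limit {0..T} (%n t. c * x n t * (d * y n t)) (%t. c * X t * (d * Y t)) sequentially"
 if "uniform_limit {0..T} x X sequentially" "uniform_limit {0..T} y Y sequentially" "bounded (X ` {0..T})" "bounded (Y ` {0..T})"
 for x y X Y and c d :: real
 proof -
 have "uniform_limit {0..T} (%n t. c * d * (x n t * y n t)) (%t. c * d * (X t * Y t)) sequentially"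
 by (intro bounded_linear.uniform_limit[OF bounded_linear_mult_right] uniform_lim_mult that)
 thus ?thesis by (simp only: mult_ac)
 qed
 have uS1: "uniform_limit {0..T} (%n t. gal_b al (int (r n)) (%i. bn (r n) i t) (%i. pn (r n) i t) k)
 (%t. rhs_b al (%j. b j t) (%j. p j t) k) sequentially" for k
 unfolding gal_b_def rhs_b_def
 proof (intro uniform_limit_add up uniform_limit_dominated_sum[OF _ _ Bs rN])
 show "uniform_limit {0..T} (%n t. al (k - l) * bn (r n) (k - l) t * (of_int l * bn (r n) l t))
 (%t. al (k - l) * b (k - l) t * (of_int l * b l t)) sequentially" for l
 by (rule mult_lim[where c="al (k - l)" and d="of_int l", OF ub ub bdd(1) bdd(1)])
 qed (use B1 in auto)
 have uS2: "uniform_limit {0..T} (%n t. gal_p al (int (r n)) (%i. bn (r n) i t) (%i. pn (r n) i t) k)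
 (%t. rhs_p al (%j. b j t) (%j. p j t) k) sequentially" for k
 unfolding gal_p_def rhs_p_def
 proof (intro bounded_linear.uniform_limit[OF bounded_linear_mult_right] uniform_limit_dominated_sum[OF _ _ Bs rN])
 show "uniform_limit {0..T} (%n t. al (k - l) * bn (r n) (k - l) t * pn (r n) l t)
 (%t. al (k - l) * b (k - l) t * p l t) sequentially" for l
 using mult_lim[where c="al (k - l)" and d=1, OF ub up bdd(1) bdd(2), of "k - l" l] by simp
 qed (use B1 in auto)
 have ev: "eventually (%n. k : {- int (r n)..int (r n)}) sequentially" for k
 proof -
 have "eventually (%n. nat |k| <= r n) sequentially" using rN by (simp add: filterlim_at_top)
 thus ?thesis by eventually_elim auto
 qed
 have db: "(b k hrd rhs_b al (%j. b j t) (%j. p j t) k) (wi t T)" if "t : {0..T}" for k t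
 by (rule uniform_limit_derivative[OF convex_real_interval(5) ub uS1 _ that], rule eventually_mono[OF ev[of k]]) (use der in auto)
 have dp: "(p k hrd rhs_p al (%j. b j t) (%j. p j t) k) (wi t T)" if "t : {0..T}" for k t
 by (rule uniform_limit_derivative[OF convex_real_interval(5) up uS2 _ that], rule eventually_mono[OF ev[of k]]) (use der in auto)
 have T0: "0 : {0..T}" using T by simp
 show ?thesis
 proof (rule that[of b p, folded T_def])
 have "b (- k) t = - b k t" "p (- k) t = - p k t" if "t : {0..T}" for k t
 using LIMSEQ_unique[OF lb[OF that, of "- k"]] LIMSEQ_unique[OF lp[OF that, of "- k"]]
 tendsto_minus[OF lb[OF that, of k]] tendsto_minus[OF lp[OF that, of k]] by (simp_all add: odd)
 thus "coef_solution al {0..T} b p" unfolding coef_solution_def using db dp by blast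
 show "rapid_on {0..T} b" "rapid_on {0..T} p" unfolding rapid_on_def using wb by blast+
 show "b k 0 = b0 k" "p k 0 = p0 k" for k
 proof -
 have "(%n. bn (r n) k 0) \<longlonglongrightarrow> b0 k" "(%n. pn (r n) k 0) \<longlonglongrightarrow> p0 k"
 using init by (auto intro!: tendsto_eventually eventually_mono[OF ev[of k]])
 thus "b k 0 = b0 k" "p k 0 = p0 k"
 using LIMSEQ_unique[OF lb[OF T0, of k]] LIMSEQ_unique[OF lp[OF T0, of k]] by simp_all
 qed
 qed
qed

section \<open>Fourier series on the circle\<close>

lemma infsum_continuous_on:
 fixes f :: "int => 'a::topological_space => real"
 assumes "!!k. co S (f k)" "!!k x. x : S ==> |f k x| <= M k" "M summable_on UNIV"
 shows "co S (%x. ISUM k. f k x)"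
proof (rule uniform_limit_theorem)
 show "uniform_limit S (%n t. SUM l:{- int (id n)..int (id n)}. f l t) (%x. ISUM k. f k x) sequentially"
 by (rule uniform_limit_dominated_sum[where f="%n. f", OF uniform_limit_const assms(2,3)]) (auto simp: filterlim_ident id_def)
 show "eventually (%n. co S (%t. SUM l:{- int (id n)..int (id n)}. f l t)) sequentially"
 by (intro always_eventually allI cin assms(1))
qed simp

lemma infsum_has_real_derivative:
 fixes f f' :: "int => real => real"
 assumes S: "convex S"
 and der: "!!k x. x : S ==> (f k hrd f' k x) (at x within S)"
 and b0: "!!k x. x : S ==> |f k x| <= M0 k" "M0 summable_on UNIV"
 and b1: "!!k x. x : S ==> |f' k x| <= M k" "M summable_on UNIV" and x: "x : S"
 shows "((%x. ISUM k. f k x) hrd (ISUM k. f' k x)) (at x within S)"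
proof (rule uniform_limit_derivative[OF S _ _ _ x])
 show "uniform_limit S (%n t. SUM l:{- int (id n)..int (id n)}. f l t) (%x. ISUM k. f k x) sequentially"
 by (rule uniform_limit_dominated_sum[where f="%n. f", OF uniform_limit_const b0]) (auto simp: filterlim_ident id_def)
 show "uniform_limit S (%n t. SUM l:{- int (id n)..int (id n)}. f' l t) (%x. ISUM k. f' k x) sequentially"
 by (rule uniform_limit_dominated_sum[where f="%n. f'", OF uniform_limit_const b1]) (auto simp: filterlim_ident id_def)
 show "eventually (%n. ALL t:S. ((%t. SUM l:{- int (id n)..int (id n)}. f l t) hrd (SUM l:{- int (id n)..int (id n)}. f' l t)) (at t within S)) sequentially"
 by (intro always_eventually allI ballI DERIV_sum der)
qed

text \<open>Membership in a weighted Wiener algebra: weight n admits n termwise derivatives, and the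
  class is stable under \<open>conv\<close>.\<close>

definition wsum :: "nat => (int => complex) => bool" where
 "wsum n c \<longleftrightarrow> (%k. (wt k) ^ n * norm (c k)) summable_on UNIV"

definition hermitian :: "(int => complex) => bool" where
 "hermitian c \<longleftrightarrow> (\<forall>k. c (- k) = cnj (c k))"

definition conv :: "(int => complex) => (int => complex) => int => complex" where
 "conv c d k = (ISUM l. c (k - l) * d l)"

lemma wsum_le:
 assumes "wsum n c" and "!!k. (wt k) ^ m * norm (d k) <= C * ((wt k) ^ n * norm (c k))"
 shows "wsum m d"
 unfolding wsum_def
 by (rule summable_on_comparison_test[OF scr[OF assms(1)[unfolded wsum_def], of C]])
 (use assms(2) in "auto intro: mnn")

lemma wsum_mono: "wsum n c ==> m <= n ==> wsum m c"
 by (rule wsum_le[where C=1]) (auto intro!: mrm power_increasing)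

lemma wsum_rapid:
 assumes "!!k. (wt k) ^ (n + 2) * norm (c k) <= C"
 shows "wsum n c"
 unfolding wsum_def
proof (rule summable_on_comparison_test[OF scr[OF summable_inverse_weight, of C]])
 fix k :: int
 have "(wt k)^2 > 0" by (simp add: add_pos_nonneg)
 moreover have "((wt k) ^ n * norm (c k)) * (wt k)^2 <= C" using assms[of k] unfolding power_add by (simp only: mult_ac)
 ultimately show "(wt k) ^ n * norm (c k) <= C * (1 / (wt k)^2)"
 by (simp add: pos_le_divide_eq)
qed auto

lemma wsum_0D: "wsum n c ==> (%k. norm (c k)) summable_on UNIV"
 using wsum_mono[of n c 0] by (simp add: wsum_def)

lemma wsum_add: "wsum n c ==> wsum n d ==> wsum n (%k. c k + d k)"
proof -
 assume "wsum n c" "wsum n d"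
 from summable_on_add[OF this[unfolded wsum_def]] show ?thesis
 unfolding wsum_def
 proof (rule summable_on_comparison_test)
 fix k :: int
 show "(wt k) ^ n * norm (c k + d k) <= (wt k) ^ n * norm (c k) + (wt k) ^ n * norm (d k)"
 unfolding distrib_left[symmetric] by (intro mlm norm_triangle_ineq) simp
 qed simp
qed

lemma wsum_cmult: "wsum n c ==> wsum n (%k. a * c k)"
 by (rule wsum_le[where C="norm a"], assumption) (simp add: norm_mult mult_ac)

lemma wsum_diff: "wsum n c ==> wsum n d ==> wsum n (%k. c k - d k)"
 using wsum_add[OF _ wsum_cmult[of n d "-1"]] by simp

lemma summable_on_int_product:
 fixes f g :: "int => real"
 assumes "f summable_on UNIV" "g summable_on UNIV" "!!k. f k >= 0" "!!k. g k >= 0"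
 shows "(%(k, l). f (k - l) * g l) summable_on (UNIV :: (int \<times> int) set)"
proof -
 have "(%p. norm ((%(j, l). f j * g l) p)) summable_on (UNIV \<times> UNIV)"
 unfolding Infinite_Sum.abs_summable_on_Sigma_iff
 using assms by (auto simp: infsum_cmult_right' abs_mult infsum_nonneg intro!: scr summable_on_cmult_left)
 hence "(%(j, l). f j * g l) summable_on UNIV"
 using assms(3,4) by (simp add: case_prod_unfold)
 also have "?this \<longleftrightarrow> (%p. (case (fst p - snd p, snd p) of (j, l) => f j * g l)) summable_on UNIV"
 by (rule summable_on_reindex_bij_betw[symmetric])
 (rule bij_betwI[of _ _ _ "%p. (fst p + snd p, snd p)"]; auto)
 finally show ?thesis by (simp add: case_prod_unfold)
qed

text \<open>Submultiplicativity of 1 + |k| is what makes the weighted spaces algebras under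
  \<open>conv\<close>.\<close>

lemma weight_submult: "(wt k) ^ n <= (wt (k - l)) ^ n * (wt l) ^ n"
proof -
 have "(wt k) <= (wt (k - l)) + |of_int l|" by linarith
 also have "... <= (wt (k - l)) * (wt l)"
 using mnn[of "|of_int (k - l) :: real|" "|of_int l|"] by (simp only: distrib_left distrib_right) simp
 finally show ?thesis by (simp add: power_mono flip: pmd)
qed

lemma conv_summable:
 assumes "wsum n c" "wsum n d"
 shows "(%(k, l). ((wt (k - l)) ^ n * norm (c (k - l))) * ((wt l) ^ n * norm (d l))) summable_on UNIV"
 using summable_on_int_product[OF assms(1)[unfolded wsum_def] assms(2)[unfolded wsum_def]] by simp

lemma conv_summable_l: "wsum 0 c ==> wsum 0 d ==> (%l. norm (c (k - l) * d l)) summable_on UNIV"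
proof -
 assume "wsum 0 c" "wsum 0 d"
 from conv_summable[OF this] have "(%p. norm (c (fst p - snd p)) * norm (d (snd p))) summable_on UNIV"
 by (simp add: case_prod_unfold)
 hence "(%p. norm (c (fst p - snd p)) * norm (d (snd p))) summable_on (Pair k ` UNIV)"
 by (rule summable_on_subset_banach) simp
 thus ?thesis by (subst (asm) summable_on_reindex) (auto simp: inj_on_def o_def norm_mult)
qed

lemma wsum_conv:
 assumes c: "wsum n c" and d: "wsum n d"
 shows "wsum n (conv c d)"
proof -
 let ?F = "%k l. ((wt (k - l)) ^ n * norm (c (k - l))) * ((wt l) ^ n * norm (d l))"
 have S: "(%(k, l). ?F k l) summable_on UNIV \<times> UNIV" using conv_summable[OF c d] by simp
 have Sl: "(%l. ?F k l) summable_on UNIV" for k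
 proof -
 have "(%(k, l). ?F k l) summable_on (Pair k ` UNIV)"
 by (rule summable_on_subset_banach[OF S]) simp
 thus ?thesis by (subst (asm) summable_on_reindex) (auto simp: inj_on_def o_def)
 qed
 have "(%k. ISUM l. ?F k l) summable_on UNIV"
 using summable_on_Sigma_banach[OF S] .
 thus ?thesis
 unfolding wsum_def
 proof (rule summable_on_comparison_test)
 fix k :: int
 have c0: "wsum 0 c" "wsum 0 d" using c d by (auto intro: wsum_mono)
 have "norm (conv c d k) <= (ISUM l. norm (c (k - l) * d l))"
 unfolding conv_def by (rule norm_infsum_bound[OF conv_summable_l[OF c0]])
 hence "(wt k) ^ n * norm (conv c d k) <= (wt k) ^ n * (ISUM l. norm (c (k - l) * d l))"
 by (rule mlm) simp
 also have "... = (ISUM l. (wt k) ^ n * norm (c (k - l) * d l))"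
 by (simp add: infsum_cmult_right')
 also have "... <= (ISUM l. ?F k l)"
 proof (rule infsum_mono[OF scr[OF conv_summable_l[OF c0]] Sl])
 fix l
 have "(wt k) ^ n * norm (c (k - l) * d l) <= ((wt (k - l)) ^ n * (wt l) ^ n) * norm (c (k - l) * d l)"
 by (intro mrm weight_submult) simp
 thus "(wt k) ^ n * norm (c (k - l) * d l) <= ?F k l" by (simp add: norm_mult mult_ac)
 qed
 finally show "(wt k) ^ n * norm (conv c d k) <= (ISUM l. ?F k l)" .
 qed simp
qed

lemma hermitian_conv:
 assumes "hermitian c" "hermitian d"
 shows "hermitian (conv c d)"
 unfolding hermitian_def
proof
 fix k
 have "conv c d (- k) = (ISUM l. c (- k - (- l)) * d (- l))"
 unfolding conv_def by (rule infsum_reindex_bij_betw[symmetric, of uminus UNIV UNIV "%l. c (- k - l) * d l"]) (simp add: bij_uminus)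
 also have "... = (ISUM l. cnj (c (k - l) * d l))"
 proof (rule infsum_cong)
 fix l
 have "c (- k - (- l)) = cnj (c (k - l))" using assms(1) unfolding hermitian_def by (metis minus_diff_eq minus_diff_commute diff_minus_eq_add uminus_add_conv_diff)
 thus "c (- k - (- l)) * d (- l) = cnj (c (k - l) * d l)" using assms(2) by (simp add: hermitian_def)
 qed
 also have "... = cnj (conv c d k)" unfolding conv_def by (rule infsum_cnj)
 finally show "conv c d (- k) = cnj (conv c d k)" .
qed

section \<open>Fourier series of period L\<close>

locale circle =
 fixes L :: real
 assumes L_pos: "L > 0"
begin

definition K :: real where "K = 2 * pi / L"

lemma K_pos: "K > 0" using L_pos by (simp add: K_def)
lemma KL: "K * L = 2 * pi" using L_pos by (simp add: K_def)

text \<open>Taking the real part term by term makes \<open>fs c\<close> a real function for every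
  \<open>c\<close>; for hermitian \<open>c\<close> nothing is lost, see
  \<open>fs_complex\<close>.\<close>

definition fs :: "(int => complex) => real => real" where
 "fs c x = (ISUM k. Re (c k * cis (K * of_int k * x)))"

definition D :: "(int => complex) => int => complex" where
 "D c k = \<i> * of_real (K * of_int k) * c k"

lemma abs_Re_cis_le: "|Re (c * cis t) | <= norm c"
 using abs_Re_le_cmod[of "c * cis t"] by (simp add: norm_mult)

lemma fs_summable: "wsum 0 c ==> (%k. Re (c k * cis (K * of_int k * x))) summable_on A"
proof -
 assume "wsum 0 c"
 hence "(%k. norm (Re (c k * cis (K * of_int k * x)))) summable_on UNIV"
 by (rule Infinite_Sum.abs_summable_on_comparison_test'[OF wsum_0D]) (simp only: real_norm_def abs_Re_cis_le)
 from summable_on_subset_banach[OF Infinite_Sum.abs_summable_summable[OF this]] show ?thesis by simp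
qed

lemma fs_joint_continuous:
 assumes "!!k. co S (c k)" "!!k t. t : S ==> norm (c k t) <= M k" "M summable_on UNIV"
 shows "co (UNIV \<times> S) (%(x, t). fs (%k. c k t) x)"
proof -
 have "co (UNIV \<times> S) (%p. ISUM k. Re (c k (snd p) * cis (K * of_int k * fst p)))"
 proof (rule infsum_continuous_on[OF _ _ assms(3)])
 show "co (UNIV \<times> S) (%p. Re (c k (snd p) * cis (K * of_int k * fst p)))" for k
 by (intro cin coc[OF assms(1)]) auto
 show "|Re (c k (snd p) * cis (K * of_int k * fst p)) | <= M k" if "p : UNIV \<times> S" for k p
 using that by (intro order_trans[OF abs_Re_cis_le] assms(2)) auto
 qed
 thus ?thesis by (simp add: fs_def case_prod_unfold)
qed

lemma fs_continuous: "wsum 0 c ==> co S (fs c)"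
 unfolding fs_def
 by (rule infsum_continuous_on[OF _ abs_Re_cis_le wsum_0D]) (auto intro!: cin)

lemma fs_periodic: "fs c (x + L) = fs c x"
proof -
 have "cis (K * of_int k * (x + L)) = cis (K * of_int k * x)" for k
 proof -
 have "K * of_int k * (x + L) = K * of_int k * x + 2 * pi * of_int k" using KL by (simp add: als)
 thus ?thesis by (simp flip: cis_mult)
 qed
 thus ?thesis by (simp add: fs_def)
qed

lemma wsum_D: "wsum (Suc n) c ==> wsum n (D c)"
proof (rule wsum_le[where C=K])
 fix k
 have "(wt k) ^ n * norm (D c k) = K * ((wt k) ^ n * ( |of_int k| * norm (c k)))"
 using K_pos by (simp add: D_def norm_mult abs_mult)
 also have "... <= K * ((wt k) ^ n * ((wt k) * norm (c k)))"
 using K_pos by (intro mlm mrm) auto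
 finally show "(wt k) ^ n * norm (D c k) <= K * ((wt k) ^ Suc n * norm (c k))" by (simp add: mult_ac)
qed

lemma hermitian_D: "hermitian c ==> hermitian (D c)"
 by (simp add: hermitian_def D_def)

lemma fs_deriv:
 assumes "wsum 1 c"
 shows "(fs c hrd fs (D c) x) (at x)"
proof -
 have "((%x. ISUM k. Re (c k * cis (K * of_int k * x))) hrd (ISUM k. Re (D c k * cis (K * of_int k * x)))) (at x within UNIV)"
 proof (rule infsum_has_real_derivative[OF convex_UNIV _ abs_Re_cis_le wsum_0D[OF assms] abs_Re_cis_le wsum_0D[OF wsum_D[of 0]]])
 show "((%x. Re (c k * cis (K * of_int k * x))) hrd Re (D c k * cis (K * of_int k * x))) (at x within UNIV)" for k x
 by (auto simp: cis.ctr D_def intro!: dei simp: als)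
 qed (use assms in auto)
 thus ?thesis unfolding fs_def[abs_def] .
qed

lemma fs_time_deriv:
 assumes S: "convex S" and t: "t : S"
 and der: "!!k t. t : S ==> (c k has_vector_derivative c' k t) (at t within S)"
 and b: "!!k t. t : S ==> norm (c k t) <= M0 k" "M0 summable_on UNIV"
 "!!k t. t : S ==> norm (c' k t) <= M k" "M summable_on UNIV"
 shows "((%t. fs (%k. c k t) x) hrd fs (%k. c' k t) x) (at t within S)"
 unfolding fs_def
proof (rule infsum_has_real_derivative[OF S _ _ b(2) _ b(4) t])
 show "((%t. Re (c k t * cis (K * of_int k * x))) hrd Re (c' k t * cis (K * of_int k * x))) (at t within S)" if "t : S" for k t
 unfolding hrv
 by (rule bounded_linear.has_vector_derivative[OF bounded_linear_Re])
 (rule bounded_linear.has_vector_derivative[OF bounded_linear_mult_left der[OF that]])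
qed (rule order_trans[OF abs_Re_cis_le b(1)] order_trans[OF abs_Re_cis_le b(3)], assumption)+

lemma fs_add: "wsum 0 c ==> wsum 0 d ==> fs (%k. c k + d k) x = fs c x + fs d x"
 unfolding fs_def using infsum_add[OF fs_summable[of c x UNIV] fs_summable[of d x UNIV]] by (simp add: distrib_right)

lemma fs_cmult: "fs (%k. of_real r * c k) x = r * fs c x"
 unfolding fs_def by (simp add: infsum_cmult_right' mult.assoc)

lemma fs_diff: "wsum 0 c ==> wsum 0 d ==> fs (%k. c k - d k) x = fs c x - fs d x"
 using fs_add[OF _ wsum_cmult[of 0 d "-1"], of c x] fs_cmult[of "-1" d x] by simp

text \<open>Reflecting k to - k turns the complex sum into its own conjugate.\<close>

lemma fs_complex:
 assumes "wsum 0 c" "hermitian c"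
 shows "((%k. c k * cis (K * of_int k * x)) has_sum of_real (fs c x)) UNIV"
proof -
 let ?f = "%k. c k * cis (K * of_int k * x)"
 have sum: "?f summable_on UNIV"
 by (rule Infinite_Sum.abs_summable_summable[OF Infinite_Sum.abs_summable_on_comparison_test'[OF wsum_0D[OF assms(1)]]]) (simp add: norm_mult)
 have "infsum ?f UNIV = (ISUM k. ?f (- k))"
 by (rule infsum_reindex_bij_betw[symmetric]) (simp add: bij_uminus)
 also have "... = (ISUM k. cnj (?f k))"
 by (rule infsum_cong) (use assms(2) in "simp add: hermitian_def cis_cnj")
 also have "... = cnj (infsum ?f UNIV)" by (rule infsum_cnj)
 finally have "infsum ?f UNIV : \<real>" by (metis Reals_cnj_iff)
 hence "infsum ?f UNIV = of_real (Re (infsum ?f UNIV))" by (metis Reals_cases complex_of_real_def Re_complex_of_real)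
 also have "Re (infsum ?f UNIV) = fs c x" unfolding fs_def by (rule infsum_Re[OF sum, symmetric])
 finally show ?thesis using has_sum_infsum[OF sum] by simp
qed

text \<open>Fubini for the absolutely summable double family, with the first index sheared by the
  second.\<close>

lemma fs_mult:
 assumes c: "wsum 0 c" "hermitian c" and d: "wsum 0 d" "hermitian d"
 shows "fs c x * fs d x = fs (conv c d) x"
proof -
 let ?e = "%k::int. cis (K * of_int k * x)"
 let ?F = "%k l. (c (k - l) * ?e (k - l)) * (d l * ?e l)"
 have S: "(%(k, l). norm (?F k l)) summable_on UNIV \<times> UNIV"
 using conv_summable[OF c(1) d(1)] by (simp add: norm_mult)
 have S': "(%(k, l). ?F k l) summable_on UNIV \<times> UNIV"
 by (rule Infinite_Sum.abs_summable_summable) (use S in "simp add: case_prod_unfold")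
 have "(ISUM k. ISUM l. ?F k l) = (ISUM l. ISUM k. ?F k l)"
 by (rule infsum_swap_banach[OF S'])
 also have "... = (ISUM l. of_real (fs c x) * (d l * ?e l))"
 proof (rule infsum_cong)
 fix l
 have "(ISUM k. ?F k l) = (ISUM k. c (k - l) * ?e (k - l)) * (d l * ?e l)" by (simp only: infsum_cmult_left')
 also have "(ISUM k. c (k - l) * ?e (k - l)) = (ISUM k. c k * ?e k)"
 by (rule infsum_reindex_bij_betw[of "%k. k - l" UNIV UNIV "%k. c k * ?e k"]) (rule bij_betwI[of _ _ _ "%k. k + l"]; auto)
 also have "... = of_real (fs c x)" by (rule infsumI[OF fs_complex[OF c]])
 finally show "(ISUM k. ?F k l) = of_real (fs c x) * (d l * ?e l)" .
 qed
 also have "... = of_real (fs c x) * of_real (fs d x)"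
 by (simp only: infsum_cmult_right' infsumI[OF fs_complex[OF d]])
 finally have "of_real (fs c x * fs d x) = (ISUM k. ISUM l. ?F k l)" by simp
 also have "... = (ISUM k. conv c d k * ?e k)"
 proof (rule infsum_cong)
 fix k
 have "?F k l = (c (k - l) * d l) * ?e k" for l
 proof -
 have "?e (k - l) * ?e l = ?e k" by (simp add: cis_mult als)
 thus ?thesis by (metis (no_types, opaque_lifting) mult.assoc mult.commute)
 qed
 thus "(ISUM l. ?F k l) = conv c d k * ?e k" unfolding conv_def by (simp only: infsum_cmult_left')
 qed
 also have "... = of_real (fs (conv c d) x)"
 by (rule infsumI[OF fs_complex[OF wsum_conv[OF c(1) d(1)] hermitian_conv[OF c(2) d(2)]]])
 finally show ?thesis by (simp only: of_real_eq_iff)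
qed

lemma fs_const: "fs (%k. if k = 0 then a else 0) x = Re a"
proof -
 have "fs (%k. if k = 0 then a else 0) x = (\<Sum>\<^sub>\<infinity>k\<in>{0}. Re ((if k = 0 then a else 0) * cis (K * of_int k * x)))"
 unfolding fs_def by (rule infsum_cong_neutral) auto
 thus ?thesis by simp
qed

text \<open>The nonconstant part is the derivative of the periodic series \<open>h\<close>, whose
  coefficients are divided by i K k, so its integral vanishes by the fundamental theorem; sum and
  integral are never exchanged.\<close>

lemma fs_integral:
 assumes "wsum 0 c"
 shows "(fs c has_integral L * Re (c 0)) {0..L}"
proof -
 define h where "h = (%k::int. if k = 0 then 0 else c k / (\<i> * of_real (K * of_int k)))"
 define c0 where "c0 = (%k::int. if k = 0 then c 0 else 0)"
 have w0: "wsum 0 c0" by (rule wsum_le[OF assms, where C=1]) (auto simp: c0_def)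
 have hw: "wsum 1 h"
 proof (rule wsum_le[OF assms, where C="2 / K"])
 fix k :: int
 show "(wt k) ^ 1 * norm (h k) <= 2 / K * ((wt k) ^ 0 * norm (c k))"
 proof (cases "k = 0")
 case False
 hence k1: "1 <= |of_int k :: real|" by linarith
 have "(wt k) / |of_int k| <= 2" using k1 by (simp add: fsi)
 hence "(wt k) / |of_int k| * (norm (c k) / K) <= 2 * (norm (c k) / K)"
 using K_pos by (intro mrm) auto
 thus ?thesis using False K_pos by (simp add: h_def norm_divide norm_mult abs_mult mult.commute[of K])
 qed (use K_pos in "simp add: h_def")
 qed
 have Dh: "D h = (%k. c k - c0 k)" using K_pos by (auto simp: D_def h_def c0_def fun_eq_iff)
 have e: "fs c x = fs (D h) x + Re (c 0)" for x
 using fs_add[OF wsum_diff[OF assms w0] w0, of x] fs_const[of "c 0" x] by (simp add: Dh c0_def)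
 have "((%x. fs (D h) x + Re (c 0)) has_integral (fs h L + Re (c 0) * L - (fs h 0 + Re (c 0) * 0))) {0..L}"
 by (rule fundamental_theorem_of_calculus)
 (use L_pos in "auto intro!: dei DERIV_subset[OF fs_deriv[OF hw]] simp flip: hrv")
 thus ?thesis using fs_periodic[of h 0] by (simp add: e[abs_def] mult.commute)
qed

text \<open>The integral of the product is L times the real part of its coefficient
  \<open>conv c d 0\<close>, and hermitian symmetry turns that coefficient into the inner
  product.\<close>

lemma parseval:
 assumes c: "wsum 0 c" "hermitian c" and d: "wsum 0 d" "hermitian d"
 shows "((%x. fs c x * fs d x) has_integral L * (ISUM k. Re (cnj (c k) * d k))) {0..L}"
proof -
 have "conv c d 0 = (ISUM k. cnj (c k) * d k)" using c(2) by (simp add: conv_def hermitian_def)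
 moreover have "(%k. cnj (c k) * d k) summable_on UNIV"
 using Infinite_Sum.abs_summable_summable[OF conv_summable_l[OF c(1) d(1), of 0]] c(2) by (simp add: hermitian_def)
 ultimately have "Re (conv c d 0) = (ISUM k. Re (cnj (c k) * d k))" by (simp only: infsum_Re)
 thus ?thesis using fs_integral[OF wsum_conv[OF c(1) d(1)]] fs_mult[OF c d] by simp
qed

lemma parseval_square:
 assumes c: "wsum 0 c" "hermitian c"
 shows "((%x. (fs c x)\<^sup>2) has_integral L * (ISUM k. (norm (c k))\<^sup>2)) {0..L}"
 "(%k. (norm (c k))\<^sup>2) summable_on UNIV"
proof -
 have e: "Re (cnj (c k) * c k) = (norm (c k))^2" for k by (simp add: cmod_power2) (simp add: p2q)
 show "((%x. (fs c x)\<^sup>2) has_integral L * (ISUM k. (norm (c k))\<^sup>2)) {0..L}"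
 using parseval[OF c c] unfolding e p2q[symmetric] .
 have "(%k. norm (c (0 - k) * c k)) summable_on UNIV" by (rule conv_summable_l[OF c(1) c(1)])
 thus "(%k. (norm (c k))\<^sup>2) summable_on UNIV"
 using c(2) by (simp add: norm_mult hermitian_def p2q)
qed

end

section \<open>The velocity as a Fourier multiplier\<close>

lemma sum_symmetric_int:
 fixes g :: "int => real"
 shows "(SUM l:{- int n..int n}. g l) = g 0 + (\<Sum>k<n. g (int (Suc k)) + g (- int (Suc k)))"
proof (induction n)
 case (Suc n)
 have "{- int (Suc n)..int (Suc n)} = insert (int (Suc n)) (insert (- int (Suc n)) {- int n..int n})" by auto
 thus ?case using Suc by simp
qed simp

text \<open>Twice the real part of the Taylor series of \<open>ln (1 - z)\<close> at
  \<open>z = of_real r * cis ph\<close>.\<close>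

lemma log_cos_series:
 fixes r ph :: real
 assumes r: "0 < r" "r < 1"
 shows "(%k. - 2 * r ^ Suc k / real (Suc k) * cos (real (Suc k) * ph)) sums ln (1 - 2 * r * cos ph + r^2)"
proof -
 define z where "z = of_real r * cis ph"
 have z: "norm z = r" using r by (simp add: z_def norm_mult)
 have ne: "1 - z ~= 0" using z r by auto
 have "(%n. (-1) ^ Suc n / of_nat n * (- z) ^ n) sums ln (1 + (- z))" by (rule Ln_series) (use z r in auto)
 from sums_Re[OF this] have S: "(%n. Re ((-1) ^ Suc n / of_nat n * (- z) ^ n)) sums Re (ln (1 - z))"
 by (simp only: add_uminus_conv_diff)
 have re: "Re ((-1) ^ Suc n / of_nat n * (- z) ^ n) = - (r ^ n / real n * cos (real n * ph))" for n
 proof -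
 have "(-1) ^ n * (- z) ^ n = z ^ n" using pmd[of "-1" "- z" n] by simp
 moreover have "(-1) ^ Suc n / of_nat n * (- z) ^ n = - (((-1) ^ n * (- z) ^ n) / of_nat n)" by simp
 ultimately have "(-1) ^ Suc n / of_nat n * (- z) ^ n = - (z ^ n / of_nat n)" by (simp only:)
 also have "z ^ n = of_real (r ^ n) * cis (real n * ph)" by (simp only: z_def pmd Complex.DeMoivre of_real_power)
 finally show ?thesis by (cases "n = 0") (simp_all add: Re_divide_of_nat)
 qed
 have "(%n. - (r ^ n / real n * cos (real n * ph))) sums Re (ln (1 - z))" using S unfolding re .
 hence "(%n. - (r ^ Suc n / real (Suc n) * cos (real (Suc n) * ph))) sums Re (ln (1 - z))"
 by (subst sums_Suc_iff) simp
 hence "(%n. 2 * - (r ^ Suc n / real (Suc n) * cos (real (Suc n) * ph))) sums (2 * Re (ln (1 - z)))"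
 by (rule sums_mult)
 moreover have "2 * Re (ln (1 - z)) = ln ((norm (1 - z))^2)" using ne by (simp add: Re_Ln ln_realpow)
 moreover have "(norm (1 - z))^2 = 1 - 2 * r * cos ph + r^2"
 proof -
 have "(norm (1 - z))^2 = (1 - r * cos ph)^2 + (r * sin ph)^2" by (simp add: z_def cmod_power2)
 also have "... = 1 - 2 * r * cos ph + r^2 * ((sin ph)^2 + (cos ph)^2)" by algebra
 finally show ?thesis by simp
 qed
 ultimately show ?thesis by (simp add: mult.assoc)
qed

text \<open>Fourier coefficients of \<open>ln (s2 z + ep r)\<close>: the argument equals |1 - r cis
  (K z)|^2 / (4 r), which yields the geometric factors from the two conjugate logarithms and - ln (4
  r) at k = 0. The value r = 1 belongs to the singular kernel \<open>ln (s2 z)\<close>.\<close>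

definition lc :: "real => int => real" where
 "lc r k = (if k = 0 then - ln (4 * r) else - (r ^ nat |k| / of_int |k| ))"

definition ep :: "real => real" where
 "ep r = (1 - r)^2 / (4 * r)"

text \<open>The root in (0, 1) of \<open>ep r = a\<close>, so that the second logarithm of the
  kernel belongs to the same family.\<close>

definition rr :: "real => real" where
 "rr a = 1 + 2 * a - 2 * sqrt (a^2 + a)"

lemma ep_rr:
 assumes "a > 0"
 shows "0 < rr a" "rr a < 1" "ep (rr a) = a"
proof -
 define s where "s = sqrt (a^2 + a)"
 have s2: "s^2 = a^2 + a" using assms by (simp add: s_def)
 have s0: "s > a" unfolding s_def using assms by (intro real_less_rsqrt) simp
 have "s < a + 1 / 2" unfolding s_def by (rule real_less_lsqrt) (use assms in "auto simp: p2q fsi")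
 thus r: "0 < rr a" "rr a < 1" using s0 by (simp_all add: rr_def s_def)
 have "(1 - rr a)^2 = 4 * rr a * a"
 unfolding rr_def s_def[symmetric] using s2 by (simp add: p2q als)
 thus "ep (rr a) = a" using r by (simp add: ep_def)
qed

lemma lc_abs_le:
 assumes "1 / 2 <= r" "r <= 1"
 shows "|lc r k| <= 2"
proof (cases "k = 0")
 case True
 have "ln (4 * r) >= 0" "ln (4 * r) <= 4 * r - 1" using assms by (auto intro: ln_ge_zero ln_le_minus_one)
 moreover have "ln (4 * r) <= ln (2 ^ 2)" using assms by (intro ln_mono) auto
 moreover have "ln (2 ^ 2 :: real) = 2 * ln 2" using ln_realpow[of 2 2] by simp
 moreover have "ln 2 <= (1 :: real)" using ln_le_minus_one[of 2] by simp
 ultimately have "|ln (4 * r) | <= 2" by linarith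
 thus ?thesis using True by (simp add: lc_def)
next
 case False
 hence "1 <= |of_int k :: real|" by linarith
 moreover have "0 <= r ^ nat |k|" "r ^ nat |k| <= 1" using assms by (auto intro: power_le_one)
 ultimately have "r ^ nat |k| / |of_int k| <= 1" by (simp add: divide_le_eq)
 moreover have "|lc r k| = r ^ nat |k| / |of_int k|" using False assms by (simp add: lc_def)
 ultimately show ?thesis by linarith
qed

context circle begin

definition s2 :: "real => real" where
 "s2 z = (sin (pi / L * z))^2"

lemma s2_nonneg: "s2 z >= 0" and s2_le_1: "s2 z <= 1"
 by (simp_all add: s2_def abs_square_le_1)

lemma s2_cos: "s2 z = (1 - cos (K * z)) / 2"
 using cos_double_sin[of "pi / L * z"] by (simp add: s2_def K_def fsi)

lemma wsum_lc:
 assumes "0 < r" "r < 1"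
 shows "wsum 0 (%k. of_real (lc r k))"
proof -
 have "summable (%n. r ^ n)" using assms by (intro summable_geometric) auto
 hence "(%n::nat. r ^ n) summable_on UNIV" using assms by (simp add: summable_on_UNIV_nonneg_real_iff)
 have S: "(%k. r ^ nat |k| ) summable_on (UNIV :: int set)"
 proof -
 have a: "(%k::int. r ^ nat |k| ) summable_on (int ` UNIV)"
 by (subst summable_on_reindex) (use \<open>(%n::nat. r ^ n) summable_on UNIV\<close> in "auto simp: o_def")
 have b: "(%k::int. r ^ nat |k| ) summable_on ((%n. - int n) ` UNIV)"
 by (subst summable_on_reindex) (use \<open>(%n::nat. r ^ n) summable_on UNIV\<close> in "auto simp: o_def inj_def")
 have "(UNIV :: int set) = int ` UNIV \<union> (%n. - int n) ` UNIV"
 by (auto simp: image_iff) (metis int_cases2)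
 thus ?thesis using summable_on_union[OF a b] by simp
 qed
 have "(%k. r ^ nat |k| + (if k = 0 then |ln (4 * r) | else 0)) summable_on (UNIV :: int set)"
 proof (rule summable_on_add[OF S])
 have "(%k. if k = 0 then |ln (4 * r) | else 0) summable_on {0 :: int}" by simp
 thus "(%k. if k = 0 then |ln (4 * r) | else 0) summable_on (UNIV :: int set)"
 by (subst summable_on_cong_neutral[where T="{0}" and g="%k. if k = 0 then |ln (4 * r) | else 0"]) auto
 qed
 thus ?thesis unfolding wsum_def
 proof (rule summable_on_comparison_test)
 fix k :: int
 show "(wt k) ^ 0 * norm (of_real (lc r k) :: complex) <= r ^ nat |k| + (if k = 0 then |ln (4 * r) | else 0)"
 proof (cases "k = 0")
 case False
 hence "1 <= |of_int k :: real|" by linarith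
 hence "r ^ nat |k| / |of_int k| <= r ^ nat |k| / 1" using assms by (intro divide_left_mono) auto
 thus ?thesis unfolding norm_of_real using False assms by (simp add: lc_def)
 qed (use assms in "simp add: lc_def")
 qed simp
qed

lemma log_kernel_series:
 assumes r: "0 < r" "r < 1"
 shows "ln (s2 z + ep r) = fs (%k. of_real (lc r k)) z"
proof -
 define g where "g = (%k::int. Re (of_real (lc r k) * cis (K * of_int k * z)))"
 have gs: "g summable_on UNIV" unfolding g_def by (rule fs_summable[OF wsum_lc[OF r]])
 have "uniform_limit {0::real} (%n t. SUM l:{- int (id n)..int (id n)}. g l) (%t. ISUM l. g l) sequentially"
 by (rule uniform_limit_dominated_sum[where f="%n l t. g l" and M="%l. |g l|"])
 (use summable_on_iff_abs_summable_on_real[THEN iffD1, OF gs] in "auto simp: filterlim_ident id_def intro: uniform_limit_const")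
 from tendsto_uniform_limitI[OF this, of 0]
 have lim: "(%n. SUM l:{- int n..int n}. g l) \<longlonglongrightarrow> (ISUM l. g l)" by simp
 have g1: "g (int (Suc k)) + g (- int (Suc k)) = - 2 * r ^ Suc k / real (Suc k) * cos (real (Suc k) * (K * z))" for k
 proof -
 have ga: "g (int (Suc k)) = - (r ^ Suc k / real (Suc k)) * cos (real (Suc k) * (K * z))"
 by (simp add: g_def lc_def nat_add_distrib mult_ac)
 have gb: "g (- int (Suc k)) = - (r ^ Suc k / real (Suc k)) * cos (- (real (Suc k) * (K * z)))"
 by (simp add: g_def lc_def nat_add_distrib mult_ac del: cos_minus) (simp add: als)
 have "- (A / B) * c + - (A / B) * c = - 2 * A / B * c" for A B c :: real by simp
 thus ?thesis unfolding ga gb cos_minus .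
 qed
 have "(%n. g 0 + (\<Sum>k<n. g (int (Suc k)) + g (- int (Suc k)))) \<longlonglongrightarrow> g 0 + ln (1 - 2 * r * cos (K * z) + r^2)"
 unfolding g1 using log_cos_series[OF r, of "K * z"] by (intro tendsto_intros) (simp add: sums_def)
 hence "(ISUM l. g l) = g 0 + ln (1 - 2 * r * cos (K * z) + r^2)"
 using lim unfolding sum_symmetric_int by (rule LIMSEQ_unique[rotated])
 moreover have "g 0 = - ln (4 * r)" by (simp add: g_def lc_def)
 moreover have "s2 z + ep r = (1 - 2 * r * cos (K * z) + r^2) / (4 * r)"
 using r by (simp add: s2_cos ep_def fsi p2q)
 moreover have "1 - 2 * r * cos (K * z) + r^2 > 0"
 proof -
 have "(1 - r)^2 > 0" using r by simp
 moreover have "r * cos (K * z) <= r * 1" using r by (intro mlm) auto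
 ultimately show ?thesis by (simp add: power2_diff)
 qed
 ultimately show ?thesis using r by (simp add: fs_def g_def ln_div)
qed

lemma circle_integral_eq:
 "co {0..L} f ==> ci L f = in0 L f"
 by (rule lebesgue_integral_eq_integral[OF continuous_imp_integrable_real]) auto

lemma integrable_circle: "co {0..L} f ==> integrable (lebesgue_on {0..L}) (f :: real => real)"
 by (rule continuous_imp_integrable_real)

text \<open>Parseval against the translate of the even kernel; the translation by x appears as the
  phase in \<open>c\<close>.\<close>

lemma log_kernel_convolution:
 assumes r: "0 < r" "r < 1" and d: "wsum 0 d" "hermitian d"
 shows "ci L (%y. fs d y * ln (s2 (x - y) + ep r)) = L * fs (%k. of_real (lc r k) * d k) x"
proof -
 define c where "c = (%k. of_real (lc r k) * cis (- (K * of_int k * x)) :: complex)"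
 have c: "wsum 0 c" "hermitian c"
 using wsum_lc[OF r] by (auto simp: wsum_def c_def norm_mult hermitian_def cis_cnj lc_def)
 have e: "ln (s2 (x - y) + ep r) = fs c y" for y
 proof -
 have "s2 (x - y) = s2 (y - x)" by (simp add: s2_cos) (metis cos_minus minus_diff_eq mult_minus_right)
 hence "ln (s2 (x - y) + ep r) = fs (%k. of_real (lc r k)) (y - x)" by (simp add: log_kernel_series[OF r])
 also have "... = fs c y" unfolding fs_def
 by (intro infsum_cong) (simp add: c_def mult.assoc cis_mult right_diff_distrib)
 finally show ?thesis .
 qed
 have "ci L (%y. fs d y * fs c y) = in0 L (%y. fs d y * fs c y)"
 by (intro circle_integral_eq cin fs_continuous c d)
 also have "... = L * (ISUM k. Re (cnj (d k) * c k))" by (rule integral_unique[OF parseval[OF d c]])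
 also have "(ISUM k. Re (cnj (d k) * c k)) = fs (%k. of_real (lc r k) * d k) x"
 unfolding fs_def
 proof (rule infsum_cong)
 fix k
 have "cnj (of_real (lc r k) * d k * cis (K * of_int k * x)) = cnj (d k) * c k" by (simp add: c_def cis_cnj)
 thus "Re (cnj (d k) * c k) = Re (of_real (lc r k) * d k * cis (K * of_int k * x))" by (metis complex_cnj(1) cnj.sel(1))
 qed
 finally show ?thesis by (simp add: e)
qed

text \<open>A sequence increasing to 1 along which \<open>ep\<close> decreases to 0; staying above
  1/2 keeps \<open>lc\<close> bounded by 2 uniformly.\<close>

definition rs :: "nat => real" where "rs n = 1 - 1 / (real n + 2)"

lemma rs: "0 < rs n" "rs n < 1" "1 / 2 <= rs n" and rs_lim: "rs \<longlonglongrightarrow> 1" and ep_rs_lim: "(%n. ep (rs n)) \<longlonglongrightarrow> 0"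
proof -
 show "0 < rs n" "rs n < 1" "1 / 2 <= rs n" by (simp_all add: rs_def fsi)
 show l: "rs \<longlonglongrightarrow> 1" unfolding rs_def by real_asymp
 have "(%n. ep (rs n)) \<longlonglongrightarrow> (1 - 1)\<^sup>2 / (4 * 1)"
 unfolding ep_def by (intro tendsto_intros l) auto
 thus "(%n. ep (rs n)) \<longlonglongrightarrow> 0" by simp
qed

lemma ep_rs: "0 < ep (rs n)" "ep (rs (Suc n)) <= ep (rs n)" "ep (rs n) <= 1"
proof -
 have e: "ep (rs n) = 1 / (4 * (real n + 1) * (real n + 2))" for n
 proof -
 have e1: "1 - rs n = 1 / (real n + 2)" by (simp add: rs_def)
 have e2: "rs n = (real n + 1) / (real n + 2)" by (simp add: rs_def fsi)
 have "(1 / q)^2 / (4 * (p / q)) = 1 / (4 * p * q)" if "p > 0" "q > 0" for p q :: real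
 using that by (simp add: p2q fsi)
 thus ?thesis unfolding ep_def e1 unfolding e2 by (rule) simp_all
 qed
 show "0 < ep (rs n)" unfolding e by simp
 show "ep (rs (Suc n)) <= ep (rs n)" unfolding e by (intro divide_left_mono mult_mono mult_pos_pos) auto
 have "1 <= 4 * (real n + 1) * (real n + 2)" by (simp add: als)
 hence "1 / (4 * (real n + 1) * (real n + 2)) <= 1 / 1" by (rule divide_left_mono) auto
 thus "ep (rs n) <= 1" unfolding e by simp
qed

section \<open>Integrability of the singular kernel and the velocity multiplier\<close>

lemma s2_zero_negligible: "negligible {y. s2 (x - y) = 0}"
proof (rule negligible_subset)
 show "negligible (range (%n::int. x - of_int n * L))"
 by (simp add: negligible_iff_null_sets null_sets_completionI countable_imp_null_set_lborel)
 show "{y. s2 (x - y) = 0} \<subseteq> range (%n::int. x - of_int n * L)"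
 proof
 fix y assume "y : {y. s2 (x - y) = 0}"
 then obtain n :: int where "pi / L * (x - y) = of_int n * pi" by (auto simp: s2_def sin_zero_iff_int2)
 hence "pi * (x - y) = pi * (of_int n * L)" using L_pos by (simp add: fsi)
 hence "x - y = of_int n * L" by (simp only: mult_cancel_left) simp
 thus "y : range (%n::int. x - of_int n * L)" by (auto intro!: image_eqI[of _ _ n])
 qed
qed

lemma s2_continuous: "co S (%y. s2 (x - y))"
 unfolding s2_def by (intro cin)

lemma ln_s2_continuous: "e > 0 ==> co S (%y. ln (s2 (x - y) + e))"
 by (intro cin s2_continuous) (metis add_nonneg_pos s2_nonneg less_irrefl)

lemma log_sin_integrable:
 shows "integrable (lebesgue_on {0..L}) (%y. ln (s2 (x - y)))"
proof -
 \<comment> \<open>At the zeros of \<open>s2\<close> the limit is \<open>ln 0 = 0\<close>, whereas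
   \<open>ln (ep (rs n))\<close> tends to minus infinity. Setting \<open>f\<close> to 0 on this null
   set makes the sequence converge everywhere and leaves the integrals unchanged.\<close>
 define f where "f = (%n y. if s2 (x - y) = 0 then 0 else ln (s2 (x - y) + ep (rs n)))"
 have ci: "(%y. ln (s2 (x - y) + ep (rs n))) integrable_on {0..L}" for n
 by (rule icr[OF ln_s2_continuous[OF ep_rs(1)]])
 have spike: "f n integrable_on {0..L}" "in0 L (f n) = in0 L (%y. ln (s2 (x - y) + ep (rs n)))" for n
 by (rule integrable_spike[OF ci s2_zero_negligible[of x]], simp add: f_def)
 (rule integral_spike[OF s2_zero_negligible[of x]], simp add: f_def)
 have "(%y. ln (s2 (x - y))) integrable_on {0..L} & (%n. in0 L (f n)) \<longlonglongrightarrow> in0 L (%y. ln (s2 (x - y)))"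
 proof (rule monotone_convergence_decreasing[OF spike(1)])
 show "f (Suc n) y <= f n y" if "y : {0..L}" for n y
 proof -
 have "0 < s2 (x - y) + ep (rs (Suc n))" using s2_nonneg[of "x - y"] ep_rs(1)[of "Suc n"] by linarith
 thus ?thesis using ep_rs(2)[of n] by (simp add: f_def)
 qed
 show "(%n. f n y) \<longlonglongrightarrow> ln (s2 (x - y))" if "y : {0..L}" for y
 proof (cases "s2 (x - y) = 0")
 case False
 have "(%n. ln (s2 (x - y) + ep (rs n))) \<longlonglongrightarrow> ln (s2 (x - y) + 0)"
 by (intro tendsto_intros ep_rs_lim) (use False in auto)
 thus ?thesis using False by (simp add: f_def)
 qed (simp add: f_def)
 have w1: "wsum 0 (%k. if k = 0 then 1 else 0)"
 unfolding wsum_def by (subst summable_on_cong_neutral[where T="{0}" and g="%_. 1"]) auto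
 have h1: "hermitian (%k. if k = 0 then 1 else 0)" by (simp add: hermitian_def)
 \<comment> \<open>Convolving the kernel with the constant 1 gives the integrals exactly; their
   boundedness is the hypothesis of monotone convergence.\<close>
 have "in0 L (f n) = L * lc (rs n) 0" for n
 proof -
 have "in0 L (f n) = ci L (%y. fs (%k. if k = 0 then 1 else 0) y * ln (s2 (x - y) + ep (rs n)))"
 unfolding spike(2) using fs_const[of 1]
 by (subst circle_integral_eq) (auto intro!: cin ln_s2_continuous ep_rs(1))
 also have "... = L * fs (%k. if k = 0 then of_real (lc (rs n) 0) else 0) x"
 unfolding log_kernel_convolution[OF rs(1,2) w1 h1] by (intro arg_cong2[where f="(*)"] arg_cong2[where f=fs]) auto
 finally show ?thesis by (simp add: fs_const)
 qed
 moreover have "|L * lc (rs n) 0| <= L * 2" for n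
 using lc_abs_le[of "rs n" 0] rs[of n] L_pos by (simp add: abs_mult)
 ultimately show "bounded (range (%n. in0 L (f n)))"
 by (auto simp: bounded_iff intro!: exI[of _ "L * 2"])
 qed
 hence "(%y. - ln (s2 (x - y))) integrable_on {0..L}" by (auto intro: integrable_neg)
 hence "(%y. - ln (s2 (x - y))) absolutely_integrable_on {0..L}"
 proof (rule nonnegative_absolutely_integrable_1)
 fix y
 show "0 <= - ln (s2 (x - y))"
 using s2_nonneg[of "x - y"] s2_le_1[of "x - y"] by (cases "s2 (x - y) = 0") auto
 qed
 hence "integrable (lebesgue_on {0..L}) (%y. - ln (s2 (x - y)))"
 by (simp add: integrable_restrict_space set_integrable_def)
 thus ?thesis by simp
qed

text \<open>Multiplier from \<omega> to the velocity: the prefactor 1 / (2 pi) and the factor L of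
  \<open>log_kernel_convolution\<close> combine to 1 / K.\<close>

definition vm :: "real => int => real" where
 "vm a k = (lc 1 k - lc (rr a) k) / K"

definition vme :: "nat => real => int => real" where
 "vme n a k = (lc (rs n) k - lc (rr a) k) / K"

definition velocity_reg :: "nat => real => (real => real) => real => real" where
 "velocity_reg n a w x = 1 / (2 * pi) * ci L (%y. w y * (ln (s2 (x - y) + ep (rs n)) - ln (s2 (x - y) + a)))"

lemma lc_bounded: "0 < r ==> r <= 1 ==> |lc r k| <= |ln (4 * r) | + 1"
proof (cases "k = 0")
 case False
 assume r: "0 < r" "r <= 1"
 have "1 <= |of_int k :: real|" using False by linarith
 moreover have "0 <= r ^ nat |k|" "r ^ nat |k| <= 1" using r by (auto intro: power_le_one)
 ultimately have "r ^ nat |k| / |of_int k| <= 1" by (simp add: divide_le_eq)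
 moreover have "|lc r k| = r ^ nat |k| / |of_int k|" using False r by (simp add: lc_def)
 ultimately show ?thesis using abs_ge_zero[of "ln (4 * r)"] by linarith
qed (simp add: lc_def)

lemma wsum_real_mult:
 assumes "wsum n d" "!!k. |q k| <= B"
 shows "wsum n (%k. of_real (q k) * d k)"
proof (rule wsum_le[OF assms(1), where C=B])
 fix k
 have "(wt k) ^ n * ( |q k| * norm (d k)) <= (wt k) ^ n * (B * norm (d k))"
 by (intro mlm mrm assms) auto
 thus "(wt k) ^ n * norm (of_real (q k) * d k) <= B * ((wt k) ^ n * norm (d k))"
 by (simp add: norm_mult mult_ac)
qed

lemma velocity_reg_fs:
 assumes a: "a > 0" and d: "wsum 0 d" "hermitian d"
 shows "velocity_reg n a (fs d) x = fs (%k. of_real (vme n a k) * d k) x"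
proof -
 have w: "wsum 0 (%k. of_real (lc r k) * d k)" if "0 < r" "r < 1" for r
 by (rule wsum_real_mult[OF d(1) lc_bounded]) (use that in auto)
 have ci: "integrable (lebesgue_on {0..L}) (%y. fs d y * ln (s2 (x - y) + e))" if "e > 0" for e
 by (intro integrable_circle cin fs_continuous d ln_s2_continuous that)
 have "ci L (%y. fs d y * (ln (s2 (x - y) + ep (rs n)) - ln (s2 (x - y) + a)))
 = ci L (%y. fs d y * ln (s2 (x - y) + ep (rs n))) - ci L (%y. fs d y * ln (s2 (x - y) + a))"
 unfolding right_diff_distrib by (rule Bochner_Integration.integral_diff[OF ci ci]) (use a ep_rs in auto)
 also have "... = L * fs (%k. of_real (lc (rs n) k) * d k) x - L * fs (%k. of_real (lc (rr a) k) * d k) x"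
 using log_kernel_convolution[OF rs(1,2) d, of x n] log_kernel_convolution[OF ep_rr(1,2)[OF a] d, of x] ep_rr(3)[OF a] by simp
 also have "... = L * fs (%k. of_real (lc (rs n) k) * d k - of_real (lc (rr a) k) * d k) x"
 using fs_diff[OF w[OF rs(1,2)] w[OF ep_rr(1,2)[OF a]]] by (simp add: right_diff_distrib)
 finally have "velocity_reg n a (fs d) x = 1 / K * fs (%k. of_real (lc (rs n) k) * d k - of_real (lc (rr a) k) * d k) x"
 by (simp add: velocity_reg_def K_def)
 also have "... = fs (%k. of_real (1 / K) * (of_real (lc (rs n) k) * d k - of_real (lc (rr a) k) * d k)) x"
 by (rule fs_cmult[symmetric])
 also have "... = fs (%k. of_real (vme n a k) * d k) x"
 by (intro arg_cong2[where f=fs] ext) (simp_all add: vme_def als diff_divide_distrib)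
 finally show ?thesis .
qed

lemma velocity_eq_s2:
 assumes "a > 0"
 shows "velocity L a w x = 1 / (2 * pi) * ci L (%y. w y * (ln (s2 (x - y)) - ln (s2 (x - y) + a)))"
proof -
 have "|s2 (x - y) + a| = s2 (x - y) + a" for y using s2_nonneg[of "x - y"] assms by simp
 thus ?thesis unfolding velocity_def by (simp add: s2_def)
qed

lemma velocity_reg_lim:
 assumes a: "a > 0" and w: "co {0..L} w"
 shows "(%n. velocity_reg n a w x) \<longlonglongrightarrow> velocity L a w x"
proof -
 let ?M = "lebesgue_on {0..L}"
 have wm: "w : borel_measurable ?M" by (rule continuous_imp_measurable_on_sets_lebesgue[OF w]) auto
 have bw: "bounded (w ` {0..L})" by (intro compact_imp_bounded compact_continuous_image w) auto
 hence "\<exists>B. ALL y:{0..L}. |w y| <= B" unfolding bounded_iff by auto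
 then obtain B where B: "!!y. y : {0..L} ==> |w y| <= B" by blast
 have B0: "B >= 0" using B[of 0] L_pos by force
 have cm: "(%y. ln (s2 (x - y) + e)) : borel_measurable ?M" if "e > 0" for e
 by (rule continuous_imp_measurable_on_sets_lebesgue[OF ln_s2_continuous[OF that]]) auto
 have lm: "(%y. ln (s2 (x - y))) : borel_measurable ?M" using log_sin_integrable[of x] by (rule borel_measurable_integrable)
 have am: "integrable ?M (%y. |ln (s2 (x - y) + a) | )"
 by (intro integrable_circle cin ln_s2_continuous a)
 have "(%n. ci L (%y. w y * (ln (s2 (x - y) + ep (rs n)) - ln (s2 (x - y) + a))))
 \<longlonglongrightarrow> ci L (%y. w y * (ln (s2 (x - y)) - ln (s2 (x - y) + a)))"
 \<comment> \<open>Since \<open>ep (rs n) <= 1\<close>, the regularised logarithm lies between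
   \<open>ln (s2 (x - y))\<close>, which is integrable, and \<open>ln 2\<close>.\<close>
 proof (rule integral_dominated_convergence[where w="%y. B * ( |ln (s2 (x - y)) | + ln 2 + |ln (s2 (x - y) + a) | )"])
 show "(%y. w y * (ln (s2 (x - y)) - ln (s2 (x - y) + a))) : borel_measurable ?M"
 by (intro borel_measurable_times borel_measurable_diff wm lm cm a)
 show "(%y. w y * (ln (s2 (x - y) + ep (rs n)) - ln (s2 (x - y) + a))) : borel_measurable ?M" for n
 by (intro borel_measurable_times borel_measurable_diff wm cm a ep_rs)
 show "integrable ?M (%y. B * ( |ln (s2 (x - y)) | + ln 2 + |ln (s2 (x - y) + a) | ))"
 by (intro integrable_mult_right Bochner_Integration.integrable_add am integrable_abs log_sin_integrable integrable_circle cin)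
 have AE: "AE y in ?M. s2 (x - y) ~= 0"
 proof -
 have "{y. s2 (x - y) = 0} : null_sets lebesgue" using s2_zero_negligible[of x] by (simp add: negligible_iff_null_sets)
 hence "AE y in lebesgue. y \<notin> {y. s2 (x - y) = 0}" by (rule AE_not_in)
 thus ?thesis by (subst AE_restrict_space_iff) (auto elim: AE_mp)
 qed
 show "AE y in ?M. (%n. w y * (ln (s2 (x - y) + ep (rs n)) - ln (s2 (x - y) + a))) \<longlonglongrightarrow> w y * (ln (s2 (x - y)) - ln (s2 (x - y) + a))"
 using AE
 proof eventually_elim
 case (elim y)
 have "(%n. ln (s2 (x - y) + ep (rs n))) \<longlonglongrightarrow> ln (s2 (x - y) + 0)"
 by (intro tendsto_intros ep_rs_lim) (use elim in auto)
 thus ?case by (auto intro!: tendsto_intros)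
 qed
 show "AE y in ?M. norm (w y * (ln (s2 (x - y) + ep (rs n)) - ln (s2 (x - y) + a))) <= B * ( |ln (s2 (x - y)) | + ln 2 + |ln (s2 (x - y) + a) | )" for n
 using AE AE_space[of ?M]
 proof eventually_elim
 case (elim y)
 hence y: "y : {0..L}" by simp
 have p: "s2 (x - y) > 0" using elim(1) s2_nonneg[of "x - y"] by linarith
 have "ln (s2 (x - y)) <= ln (s2 (x - y) + ep (rs n))" using p ep_rs(1)[of n] by simp
 moreover have "ln (s2 (x - y) + ep (rs n)) <= ln 2"
 using p ep_rs(1,3)[of n] s2_le_1[of "x - y"] by (intro ln_mono) auto
 moreover have "(0::real) <= ln 2" by simp
 ultimately have "|ln (s2 (x - y) + ep (rs n)) - ln (s2 (x - y) + a) | <= |ln (s2 (x - y)) | + ln 2 + |ln (s2 (x - y) + a) |"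
 by linarith
 hence "|w y| * |ln (s2 (x - y) + ep (rs n)) - ln (s2 (x - y) + a) | <= B * ( |ln (s2 (x - y)) | + ln 2 + |ln (s2 (x - y) + a) | )"
 by (intro mult_mono B y B0) auto
 thus ?case by (simp add: abs_mult)
 qed
 qed
 thus ?thesis unfolding velocity_reg_def velocity_eq_s2[OF a] by (rule tendsto_mult_left)
qed

text \<open>Both sides are limits of the regularised identity: on the left by dominated convergence,
  on the right by continuity of the series in r up to r = 1, where \<open>lc\<close> stays
  bounded.\<close>

lemma velocity_fs:
 assumes a: "a > 0" and d: "wsum 0 d" "hermitian d"
 shows "velocity L a (fs d) x = fs (%k. of_real (vm a k) * d k) x"
proof -
 have "(%n. velocity_reg n a (fs d) x) \<longlonglongrightarrow> velocity L a (fs d) x"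
 by (rule velocity_reg_lim[OF a fs_continuous[OF d(1)]])
 moreover have "(%n. fs (%k. of_real (vme n a k) * d k) x) \<longlonglongrightarrow> fs (%k. of_real (vm a k) * d k) x"
 proof -
 define B where "B = ( |ln (4 * rr a) | + 1 + 2) / K"
 define F where "F = (%r. ISUM k. Re (of_real ((lc r k - lc (rr a) k) / K) * d k * cis (K * of_int k * x)))"
 have "co {1/2..1} F"
 unfolding F_def
 proof (rule infsum_continuous_on)
 show "(%k. B * norm (d k)) summable_on UNIV" by (intro scr wsum_0D[OF d(1)])
 show "co {1/2..1} (%r. Re (of_real ((lc r k - lc (rr a) k) / K) * d k * cis (K * of_int k * x)))" for k
 unfolding lc_def using K_pos by (cases "k = 0") (auto intro!: cin)
 show "|Re (of_real ((lc r k - lc (rr a) k) / K) * d k * cis (K * of_int k * x)) | <= B * norm (d k)" if "r : {1/2..1}" for k r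
 proof -
 have "|lc r k| <= 2" by (rule lc_abs_le) (use that in auto)
 moreover have "|lc (rr a) k| <= |ln (4 * rr a) | + 1" using ep_rr[OF a] by (intro lc_bounded) auto
 ultimately have "|lc r k - lc (rr a) k| <= |ln (4 * rr a) | + 1 + 2" by linarith
 hence "| (lc r k - lc (rr a) k) / K| <= B" using K_pos by (simp add: B_def divide_right_mono)
 hence "norm (of_real ((lc r k - lc (rr a) k) / K) * d k) <= B * norm (d k)"
 unfolding norm_mult norm_of_real by (rule mrm) simp
 thus ?thesis using abs_Re_cis_le order_trans by blast
 qed
 qed
 hence "(%n. F (rs n)) \<longlonglongrightarrow> F 1"
 by (rule continuous_on_tendsto_compose[OF _ rs_lim]) (use rs in "auto intro!: always_eventually less_imp_le")
 thus ?thesis by (simp add: F_def fs_def vme_def vm_def)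
 qed
 ultimately show ?thesis unfolding velocity_reg_fs[OF a d] by (rule LIMSEQ_unique)
qed

end

section \<open>Completeness of the trigonometric system\<close>

text \<open>Half-lines generate the Borel sets and are stable under intersection, so Dynkin's
  theorem gives vanishing integrals over all Borel sets. Every Lebesgue set is Borel up to a null
  set.\<close>

lemma AE_zero_if_integrals_atMost_zero:
 fixes g :: "real => real"
 assumes S: "S : sets lebesgue" and g: "integrable (lebesgue_on S) g"
 and zero: "!!a. (\<integral>x\<in>{..a} \<inter> S. g x \<partial>lebesgue_on S) = 0"
 and total: "(\<integral>x. g x \<partial>lebesgue_on S) = 0"
 shows "AE x in lebesgue_on S. g x = 0"
proof -
 let ?M = "lebesgue_on S"
 have sp: "space ?M = S" by simp
 have bm: "A \<inter> S : sets ?M" if "A : sets lebesgue" for A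
 using that S by (auto simp: sets_restrict_space)
 have si: "set_integrable ?M A g" if "A : sets ?M" for A
 unfolding set_integrable_def by (rule integrable_mult_indicator[OF that g])
 have borel: "(\<integral>x\<in>A \<inter> S. g x \<partial>?M) = 0" if "A : sets borel" for A
 proof -
 have "A : sigma_sets UNIV (range (atMost :: real => _))"
 using that by (simp add: borel_eq_atMost sets_measure_of)
 thus ?thesis
 proof (induction rule: sigma_sets_induct_disjoint[rotated 2, consumes 1, case_names basic empty compl union stable sub])
 case (basic A)
 thus ?case using zero by auto
 next
 case empty
 show ?case by (simp add: set_lebesgue_integral_def)
 next
 case (compl A)
 hence A: "A : sets borel" by (simp add: borel_eq_atMost sets_measure_of)
 have "(\<integral>x\<in>S. g x \<partial>?M) = (\<integral>x. g x \<partial>?M)"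
 unfolding set_lebesgue_integral_def by (intro Bochner_Integration.integral_cong) auto
 moreover have "(\<integral>x\<in>(A \<inter> S) \<union> ((UNIV - A) \<inter> S). g x \<partial>?M) = (\<integral>x\<in>A \<inter> S. g x \<partial>?M) + (\<integral>x\<in>(UNIV - A) \<inter> S. g x \<partial>?M)"
 by (rule set_integral_Un) (use A in "auto intro!: si bm")
 moreover have "(A \<inter> S) \<union> ((UNIV - A) \<inter> S) = S" by auto
 ultimately show ?case using compl total by simp
 next
 case (union A)
 hence A: "A i : sets borel" for i by (auto simp: borel_eq_atMost sets_measure_of)
 have "(\<integral>x\<in>(\<Union>i. A i \<inter> S). g x \<partial>?M) = (\<Sum>i. (\<integral>x\<in>A i \<inter> S. g x \<partial>?M))"
 proof (rule lebesgue_integral_countable_add)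
 show "A i \<inter> S : sets ?M" for i using A by (intro bm) auto
 show "(A i \<inter> S) \<inter> (A j \<inter> S) = {}" if "i ~= j" for i j
 using union(1) that by (auto simp: disjoint_family_on_def)
 show "set_integrable ?M (\<Union>i. A i \<inter> S) g"
 by (intro si sets.countable_UN) (use A in "auto intro!: bm")
 qed
 thus ?case using union by simp
 next
 case stable
 show ?case by (auto simp: Int_stable_def)
 next
 case sub
 show ?case by simp
 qed
 qed
 show ?thesis
 proof (rule density_unique_real[of ?M g "%_. 0", OF g])
 show "(\<integral>x\<in>A. g x \<partial>?M) = (\<integral>x\<in>A. 0 \<partial>?M)" if "A : sets ?M" for A
 proof -
 have AS: "A : sets lebesgue" "A \<subseteq> S" using that S by (auto simp: sets_restrict_space)
 obtain B N N' where B: "A = B \<union> N" "N \<subseteq> N'" "N' : null_sets lborel" "B : sets lborel"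
 using AS(1) by (rule sets_completionE)
 have "N' : null_sets lebesgue" using B(3) by (rule null_sets_completionI)
 hence "AE x in lebesgue. x \<notin> N'" by (rule AE_not_in)
 hence ae: "AE x in ?M. x \<notin> N'" using S by (subst AE_restrict_space_iff) (auto elim: AE_mp)
 have "(\<integral>x\<in>A. g x \<partial>?M) = (\<integral>x\<in>B \<inter> S. g x \<partial>?M)"
 unfolding set_lebesgue_integral_def
 proof (rule integral_cong_AE)
 show "(%x. indicat_real A x *\<^sub>R g x) : borel_measurable ?M"
 using si[OF that] unfolding set_integrable_def by (rule borel_measurable_integrable)
 have "B \<inter> S : sets ?M" using B(4) by (intro bm) auto
 from si[OF this] show "(%x. indicat_real (B \<inter> S) x *\<^sub>R g x) : borel_measurable ?M"
 unfolding set_integrable_def by (rule borel_measurable_integrable)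
 show "AE x in ?M. indicat_real A x *\<^sub>R g x = indicat_real (B \<inter> S) x *\<^sub>R g x"
 using ae AE_space[of ?M] by eventually_elim (use B in "auto simp: indicator_def")
 qed
 also have "... = 0" by (rule borel) (use B in simp)
 finally show ?thesis by simp
 qed
 qed simp
qed

context circle begin

text \<open>The arc from 0 to a is a superlevel set of a single cosine centred at its midpoint. Its
  indicator is therefore a limit of continuous functions of that cosine, and polynomial
  approximation in one variable suffices for completeness.\<close>

lemma cos_ge_iff_interval:
 assumes a: "0 <= a" "a <= L" and x: "0 <= x" "x < L"
 shows "cos (K * (x - a / 2)) >= cos (K * (a / 2)) \<longleftrightarrow> x <= a"
proof -
 define t where "t = K * (x - a / 2)"
 define b where "b = K * (a / 2)"
 have b: "0 <= b" "b <= pi" using a K_pos KL mlm[OF a(2), of K] by (simp_all add: b_def)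
 have t: "- b <= t" "t < 2 * pi - b"
 using x K_pos KL mult_strict_left_mono[OF x(2), of K] by (simp_all add: t_def b_def als)
 have xa: "x <= a \<longleftrightarrow> t <= b" using K_pos by (simp add: t_def b_def)
 have "cos t >= cos b \<longleftrightarrow> t <= b"
 proof (cases "t <= b")
 case True
 hence "cos b <= cos |t|" using t b by (intro cos_monotone_0_pi_le) auto
 thus ?thesis using True by (simp add: abs_if split: if_splits)
 next
 case False
 show ?thesis
 proof (cases "t <= pi")
 case True
 hence "cos t < cos b" using False b by (intro cos_monotone_0_pi) auto
 thus ?thesis using False by simp
 next
 case False2: False
 hence "cos (2 * pi - t) < cos b" using t b by (intro cos_monotone_0_pi) auto
 thus ?thesis using False by simp
 qed
 qed
 thus ?thesis using xa by (simp add: t_def b_def)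
qed

lemma cos_power_expansion:
 "cos ph ^ n = (\<Sum>j\<le>n. real (n choose j) / 2 ^ n * cos ((2 * real j - real n) * ph))"
proof -
 have "(of_real (cos ph) :: complex) = (cis ph + cis (- ph)) / 2"
 by (simp add: complex_eq_iff)
 hence "(of_real (cos ph ^ n) :: complex) = (cis ph + cis (- ph)) ^ n / 2 ^ n"
 by (simp only: of_real_power power_divide)
 also have "(cis ph + cis (- ph)) ^ n = (\<Sum>j\<le>n. of_nat (n choose j) * cis ph ^ j * cis (- ph) ^ (n - j))"
 by (rule binomial_ring)
 also have "... = (\<Sum>j\<le>n. of_nat (n choose j) * cis ((2 * real j - real n) * ph))"
 proof (rule sum.cong[OF refl])
 fix j assume "j : {..n}"
 hence "cis ph ^ j * cis (- ph) ^ (n - j) = cis ((2 * real j - real n) * ph)"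
 unfolding Complex.DeMoivre cis_mult by (intro arg_cong[where f=cis]) (simp add: of_nat_diff als)
 thus "of_nat (n choose j) * cis ph ^ j * cis (- ph) ^ (n - j) = of_nat (n choose j) * cis ((2 * real j - real n) * ph)"
 by (simp add: mult.assoc)
 qed
 finally have "Re (of_real (cos ph ^ n)) = Re ((\<Sum>j\<le>n. of_nat (n choose j) * cis ((2 * real j - real n) * ph)) / 2 ^ n)"
 by (rule arg_cong)
 also have "... = (\<Sum>j\<le>n. real (n choose j) / 2 ^ n * cos ((2 * real j - real n) * ph))"
 proof -
 have "Re (z / 2 ^ n) = Re z / 2 ^ n" for z :: complex
 by (metis Re_divide_of_real of_real_numeral of_real_power)
 thus ?thesis by (simp add: sum_divide_distrib)
 qed
 finally show ?thesis by simp
qed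

text \<open>Powers of a shifted cosine are trigonometric polynomials; Weierstrass on [-1, 1] extends
  orthogonality to continuous functions of that cosine, and ramps extend it to indicators of
  arcs.\<close>

theorem trig_complete:
 assumes g: "integrable (lebesgue_on {0..L}) g"
 and c: "!!k::int. ci L (%x. g x * cos (K * of_int k * x)) = 0"
 and s: "!!k::int. ci L (%x. g x * sin (K * of_int k * x)) = 0"
 shows "AE x in lebesgue_on {0..L}. g x = 0"
proof (rule AE_zero_if_integrals_atMost_zero[OF _ g])
 let ?M = "lebesgue_on {0..L}"
 have gb: "integrable ?M (%x. g x * h x)" if "h : borel_measurable ?M" "!!x. x : {0..L} ==> |h x| <= B" for h B
 proof (rule Bochner_Integration.integrable_bound[OF integrable_mult_left[OF integrable_abs[OF g], of B]])
 show "(%x. g x * h x) : borel_measurable ?M" using that(1) borel_measurable_integrable[OF g] by (rule borel_measurable_times[rotated])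
 show "AE x in ?M. norm (g x * h x) <= norm ( |g x| * B)"
 using AE_space[of ?M]
 proof eventually_elim
 case (elim x)
 hence "|h x| <= |B|" using that(2)[of x] by auto
 thus ?case by (simp add: abs_mult mlm)
 qed
 qed
 have contm: "h : borel_measurable ?M" if "co {0..L} h" for h :: "real => real"
 by (rule continuous_imp_measurable_on_sets_lebesgue[OF that]) auto
 have cosx: "ci L (%x. g x * cos (K * of_int k * (x - x0))) = 0" for k :: int and x0
 proof -
 have e: "g x * cos (K * of_int k * (x - x0)) = g x * cos (K * of_int k * x) * cos (K * of_int k * x0) + g x * sin (K * of_int k * x) * sin (K * of_int k * x0)" for x
 by (simp add: cos_diff right_diff_distrib distrib_left mult.assoc)
 have "ci L (%x. g x * cos (K * of_int k * x) * cos (K * of_int k * x0) + g x * sin (K * of_int k * x) * sin (K * of_int k * x0))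
 = ci L (%x. g x * cos (K * of_int k * x) * cos (K * of_int k * x0)) + ci L (%x. g x * sin (K * of_int k * x) * sin (K * of_int k * x0))"
 by (rule Bochner_Integration.integral_add; intro integrable_mult_left gb[where B=1] contm cin) auto
 thus ?thesis by (simp add: e c s)
 qed
 have power: "ci L (%x. g x * cos (K * (x - x0)) ^ n) = 0" for n x0
 proof -
 have "ci L (%x. g x * cos (K * (x - x0)) ^ n) =
 ci L (%x. \<Sum>j\<le>n. real (n choose j) / 2 ^ n * (g x * cos (K * of_int (2 * int j - int n) * (x - x0))))"
 by (simp add: cos_power_expansion sum_distrib_left mult_ac)
 also have "... = (\<Sum>j\<le>n. ci L (%x. real (n choose j) / 2 ^ n * (g x * cos (K * of_int (2 * int j - int n) * (x - x0)))))"
 by (rule Bochner_Integration.integral_sum) (intro integrable_mult_right gb[where B=1] contm cin, auto)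
 also have "... = (\<Sum>j\<le>n. real (n choose j) / 2 ^ n * ci L (%x. g x * cos (K * of_int (2 * int j - int n) * (x - x0))))"
 by (simp only: integral_mult_right_zero)
 also have "... = 0" unfolding cosx by simp
 finally show ?thesis .
 qed
 have poly: "ci L (%x. g x * p (cos (K * (x - x0)))) = 0" if p: "real_polynomial_function p" for p x0
 proof -
 obtain a n where pe: "p = (%x. \<Sum>i\<le>n. a i * x ^ i)" using p real_polynomial_function_iff_sum by auto
 have "ci L (%x. g x * p (cos (K * (x - x0)))) = ci L (%x. \<Sum>i\<le>n. a i * (g x * cos (K * (x - x0)) ^ i))"
 by (simp add: pe sum_distrib_left mult_ac)
 also have "... = (\<Sum>i\<le>n. ci L (%x. a i * (g x * cos (K * (x - x0)) ^ i)))"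
 by (rule Bochner_Integration.integral_sum) (intro integrable_mult_right gb[where B=1] contm cin, auto simp: power_abs power_le_one)
 also have "... = 0" using power by simp
 finally show ?thesis .
 qed
 have cont: "ci L (%x. g x * \<psi> (cos (K * (x - x0)))) = 0" if \<psi>: "co UNIV \<psi>" for \<psi> x0
 proof (rule ccontr)
 assume ne: "ci L (%x. g x * \<psi> (cos (K * (x - x0)))) ~= 0"
 define A where "A = ci L (%x. |g x| ) + 1"
 have A: "A > 0" unfolding A_def by (intro add_nonneg_pos integral_nonneg_AE) auto
 define e where "e = |ci L (%x. g x * \<psi> (cos (K * (x - x0)))) | / A"
 have e: "e > 0" using ne A by (simp add: e_def)
 obtain p where p: "real_polynomial_function p" "!!y. y : {-1..1} ==> | \<psi> y - p y| < e"
 using Stone_Weierstrass_real_polynomial_function[of "{-1..1::real}" \<psi> e] e \<psi> by (auto intro: continuous_on_subset)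
 have pc: "co UNIV p" using p(1) by (intro continuous_at_imp_continuous_on ballI continuous_real_polymonial_function)
 have cc: "co {0..L} (%x. \<psi> (cos (K * (x - x0))) - p (cos (K * (x - x0))))"
 by (intro cin coc[OF \<psi>] coc[OF pc]) auto
 have in1: "cos y : {-1..1}" for y :: real by simp
 have i1: "integrable ?M (%x. g x * (\<psi> (cos (K * (x - x0))) - p (cos (K * (x - x0)))))"
 by (rule gb[OF contm[OF cc], of e]) (use p(2)[OF in1] in "auto intro: less_imp_le")
 obtain Bp where Bp: "!!x. x : {-1..1} ==> |p x| <= Bp"
 proof -
 have "bounded (p ` {-1..1})" by (intro compact_imp_bounded compact_continuous_image continuous_on_subset[OF pc]) auto
 hence "\<exists>B. ALL x:{-1..1}. |p x| <= B" unfolding bounded_iff by auto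
 thus ?thesis using that by blast
 qed
 have i2: "integrable ?M (%x. g x * p (cos (K * (x - x0))))"
 by (rule gb[of _ Bp]) (use Bp[OF in1] in "auto intro!: contm coc[OF pc] cin")
 have "ci L (%x. g x * \<psi> (cos (K * (x - x0)))) =
 ci L (%x. g x * (\<psi> (cos (K * (x - x0))) - p (cos (K * (x - x0)))) + g x * p (cos (K * (x - x0))))"
 by (simp add: als)
 also have "... = ci L (%x. g x * (\<psi> (cos (K * (x - x0))) - p (cos (K * (x - x0)))))"
 using Bochner_Integration.integral_add[OF i1 i2] poly[OF p(1), of x0] by simp
 also have "| ... | <= ci L (%x. |g x| * e)"
 proof (rule order_trans[OF integral_abs_bound])
 show "ci L (%x. |g x * (\<psi> (cos (K * (x - x0))) - p (cos (K * (x - x0)))) | ) <= ci L (%x. |g x| * e)"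
 by (rule integral_mono[OF integrable_abs[OF i1] integrable_mult_left[OF integrable_abs[OF g]]])
 (use less_imp_le[OF p(2)[OF in1]] in "auto simp: abs_mult intro!: mlm")
 qed
 also have "... < A * e" using e by (simp add: A_def)
 also have "... = |ci L (%x. g x * \<psi> (cos (K * (x - x0)))) |" using A by (simp add: e_def)
 finally show False by simp
 qed
 show total: "ci L g = 0" using c[of 0] by simp
 show "(\<integral>x\<in>{..a} \<inter> {0..L}. g x \<partial>?M) = 0" for a
 proof -
 consider "a < 0" | "a >= L" | "0 <= a" "a < L" by linarith
 thus ?thesis
 proof cases
 case 1
 hence e: "{..a} \<inter> {0..L} = {}" by auto
 show ?thesis unfolding e set_lebesgue_integral_def by simp
 next
 case 2
 hence e: "{..a} \<inter> {0..L} = {0..L}" by auto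
 have "(\<integral>x\<in>{0..L}. g x \<partial>?M) = ci L g"
 unfolding set_lebesgue_integral_def by (intro Bochner_Integration.integral_cong) auto
 thus ?thesis unfolding e using total by simp
 next
 case 3
 define b where "b = cos (K * (a / 2))"
 \<comment> \<open>A ramp equal to 1 for y >= b and to 0 as soon as n (b - y) >= 1; it converges to
   the indicator of y >= b.\<close>
 define \<psi> where "\<psi> = (%(n::nat) y. max 0 (min 1 (1 + real n * (y - b))))"
 have lim: "(%n. ci L (%x. g x * \<psi> n (cos (K * (x - a / 2))))) \<longlonglongrightarrow> (\<integral>x\<in>{..a} \<inter> {0..L}. g x \<partial>?M)"
 unfolding set_lebesgue_integral_def
 proof (rule integral_dominated_convergence[where w="%x. |g x|"])
 have "{..a} \<inter> {0..L} : sets ?M" by (auto simp: sets_restrict_space)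
 from integrable_mult_indicator[OF this g]
 show "(%x. indicat_real ({..a} \<inter> {0..L}) x *\<^sub>R g x) : borel_measurable ?M" by (rule borel_measurable_integrable)
 show "(%x. g x * \<psi> n (cos (K * (x - a / 2)))) : borel_measurable ?M" for n
 by (intro borel_measurable_times borel_measurable_integrable[OF g] contm) (auto simp: \<psi>_def intro!: cin)
 show "AE x in ?M. norm (g x * \<psi> n (cos (K * (x - a / 2)))) <= |g x|" for n
 by (intro AE_I2) (auto simp: \<psi>_def abs_mult intro!: mult_left_le)
 \<comment> \<open>The point L has to be left out: the cosine takes there its value at 0, so the
   superlevel test succeeds although L > a.\<close>
 have "{L} : null_sets lebesgue" by (simp add: null_sets_completionI)
 hence "AE x in lebesgue. x \<notin> {L}" by (rule AE_not_in)
 hence "AE x in ?M. x ~= L" by (subst AE_restrict_space_iff) (auto elim: AE_mp)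
 thus "AE x in ?M. (%n. g x * \<psi> n (cos (K * (x - a / 2)))) \<longlonglongrightarrow> indicat_real ({..a} \<inter> {0..L}) x *\<^sub>R g x"
 using AE_space[of ?M]
 proof eventually_elim
 case (elim x)
 hence x: "0 <= x" "x < L" by auto
 define y where "y = cos (K * (x - a / 2))"
 have iff: "b <= y \<longleftrightarrow> x <= a" using cos_ge_iff_interval[of a x] 3 x by (simp add: b_def y_def)
 have "(%n. \<psi> n y) \<longlonglongrightarrow> (if x <= a then 1 else 0)"
 proof (cases "x <= a")
 case True
 hence "\<psi> n y = 1" for n using iff by (simp add: \<psi>_def)
 thus ?thesis using True by simp
 next
 case False
 hence yb: "b - y > 0" using iff by simp
 have "eventually (%n. \<psi> n y = 0) sequentially"
 proof -
 obtain N :: nat where N: "1 / (b - y) < real N" using reals_Archimedean2 by blast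
 have "\<psi> n y = 0" if "n >= N" for n
 proof -
 have "1 / (b - y) < real n" using N that by (meson less_le_trans of_nat_mono)
 hence "1 < real n * (b - y)" using yb by (simp add: fsi)
 hence "1 + real n * (y - b) < 0" by (simp add: als)
 thus ?thesis by (simp add: \<psi>_def)
 qed
 thus ?thesis unfolding eventually_sequentially by blast
 qed
 thus ?thesis using False by (simp add: tendsto_eventually)
 qed
 from tendsto_mult_left[OF this, of "g x"] show ?case
 using x by (simp add: y_def indicator_def mult.commute split: if_splits)
 qed
 qed (use g in auto)
 have z: "ci L (%x. g x * \<psi> n (cos (K * (x - a / 2)))) = 0" for n
 by (rule cont) (auto simp: \<psi>_def intro!: cin)
 show ?thesis using lim unfolding z LIMSEQ_const_iff by (rule sym)
 qed
 qed
qed simp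

end

section \<open>Sobolev functions and Fourier coefficients\<close>

lemma smooth_deriv:
 assumes "smooth ph"
 shows "((deriv ^^ n) ph hrd (deriv ^^ Suc n) ph x) (at x)"
 using assms unfolding smooth_def by (metis DERIV_deriv_iff_real_differentiable comp_apply funpow.simps(2))

lemma smooth_continuous: "smooth ph ==> co S ((deriv ^^ n) ph)"
 by (intro continuous_at_imp_continuous_on ballI DERIV_isCont[OF smooth_deriv])

lemma deriv_periodic:
 assumes "smooth ph" "!!x. ph (x + L) = ph x"
 shows "(deriv ^^ n) ph (x + L) = (deriv ^^ n) ph (x :: real)"
proof (induction n arbitrary: x)
 case (Suc n)
 have "((%x. (deriv ^^ n) ph (x + L)) hrd (deriv ^^ Suc n) ph (x + L)) (at x)"
 using smooth_deriv[OF assms(1), of n "x + L"] by (simp add: DERIV_shift)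
 hence "((deriv ^^ n) ph hrd (deriv ^^ Suc n) ph (x + L)) (at x)" by (simp add: Suc)
 thus ?case using smooth_deriv[OF assms(1), of n x] DERIV_unique by blast
qed (simp add: assms)

lemma periodic_fun_simple_iff: "periodic_fun_simple f L \<longleftrightarrow> (\<forall>x. f (x + L) = f x)"
 by (simp add: periodic_fun_simple_def)

context circle begin

lemma integral_by_parts_periodic:
 fixes F G f g :: "real => real"
 assumes "!!x. (F hrd f x) (at x)" "!!x. (G hrd g x) (at x)"
 and c: "co {0..L} f" "co {0..L} g" and p: "F L = F 0" "G L = G 0"
 shows "in0 L (%x. F x * g x) = - in0 L (%x. f x * G x)"
proof -
 have cF: "co {0..L} F" "co {0..L} G"
 by (intro continuous_at_imp_continuous_on ballI DERIV_isCont[OF assms(1)] DERIV_isCont[OF assms(2)])+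
 have "((%x. f x * G x + F x * g x) has_integral (F L * G L - F 0 * G 0)) {0..L}"
 by (rule fundamental_theorem_of_calculus)
 (use L_pos in "auto intro!: dei DERIV_subset[OF assms(1)] DERIV_subset[OF assms(2)] simp: mult.commute simp flip: hrv")
 hence "in0 L (%x. f x * G x + F x * g x) = 0" using p by (simp add: integral_unique)
 moreover have "in0 L (%x. f x * G x + F x * g x) = in0 L (%x. f x * G x) + in0 L (%x. F x * g x)"
 by (rule hk_add) (intro icr cin c cF)+
 ultimately show ?thesis by simp
qed

text \<open>With all weights at once the series is smooth and may be differentiated termwise
  arbitrarily often.\<close>

definition allw :: "(int => complex) => bool" where
 "allw c \<longleftrightarrow> (\<forall>n. wsum n c)"

lemma allw_D: "allw c ==> allw ((D ^^ n) c)"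
 by (induction n) (auto simp: allw_def wsum_D)

lemma hermitian_Dn: "hermitian c ==> hermitian ((D ^^ n) c)"
 by (induction n) (auto simp: hermitian_D)

lemma Dn_eq: "(D ^^ n) c k = (\<i> * of_real (K * of_int k)) ^ n * c k"
 by (induction n) (simp_all add: D_def mult.assoc)

lemma fs_single: "fs (%j. if j = k then z else 0) x = Re (z * cis (K * of_int k * x))"
proof -
 have "fs (%j. if j = k then z else 0) x = (\<Sum>\<^sub>\<infinity>j\<in>{k}. Re ((if j = k then z else 0) * cis (K * of_int j * x)))"
 unfolding fs_def by (rule infsum_cong_neutral) auto
 thus ?thesis by simp
qed

lemma allw_finite:
 assumes "finite F" "!!k. k \<notin> F ==> c k = 0"
 shows "allw c"
 unfolding allw_def wsum_def
proof
 fix n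
 have "(%k. (wt k) ^ n * norm (c k)) summable_on F" using assms(1) by simp
 thus "(%k. (wt k) ^ n * norm (c k)) summable_on UNIV"
 by (rule summable_on_cong_neutral[THEN iffD1, rotated -1]) (use assms in auto)
qed

lemma deriv_fs:
 assumes "allw c"
 shows "(deriv ^^ n) (fs c) = fs ((D ^^ n) c)"
proof (induction n)
 case (Suc n)
 have "deriv (fs ((D ^^ n) c)) x = fs (D ((D ^^ n) c)) x" for x
 by (rule DERIV_imp_deriv[OF fs_deriv]) (use allw_D[OF assms] in "simp add: allw_def")
 moreover have "(deriv ^^ Suc n) (fs c) = deriv (fs ((D ^^ n) c))" by (simp add: Suc)
 ultimately show ?case by auto
qed simp

lemma smooth_periodic_fs: "allw c ==> smooth_periodic L (fs c)"
 unfolding smooth_periodic_def smooth_def deriv_fs periodic_fun_simple_iff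
 using fs_deriv[of "(D ^^ n) c" for n] allw_D
 by (auto simp: fs_periodic allw_def real_differentiable_def)

lemma smooth_periodic_trig: "smooth_periodic L (%x. Re (z * cis (K * of_int k * x)))"
 and deriv_trig: "(deriv ^^ n) (%x. Re (z * cis (K * of_int k * x))) = (%x. Re ((\<i> * of_real (K * of_int k)) ^ n * z * cis (K * of_int k * x)))"
proof -
 define c where "c = (%j. if j = k then z else 0)"
 have c: "allw c" by (rule allw_finite[of "{k}"]) (auto simp: c_def)
 have e: "fs c = (%x. Re (z * cis (K * of_int k * x)))" unfolding c_def by (rule ext) (rule fs_single)
 show "smooth_periodic L (%x. Re (z * cis (K * of_int k * x)))" using smooth_periodic_fs[OF c] unfolding e .
 have Dc: "(D ^^ n) c = (%j. if j = k then (\<i> * of_real (K * of_int k)) ^ n * z else 0)"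
 by (auto simp: Dn_eq c_def)
 have e2: "fs (%j. if j = k then w else 0) = (%x. Re (w * cis (K * of_int k * x)))" for w
 by (rule ext) (rule fs_single)
 show "(deriv ^^ n) (%x. Re (z * cis (K * of_int k * x))) = (%x. Re ((\<i> * of_real (K * of_int k)) ^ n * z * cis (K * of_int k * x)))"
 using deriv_fs[OF c, of n] unfolding e Dc e2 .
qed

lemma fs_weak_deriv_identity:
 assumes "allw c" "smooth_periodic L ph"
 shows "in0 L (%x. fs c x * (deriv ^^ n) ph x) = (-1) ^ n * in0 L (%x. fs ((D ^^ n) c) x * ph x)"
 using assms(1)
proof (induction n arbitrary: c)
 case (Suc n)
 have ph: "smooth ph" "!!x. ph (x + L) = ph x" using assms(2) by (auto simp: smooth_periodic_def periodic_fun_simple_iff)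
 have w: "wsum 1 c" "wsum 0 (D c)" using Suc.prems allw_D[OF Suc.prems, of 1] by (auto simp: allw_def)
 have "in0 L (%x. fs c x * (deriv ^^ Suc n) ph x) = - in0 L (%x. fs (D c) x * (deriv ^^ n) ph x)"
 by (rule integral_by_parts_periodic[OF fs_deriv[OF w(1)] smooth_deriv[OF ph(1)] fs_continuous[OF w(2)] smooth_continuous[OF ph(1)]])
 (use fs_periodic[of c 0] deriv_periodic[of ph L, OF ph, of n 0] in auto)
 also have "... = - ((-1) ^ n * in0 L (%x. fs ((D ^^ n) (D c)) x * ph x))"
 using Suc.IH[OF allw_D[OF Suc.prems, of 1, simplified]] by simp
 finally show ?case by (simp add: funpow_swap1)
qed simp

lemma square_integrable_continuous: "co {0..L} f ==> square_integrable L f"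
 unfolding square_integrable_def
 by (auto intro!: integrable_circle cin continuous_imp_measurable_on_sets_lebesgue)

lemma has_weak_deriv_fs:
 assumes "allw c"
 shows "has_weak_deriv L n (fs c) (fs ((D ^^ n) c))"
proof -
 have w: "wsum 0 c" "wsum 0 ((D ^^ n) c)" using assms allw_D[OF assms, of n] by (auto simp: allw_def)
 have "ci L (%x. fs c x * (deriv ^^ n) ph x) = (-1) ^ n * ci L (%x. fs ((D ^^ n) c) x * ph x)"
 if ph: "smooth_periodic L ph" for ph
 proof -
 have s: "smooth ph" using ph by (simp add: smooth_periodic_def)
 show ?thesis
 using fs_weak_deriv_identity[OF assms ph, of n] smooth_continuous[OF s, of "{0..L}" 0]
 by (subst (1 2) circle_integral_eq) (auto intro!: cin fs_continuous w smooth_continuous[OF s])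
 qed
 thus ?thesis unfolding has_weak_deriv_def by (auto intro!: square_integrable_continuous fs_continuous w)
qed

lemma square_integrable_imp_integrable:
 assumes "square_integrable L g"
 shows "integrable (lebesgue_on {0..L}) g"
proof (rule Bochner_Integration.integrable_bound[where f="%x. 1 + (g x)^2"])
 show "integrable (lebesgue_on {0..L}) (%x. 1 + (g x)^2)"
 using assms by (auto simp: square_integrable_def intro!: Bochner_Integration.integrable_add integrable_circle)
 show "g : borel_measurable (lebesgue_on {0..L})" using assms by (simp add: square_integrable_def)
 show "AE x in lebesgue_on {0..L}. norm (g x) <= norm (1 + (g x)^2)"
 proof (rule AE_I2)
 fix x
 have "0 <= ( |g x| - 1 / 2)^2" by simp
 moreover have "( |g x| - 1 / 2)^2 = (g x)^2 - |g x| + 1 / 4" by (simp add: power2_diff power_divide)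
 ultimately have "|g x| <= 1 + (g x)^2" by linarith
 thus "norm (g x) <= norm (1 + (g x)^2)" by simp
 qed
qed

lemma square_integrable_mult:
 assumes "square_integrable L f" "square_integrable L g"
 shows "integrable (lebesgue_on {0..L}) (%x. f x * g x)"
proof (rule Bochner_Integration.integrable_bound[where f="%x. (f x)\<^sup>2 + (g x)^2"])
 show "integrable (lebesgue_on {0..L}) (%x. (f x)\<^sup>2 + (g x)^2)"
 using assms by (auto simp: square_integrable_def intro!: Bochner_Integration.integrable_add)
 show "(%x. f x * g x) : borel_measurable (lebesgue_on {0..L})" using assms by (auto simp: square_integrable_def)
 show "AE x in lebesgue_on {0..L}. norm (f x * g x) <= norm ((f x)^2 + (g x)^2)"
 proof (rule AE_I2)
 fix x
 have "0 <= ( |f x| - |g x| )^2 + (f x)^2 + (g x)^2" by simp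
 hence "|f x * g x| <= (f x)^2 + (g x)^2" by (simp add: power2_diff abs_mult)
 thus "norm (f x * g x) <= norm ((f x)^2 + (g x)^2)" by simp
 qed
qed

lemma square_integrable_diff:
 assumes f: "square_integrable L f" and g: "square_integrable L g"
 shows "square_integrable L (%x. f x - g x)"
proof -
 have "integrable (lebesgue_on {0..L}) (%x. (f x)\<^sup>2 - 2 * (f x * g x) + (g x)^2)"
 using f g square_integrable_mult[OF f g] by (auto simp: square_integrable_def)
 moreover have "(f x - g x)^2 = (f x)^2 - 2 * (f x * g x) + (g x)^2" for x by (simp add: power2_diff)
 ultimately show ?thesis using f g by (auto simp: square_integrable_def)
qed

lemma has_weak_derivD:
 "has_weak_deriv L n f g ==> smooth_periodic L ph ==>
 ci L (%x. f x * (deriv ^^ n) ph x) = (-1) ^ n * ci L (%x. g x * ph x)"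
 by (simp add: has_weak_deriv_def)

text \<open>Sines and cosines are admissible test functions, so \<open>trig_complete\<close> applies
  to the difference. This is what frees \<open>sobolev_norm\<close> from the choice made in
  \<open>weak_deriv\<close>.\<close>

lemma weak_deriv_unique:
 assumes "has_weak_deriv L n f g" "has_weak_deriv L n f g'"
 shows "AE x in lebesgue_on {0..L}. g x = g' x"
proof -
 have sq: "square_integrable L g" "square_integrable L g'" using assms by (auto simp: has_weak_deriv_def)
 note i = square_integrable_imp_integrable[OF sq(1)] square_integrable_imp_integrable[OF sq(2)]
 have "ci L (%x. (g x - g' x) * ph x) = 0" if ph: "smooth_periodic L ph" for ph
 proof -
 have s: "square_integrable L ph"
 using ph smooth_continuous[of ph _ 0] by (auto simp: smooth_periodic_def intro!: square_integrable_continuous)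
 have "(-1) ^ n * ci L (%x. g x * ph x) = (-1) ^ n * ci L (%x. g' x * ph x)"
 using has_weak_derivD[OF assms(1) ph] has_weak_derivD[OF assms(2) ph] by simp
 hence "ci L (%x. g x * ph x) = ci L (%x. g' x * ph x)" by simp
 thus ?thesis
 unfolding left_diff_distrib
 using Bochner_Integration.integral_diff[OF square_integrable_mult[OF sq(1) s] square_integrable_mult[OF sq(2) s]] by simp
 qed
 from this[OF smooth_periodic_trig]
 have z: "ci L (%x. (g x - g' x) * Re (z * cis (K * of_int k * x))) = 0" for z k by blast
 have "AE x in lebesgue_on {0..L}. g x - g' x = 0"
 proof (rule trig_complete)
 show "ci L (%x. (g x - g' x) * cos (K * of_int k * x)) = 0" for k using z[of 1 k] by simp
 show "ci L (%x. (g x - g' x) * sin (K * of_int k * x)) = 0" for k using z[of "-\<i>" k] by simp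
 qed (use i in auto)
 thus ?thesis by simp
qed

lemma weak_deriv_works: "f : sobolev L m ==> n <= m ==> has_weak_deriv L n f (weak_deriv L n f)"
 unfolding sobolev_def weak_deriv_def by (metis (mono_tags, lifting) mem_Collect_eq someI_ex)

lemma fs_sobolev: "allw c ==> fs c : sobolev L m"
 unfolding sobolev_def periodic_fun_simple_iff
 using has_weak_deriv_fs fs_continuous[of c] square_integrable_continuous[of "fs c"]
 by (auto simp: fs_periodic allw_def)

lemma sobolev_norm_fs:
 assumes c: "allw c"
 shows "sobolev_norm L m (fs c) = sqrt (\<Sum>n\<le>m. in0 L (%x. (fs ((D ^^ n) c) x)\<^sup>2))"
proof -
 have "ci L (%x. (weak_deriv L n (fs c) x)\<^sup>2) = in0 L (%x. (fs ((D ^^ n) c) x)\<^sup>2)" if "n <= m" for n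
 proof -
 have w: "has_weak_deriv L n (fs c) (weak_deriv L n (fs c))" by (rule weak_deriv_works[OF fs_sobolev[OF c] that])
 have "ci L (%x. (weak_deriv L n (fs c) x)\<^sup>2) = ci L (%x. (fs ((D ^^ n) c) x)\<^sup>2)"
 proof (rule integral_cong_AE)
 show "AE x in lebesgue_on {0..L}. (weak_deriv L n (fs c) x)\<^sup>2 = (fs ((D ^^ n) c) x)^2"
 using weak_deriv_unique[OF w has_weak_deriv_fs[OF c]] by eventually_elim simp
 qed (use w has_weak_deriv_fs[OF c, of n] in "auto simp: has_weak_deriv_def square_integrable_def")
 thus ?thesis
 using allw_D[OF c, of n] by (subst (asm) circle_integral_eq) (auto intro!: cin fs_continuous simp: allw_def)
 qed
 thus ?thesis by (simp add: sobolev_norm_def)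
qed

lemma sobolev_diff:
 assumes f: "f : sobolev L m" and g: "g : sobolev L m"
 shows "(%x. f x - g x) : sobolev L m"
proof -
 have "\<exists>h. has_weak_deriv L n (%x. f x - g x) h" if n: "n <= m" for n
 proof -
 obtain f' g' where f': "has_weak_deriv L n f f'" and g': "has_weak_deriv L n g g'"
 using f g n unfolding sobolev_def by blast
 have sq: "square_integrable L f" "square_integrable L g" "square_integrable L f'" "square_integrable L g'"
 using f g f' g' by (auto simp: sobolev_def has_weak_deriv_def)
 have "has_weak_deriv L n (%x. f x - g x) (%x. f' x - g' x)"
 unfolding has_weak_deriv_def
 proof (intro conjI allI impI)
 show "square_integrable L (%x. f' x - g' x)" by (rule square_integrable_diff[OF sq(3,4)])
 fix ph assume ph: "smooth_periodic L ph"
 hence s: "square_integrable L ((deriv ^^ j) ph)" for j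
 using smooth_continuous[of ph] by (auto simp: smooth_periodic_def intro!: square_integrable_continuous)
 have s0: "square_integrable L ph" using s[of 0] by simp
 have "ci L (%x. (f x - g x) * (deriv ^^ n) ph x) = ci L (%x. f x * (deriv ^^ n) ph x) - ci L (%x. g x * (deriv ^^ n) ph x)"
 unfolding left_diff_distrib by (rule Bochner_Integration.integral_diff; intro square_integrable_mult sq s)
 also have "... = (-1) ^ n * ci L (%x. f' x * ph x) - (-1) ^ n * ci L (%x. g' x * ph x)"
 by (simp only: has_weak_derivD[OF f' ph] has_weak_derivD[OF g' ph])
 also have "... = (-1) ^ n * ci L (%x. (f' x - g' x) * ph x)"
 unfolding left_diff_distrib
 by (subst Bochner_Integration.integral_diff; (intro square_integrable_mult sq s0)?) (simp add: right_diff_distrib)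
 finally show "ci L (%x. (f x - g x) * (deriv ^^ n) ph x) = (-1) ^ n * ci L (%x. (f' x - g' x) * ph x)" .
 qed
 thus ?thesis by blast
 qed
 moreover have "square_integrable L (%x. f x - g x)" using f g by (intro square_integrable_diff) (auto simp: sobolev_def)
 ultimately show ?thesis using f g by (auto simp: sobolev_def periodic_fun_simple_iff)
qed

section \<open>Fourier coefficients of square integrable functions\<close>

lemma Re_of_real_mult: "Re (of_real r * w) = r * Re w"
 by simp

definition fcoef :: "(real => real) => int => complex" where
 "fcoef f k = Complex (ci L (%x. f x * cos (K * of_int k * x)) / L) (- ci L (%x. f x * sin (K * of_int k * x)) / L)"

lemma hermitian_fcoef: "hermitian (fcoef f)"
 by (simp add: hermitian_def fcoef_def complex_eq_iff)

lemma continuous_trig: "co S (%x. Re (z * cis (K * of_int k * x)))"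
 by (intro cin)

text \<open>The complex parameter z packs the cosine and the sine pairing into one real identity; z
  = 1 and z = - i recover the two parts of the coefficient.\<close>

lemma fcoef_pairing:
 assumes f: "square_integrable L f"
 shows "ci L (%x. f x * Re (z * cis (K * of_int (- k) * x))) = L * Re (z * fcoef f k)"
proof -
 have i: "integrable (lebesgue_on {0..L}) (%x. f x * cos (K * of_int k * x))" "integrable (lebesgue_on {0..L}) (%x. f x * sin (K * of_int k * x))"
 by (intro square_integrable_mult f square_integrable_continuous cin)+
 have "f x * Re (z * cis (K * of_int (- k) * x)) = Re z * (f x * cos (K * of_int k * x)) + Im z * (f x * sin (K * of_int k * x))" for x
 by (simp add: als)
 hence "ci L (%x. f x * Re (z * cis (K * of_int (- k) * x))) =
 Re z * ci L (%x. f x * cos (K * of_int k * x)) + Im z * ci L (%x. f x * sin (K * of_int k * x))"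
 using i by simp
 also have "... = L * Re (z * fcoef f k)" using L_pos by (simp add: fcoef_def fsi)
 finally show ?thesis .
qed

text \<open>Differentiating the test function multiplies z by a power of - i K k, since the pairing
  uses the frequency - k; the sign (-1)^n from the weak derivative cancels the one contained in that
  power.\<close>

lemma fcoef_weak_deriv:
 assumes f: "square_integrable L f" and g: "has_weak_deriv L n f g"
 shows "fcoef g k = (\<i> * of_real (K * of_int k)) ^ n * fcoef f k"
proof -
 have sg: "square_integrable L g" using g by (simp add: has_weak_deriv_def)
 have "Re (z * fcoef g k) = Re (z * ((\<i> * of_real (K * of_int k)) ^ n * fcoef f k))" for z
 proof -
 let ?w = "\<i> * of_real (K * of_int (- k)) :: complex"
 have "ci L (%x. f x * Re (?w ^ n * z * cis (K * of_int (- k) * x))) =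
 (-1) ^ n * ci L (%x. g x * Re (z * cis (K * of_int (- k) * x)))"
 using has_weak_derivD[OF g smooth_periodic_trig[of z "- k"]] unfolding deriv_trig .
 hence "L * Re (?w ^ n * z * fcoef f k) = (-1) ^ n * (L * Re (z * fcoef g k))"
 unfolding fcoef_pairing[OF f] fcoef_pairing[OF sg] .
 moreover define q where "q = (\<i> * of_real (K * of_int k)) ^ n * z * fcoef f k"
 have "?w = - (\<i> * of_real (K * of_int k))" by simp
 hence "?w ^ n = of_real ((-1) ^ n) * (\<i> * of_real (K * of_int k)) ^ n"
 by (simp only: power_minus[of "\<i> * of_real (K * of_int k)" n] of_real_power of_real_minus of_real_1)
 hence "?w ^ n * z * fcoef f k = of_real ((-1) ^ n) * q" by (simp only: q_def mult.assoc)
 moreover have "Re (of_real ((-1) ^ n) * q) = (-1) ^ n * Re q" by (rule Re_of_real_mult)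
 ultimately have "L * ((-1) ^ n * Re q) = (-1) ^ n * (L * Re (z * fcoef g k))" by (simp only:)
 hence "Re q = Re (z * fcoef g k)" using L_pos by simp
 moreover have "q = z * ((\<i> * of_real (K * of_int k)) ^ n * fcoef f k)" by (simp only: q_def mult_ac)
 ultimately show ?thesis by (simp only:)
 qed
 from this[of 1] this[of "-\<i>"] show ?thesis by (simp add: complex_eq_iff)
qed

lemma bessel:
 assumes g: "square_integrable L g"
 shows "(%k. (norm (fcoef g k))\<^sup>2) summable_on UNIV"
 "L * (ISUM k. (norm (fcoef g k))\<^sup>2) <= ci L (%x. (g x)\<^sup>2)"
proof -
 have fin: "L * (SUM k:F. (norm (fcoef g k))\<^sup>2) <= ci L (%x. (g x)\<^sup>2)" if "finite F" for F
 proof -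
 define N where "N = (SUM l:F. |l| )"
 define I where "I = {-N..N}"
 have "|l| <= N" if "l : F" for l
 using member_le_sum[OF that, of abs] \<open>finite F\<close> by (simp add: N_def)
 hence FI: "F \<subseteq> I" unfolding I_def by force
 define d where "d = (%k. if k : I then fcoef g k else 0)"
 have "allw d" by (rule allw_finite[of I]) (auto simp: d_def I_def)
 hence wd: "wsum 0 d" by (simp add: allw_def)
 have hd: "hermitian d" using hermitian_fcoef[of g] by (auto simp: hermitian_def d_def I_def)
 have fsd: "fs d x = (SUM k:I. Re (cnj (fcoef g k) * cis (K * of_int (- k) * x)))" for x
 proof -
 have "fs d x = (\<Sum>\<^sub>\<infinity>k\<in>I. Re (d k * cis (K * of_int k * x)))"
 unfolding fs_def by (rule infsum_cong_neutral) (auto simp: d_def)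
 also have "... = (SUM k:I. Re (fcoef g k * cis (K * of_int k * x)))" by (simp add: I_def d_def)
 also have "... = (SUM k:I. Re (cnj (fcoef g k) * cis (K * of_int (- k) * x)))"
 by (intro sum.cong) auto
 finally show ?thesis .
 qed
 have sd: "square_integrable L (fs d)" by (intro square_integrable_continuous fs_continuous wd)
 have e: "Re (cnj z * z) = (norm z)^2" for z by (simp add: cmod_power2) (simp add: p2q)
 have "ci L (%x. g x * fs d x) = ci L (%x. SUM k:I. g x * Re (cnj (fcoef g k) * cis (K * of_int (- k) * x)))"
 by (simp only: fsd sum_distrib_left)
 also have "... = (SUM k:I. ci L (%x. g x * Re (cnj (fcoef g k) * cis (K * of_int (- k) * x))))"
 by (rule Bochner_Integration.integral_sum) (intro square_integrable_mult g square_integrable_continuous continuous_trig)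
 also have "... = (SUM k:I. L * (norm (fcoef g k))^2)" unfolding fcoef_pairing[OF g] e ..
 finally have cross: "ci L (%x. g x * fs d x) = L * (SUM k:I. (norm (fcoef g k))\<^sup>2)" by (simp add: sum_distrib_left)
 have "(ISUM k. (norm (d k))\<^sup>2) = (\<Sum>\<^sub>\<infinity>k\<in>I. (norm (d k))\<^sup>2)" by (rule infsum_cong_neutral) (auto simp: d_def)
 also have "... = (SUM k:I. (norm (fcoef g k))\<^sup>2)" by (simp add: I_def d_def)
 finally have "in0 L (%x. (fs d x)\<^sup>2) = L * (SUM k:I. (norm (fcoef g k))\<^sup>2)"
 using integral_unique[OF parseval_square(1)[OF wd hd]] by simp
 hence sq: "ci L (%x. (fs d x)\<^sup>2) = L * (SUM k:I. (norm (fcoef g k))\<^sup>2)"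
 by (subst circle_integral_eq) (auto intro!: cin fs_continuous wd)
 have e': "(g x - fs d x)^2 = (g x)^2 - 2 * (g x * fs d x) + (fs d x)^2" for x by (simp add: power2_diff)
 have "0 <= ci L (%x. (g x - fs d x)\<^sup>2)" by (rule integral_nonneg_AE) auto
 also have "... = ci L (%x. (g x)\<^sup>2 - 2 * (g x * fs d x) + (fs d x)^2)"
 by (simp only: e')
 also have "... = ci L (%x. (g x)\<^sup>2) - 2 * ci L (%x. g x * fs d x) + ci L (%x. (fs d x)\<^sup>2)"
 using g sd square_integrable_mult[OF g sd] by (simp add: square_integrable_def)
 finally have "L * (SUM k:I. (norm (fcoef g k))\<^sup>2) <= ci L (%x. (g x)\<^sup>2)"
 unfolding cross sq by simp
 moreover have "(SUM k:F. (norm (fcoef g k))\<^sup>2) <= (SUM k:I. (norm (fcoef g k))\<^sup>2)"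
 using FI by (intro sum_mono2) (auto simp: I_def)
 ultimately show ?thesis using L_pos by (meson mlm less_imp_le order_trans)
 qed
 show s: "(%k. (norm (fcoef g k))\<^sup>2) summable_on UNIV"
 proof (rule nonneg_bdd_above_summable_on)
 show "bdd_above (sum (%k. (norm (fcoef g k))\<^sup>2) ` {F. F \<subseteq> UNIV & finite F})"
 using fin L_pos by (auto intro!: bdd_aboveI[of _ "ci L (%x. (g x)\<^sup>2) / L"] simp: fsi)
 qed simp
 have "(ISUM k. (norm (fcoef g k))\<^sup>2) <= ci L (%x. (g x)\<^sup>2) / L"
 by (rule infsum_le_finite_sums[OF s]) (use fin L_pos in "simp add: fsi")
 thus "L * (ISUM k. (norm (fcoef g k))\<^sup>2) <= ci L (%x. (g x)\<^sup>2)"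
 using L_pos by (simp add: fsi)
qed

lemma fs_shift:
 assumes c: "wsum 0 c" "hermitian c"
 shows "fs c x * Re (z * cis (- (K * of_int k * x))) = fs (%j. z * c (j + k)) x"
proof -
 have "((%j. c j * cis (K * of_int j * x)) has_sum of_real (fs c x)) UNIV" by (rule fs_complex[OF c])
 hence "((%j. c (j + k) * cis (K * of_int (j + k) * x)) has_sum of_real (fs c x)) UNIV"
 by (subst has_sum_reindex_bij_betw[of "%j. j + k" UNIV UNIV]) (auto intro: bij_betwI[of _ _ _ "%j. j - k"])
 hence S: "((%j. (z * cis (- (K * of_int k * x))) * (c (j + k) * cis (K * of_int (j + k) * x))) has_sum (z * cis (- (K * of_int k * x))) * of_real (fs c x)) UNIV"
 by (rule has_sum_cmult_right)
 have e: "(z * cis (- (K * of_int k * x))) * (c (j + k) * cis (K * of_int (j + k) * x)) = z * c (j + k) * cis (K * of_int j * x)" for j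
 proof -
 have "cis (- (K * of_int k * x)) * cis (K * of_int (j + k) * x) = cis (K * of_int j * x)"
 by (simp add: cis_mult als)
 thus ?thesis by (metis (no_types, opaque_lifting) mult.assoc mult.left_commute)
 qed
 have "((%j. z * c (j + k) * cis (K * of_int j * x)) has_sum (z * cis (- (K * of_int k * x))) * of_real (fs c x)) UNIV"
 using S unfolding e .
 from infsumI[OF has_sum_Re[OF this]] show ?thesis by (simp add: fs_def mult.commute)
qed

lemma fcoef_fs:
 assumes c: "wsum 0 c" "hermitian c"
 shows "fcoef (fs c) k = c k"
proof -
 have "ci L (%x. fs c x * Re (z * cis (K * of_int (- k) * x))) = L * Re (z * c k)" for z
 proof -
 have w: "wsum 0 (%j. z * c (j + k))"
 proof (rule wsum_cmult)
 have "(%j. norm (c j)) summable_on UNIV" by (rule wsum_0D[OF c(1)])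
 hence "(%j. norm (c (j + k))) summable_on UNIV"
 by (subst summable_on_reindex_bij_betw[of "%j. j + k" UNIV UNIV]) (auto intro: bij_betwI[of _ _ _ "%j. j - k"])
 thus "wsum 0 (%j. c (j + k))" by (simp add: wsum_def)
 qed
 have "ci L (%x. fs c x * Re (z * cis (K * of_int (- k) * x))) = ci L (fs (%j. z * c (j + k)))"
 using fs_shift[OF c, of _ z k] by simp
 also have "... = L * Re (z * c k)"
 using integral_unique[OF fs_integral[OF w]] by (subst circle_integral_eq) (auto intro!: fs_continuous w)
 finally show ?thesis .
 qed
 moreover have sq: "square_integrable L (fs c)" by (intro square_integrable_continuous fs_continuous c)
 ultimately have "L * Re (z * fcoef (fs c) k) = L * Re (z * c k)" for z using fcoef_pairing[OF sq] by metis
 hence "Re (z * fcoef (fs c) k) = Re (z * c k)" for z using L_pos by simp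
 from this[of 1] this[of "-\<i>"] show ?thesis by (simp add: complex_eq_iff)
qed

text \<open>The continuous difference \<open>h\<close> has vanishing Fourier coefficients and is
  zero almost everywhere; the integral of its square then forces it to vanish on a period.\<close>

lemma fourier_representation:
 assumes f: "co UNIV f" "!!x. f (x + L) = f x" and w: "wsum 0 (fcoef f)"
 shows "f x = fs (fcoef f) x"
proof -
 have cf: "co S f" for S by (rule continuous_on_subset[OF f(1)]) simp
 define h where "h = (%x. f x - fs (fcoef f) x)"
 have hc: "co S h" for S unfolding h_def by (intro cin cf fs_continuous w)
 have sq: "square_integrable L f" "square_integrable L (fs (fcoef f))" "square_integrable L h"
 by (intro square_integrable_continuous cf fs_continuous w hc)+
 have i: "integrable (lebesgue_on {0..L}) h" by (rule square_integrable_imp_integrable[OF sq(3)])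
 have pair: "ci L (%x. h x * Re (z * cis (K * of_int (- k) * x))) = 0" for z k
 proof -
 have t: "square_integrable L (%x. Re (z * cis (K * of_int (- k) * x)))" by (intro square_integrable_continuous continuous_trig)
 have "ci L (%x. h x * Re (z * cis (K * of_int (- k) * x))) =
 ci L (%x. f x * Re (z * cis (K * of_int (- k) * x))) - ci L (%x. fs (fcoef f) x * Re (z * cis (K * of_int (- k) * x)))"
 unfolding h_def left_diff_distrib by (rule Bochner_Integration.integral_diff; intro square_integrable_mult sq t)
 thus ?thesis unfolding fcoef_pairing[OF sq(1)] fcoef_pairing[OF sq(2)] fcoef_fs[OF w hermitian_fcoef] by simp
 qed
 have "AE x in lebesgue_on {0..L}. h x = 0"
 proof (rule trig_complete[OF i])
 show "ci L (%x. h x * cos (K * of_int k * x)) = 0" for k using pair[of 1 k] by simp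
 show "ci L (%x. h x * sin (K * of_int k * x)) = 0" for k using pair[of "\<i>" k] by simp
 qed
 hence "ci L (%x. (h x)\<^sup>2) = 0" by (intro integral_eq_zero_AE) (auto elim: AE_mp)
 hence "in0 L (%x. (h x)\<^sup>2) = 0" by (subst (asm) circle_integral_eq) (auto intro!: cin hc)
 moreover have "(%x. (h x)\<^sup>2) integrable_on {0..L}" by (intro icr cin hc)
 ultimately have "((%x. (h x)\<^sup>2) has_integral 0) (cbox 0 L)" by (metis integrable_integral cbox_interval)
 hence z: "(h y)^2 = 0" if "y : {0..L}" for y
 using has_integral_0_cbox_imp_0[of 0 L "%x. (h x)\<^sup>2" y] that L_pos by (auto intro!: cin hc)
 have per: "h (y + L) = h y" for y by (simp add: h_def f fs_periodic)
 interpret h: periodic_fun_simple h L by standard (rule per)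
 define n where "n = \<lfloor>x / L\<rfloor>"
 have "of_int n <= x / L" "x / L < of_int n + 1" unfolding n_def by linarith+
 hence "x - of_int n * L : {0..L}" using L_pos by (simp add: fsi)
 hence "h (x - of_int n * L) = 0" using z by simp
 moreover have "h (x - of_int n * L) = h x" by (rule h.minus_of_int)
 ultimately show ?thesis by (simp add: h_def)
qed

end

section \<open>From the coefficient system to the equations\<close>

lemma rapid_onD:
 assumes "rapid_on S b"
 obtains C where "C >= 0" "!!k t. t : S ==> (wt k) ^ s * |b k t| <= C"
proof -
 obtain C where C: "!!k t. t : S ==> (wt k) ^ s * |b k t| <= C"
 using assms unfolding rapid_on_def by blast
 show ?thesis by (rule that[of "max 0 C"]) (use C in "auto intro: max.coboundedI2")
qed

lemma rapid_on_subset: "rapid_on S b ==> T \<subseteq> S ==> rapid_on T b"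
 unfolding rapid_on_def by (meson subsetD)

lemma rapid_on_add:
 assumes "rapid_on S b" "rapid_on S d"
 shows "rapid_on S (%k t. b k t + d k t)"
 unfolding rapid_on_def
proof
 fix s
 obtain C1 where C1: "C1 >= 0" "!!k t. t : S ==> (wt k) ^ s * |b k t| <= C1" by (rule rapid_onD[where s="s", OF assms(1)]) (rule that)
 obtain C2 where C2: "C2 >= 0" "!!k t. t : S ==> (wt k) ^ s * |d k t| <= C2" by (rule rapid_onD[where s="s", OF assms(2)]) (rule that)
 have "(wt k) ^ s * |b k t + d k t| <= C1 + C2" if "t : S" for k t
 proof -
 have "(wt k) ^ s * |b k t + d k t| <= (wt k) ^ s * ( |b k t| + |d k t| )"
 by (intro mlm abs_triangle_ineq) auto
 thus ?thesis using C1(2)[OF that, of k] C2(2)[OF that, of k] by (simp add: distrib_left)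
 qed
 thus "\<exists>C. \<forall>k. ALL t:S. (wt k) ^ s * |b k t + d k t| <= C" by blast
qed

lemma rapid_on_int_mult:
 assumes "rapid_on S b"
 shows "rapid_on S (%k t. of_int k * b k t)"
 unfolding rapid_on_def
proof
 fix s
 obtain C where C: "C >= 0" "!!k t. t : S ==> (wt k) ^ Suc s * |b k t| <= C" by (rule rapid_onD[where s="Suc s", OF assms]) (rule that)
 have "(wt k) ^ s * |of_int k * b k t| <= C" if "t : S" for k t
 proof -
 have "|of_int k| * ((wt k) ^ s * |b k t| ) <= (wt k) * ((wt k) ^ s * |b k t| )"
 by (intro mrm) auto
 thus ?thesis using C(2)[OF that, of k] by (simp add: abs_mult mult_ac)
 qed
 thus "\<exists>C. \<forall>k. ALL t:S. (wt k) ^ s * |of_int k * b k t| <= C" by blast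
qed

lemma convolution_weighted_bound:
 fixes al b d :: "int => real"
 assumes al: "!!j. |al j| <= 1" and C: "C1 >= 0" "C2 >= 0"
 and b: "!!k. (wt k) ^ s * |b k| <= C1" and d: "!!k. (wt k) ^ (s + 2) * |d k| <= C2"
 shows "(wt k) ^ s * |ISUM l. al (k - l) * b (k - l) * d l| <= C1 * C2 * (ISUM l::int. 1 / (wt l)^2)"
 "(%l. al (k - l) * b (k - l) * d l) summable_on UNIV"
proof -
 let ?w = "%k::int. (wt k)"
 have w1: "1 <= ?w k ^ s" for k by simp
 have w: "?w k > 0" for k by (simp add: add_pos_nonneg)
 have t: "?w k ^ s * |al (k - l) * b (k - l) * d l| <= C1 * C2 * (1 / (?w l)^2)" for l
 proof -
 have "?w k ^ s * |al (k - l) * b (k - l) * d l| <= (?w (k - l) ^ s * ?w l ^ s) * (1 * |b (k - l) | * |d l| )"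
 unfolding abs_mult by (intro mult_mono weight_submult al) (auto intro!: mrm al)
 also have "... = (?w (k - l) ^ s * |b (k - l) | ) * (?w l ^ s * |d l| )" by (simp add: mult_ac)
 also have "... <= C1 * (C2 * (1 / (?w l)^2))"
 proof (rule mult_mono)
 show "?w (k - l) ^ s * |b (k - l) | <= C1" by (rule b)
 have "(?w l ^ s * |d l| ) * (?w l)^2 <= C2" using d[of l] by (simp only: power_add mult_ac)
 thus "?w l ^ s * |d l| <= C2 * (1 / (?w l)^2)" using w[of l] by (simp add: pos_le_divide_eq)
 qed (use C in auto)
 finally show ?thesis by (simp add: mult.assoc)
 qed
 have S: "(%l. C1 * C2 * (1 / (?w l)^2)) summable_on UNIV" by (intro scr summable_inverse_weight)
 have A: "(%l. norm (?w k ^ s * (al (k - l) * b (k - l) * d l))) summable_on UNIV"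
 by (rule summable_on_comparison_test[OF S]) (use t in "auto simp: abs_mult mult_ac")
 have "(%l. ?w k ^ s * (al (k - l) * b (k - l) * d l)) summable_on UNIV" by (rule Infinite_Sum.abs_summable_summable[OF A])
 hence "(%l. inverse (?w k ^ s) * (?w k ^ s * (al (k - l) * b (k - l) * d l))) summable_on UNIV" by (rule scr)
 moreover have "?w k ^ s ~= 0" using w[of k] by simp
 ultimately show "(%l. al (k - l) * b (k - l) * d l) summable_on UNIV" by (simp add: mult.assoc[symmetric])
 have "?w k ^ s * |ISUM l. al (k - l) * b (k - l) * d l| = norm (ISUM l. ?w k ^ s * (al (k - l) * b (k - l) * d l))"
 unfolding infsum_cmult_right' by (simp add: abs_mult)
 also have "... <= (ISUM l. norm (?w k ^ s * (al (k - l) * b (k - l) * d l)))" by (rule norm_infsum_bound[OF A])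
 also have "... <= (ISUM l. C1 * C2 * (1 / (?w l)^2))"
 by (rule infsum_mono[OF A S]) (use t in "auto simp: abs_mult mult_ac")
 also have "... = C1 * C2 * (ISUM l. 1 / (?w l)^2)" by (rule infsum_cmult_right')
 finally show "(wt k) ^ s * |ISUM l. al (k - l) * b (k - l) * d l| <= C1 * C2 * (ISUM l::int. 1 / (wt l)^2)" .
qed

lemma rapid_on_convolution:
 assumes al: "!!j. |al j| <= 1" and b: "rapid_on S b" and d: "rapid_on S d"
 shows "rapid_on S (%k t. ISUM l. al (k - l) * b (k - l) t * d l t)"
 unfolding rapid_on_def
proof
 fix s
 obtain C1 where C1: "C1 >= 0" "!!k t. t : S ==> (wt k) ^ s * |b k t| <= C1" by (rule rapid_onD[where s="s", OF b]) (rule that)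
 obtain C2 where C2: "C2 >= 0" "!!k t. t : S ==> (wt k) ^ (s + 2) * |d k t| <= C2" by (rule rapid_onD[where s="(s + 2)", OF d]) (rule that)
 have "(wt k) ^ s * |ISUM l. al (k - l) * b (k - l) t * d l t| <= C1 * C2 * (ISUM l::int. 1 / (wt l)^2)" if "t : S" for k t
 by (rule convolution_weighted_bound(1)[OF al C1(1) C2(1) C1(2)[OF that] C2(2)[OF that]])
 thus "\<exists>C. \<forall>k. ALL t:S. (wt k) ^ s * |ISUM l. al (k - l) * b (k - l) t * d l t| <= C" by blast
qed

lemma rapid_on_rhs:
 assumes al: "!!j. |al j| <= 1" and b: "rapid_on S b" and p: "rapid_on S p"
 shows "rapid_on S (%k t. rhs_b al (%j. b j t) (%j. p j t) k)" "rapid_on S (%k t. rhs_p al (%j. b j t) (%j. p j t) k)"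
 unfolding rhs_b_def rhs_p_def
 by (intro rapid_on_add rapid_on_int_mult rapid_on_convolution al b p)+

text \<open>The complex coefficient of a sine series: for odd \<open>b\<close> the terms at k and -
  k together give b k sin (K k x).\<close>

definition cc :: "real => complex" where "cc r = - \<i> * of_real r / 2"

lemma cc_simps: "cc (x + y) = cc x + cc y" "cc (- x) = - cc x" "norm (cc x) = |x| / 2" "cc 0 = 0" "cc (x - y) = cc x - cc y"
 by (simp_all add: cc_def norm_mult norm_divide add_divide_distrib distrib_left diff_divide_distrib right_diff_distrib)

section \<open>Fields built from a coefficient solution\<close>

context circle begin

text \<open>The factor - K / 2 turns the product of the velocity and a derivative into the
  convolution of \<open>rhs_b\<close>. The value 0 at j = 0 stands in for the logarithms of
  \<open>vm a 0\<close>, which meet only the vanishing coefficient \<open>b 0\<close>, and makes the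
  bounds by 1 possible.\<close>

definition alpha :: "real => int => real" where
 "alpha a j = (if j = 0 then 0 else - (K / 2) * vm a j)"

lemma alpha_eq:
 assumes "j ~= 0"
 shows "alpha a j = (1 - rr a ^ nat |j| ) / (2 * |of_int j| )"
 using assms K_pos by (simp add: alpha_def vm_def lc_def diff_divide_distrib) (simp add: fsi)

lemma alpha_props:
 assumes a: "a > 0"
 shows "alpha a (- j) = alpha a j" "|alpha a j| <= 1" "|of_int j * alpha a j| <= 1" "|K * of_int j * vm a j| <= 2"
proof -
 show "alpha a (- j) = alpha a j" by (cases "j = 0") (simp_all add: alpha_eq)
 have r: "0 <= rr a ^ nat |j|" "rr a ^ nat |j| <= 1" using ep_rr[OF a] by (auto intro: power_le_one)
 show j1: "|of_int j * alpha a j| <= 1"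
 proof (cases "j = 0")
 case False
 hence "|of_int j * alpha a j| = |1 - rr a ^ nat |j| | / 2" by (simp add: alpha_eq abs_mult)
 thus ?thesis using r by simp
 qed simp
 show "|alpha a j| <= 1"
 proof (cases "j = 0")
 case False
 hence "1 <= |of_int j :: real|" by linarith
 from mrm[OF this abs_ge_zero[of "alpha a j"]] show ?thesis using j1 by (simp add: abs_mult)
 qed (simp add: alpha_def)
 show "|K * of_int j * vm a j| <= 2"
 proof (cases "j = 0")
 case False
 hence "K * of_int j * vm a j = - 2 * (of_int j * alpha a j)" by (simp add: alpha_def)
 thus ?thesis using j1 by (simp add: abs_mult)
 qed simp
qed

lemma vm_bounded: "a > 0 ==> \<exists>B. \<forall>k. |vm a k| <= B"
proof -
 assume a: "a > 0"
 have "|vm a k| <= ( |ln 4| + 1 + ( |ln (4 * rr a) | + 1)) / K" for k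
 proof -
 have "|lc 1 k - lc (rr a) k| <= |ln 4| + 1 + ( |ln (4 * rr a) | + 1)"
 using lc_bounded[of 1 k] lc_bounded[of "rr a" k] ep_rr[OF a] by auto
 thus ?thesis using K_pos by (simp add: vm_def divide_right_mono)
 qed
 thus ?thesis by blast
qed

text \<open>The n-th space derivative of the sine series with coefficients \<open>b\<close>;
  \<open>us\<close> is the same for the velocity that this series induces.\<close>

definition sr :: "(int => real => real) => nat => real => real => real" where
 "sr b n x t = fs ((D ^^ n) (%k. cc (b k t))) x"

definition us :: "real => (int => real => real) => nat => real => real => real" where
 "us a b n x t = fs ((D ^^ n) (%k. of_real (vm a k) * cc (b k t))) x"

lemma rapid_norm_Dn:
 assumes "rapid_on S b"
 obtains M where "M summable_on UNIV" "!!k t. t : S ==> norm ((D ^^ n) (%k. cc (b k t)) k) <= M k"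
proof -
 obtain C where C: "C >= 0" "!!k t. t : S ==> (wt k) ^ (n + 2) * |b k t| <= C" by (rule rapid_onD[where s="(n + 2)", OF assms]) (rule that)
 show ?thesis
 proof (rule that[of "%k. K ^ n * C * (1 / (wt k)^2)"])
 show "(%k::int. K ^ n * C * (1 / (wt k)^2)) summable_on UNIV"
 by (intro scr summable_inverse_weight)
 fix k t assume t: "t : S"
 let ?w = "1 + |of_int k :: real|"
 have w: "?w > 0" by (simp add: add_pos_nonneg)
 have "norm ((D ^^ n) (%k. cc (b k t)) k) = K ^ n * ( |of_int k| ^ n * |b k t| / 2)"
 using K_pos by (simp add: Dn_eq norm_mult norm_power cc_simps abs_mult pmd)
 also have "... <= K ^ n * (C * (1 / ?w^2))"
 proof (intro mlm)
 have "|of_int k| ^ n * |b k t| / 2 <= ?w ^ n * |b k t|"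
 proof -
 have "|of_int k| ^ n * |b k t| <= ?w ^ n * |b k t|" by (intro mrm power_mono) auto
 moreover have "0 <= |of_int k :: real| ^ n * |b k t|" by simp
 ultimately show ?thesis by linarith
 qed
 also have "... <= C * (1 / ?w^2)"
 proof -
 have "(?w ^ n * |b k t| ) * ?w^2 <= C" using C(2)[OF t, of k] by (simp only: power_add mult_ac)
 thus ?thesis using w by (simp add: pos_le_divide_eq)
 qed
 finally show "|of_int k| ^ n * |b k t| / 2 <= C * (1 / ?w^2)" .
 qed (use K_pos in simp)
 finally show "norm ((D ^^ n) (%k. cc (b k t)) k) <= K ^ n * C * (1 / ?w^2)" by (simp only: mult.assoc)
 qed
qed

lemma rapid_allw:
 assumes "rapid_on S b" "t : S"
 shows "allw (%k. cc (b k t))"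
 unfolding allw_def
proof
 fix n
 obtain C where C: "C >= 0" "!!k t. t : S ==> (wt k) ^ (n + 2) * |b k t| <= C" by (rule rapid_onD[where s="(n + 2)", OF assms(1)]) (rule that)
 show "wsum n (%k. cc (b k t))"
 by (rule wsum_rapid[where C="C / 2"]) (use C(2)[OF assms(2)] in "simp add: cc_simps")
qed

lemma allw_vm:
 assumes a: "a > 0" and "allw c"
 shows "allw (%k. of_real (vm a k) * c k)"
proof -
 obtain B where "!!k. |vm a k| <= B" using vm_bounded[OF a] by blast
 thus ?thesis using assms(2) by (auto simp: allw_def intro: wsum_real_mult)
qed

lemma vm_even: "vm a (- k) = vm a k" by (simp add: vm_def lc_def)

lemma hermitian_vm: "hermitian c ==> hermitian (%k. of_real (vm a k) * c k)"
 by (simp add: hermitian_def vm_even)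

lemma hermitian_cc: "(!!k. b (- k) = - b k) ==> hermitian (%k. cc (b k))"
 by (simp add: hermitian_def cc_def)

lemma sr_deriv:
 assumes "rapid_on S b" "t : S"
 shows "((%x. sr b n x t) hrd sr b (Suc n) x t) (at x)"
 unfolding sr_def using allw_D[OF rapid_allw[OF assms], of n] fs_deriv[of "(D ^^ n) (%k. cc (b k t))" x] by (simp add: allw_def)

lemma us_deriv:
 assumes "a > 0" "rapid_on S b" "t : S"
 shows "((%x. us a b n x t) hrd us a b (Suc n) x t) (at x)"
 unfolding us_def
 using allw_D[OF allw_vm[OF assms(1) rapid_allw[OF assms(2,3)]], of n] fs_deriv[of "(D ^^ n) (%k. of_real (vm a k) * cc (b k t))" x]
 by (simp add: allw_def)

lemma Dn_continuous: "co S (b k) ==> co S (%t. (D ^^ n) (%k. cc (b k t)) k)"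
 unfolding Dn_eq cc_def by (intro cin) auto

lemma sr_continuous:
 assumes "rapid_on S b" "!!k. co S (b k)"
 shows "co (UNIV \<times> S) (%(x, t). sr b n x t)"
proof -
 obtain M where M: "M summable_on UNIV" "!!k t. t : S ==> norm ((D ^^ n) (%k. cc (b k t)) k) <= M k"
 by (rule rapid_norm_Dn[where n=n, OF assms(1)]) (rule that)
 show ?thesis unfolding sr_def
 using fs_joint_continuous[of S "%k t. (D ^^ n) (%k. cc (b k t)) k", OF Dn_continuous[OF assms(2)] M(2,1)] by simp
qed

lemma us_continuous:
 assumes a: "a > 0" and "rapid_on S b" "!!k. co S (b k)"
 shows "co (UNIV \<times> S) (%(x, t). us a b n x t)"
proof -
 obtain M where M: "M summable_on UNIV" "!!k t. t : S ==> norm ((D ^^ n) (%k. cc (b k t)) k) <= M k"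
 by (rule rapid_norm_Dn[where n=n, OF assms(2)]) (rule that)
 obtain B where B: "!!k. |vm a k| <= B" using vm_bounded[OF a] by blast
 have e: "(D ^^ n) (%k. of_real (vm a k) * cc (b k t)) k = of_real (vm a k) * (D ^^ n) (%k. cc (b k t)) k" for k t
 by (simp add: Dn_eq)
 have "co (UNIV \<times> S) (%(x, t). fs (%k. (D ^^ n) (%k. of_real (vm a k) * cc (b k t)) k) x)"
 proof (rule fs_joint_continuous)
 show "co S (%t. (D ^^ n) (%k. of_real (vm a k) * cc (b k t)) k)" for k
 unfolding e by (intro cin Dn_continuous assms(3))
 show "(%k. B * M k) summable_on UNIV" by (intro scr M)
 show "norm ((D ^^ n) (%k. of_real (vm a k) * cc (b k t)) k) <= B * M k" if "t : S" for k t
 unfolding e norm_mult norm_of_real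
 using M(2)[OF that, of k] B[of k] order_trans[OF abs_ge_zero B[of k]] by (intro mult_mono) auto
 qed
 thus ?thesis by (simp add: us_def)
qed

lemma sr_time_deriv:
 assumes S: "convex S" "t : S" and b: "rapid_on S b" "rapid_on S b'"
 and der: "!!k t. t : S ==> (b k hrd b' k t) (at t within S)"
 shows "((%t. sr b n x t) hrd sr b' n x t) (at t within S)"
proof -
 obtain M where M: "M summable_on UNIV" "!!k t. t : S ==> norm ((D ^^ n) (%k. cc (b k t)) k) <= M k"
 by (rule rapid_norm_Dn[where n=n, OF b(1)]) (rule that)
 obtain M' where M': "M' summable_on UNIV" "!!k t. t : S ==> norm ((D ^^ n) (%k. cc (b' k t)) k) <= M' k"
 by (rule rapid_norm_Dn[where n=n, OF b(2)]) (rule that)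
 have "((%t. fs (%k. (D ^^ n) (%k. cc (b k t)) k) x) hrd fs (%k. (D ^^ n) (%k. cc (b' k t)) k) x) (at t within S)"
 proof (rule fs_time_deriv[OF S _ M(2,1) M'(2,1)])
 show "((%t. (D ^^ n) (%k. cc (b k t)) k) has_vector_derivative (D ^^ n) (%k. cc (b' k t)) k) (at t within S)" if "t : S" for k t
 unfolding Dn_eq cc_def
 by (rule bounded_linear.has_vector_derivative[OF bounded_linear_mult_right])
 (use der[OF that, of k] in "auto intro!: dei bounded_linear.has_vector_derivative[OF bounded_linear_of_real] simp: hrv")
 qed
 thus ?thesis by (simp add: sr_def)
qed

definition csol :: "real => real => (int => real => real) => (int => real => real) => bool" where
 "csol a T b p \<longleftrightarrow> T > 0 & coef_solution (alpha a) {0..T} b p & rapid_on {0..T} b & rapid_on {0..T} p"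

lemma infsum_complex_of_real: "f summable_on A ==> (\<Sum>\<^sub>\<infinity>l\<in>A. complex_of_real (f l)) = of_real (\<Sum>\<^sub>\<infinity>l\<in>A. f l)"
 by (metis has_sum_infsum has_sum_bounded_linear[OF bounded_linear_of_real] infsumI)

lemma cc_mult: "cc x * cc y = - of_real (x * y / 4)"
proof -
 have "(- \<i> * of_real x / 2) * (- \<i> * of_real y / 2) = (\<i> * \<i>) * (of_real x * of_real y / 4)" by (simp only: mult_ac times_divide_eq_left times_divide_eq_right) simp
 thus ?thesis by (simp add: cc_def)
qed

lemma csol_pde:
 assumes a: "a > 0" and sol: "csol a T b p" and t: "t : {0..T}"
 shows "velocity L a (%y. sr b 0 y t) x = us a b 0 x t"
 and "((%t. sr b n x t) hrd sr (%k t. rhs_b (alpha a) (%j. b j t) (%j. p j t) k) n x t) (wi t T)"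
 and "((%t. sr p n x t) hrd sr (%k t. rhs_p (alpha a) (%j. b j t) (%j. p j t) k) n x t) (wi t T)"
 and "sr (%k t. rhs_b (alpha a) (%j. b j t) (%j. p j t) k) 0 x t = sr p 0 x t - us a b 0 x t * sr b 1 x t"
 and "sr (%k t. rhs_p (alpha a) (%j. b j t) (%j. p j t) k) 0 x t = - (us a b 1 x t * sr p 0 x t + us a b 0 x t * sr p 1 x t)"
proof -
 have cs: "coef_solution (alpha a) {0..T} b p" and r: "rapid_on {0..T} b" "rapid_on {0..T} p"
 using sol by (auto simp: csol_def)
 have odd: "b (- k) t = - b k t" "p (- k) t = - p k t" for k using cs t by (auto simp: coef_solution_def)
 have b0: "b 0 t = 0" using odd(1)[of 0] by simp
 define c where "c = (%k. cc (b k t))"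
 define q where "q = (%k. cc (p k t))"
 define v where "v = (%k. of_real (vm a k) * c k)"
 have aw: "allw c" "allw q" unfolding c_def q_def by (rule rapid_allw[OF r(1) t], rule rapid_allw[OF r(2) t])
 have avw: "allw v" unfolding v_def by (rule allw_vm[OF a aw(1)])
 have h: "hermitian c" "hermitian q" unfolding c_def q_def by (rule hermitian_cc, rule odd)+
 have hv: "hermitian v" unfolding v_def by (rule hermitian_vm[OF h(1)])
 have w0: "wsum 0 c" "wsum 0 q" "wsum 0 v" "wsum 0 (D c)" "wsum 1 v" "wsum 1 q"
 using aw avw wsum_D[of 0 c] by (auto simp: allw_def)
 show "velocity L a (%y. sr b 0 y t) x = us a b 0 x t"
 using velocity_fs[OF a w0(1) h(1), of x] by (simp add: sr_def us_def c_def)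
 note rr = rapid_on_rhs[OF alpha_props(2)[OF a] r]
 have der: "!!k t. t : {0..T} ==> (b k hrd rhs_b (alpha a) (%j. b j t) (%j. p j t) k) (wi t T)"
 "!!k t. t : {0..T} ==> (p k hrd rhs_p (alpha a) (%j. b j t) (%j. p j t) k) (wi t T)"
 using cs by (auto simp: coef_solution_def)
 show "((%t. sr b n x t) hrd sr (%k t. rhs_b (alpha a) (%j. b j t) (%j. p j t) k) n x t) (wi t T)"
 by (rule sr_time_deriv[OF _ t r(1) rr(1) der(1)]) auto
 show "((%t. sr p n x t) hrd sr (%k t. rhs_p (alpha a) (%j. b j t) (%j. p j t) k) n x t) (wi t T)"
 by (rule sr_time_deriv[OF _ t r(2) rr(2) der(2)]) auto
 \<comment> \<open>Valid also at j = 0, where \<open>alpha\<close> is not the scaled multiplier,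
   because \<open>b 0 t = 0\<close>.\<close>
 have vmc: "K * vm a j * b j t = - 2 * (alpha a j * b j t)" for j
 using b0 by (cases "j = 0") (simp_all add: alpha_def)
 have bnd: "\<exists>C\<ge>0. \<forall>k. (wt k) ^ s * |b k t| <= C" "\<exists>C\<ge>0. \<forall>k. (wt k) ^ s * |p k t| <= C"
 "\<exists>C\<ge>0. \<forall>k. (wt k) ^ s * |of_int k * b k t| <= C" for s
 using rapid_onD[OF r(1), of s] rapid_onD[OF r(2), of s] rapid_onD[OF rapid_on_int_mult[OF r(1)], of s] t by metis+
 have sm1: "(%l. alpha a (k - l) * b (k - l) t * (of_int l * b l t)) summable_on UNIV" for k
 proof -
 obtain C1 where "C1 >= 0" "!!k. (wt k) ^ 0 * |b k t| <= C1" using bnd(1)[of 0] by blast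
 moreover obtain C2 where "C2 >= 0" "!!k. (wt k) ^ (0 + 2) * |of_int k * b k t| <= C2" using bnd(3)[of "0 + 2"] by blast
 ultimately show ?thesis by - (rule convolution_weighted_bound(2)[OF alpha_props(2)[OF a], where ?C1.0=C1 and ?C2.0=C2 and s=0], assumption+)
 qed
 have sm2: "(%l. alpha a (k - l) * b (k - l) t * p l t) summable_on UNIV" for k
 proof -
 obtain C1 where "C1 >= 0" "!!k. (wt k) ^ 0 * |b k t| <= C1" using bnd(1)[of 0] by blast
 moreover obtain C2 where "C2 >= 0" "!!k. (wt k) ^ (0 + 2) * |p k t| <= C2" using bnd(2)[of "0 + 2"] by blast
 ultimately show ?thesis by - (rule convolution_weighted_bound(2)[OF alpha_props(2)[OF a], where ?C1.0=C1 and ?C2.0=C2 and s=0], assumption+)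
 qed
 have conv1: "conv v (D c) k = - cc (ISUM l. alpha a (k - l) * b (k - l) t * (of_int l * b l t))" for k
 proof -
 have "v (k - l) * D c l = (\<i> / 2) * of_real (alpha a (k - l) * b (k - l) t * (of_int l * b l t))" for l
 proof -
 have "v (k - l) * D c l = \<i> * of_real (K * vm a (k - l) * of_int l) * (cc (b (k - l) t) * cc (b l t))"
 by (simp add: v_def D_def c_def mult_ac)
 also have "... = - (\<i> / 4) * of_real ((K * vm a (k - l) * b (k - l) t) * (of_int l * b l t))"
 by (simp add: cc_mult mult_ac)
 finally show ?thesis unfolding vmc by (simp add: mult_ac)
 qed
 hence "conv v (D c) k = (\<i> / 2) * of_real (ISUM l. alpha a (k - l) * b (k - l) t * (of_int l * b l t))"
 unfolding conv_def by (simp only: infsum_cmult_right' infsum_complex_of_real[OF sm1])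
 thus ?thesis by (simp add: cc_def)
 qed
 have conv2: "conv v q k = of_real (ISUM l. alpha a (k - l) * b (k - l) t * p l t) / (2 * of_real K)" for k
 proof -
 have "v (k - l) * q l = (1 / (2 * of_real K)) * of_real (alpha a (k - l) * b (k - l) t * p l t)" for l
 proof -
 have "v (k - l) * q l = of_real (vm a (k - l)) * (cc (b (k - l) t) * cc (p l t))" by (simp add: v_def q_def c_def mult_ac)
 also have "... = of_real (- (vm a (k - l) * b (k - l) t * p l t) / 4)" by (simp add: cc_mult mult_ac)
 also have "- (vm a (k - l) * b (k - l) t * p l t) / 4 = (1 / (2 * K)) * (alpha a (k - l) * b (k - l) t * p l t)"
 proof -
 have "vm a (k - l) * b (k - l) t = - 2 * (alpha a (k - l) * b (k - l) t) / K" using vmc[of "k - l"] K_pos by (simp add: fsi)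
 hence "- (vm a (k - l) * b (k - l) t * p l t) / 4 = - ((- 2 * (alpha a (k - l) * b (k - l) t) / K) * p l t) / 4" by (simp only:)
 thus ?thesis using K_pos by simp
 qed
 finally show ?thesis by simp
 qed
 hence "conv v q k = (1 / (2 * of_real K)) * of_real (ISUM l. alpha a (k - l) * b (k - l) t * p l t)"
 unfolding conv_def by (simp only: infsum_cmult_right' infsum_complex_of_real[OF sm2])
 thus ?thesis by simp
 qed
 have "sr (%k t. rhs_b (alpha a) (%j. b j t) (%j. p j t) k) 0 x t = fs (%k. q k - conv v (D c) k) x"
 unfolding sr_def rhs_b_def q_def conv1 by (simp add: cc_simps add.commute)
 also have "... = fs q x - fs (conv v (D c)) x" by (rule fs_diff[OF w0(2) wsum_conv[OF w0(3,4)]])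
 also have "fs (conv v (D c)) x = fs v x * fs (D c) x" by (rule fs_mult[OF w0(3) hv w0(4) hermitian_D[OF h(1)], symmetric])
 finally show "sr (%k t. rhs_b (alpha a) (%j. b j t) (%j. p j t) k) 0 x t = sr p 0 x t - us a b 0 x t * sr b 1 x t"
 by (simp add: sr_def us_def c_def q_def v_def)
 have cq: "wsum 1 (conv v q)" by (rule wsum_conv[OF w0(5,6)])
 have "sr (%k t. rhs_p (alpha a) (%j. b j t) (%j. p j t) k) 0 x t = fs (%k. of_real (-1) * D (conv v q) k) x"
 unfolding sr_def rhs_p_def D_def conv2 using K_pos
 by (intro arg_cong2[where f=fs] ext) (simp_all add: cc_def)
 also have "... = - fs (D (conv v q)) x" by (simp only: fs_cmult)
 \<comment> \<open>The function is differentiated once as the series of \<open>conv v q\<close> and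
   once as the product of two series; comparing both gives the product rule for
   coefficients.\<close>
 also have "fs (D (conv v q)) x = fs (D v) x * fs q x + fs v x * fs (D q) x"
 proof (rule DERIV_unique)
 show "(fs (conv v q) hrd fs (D (conv v q)) x) (at x)" by (rule fs_deriv[OF cq])
 have "fs (conv v q) = (%x. fs v x * fs q x)" by (rule ext) (rule fs_mult[OF w0(3) hv w0(2) h(2), symmetric])
 thus "(fs (conv v q) hrd fs (D v) x * fs q x + fs v x * fs (D q) x) (at x)"
 by (auto intro!: dei fs_deriv w0 simp: mult.commute)
 qed
 finally show "sr (%k t. rhs_p (alpha a) (%j. b j t) (%j. p j t) k) 0 x t = - (us a b 1 x t * sr p 0 x t + us a b 0 x t * sr p 1 x t)"
 by (simp add: sr_def us_def c_def q_def v_def)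
qed

end

lemma at_within_Ico_Icc:
 fixes t :: real
 assumes "0 <= t" "t < s" "s < T"
 shows "at t within {0..<T} = at t within {0..s}"
 by (rule at_within_nhd[of _ "{..<s}"]) (use assms in auto)

lemma time_interval_ereal: "time_interval (ereal T) = {0..<T}"
 by (auto simp: time_interval_def)

context circle begin

lemma summable_single: "(%k::int. if k = 0 then B else 0 :: real) summable_on UNIV"
 by (rule summable_on_cong_neutral[THEN iffD1, of _ "{0}", rotated -1]) auto

text \<open>The norm of a difference is the root of a sum of integrals of functions jointly
  continuous in time and space; it is continuous in time and vanishes at r = t.\<close>

lemma continuous_into_sobolev_fs:
 assumes c: "\<And>k. continuous_on {0..s} (c k)"
 and M: "\<And>n. \<exists>M. M summable_on UNIV \<and> (\<forall>k. \<forall>t\<in>{0..s}. norm ((D ^^ n) (\<lambda>k. c k t) k) \<le> M k)"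
 and aw: "\<And>t. t \<in> {0..s} \<Longrightarrow> allw (\<lambda>k. c k t)"
 shows "continuous_into_sobolev L m {0..s} (\<lambda>x t. fs (\<lambda>k. c k t) x)"
proof -
 have "((\<lambda>r. sobolev_norm L m (\<lambda>x. fs (\<lambda>k. c k r) x - fs (\<lambda>k. c k t) x)) \<longlongrightarrow> 0) (at t within {0..s})" if t: "t \<in> {0..s}" for t
 proof -
 let ?g = "\<lambda>n r x. fs ((D ^^ n) (\<lambda>k. c k r)) x - fs ((D ^^ n) (\<lambda>k. c k t)) x"
 have cont: "continuous_on ({0..s} \<times> {0..L}) (\<lambda>(r, x). (?g n r x)\<^sup>2)" for n
 proof -
 obtain M where M: "M summable_on UNIV" "\<And>k t. t \<in> {0..s} \<Longrightarrow> norm ((D ^^ n) (\<lambda>k. c k t) k) \<le> M k" using assms(2)[of n] by blast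
 have "continuous_on (UNIV \<times> {0..s}) (\<lambda>(x, t). fs (\<lambda>k. (D ^^ n) (\<lambda>k. c k t) k) x)"
 by (rule fs_joint_continuous[OF _ M(2,1)]) (auto simp: Dn_eq intro!: continuous_intros c)
 then have j: "continuous_on ({0..s} \<times> {0..L}) (\<lambda>p. fs ((D ^^ n) (\<lambda>k. c k (fst p))) (snd p))"
 by (intro continuous_on_compose2[of "UNIV \<times> {0..s}" "\<lambda>(x, t). fs ((D ^^ n) (\<lambda>k. c k t)) x" _ "\<lambda>p. (snd p, fst p)", simplified])
 (auto intro!: continuous_intros)
 have "continuous_on ({0..s} \<times> {0..L}) (\<lambda>p. fs ((D ^^ n) (\<lambda>k. c k t)) (snd p))"
 by (rule continuous_on_compose2[OF fs_continuous[of _ UNIV]]) (use allw_D[OF aw[OF t], of n] in \<open>auto simp: allw_def intro!: continuous_intros\<close>)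
 with j show ?thesis unfolding case_prod_unfold by (intro continuous_intros)
 qed
 let ?F = "\<lambda>r. sqrt (\<Sum>n\<le>m. integral {0..L} (\<lambda>x. (?g n r x)\<^sup>2))"
 have cont': "continuous_on ({0..s} \<times> cbox 0 L) (\<lambda>(r, x). (?g n r x)\<^sup>2)" for n using cont by (simp only: cbox_interval)
 have "continuous_on {0..s} ?F"
 using integral_continuous_on_param[OF cont'] by (intro continuous_intros) (simp only: cbox_interval)
 then have "(?F \<longlongrightarrow> ?F t) (at t within {0..s})" unfolding continuous_on using t by blast
 moreover have "?F t = 0" by simp
 ultimately have lim: "(?F \<longlongrightarrow> 0) (at t within {0..s})" by (simp only:)
 have eq: "?F r = sobolev_norm L m (\<lambda>x. fs (\<lambda>k. c k r) x - fs (\<lambda>k. c k t) x)" if r: "r \<in> {0..s}" for r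
 proof -
 have w: "wsum n (\<lambda>k. c k r)" "wsum n (\<lambda>k. c k t)" for n using aw[OF r] aw[OF t] by (auto simp: allw_def)
 have e1: "(\<lambda>x. fs (\<lambda>k. c k r) x - fs (\<lambda>k. c k t) x) = fs (\<lambda>k. c k r - c k t)"
 by (rule ext) (rule fs_diff[OF w, symmetric])
 have e2: "(D ^^ n) (\<lambda>k. c k r - c k t) = (\<lambda>k. (D ^^ n) (\<lambda>k. c k r) k - (D ^^ n) (\<lambda>k. c k t) k)" for n
 by (rule ext) (simp add: Dn_eq right_diff_distrib)
 have wd: "wsum 0 ((D ^^ n) (\<lambda>k. c k r))" "wsum 0 ((D ^^ n) (\<lambda>k. c k t))" for n
 using allw_D[OF aw[OF r], of n] allw_D[OF aw[OF t], of n] by (auto simp: allw_def)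
 have al: "allw (\<lambda>k. c k r - c k t)" using wsum_diff[OF w] by (simp add: allw_def)
 have e3: "fs ((D ^^ n) (\<lambda>k. c k r - c k t)) x = ?g n r x" for n x unfolding e2 by (rule fs_diff[OF wd])
 show ?thesis unfolding e1 sobolev_norm_fs[OF al] e3 ..
 qed
 have "\<forall>\<^sub>F r in at t within {0..s}. ?F r = sobolev_norm L m (\<lambda>x. fs (\<lambda>k. c k r) x - fs (\<lambda>k. c k t) x)"
 unfolding eventually_at_filter by (rule always_eventually) (blast intro: eq)
 then show ?thesis by (rule Lim_transform_eventually[OF lim])
 qed
 then show ?thesis using fs_sobolev[OF aw] by (auto simp: continuous_into_sobolev_def)
qed

lemma continuous_into_sobolev_Ico:
 assumes "!!s. 0 < s ==> s < T ==> continuous_into_sobolev L m {0..s} f"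
 shows "continuous_into_sobolev L m {0..<T} f"
 unfolding continuous_into_sobolev_def
proof (intro conjI ballI)
 fix t assume t: "t : {0..<T}"
 obtain s where s: "t < s" "s < T" using dense[of t T] t by auto
 hence c: "continuous_into_sobolev L m {0..s} f" using assms t by simp
 show "(%x. f x t) : sobolev L m" using c s t by (simp add: continuous_into_sobolev_def)
 show "((%r. sobolev_norm L m (%x. f x r - f x t)) \<longlongrightarrow> 0) (at t within {0..<T})"
 using c s t at_within_Ico_Icc[of t s T] by (simp add: continuous_into_sobolev_def)
qed

section \<open>Recovering \<theta> from its derivative\<close>

definition Ac :: "real => int => complex" where
 "Ac r k = (if k = 0 then 0 else of_real (- r / (2 * K * of_int k)))"

text \<open>The constant mode is chosen so that \<theta> vanishes at x = 0 for all times. This is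
  compatible with transport because the odd velocity vanishes there.\<close>

definition cth :: "(int => real => real) => int => real => complex" where
 "cth p k t = (if k = 0 then - of_real (fs (%k. Ac (p k t) k) 0) else Ac (p k t) k)"

definition theta :: "(int => real => real) => real => real => real" where
 "theta p x t = fs (%k. cth p k t) x"

lemma norm_Ac: "norm (Ac r k) <= norm (cc r) / K"
proof (cases "k = 0")
 case False
 hence "1 <= |of_int k :: real|" by linarith
 hence "|r| / (2 * K * |of_int k| ) <= |r| / (2 * K * 1)" using K_pos by (intro divide_left_mono mlm) auto
 moreover have "norm (Ac r k) = | - r / (2 * K * of_int k) |" using False by (simp only: Ac_def norm_of_real if_False)
 ultimately show ?thesis using K_pos by (simp add: cc_simps abs_mult)
qed (use K_pos in "simp add: Ac_def")

lemma allw_Ac: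
 assumes "rapid_on S p" "t : S"
 shows "allw (%k. Ac (p k t) k)"
 unfolding allw_def
proof
 fix n
 have w: "wsum n (%k. cc (p k t))" using rapid_allw[OF assms] by (simp add: allw_def)
 show "wsum n (%k. Ac (p k t) k)"
 proof (rule wsum_le[OF w, of _ _ "1 / K"])
 fix k
 have "(wt k) ^ n * norm (Ac (p k t) k) <= (wt k) ^ n * (norm (cc (p k t)) / K)"
 by (intro mlm norm_Ac) auto
 thus "(wt k) ^ n * norm (Ac (p k t) k) <= 1 / K * ((wt k) ^ n * norm (cc (p k t)))"
 by (simp add: mult_ac)
 qed
qed

lemma D_Ac: "r 0 = 0 ==> D (%k. Ac (r k) k) = (%k. cc (r k))"
 using K_pos by (auto simp: D_def Ac_def cc_def)

lemma theta_eq: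
 assumes "rapid_on S p" "t : S"
 shows "theta p x t = fs (%k. Ac (p k t) k) x - fs (%k. Ac (p k t) k) 0" "allw (%k. cth p k t)"
proof -
 let ?B = "fs (%k. Ac (p k t) k) 0"
 have A: "allw (%k. Ac (p k t) k)" by (rule allw_Ac[OF assms])
 have B: "allw (%k::int. if k = 0 then of_real ?B else 0)" by (rule allw_finite[of "{0}"]) auto
 have e: "(%k. cth p k t) = (%k. Ac (p k t) k - (if k = 0 then of_real ?B else 0))"
 by (auto simp: cth_def Ac_def)
 show "allw (%k. cth p k t)" unfolding e using A B wsum_diff by (auto simp: allw_def)
 show "theta p x t = fs (%k. Ac (p k t) k) x - ?B"
 unfolding theta_def e using A B by (subst fs_diff) (auto simp: allw_def fs_const)
qed

lemma theta_deriv: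
 assumes "rapid_on S p" "t : S" "p 0 t = 0"
 shows "((%x. theta p x t) hrd sr p 0 x t) (at x)"
proof -
 have "(fs (%k. Ac (p k t) k) hrd fs (D (%k. Ac (p k t) k)) x) (at x)"
 by (rule fs_deriv) (use allw_Ac[OF assms(1,2)] in "simp add: allw_def")
 thus ?thesis using D_Ac[of "%k. p k t"] assms(3)
 by (auto simp: theta_eq[OF assms(1,2)] sr_def intro!: dei)
qed

lemma theta_0: "rapid_on S p ==> t : S ==> theta p 0 t = 0"
 by (simp add: theta_eq)

lemma Ac_time_deriv:
 assumes S: "convex S" "t : S" and b: "rapid_on S b" "rapid_on S b'"
 and der: "!!k t. t : S ==> (b k hrd b' k t) (at t within S)"
 shows "((%t. fs (%k. Ac (b k t) k) x) hrd fs (%k. Ac (b' k t) k) x) (at t within S)"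
proof -
 have bd: "\<exists>M. M summable_on UNIV & (\<forall>k. ALL t:S. norm (Ac (d k t) k) <= M k)" if d: "rapid_on S d" for d
 proof -
 obtain M where M: "M summable_on UNIV" "!!k t. t : S ==> norm ((D ^^ 0) (%k. cc (d k t)) k) <= M k"
 by (rule rapid_norm_Dn[where n=0, OF d]) (rule that)
 have "(%k. M k * (1 / K)) summable_on UNIV" by (rule summable_on_cmult_left[OF M(1)])
 moreover have "norm (Ac (d k t) k) <= M k * (1 / K)" if "t : S" for k t
 using order_trans[OF norm_Ac divide_right_mono[of _ "M k" K]] M(2)[OF that, of k] K_pos by simp
 ultimately show ?thesis by blast
 qed
 obtain M where M: "M summable_on UNIV" "!!k t. t : S ==> norm (Ac (b k t) k) <= M k" using bd[OF b(1)] by blast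
 obtain M' where M': "M' summable_on UNIV" "!!k t. t : S ==> norm (Ac (b' k t) k) <= M' k" using bd[OF b(2)] by blast
 show ?thesis
 proof (rule fs_time_deriv[OF S _ M(2,1) M'(2,1)])
 show "((%t. Ac (b k t) k) has_vector_derivative Ac (b' k t) k) (at t within S)" if "t : S" for k t
 proof (cases "k = 0")
 case False
 have "((%t. - b k t / (2 * K * of_int k)) hrd - b' k t / (2 * K * of_int k)) (at t within S)"
 by (intro DERIV_cdivide DERIV_minus der that)
 hence "((%t. complex_of_real (- b k t / (2 * K * of_int k))) has_vector_derivative of_real (- b' k t / (2 * K * of_int k))) (at t within S)"
 by (intro bounded_linear.has_vector_derivative[OF bounded_linear_of_real]) (simp add: hrv)
 thus ?thesis using False by (simp add: Ac_def)
 qed (simp add: Ac_def)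
 qed
qed

lemma csol_odd:
 assumes "csol a T b p" "t : {0..T}"
 shows "b (- k) t = - b k t" "p (- k) t = - p k t" "b 0 t = 0" "p 0 t = 0"
proof -
 show o: "b (- k) t = - b k t" "p (- k) t = - p k t" for k using assms by (auto simp: csol_def coef_solution_def)
 show "b 0 t = 0" "p 0 t = 0" using o[of 0] by auto
qed

lemma csol_rapid: "csol a T b p ==> rapid_on {0..T} b" "csol a T b p ==> rapid_on {0..T} p"
 by (auto simp: csol_def)

lemma csol_continuous:
 assumes "csol a T b p"
 shows "co {0..T} (b k)" "co {0..T} (p k)"
 using assms by (auto simp: csol_def coef_solution_def intro!: DERIV_continuous_on)

lemma sr_odd:
 assumes "!!k. b (- k) t = - b k t"
 shows "sr b 0 (- x) t = - sr b 0 x t" "us a b 0 (- x) t = - us a b 0 x t"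
proof -
 have g: "fs (%k. of_real (q k) * cc (b k t)) (- x) = - fs (%k. of_real (q k) * cc (b k t)) x" for q
 proof -
 have "Re (of_real (q k) * cc (b k t) * cis (K * of_int k * y)) = q k * b k t * sin (K * of_int k * y) / 2" for k y
 by (simp add: cc_def)
 note e = this
 show ?thesis unfolding fs_def e by (simp only: mult_minus_right sin_minus mult_minus_left minus_divide_left[symmetric] infsum_uminus)
 qed
 show "sr b 0 (- x) t = - sr b 0 x t" using g[of "%k. 1"] by (simp add: sr_def)
 show "us a b 0 (- x) t = - us a b 0 x t" using g[of "vm a"] by (simp add: us_def)
qed

lemma sr_periodic: "sr b n (x + L) t = sr b n x t" "us a b n (x + L) t = us a b n x t"
 by (simp_all add: sr_def us_def fs_periodic)

text \<open>An odd function of period L vanishes at both ends of the half period. For the velocity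
  this means that nothing flows through 0 and L / 2.\<close>

lemma sr_vanish:
 assumes "!!k. b (- k) t = - b k t"
 shows "sr b 0 0 t = 0" "sr b 0 (L / 2) t = 0" "us a b 0 0 t = 0" "us a b 0 (L / 2) t = 0"
 using sr_odd(1)[where b=b and t=t, OF assms, where x=0] sr_odd(1)[where b=b and t=t, OF assms, where x="L / 2"]
 sr_odd(2)[where b=b and t=t and a=a, OF assms, where x=0] sr_odd(2)[where b=b and t=t and a=a, OF assms, where x="L / 2"] sr_periodic(1)[of b 0 "- (L / 2)" t] sr_periodic(2)[of a b 0 "- (L / 2)" t]
 by auto

text \<open>The equation for \<rho> is the space derivative of the transport equation for \<theta>.
  Both sides of the latter vanish at x = 0, so equality of the derivatives integrates to
  equality.\<close>

lemma csol_theta: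
 assumes a: "a > 0" and sol: "csol a T b p" and t: "t : {0..T}"
 shows "((%t. theta p x t) hrd - us a b 0 x t * sr p 0 x t) (wi t T)"
proof -
 note r = csol_rapid[OF sol]
 define q where "q = (%k t. rhs_p (alpha a) (%j. b j t) (%j. p j t) k)"
 have rq: "rapid_on {0..T} q" unfolding q_def by (rule rapid_on_rhs[OF alpha_props(2)[OF a] r])
 have q0: "q 0 t = 0" by (simp add: q_def rhs_p_def)
 have "((%t. fs (%k. Ac (p k t) k) y) hrd fs (%k. Ac (q k t) k) y) (wi t T)" for y
 by (rule Ac_time_deriv[OF _ t r(2) rq]) (use sol in "auto simp: q_def csol_def coef_solution_def")
 hence "((%t. fs (%k. Ac (p k t) k) x - fs (%k. Ac (p k t) k) 0) hrd fs (%k. Ac (q k t) k) x - fs (%k. Ac (q k t) k) 0) (wi t T)"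
 by (intro DERIV_diff)
 hence d: "((%t. theta p x t) hrd theta q x t) (wi t T)"
 unfolding theta_eq(1)[OF rq t]
 by (rule has_field_derivative_transform_within[of _ _ _ _ 1]) (use t theta_eq(1)[OF r(2)] in auto)
 have "((%x. theta q x t + us a b 0 x t * sr p 0 x t) hrd 0) (at x)" for x
 using csol_pde(5)[OF a sol t, of x] unfolding q_def[symmetric]
 by (auto intro!: dei theta_deriv[where S="{0..T}" and p=q] us_deriv[where S="{0..T}"] sr_deriv[where S="{0..T}"] a r rq t q0)
 hence "theta q x t + us a b 0 x t * sr p 0 x t = theta q 0 t + us a b 0 0 t * sr p 0 0 t"
 by (intro DERIV_isconst_all) auto
 hence "theta q x t = - us a b 0 x t * sr p 0 x t"
 using theta_0[OF rq t] sr_vanish(1)[of p t] csol_odd[OF sol t] by simp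
 thus ?thesis using d by simp
qed

lemma csol_sobolev:
 assumes sol: "csol a T b p"
 shows "continuous_into_sobolev L m {0..T} (sr b 0)" "continuous_into_sobolev L m {0..T} (theta p)"
proof -
 note r = csol_rapid[OF sol] and c = csol_continuous[OF sol]
 have "continuous_into_sobolev L m {0..T} (%x t. fs (%k. cc (b k t)) x)"
 proof (rule continuous_into_sobolev_fs)
 show "co {0..T} (%t. cc (b k t))" for k using Dn_continuous[OF c(1), of 0] by simp
 show "\<exists>M. M summable_on UNIV & (\<forall>k. ALL t:{0..T}. norm ((D ^^ n) (%k. cc (b k t)) k) <= M k)" for n
 by (rule rapid_norm_Dn[where n=n, OF r(1)]) blast
 qed (rule rapid_allw[OF r(1)])
 thus "continuous_into_sobolev L m {0..T} (sr b 0)" by (simp add: sr_def[abs_def])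
 have bd: "\<exists>M. M summable_on UNIV & (\<forall>k. ALL t:{0..T}. norm ((D ^^ n) (%k. Ac (p k t) k) k) <= M k)" for n
 proof -
 obtain M where M: "M summable_on UNIV" "!!k t. t : {0..T} ==> norm ((D ^^ n) (%k. cc (p k t)) k) <= M k"
 by (rule rapid_norm_Dn[where n=n, OF r(2)]) (rule that)
 have "(%k. M k * (1 / K)) summable_on UNIV" by (rule summable_on_cmult_left[OF M(1)])
 moreover have "norm ((D ^^ n) (%k. Ac (p k t) k) k) <= M k * (1 / K)" if "t : {0..T}" for k t
 proof -
 have "norm ((D ^^ n) (%k. Ac (p k t) k) k) <= norm ((\<i> * complex_of_real (K * of_int k)) ^ n) * (norm (cc (p k t)) / K)"
 unfolding Dn_eq norm_mult by (intro mlm norm_Ac) auto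
 also have "... = norm ((D ^^ n) (%k. cc (p k t)) k) / K" by (simp add: Dn_eq norm_mult)
 finally show ?thesis using divide_right_mono[OF M(2)[OF that, of k], of K] K_pos by simp
 qed
 ultimately show ?thesis by blast
 qed
 have cA: "co {0..T} (%t. Ac (p k t) k)" for k
 unfolding Ac_def by (cases "k = 0") (use K_pos in "auto intro!: cin c")
 obtain M0 where M0: "M0 summable_on UNIV" "!!k t. t : {0..T} ==> norm (Ac (p k t) k) <= M0 k"
 using bd[of 0] by auto
 have J: "co (UNIV \<times> {0..T}) (%(x, t). fs (%k. Ac (p k t) k) x)" by (rule fs_joint_continuous[OF cA M0(2,1)])
 have "co {0..T} (%t::real. (0::real, t))" by (intro cin)
 hence cB: "co {0..T} (%t. fs (%k. Ac (p k t) k) 0)"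
 using coc[OF J, of "{0..T}" "%t. (0, t)"] by auto
 obtain B where B: "!!t. t : {0..T} ==> norm (fs (%k. Ac (p k t) k) 0) <= B"
 using compact_imp_bounded[OF compact_continuous_image[OF cB compact_Icc]] unfolding bounded_iff by blast
 have "continuous_into_sobolev L m {0..T} (%x t. fs (%k. cth p k t) x)"
 proof (rule continuous_into_sobolev_fs)
 show "co {0..T} (cth p k)" for k
 using cA[of k] cB unfolding cth_def[abs_def] by (cases "k = 0") (auto intro!: cin)
 show "allw (%k. cth p k t)" if "t : {0..T}" for t by (rule theta_eq(2)[OF r(2) that])
 show "\<exists>M. M summable_on UNIV & (\<forall>k. ALL t:{0..T}. norm ((D ^^ n) (%k. cth p k t) k) <= M k)" for n
 proof -
 obtain M where M: "M summable_on UNIV" "!!k t. t : {0..T} ==> norm ((D ^^ n) (%k. Ac (p k t) k) k) <= M k"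
 using bd[of n] by blast
 have "norm ((D ^^ n) (%k. cth p k t) k) <= (if k = 0 then B else 0) + M k" if "t : {0..T}" for k t
 proof -
 have "0 <= M k" using M(2)[OF that, of k] norm_ge_zero order_trans by blast
 moreover have "0 <= B" using B[OF that] norm_ge_zero order_trans by blast
 ultimately show ?thesis
 using M(2)[OF that, of k] B[OF that] by (cases "n = 0"; cases "k = 0") (auto simp: Dn_eq cth_def power_0_left)
 qed
 moreover have "(%k. (if k = 0 then B else 0) + M k) summable_on UNIV"
 by (intro summable_on_add summable_single M(1))
 ultimately show ?thesis by blast
 qed
 qed
 thus "continuous_into_sobolev L m {0..T} (theta p)" by (simp add: theta_def[abs_def])
qed

lemma csol_classical:
 assumes a: "a > 0" and T: "T > 0" and sol: "!!s. 0 < s ==> s < T ==> csol a s b p"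
 shows "classical_solution L a m (%x. sr b 0 x 0) (%x. theta p x 0) (ereal T) (sr b 0) (theta p)"
 unfolding classical_solution_def time_interval_ereal
proof (intro conjI ballI allI)
 show "continuous_into_sobolev L m {0..<T} (sr b 0)" "continuous_into_sobolev L (Suc m) {0..<T} (theta p)"
 using csol_sobolev[OF sol] by (auto intro: continuous_into_sobolev_Ico)
 fix t x assume t: "t : {0..<T}"
 then obtain s where s: "t < s" "s < T" using dense[of t T] by auto
 note cs = sol[of s]
 have t': "t : {0..s}" and s0: "0 < s" using t s by auto
 note cs = sol[OF s0 s(2)]
 note r = csol_rapid[OF cs]
 have w: "at t within {0..<T} = at t within {0..s}" using t s by (intro at_within_Ico_Icc) auto
 have dw: "((%y. sr b 0 y t) hrd sr b 1 x t) (at x)" using sr_deriv[OF r(1) t', of 0] by simp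
 have dt: "((%y. theta p y t) hrd sr p 0 x t) (at x)" by (rule theta_deriv[OF r(2) t' csol_odd(4)[OF cs t']])
 show "(%y. sr b 0 y t) differentiable (at x)" "(%y. theta p y t) differentiable (at x)"
 using dw dt by (auto simp: real_differentiable_def)
 note v = csol_pde(1)[OF a cs t']
 show "((%s. sr b 0 x s) has_real_derivative
 deriv (%y. theta p y t) x - velocity L a (%y. sr b 0 y t) x * deriv (%y. sr b 0 y t) x) (at t within {0..<T})"
 unfolding w v DERIV_imp_deriv[OF dw] DERIV_imp_deriv[OF dt] csol_pde(4)[OF a cs t', symmetric] by (rule csol_pde(2)[OF a cs t'])
 show "((%s. theta p x s) hrd - velocity L a (%y. sr b 0 y t) x * deriv (%y. theta p y t) x) (at t within {0..<T})"
 unfolding w v DERIV_imp_deriv[OF dt] by (rule csol_theta[OF a cs t'])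
qed (use T in auto)

end

section \<open>Uniqueness\<close>

text \<open>Joint continuity for curried fields, which keeps the closure rules free of
  pairs.\<close>

definition jc :: "real set => real set => (real => real => real) => bool" where
 "jc X I f \<longleftrightarrow> co (X \<times> I) (%p. f (fst p) (snd p))"

lemma jc_add: "jc X I f ==> jc X I g ==> jc X I (%x t. f x t + g x t)"
 and jc_diff: "jc X I f ==> jc X I g ==> jc X I (%x t. f x t - g x t)"
 and jc_mult: "jc X I f ==> jc X I g ==> jc X I (%x t. f x t * g x t)"
 and jc_minus: "jc X I f ==> jc X I (%x t. - f x t)"
 and jc_power: "jc X I f ==> jc X I (%x t. f x t ^ n)"
 and jc_const: "jc X I (%x t. c)"
 by (simp_all add: jc_def cin)

lemma jc_space: "co X g ==> jc X I (%x t. g x)"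
 and jc_time: "co I h ==> jc X I (%x t. h t)"
 unfolding jc_def by (rule coc[where f=fst and t=X], auto intro: cin)
 (rule coc[where f=snd and t=I], auto intro: cin)

lemmas jc_intros = jc_add jc_diff jc_mult jc_minus jc_power jc_const jc_space jc_time

lemma jc_compose: "co UNIV ph ==> jc X I f ==> jc X I (%x t. ph (f x t))"
 unfolding jc_def by (rule coc[of UNIV ph]) auto

lemma jc_subset: "jc X I f ==> Y \<subseteq> X ==> J \<subseteq> I ==> jc Y J f"
 unfolding jc_def by (rule continuous_on_subset) auto

lemma jc_slice:
 assumes "jc X I f" "t : I"
 shows "co X (%x. f x t)"
proof -
 have "co X (%x. (x, t))" by (intro cin)
 from coc[OF assms(1)[unfolded jc_def] this] show ?thesis using assms(2) by auto
qed

lemma jc_slice_t: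
 assumes "jc X I f" "x : X"
 shows "co I (%t. f x t)"
proof -
 have "co I (%t. (x, t))" by (intro cin)
 from coc[OF assms(1)[unfolded jc_def] this] show ?thesis using assms(2) by auto
qed

lemma jc_swap:
 assumes "jc X I f"
 shows "co (I \<times> X) (%(t, x). f x t)"
proof -
 have "co (I \<times> X) (%p. (snd p, fst p))" by (intro cin)
 from coc[OF assms[unfolded jc_def] this] show ?thesis by (force simp: case_prod_unfold)
qed

lemma jc_case: "jc X I f \<longleftrightarrow> co (X \<times> I) (%(x, t). f x t)"
 by (simp add: jc_def case_prod_unfold)

lemma jc_bounded:
 assumes "jc X I f" "compact X" "compact I"
 obtains B where "B >= 0" "!!x t. x : X ==> t : I ==> |f x t| <= B"
proof -
 obtain B where B: "ALL y:(%p. f (fst p) (snd p)) ` (X \<times> I). norm y <= B"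
 using compact_imp_bounded[OF compact_continuous_image[OF assms(1)[unfolded jc_def] compact_Times[OF assms(2,3)]]] unfolding bounded_iff by blast
 have "|f x t| <= |B|" if "x : X" "t : I" for x t
 using B[rule_format, of "f x t"] that by force
 thus ?thesis using that[of "|B|"] by auto
qed

lemma jc_integral:
 assumes "jc {al..be} I f"
 shows "co I (%t. integral {al..be} (%x. f x t))"
 using integral_continuous_on_param[of I al be "%t x. f x t"] jc_swap[OF assms] by (simp add: cbox_interval)

lemma integral_time_deriv:
 fixes f f' :: "real => real => real"
 assumes d: "!!x t. x : {al..be} ==> t : I ==> ((%t. f x t) hrd f' x t) (at t within I)"
 and c: "jc {al..be} I f" "jc {al..be} I f'" and t: "t : I" "convex I"
 shows "((%t. integral {al..be} (%x. f x t)) hrd integral {al..be} (%x. f' x t)) (at t within I)"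
 using leibniz_rule_field_derivative[of I al be "%t x. f x t" "%t x. f' x t" t]
 d jc_swap[OF c(2)] icr[OF jc_slice[OF c(1)]] t by (simp add: cbox_interval)

lemma transport_integral:
 fixes f fx u ux G :: "real => real => real" and ph ph' :: "real => real"
 assumes ab: "al <= be"
 and dx: "!!x t. x : {al..be} ==> t : {0..s} ==> ((%x. f x t) hrd fx x t) (at x)"
 and du: "!!x t. x : {al..be} ==> t : {0..s} ==> ((%x. u x t) hrd ux x t) (at x)"
 and dt: "!!x t. x : {al..be} ==> t : {0..s} ==> ((%t. f x t) hrd - u x t * fx x t + G x t) (wi t s)"
 and c: "jc {al..be} {0..s} f" "jc {al..be} {0..s} fx" "jc {al..be} {0..s} u" "jc {al..be} {0..s} ux" "jc {al..be} {0..s} G"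
 and ph: "!!y. (ph hrd ph' y) (at y)" "co UNIV ph'"
 and bd: "u al t * ph (f al t) = u be t * ph (f be t)" and t: "t : {0..s}"
 shows "((%t. integral {al..be} (%x. ph (f x t))) has_real_derivative
 integral {al..be} (%x. ux x t * ph (f x t) + ph' (f x t) * G x t)) (wi t s)"
proof -
 have cph: "co UNIV ph" by (rule DERIV_continuous_on[OF ph(1)[THEN has_field_derivative_at_within]])
 let ?J = "jc {al..be} {0..s}"
 have j: "?J (%x t. ph (f x t))" "?J (%x t. ph' (f x t))"
 by (rule jc_compose[OF cph c(1)], rule jc_compose[OF ph(2) c(1)])
 have "((%t. integral {al..be} (%x. ph (f x t))) has_real_derivative
 integral {al..be} (%x. ph' (f x t) * (- u x t * fx x t + G x t))) (wi t s)"
 proof (rule integral_time_deriv[OF _ j(1) _ t])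
 show "((%t. ph (f x t)) hrd ph' (f x t) * (- u x t * fx x t + G x t)) (wi t s)"
 if "x : {al..be}" "t : {0..s}" for x t using DERIV_chain2[OF ph(1) dt[OF that]] .
 qed (intro jc_intros j c, simp)
 moreover have "integral {al..be} (%x. ph' (f x t) * (- u x t * fx x t + G x t)) = integral {al..be} (%x. ux x t * ph (f x t) + ph' (f x t) * G x t)"
 proof -
 have "((%x. ux x t * ph (f x t) + ph' (f x t) * fx x t * u x t) has_integral u be t * ph (f be t) - u al t * ph (f al t)) {al..be}"
 proof (rule fundamental_theorem_of_calculus[OF ab])
 fix x assume x: "x : {al..be}"
 have "((%x. u x t * ph (f x t)) hrd ux x t * ph (f x t) + ph' (f x t) * fx x t * u x t) (at x)"
 by (rule DERIV_mult[OF du[OF x t] DERIV_chain2[OF ph(1) dx[OF x t]]])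
 thus "((%x. u x t * ph (f x t)) has_vector_derivative ux x t * ph (f x t) + ph' (f x t) * fx x t * u x t) (at x within {al..be})"
 by (simp add: hrv has_vector_derivative_at_within)
 qed
 hence z: "integral {al..be} (%x. ux x t * ph (f x t) + ph' (f x t) * fx x t * u x t) = 0" using bd by (simp add: integral_unique)
 have "integral {al..be} (%x. ux x t * ph (f x t) + ph' (f x t) * G x t) =
 integral {al..be} (%x. (ux x t * ph (f x t) + ph' (f x t) * fx x t * u x t) + ph' (f x t) * (- u x t * fx x t + G x t))"
 by (simp add: als)
 also have "... = integral {al..be} (%x. ux x t * ph (f x t) + ph' (f x t) * fx x t * u x t) + integral {al..be} (%x. ph' (f x t) * (- u x t * fx x t + G x t))"
 by (rule hk_add; rule icr)
 (intro cin jc_slice[OF c(1) t] jc_slice[OF c(2) t] jc_slice[OF c(3) t] jc_slice[OF c(4) t] jc_slice[OF c(5) t] jc_slice[OF j(1) t] jc_slice[OF j(2) t])+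
 finally show ?thesis using z by simp
 qed
 ultimately show ?thesis by simp
qed

lemma within_imp_at:
 fixes t :: real
 shows "(f hrd d) (wi t s) ==> 0 < t ==> t < s ==> (f hrd d) (at t)"
 by (simp add: at_within_Icc_at)

lemma gronwall_within:
 fixes E V :: "real => real"
 assumes "0 <= s" and dE: "!!t. t : {0..s} ==> (E hrd E' t) (wi t s)"
 and dV: "!!t. t : {0..s} ==> (V hrd A t) (wi t s)"
 and le: "!!t. t : {0..s} ==> E' t <= A t * E t"
 shows "E s <= E 0 * exp (V s - V 0)"
 by (rule gronwall_exp[OF assms(1) DERIV_continuous_on[OF dE] DERIV_continuous_on[OF dV] within_imp_at[OF dE] within_imp_at[OF dV] le]) auto

lemma young_weighted:
 fixes X Y et :: real
 assumes et: "et > 0" and X: "X >= 0" and Y: "Y >= 0"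
 shows "X * Y <= et * Y^2 + 1 / et * X^2"
proof -
 have "0 <= (et * Y - X)^2" by simp
 also have "... = (et * Y)^2 - 2 * (et * (X * Y)) + X^2" by (simp add: power2_diff mult_ac)
 finally have "et * (X * Y) <= (et * Y)^2 + X^2" using mnn[OF less_imp_le[OF et] mnn[OF X Y]] by linarith
 also have "... = et * (et * Y^2 + 1 / et * X^2)" using et by (simp add: distrib_left pmd p2q)
 finally show ?thesis using et by (simp only: mult_le_cancel_left_pos)
qed

lemma summable_on_real_divide: "f summable_on A ==> (%k. f k / c :: real) summable_on A"
 using summable_on_cmult_left[of f A "1 / c"] by simp

section \<open>Sobolev embedding through Fourier coefficients\<close>

context circle begin

definition Zw :: real where "Zw = (ISUM k::int. 1 / (wt k)^2)"

definition Cs :: "nat => real" where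
 "Cs j = Zw + 4 ^ Suc j * (1 / L + 1 / (L * K ^ (2 * Suc j)))"

text \<open>One Sobolev order is spent on summability: the weighted coefficient is a product of 1 /
  (1 + |k|) and a square summable factor. Balancing Young's inequality with a positive upper bound
  \<open>et\<close>, instead of the norm itself, gives an estimate linear in \<open>et\<close> that
  also covers a vanishing norm.\<close>

lemma sobolev_sum:
 assumes f: "f : sobolev L (Suc j)" and n: "sobolev_norm L (Suc j) f <= et" and et: "et > 0"
 shows "wsum j (fcoef f)" "(ISUM k. (wt k) ^ j * norm (fcoef f k)) <= Cs j * et"
proof -
 let ?n = "Suc j"
 define g where "g = (%i. weak_deriv L i f)"
 have sf: "square_integrable L f" using f by (simp add: sobolev_def)
 have gw: "has_weak_deriv L i f (g i)" if "i <= ?n" for i unfolding g_def by (rule weak_deriv_works[OF f that])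
 hence sg: "square_integrable L (g i)" if "i <= ?n" for i using that by (auto simp: has_weak_deriv_def)
 have nn: "0 <= ci L (%x. (g i x)\<^sup>2)" for i by (rule integral_nonneg_AE) auto
 have sn: "0 <= sobolev_norm L ?n f" unfolding sobolev_norm_def by (rule real_sqrt_ge_zero, rule sum_nonneg, rule integral_nonneg_AE, simp)
 have "(\<Sum>i\<le>?n. ci L (%x. (g i x)\<^sup>2)) = (sobolev_norm L ?n f)^2"
 unfolding sobolev_norm_def g_def by (rule real_sqrt_pow2[symmetric], rule sum_nonneg, rule integral_nonneg_AE, simp)
 also from power_mono[OF n sn] have "(sobolev_norm L ?n f)^2 <= et\<^sup>2" .
 finally have tot: "(\<Sum>i\<le>?n. ci L (%x. (g i x)\<^sup>2)) <= et\<^sup>2" .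
 have gi: "ci L (%x. (g i x)\<^sup>2) <= et\<^sup>2" if "i <= ?n" for i
 using member_le_sum[of i "{..?n}" "%i. ci L (%x. (g i x)\<^sup>2)"] nn that tot by force
 have bes: "(%k. (norm (fcoef (g i) k))\<^sup>2) summable_on UNIV" "(ISUM k. (norm (fcoef (g i) k))\<^sup>2) <= et\<^sup>2 / L" if "i <= ?n" for i
 using bessel[OF sg[OF that]] gi[OF that] L_pos by (auto simp: fsi)
 have nf: "norm (fcoef (g i) k) = (K * |of_int k| ) ^ i * norm (fcoef f k)" if "i <= ?n" for i k
 using fcoef_weak_deriv[OF sf gw[OF that], of k] K_pos by (simp add: norm_mult norm_power abs_mult)
 let ?Q = "%k. (norm (fcoef (g 0) k))\<^sup>2 + (norm (fcoef (g ?n) k))^2 / K ^ (2 * ?n)"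
 have term_le: "(wt k) ^ j * norm (fcoef f k) <= et * (1 / (wt k)^2) + 4 ^ ?n / et * ?Q k" for k
 proof -
 let ?w = "1 + |of_int k| :: real" and ?c = "norm (fcoef f k)"
 have w: "?w > 0" by (simp add: add_pos_nonneg)
 have q: "?w ^ (2 * ?n) * ?c^2 <= 4 ^ ?n * ?Q k"
 proof (cases "k = 0")
 case True
 have "1 <= (4::real) ^ ?n" by (rule one_le_power) simp
 hence "1 * ?c^2 <= 4 ^ ?n * ?c^2" by (rule mrm) simp
 thus ?thesis using True nf[of 0 k] nf[of ?n k] by simp
 next
 case False
 hence "1 <= |of_int k :: real|" by linarith
 hence "?w ^ (2 * ?n) <= (2 * |of_int k| ) ^ (2 * ?n)" by (intro power_mono) auto
 also have "... = 4 ^ ?n * |of_int k| ^ (2 * ?n)" by (simp only: pmd power_mult) simp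
 finally have "?w ^ (2 * ?n) * ?c^2 <= (4 ^ ?n * |of_int k| ^ (2 * ?n)) * ?c^2" by (rule mrm) simp
 also have "... = 4 ^ ?n * ( |of_int k| ^ (2 * ?n) * ?c^2)" by (rule mult.assoc)
 finally have 1: "?w ^ (2 * ?n) * ?c^2 <= 4 ^ ?n * ( |of_int k| ^ (2 * ?n) * ?c^2)" .
 have "(norm (fcoef (g ?n) k))^2 = K ^ (2 * ?n) * ( |of_int k| ^ (2 * ?n) * ?c^2)"
 unfolding nf[OF order_refl] by (simp only: pmd power_mult[symmetric] mult.commute[of ?n 2] mult.assoc)
 hence "|of_int k| ^ (2 * ?n) * ?c^2 = (norm (fcoef (g ?n) k))^2 / K ^ (2 * ?n)" using K_pos by simp
 moreover have "(norm (fcoef (g ?n) k))^2 / K ^ (2 * ?n) <= ?Q k" by simp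
 ultimately have "|of_int k| ^ (2 * ?n) * ?c^2 <= ?Q k" by (simp only:)
 hence "4 ^ ?n * ( |of_int k| ^ (2 * ?n) * ?c^2) <= 4 ^ ?n * ?Q k" by (rule mlm) simp
 with 1 show ?thesis by (rule order_trans)
 qed
 have "?w ^ j * ?c = (?w ^ ?n * ?c) * (1 / ?w)" using w by simp
 also have "... <= et * (1 / ?w)^2 + 1 / et * (?w ^ ?n * ?c)^2" by (rule young_weighted[OF et]) (use w in auto)
 finally have A: "?w ^ j * ?c <= et * (1 / ?w)^2 + 1 / et * (?w ^ ?n * ?c)^2" .
 have B: "(?w ^ ?n * ?c)^2 = ?w ^ (2 * ?n) * ?c^2" by (simp only: pmd power_mult[symmetric] mult.commute[of ?n 2])
 have C: "1 / et * (?w ^ (2 * ?n) * ?c^2) <= 1 / et * (4 ^ ?n * ?Q k)" by (rule mlm[OF q]) (use et in simp)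
 have e1: "1 / et * (4 ^ ?n * ?Q k) = 4 ^ ?n / et * ?Q k" by (simp only: times_divide_eq_left mult_1)
 have e2: "(1 / ?w)^2 = 1 / ?w^2" by (simp only: power_divide power_one)
 show ?thesis using A C unfolding B e1 e2 by linarith
 qed
 have le0: "0 <= ?n" by simp
 have S2: "?Q summable_on UNIV" by (rule summable_on_add[OF bes(1)[OF le0] summable_on_real_divide[OF bes(1)[OF order_refl]]])
 have S: "(%k. et * (1 / (wt k)^2) + 4 ^ ?n / et * ?Q k) summable_on UNIV"
 by (intro summable_on_add[OF scr scr] summable_inverse_weight S2)
 show w: "wsum j (fcoef f)" unfolding wsum_def
 by (rule summable_on_comparison_test[OF S term_le]) simp
 have "(ISUM k. (wt k) ^ j * norm (fcoef f k)) <= (ISUM k. et * (1 / (wt k)^2) + 4 ^ ?n / et * ?Q k)"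
 by (rule infsum_mono[OF w[unfolded wsum_def] S term_le])
 also have "... = (ISUM k::int. et * (1 / (wt k)^2)) + (ISUM k. 4 ^ ?n / et * ?Q k)"
 by (rule infsum_add[OF scr[OF summable_inverse_weight] scr[OF S2]])
 also have "... = et * Zw + 4 ^ ?n / et * (ISUM k. ?Q k)"
 unfolding Zw_def infsum_cmult_right' ..
 finally have s1: "(ISUM k. (wt k) ^ j * norm (fcoef f k)) <= et * Zw + 4 ^ ?n / et * (ISUM k. ?Q k)" .
 have "(ISUM k. ?Q k) = (ISUM k. (norm (fcoef (g 0) k))\<^sup>2) + (ISUM k. (norm (fcoef (g ?n) k))\<^sup>2 / K ^ (2 * ?n))"
 by (rule infsum_add[OF bes(1)[OF le0] summable_on_real_divide[OF bes(1)[OF order_refl]]])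
 also have "(ISUM k. (norm (fcoef (g ?n) k))\<^sup>2 / K ^ (2 * ?n)) = (ISUM k. (norm (fcoef (g ?n) k))\<^sup>2) / K ^ (2 * ?n)"
 using infsum_cmult_left'[of "%k. (norm (fcoef (g ?n) k))\<^sup>2" "1 / K ^ (2 * ?n)" UNIV] by simp
 finally have "(ISUM k. ?Q k) <= et\<^sup>2 / L + (et\<^sup>2 / L) / K ^ (2 * ?n)"
 using bes(2)[OF le0] divide_right_mono[OF bes(2)[OF order_refl], of "K ^ (2 * ?n)"] K_pos by simp
 hence "4 ^ ?n / et * (ISUM k. ?Q k) <= 4 ^ ?n / et * (et\<^sup>2 / L + (et\<^sup>2 / L) / K ^ (2 * ?n))" by (rule mlm) (use et in simp)
 also have "... = 4 ^ ?n * (1 / L + 1 / (L * K ^ (2 * ?n))) * et" using et L_pos K_pos by (simp add: fsi p2q del: power_Suc mult_Suc_right)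
 finally show "(ISUM k. (wt k) ^ j * norm (fcoef f k)) <= Cs j * et" using s1 unfolding Cs_def by (simp only: distrib_right mult.commute[of et Zw])
qed

lemma fcoef_diff:
 assumes "square_integrable L f" "square_integrable L g"
 shows "fcoef (%x. f x - g x) k = fcoef f k - fcoef g k"
proof -
 have i: "integrable (lebesgue_on {0..L}) (%x. f x * cos (K * of_int k * x))" "integrable (lebesgue_on {0..L}) (%x. g x * cos (K * of_int k * x))"
 "integrable (lebesgue_on {0..L}) (%x. f x * sin (K * of_int k * x))" "integrable (lebesgue_on {0..L}) (%x. g x * sin (K * of_int k * x))"
 by (intro square_integrable_mult assms square_integrable_continuous cin)+
 show ?thesis using i by (simp add: fcoef_def complex_eq_iff left_diff_distrib diff_divide_distrib)
qed

lemma fs_abs_le: "wsum 0 c ==> |fs c x| <= (ISUM k. norm (c k))"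
proof -
 assume w: "wsum 0 c"
 have s: "(%k. norm (Re (c k * cis (K * of_int k * x)))) summable_on UNIV"
 by (rule Infinite_Sum.abs_summable_on_comparison_test'[OF wsum_0D[OF w]]) (simp only: real_norm_def abs_Re_cis_le)
 have "norm (fs c x) <= (ISUM k. norm (Re (c k * cis (K * of_int k * x))))" unfolding fs_def by (rule norm_infsum_bound[OF s])
 also have "... <= (ISUM k. norm (c k))" by (rule infsum_mono[OF s wsum_0D[OF w]]) (simp only: real_norm_def abs_Re_cis_le)
 finally show ?thesis by simp
qed

lemma wsum_Dn_le:
 assumes w: "wsum j d" and i: "i <= j" and q: "!!k. |q k| <= B"
 shows "wsum 0 ((D ^^ i) (%k. of_real (q k) * d k))"
 "(ISUM k. norm ((D ^^ i) (%k. of_real (q k) * d k) k)) <= K ^ i * B * (ISUM k. (wt k) ^ j * norm (d k))"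
proof -
 have B: "B >= 0" using order_trans[OF abs_ge_zero q] .
 have le: "norm ((D ^^ i) (%k. of_real (q k) * d k) k) <= K ^ i * B * ((wt k) ^ j * norm (d k))" for k
 proof -
 have "norm ((D ^^ i) (%k. of_real (q k) * d k) k) = K ^ i * ( |of_int k| ^ i * ( |q k| * norm (d k)))"
 using K_pos by (simp add: Dn_eq norm_mult norm_power abs_mult pmd)
 also have "... <= K ^ i * ((wt k) ^ j * (B * norm (d k)))"
 proof (intro mlm mult_mono mrm q)
 have "|of_int k :: real| ^ i <= (wt k) ^ i" by (intro power_mono) auto
 also have "... <= (wt k) ^ j" using i by (intro power_increasing) auto
 finally show "|of_int k :: real| ^ i <= (wt k) ^ j" .
 qed (use K_pos B in auto)
 finally show ?thesis by (simp only: mult_ac)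
 qed
 have S: "(%k. K ^ i * B * ((wt k) ^ j * norm (d k))) summable_on UNIV" using w by (intro scr) (simp add: wsum_def)
 show 1: "wsum 0 ((D ^^ i) (%k. of_real (q k) * d k))"
 unfolding wsum_def by (rule summable_on_comparison_test[OF S]) (use le in auto)
 show "(ISUM k. norm ((D ^^ i) (%k. of_real (q k) * d k) k)) <= K ^ i * B * (ISUM k. (wt k) ^ j * norm (d k))"
 unfolding infsum_cmult_right'[symmetric] by (rule infsum_mono[OF wsum_0D[OF 1] S le])
qed

text \<open>The i-th space derivative of the Fourier multiplier \<open>q\<close> applied to the
  slice at time t: q = 1 gives the field itself, \<open>vm a\<close> its velocity.\<close>

definition sd :: "(int => real) => nat => (real => real => real) => real => real => real" where
 "sd q i f x t = fs ((D ^^ i) (%k. of_real (q k) * fcoef (%y. f y t) k)) x"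

context
 fixes I :: "real set" and j :: nat and f :: "real => real => real" and q :: "int => real" and B :: real
 assumes cs: "continuous_into_sobolev L (Suc j) I f" and q: "!!k. |q k| <= B"
begin

lemma sd_sobolev: "t : I ==> (%x. f x t) : sobolev L (Suc j)"
 using cs by (simp add: continuous_into_sobolev_def)

lemma sd_wsum: "t : I ==> wsum j (fcoef (%x. f x t))"
 by (rule sobolev_sum(1)[OF sd_sobolev, of _ "max 1 (sobolev_norm L (Suc j) (%x. f x t))"]) auto

text \<open>Continuity in time comes from \<open>sobolev_sum\<close> applied to differences,
  uniformly in x; continuity in x comes from the summable series at the fixed time.\<close>

lemma sd_jc:
 assumes i: "i <= j"
 shows "jc UNIV I (sd q i f)"
 unfolding jc_def continuous_on_iff
proof (intro ballI allI impI)
 fix p0 :: "real \<times> real" and e :: real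
 assume p0: "p0 : UNIV \<times> I" and e: "e > 0"
 define t0 where "t0 = snd p0"
 have t0: "t0 : I" using p0 by (auto simp: t0_def)
 have B: "B >= 0" using order_trans[OF abs_ge_zero q] .
 have Zw0: "Zw >= 0" unfolding Zw_def by (rule infsum_nonneg) simp
 have Cs0: "Cs j >= 0" unfolding Cs_def using Zw0 L_pos K_pos by (intro add_nonneg_nonneg mnn divide_nonneg_nonneg) auto
 define Q where "Q = K ^ i * B * Cs j + 1"
 have Q: "Q > 0" unfolding Q_def using B Cs0 K_pos by (intro add_nonneg_pos mnn) auto
 define et where "et = e / (2 * Q)"
 have et: "et > 0" using e Q by (simp add: et_def)
 have "((%s. sobolev_norm L (Suc j) (%x. f x s - f x t0)) \<longlongrightarrow> 0) (at t0 within I)"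
 using cs t0 by (simp add: continuous_into_sobolev_def)
 from order_tendstoD(2)[OF this et] obtain d1 where d1: "d1 > 0"
 "!!s. s : I ==> s ~= t0 ==> dist s t0 < d1 ==> sobolev_norm L (Suc j) (%x. f x s - f x t0) < et"
 by (auto simp: eventually_at)
 have first: "|sd q i f x s - sd q i f x t0| < e / 2" if s: "s : I" "dist s t0 < d1" for x s
 proof (cases "s = t0")
 case False
 let ?d = "fcoef (%x. f x s - f x t0)"
 have sq: "square_integrable L (%x. f x t)" if "t : I" for t using sd_sobolev[OF that] by (simp add: sobolev_def)
 have sob: "(%x. f x s - f x t0) : sobolev L (Suc j)" by (rule sobolev_diff[OF sd_sobolev[OF s(1)] sd_sobolev[OF t0]])
 note ss = sobolev_sum[OF sob less_imp_le[OF d1(2)[OF s(1) False s(2)]] et]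
 have w: "wsum 0 ((D ^^ i) (%k. of_real (q k) * fcoef (%y. f y t) k))" if "t : I" for t by (rule wsum_Dn_le(1)[OF sd_wsum[OF that] i q])
 have "sd q i f x s - sd q i f x t0 = fs ((D ^^ i) (%k. of_real (q k) * ?d k)) x"
 unfolding sd_def fs_diff[OF w[OF s(1)] w[OF t0], symmetric] fcoef_diff[OF sq[OF s(1)] sq[OF t0]]
 by (intro arg_cong2[where f=fs] ext) (simp_all add: Dn_eq right_diff_distrib)
 also have "| ... | <= (ISUM k. norm ((D ^^ i) (%k. of_real (q k) * ?d k) k))"
 by (rule fs_abs_le[OF wsum_Dn_le(1)[OF ss(1) i q]])
 also have "... <= K ^ i * B * (ISUM k. (wt k) ^ j * norm (?d k))" by (rule wsum_Dn_le(2)[OF ss(1) i q])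
 also have "... <= K ^ i * B * (Cs j * et)" using B K_pos by (intro mlm ss(2)) auto
 also have "... < Q * et" using et by (simp add: Q_def als)
 also have "... = e / 2" using Q by (simp add: et_def)
 finally show ?thesis .
 qed (use e in simp)
 have "co UNIV (%x. sd q i f x t0)" unfolding sd_def by (rule fs_continuous[OF wsum_Dn_le(1)[OF sd_wsum[OF t0] i q]])
 then obtain d2 where d2: "d2 > 0" "!!x. dist x (fst p0) < d2 ==> dist (sd q i f x t0) (sd q i f (fst p0) t0) < e / 2"
 unfolding continuous_on_iff using half_gt_zero[OF e] by blast
 show "\<exists>d>0. ALL p:UNIV \<times> I. dist p p0 < d --> dist (sd q i f (fst p) (snd p)) (sd q i f (fst p0) (snd p0)) < e"
 proof (intro exI[of _ "min d1 d2"] conjI ballI impI)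
 fix p assume p: "p : UNIV \<times> I" "dist p p0 < min d1 d2"
 have "dist (fst p) (fst p0) < d2" "dist (snd p) t0 < d1"
 using dist_fst_le[of p p0] dist_snd_le[of p p0] p(2) by (auto simp: t0_def)
 hence "|sd q i f (fst p) (snd p) - sd q i f (fst p) t0| < e / 2" "|sd q i f (fst p) t0 - sd q i f (fst p0) t0| < e / 2"
 using first[of "snd p" "fst p"] d2(2)[of "fst p"] p(1) by (auto simp: dist_real_def)
 thus "dist (sd q i f (fst p) (snd p)) (sd q i f (fst p0) (snd p0)) < e" unfolding dist_real_def t0_def[symmetric] by linarith
 qed (use d1 d2 in auto)
qed

lemma sd_deriv:
 assumes i: "i < j" and t: "t : I"
 shows "((%x. sd q i f x t) hrd sd q (Suc i) f x t) (at x)"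
proof -
 have "wsum 1 ((D ^^ i) (%k. of_real (q k) * fcoef (%y. f y t) k))"
 proof (rule wsum_le[OF wsum_real_mult[OF sd_wsum[OF t] q], where C="K ^ i"])
 fix k
 let ?c = "norm (of_real (q k) * fcoef (%y. f y t) k)"
 have "(wt k) ^ 1 * |of_int k| ^ i <= (wt k) ^ 1 * (wt k) ^ i" by (intro mlm power_mono) auto
 also have "... <= (wt k) ^ j" unfolding power_add[symmetric] using i by (intro power_increasing) auto
 finally have "((wt k) ^ 1 * |of_int k| ^ i) * (K ^ i * ?c) <= (wt k) ^ j * (K ^ i * ?c)" using K_pos by (intro mrm) auto
 moreover have "norm ((D ^^ i) (%k. of_real (q k) * fcoef (%y. f y t) k) k) = |of_int k| ^ i * (K ^ i * ?c)"
 using K_pos by (simp add: Dn_eq norm_mult norm_power abs_mult pmd)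
 ultimately show "(wt k) ^ 1 * norm ((D ^^ i) (%k. of_real (q k) * fcoef (%y. f y t) k) k) <= K ^ i * ((wt k) ^ j * ?c)"
 by (simp only: mult_ac)
 qed
 from fs_deriv[OF this, of x] show ?thesis by (simp add: sd_def)
qed

lemma sd_representation:
 assumes t: "t : I" and c: "co UNIV (%x. f x t)"
 shows "f x t = sd (%k. 1) 0 f x t"
proof -
 have "f (x + L) t = f x t" for x using sd_sobolev[OF t] by (simp add: sobolev_def periodic_fun_simple_iff)
 hence "f x t = fs (fcoef (%x. f x t)) x"
 by (intro fourier_representation[OF c _ wsum_mono[OF sd_wsum[OF t] le0]])
 also have "... = sd (%k. 1) 0 f x t" unfolding sd_def by simp
 finally show ?thesis .
qed

end

end

section \<open>The L2 estimate for the difference of two solutions\<close>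

lemma young_product:
 fixes x y w B :: real
 assumes "|w| <= B"
 shows "2 * (x * y * w) <= B * (x^2 + y^2)"
proof -
 have "2 * (x * y * w) <= |2 * (x * y * w) |" by simp
 also have "... = (2 * |x| * |y| ) * |w|" by (simp add: abs_mult)
 also have "... <= (2 * |x| * |y| ) * B" by (intro mlm assms) simp
 also have "... <= (x^2 + y^2) * B"
 proof (rule mrm)
 have "0 <= ( |x| - |y| )^2" by simp
 thus "2 * |x| * |y| <= x^2 + y^2" by (simp add: power2_diff)
 qed (use assms in linarith)
 finally show ?thesis by (simp only: mult.commute)
qed

text \<open>\<open>p\<close>, \<open>q\<close> are the differences of \<omega> and \<rho>,
  \<open>d\<close>, \<open>e\<close> those of the velocity and its gradient; \<open>v\<close> is the
  velocity gradient of one solution, and \<open>w\<close>, \<open>r\<close>, \<open>r1\<close> are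
  \<omega>_x, \<rho>, \<rho>_x of the other. Every term is quadratic in the differences.\<close>

lemma difference_energy_pointwise:
 fixes v w r r1 p q d e B :: real
 assumes "|v| <= B" "|w| <= B" "|r| <= B" "|r1| <= B"
 shows "(v * p^2 + 2 * p * (- d * w + q)) + (v * q^2 + 2 * q * (- v * q - e * r - d * r1)) <= (3 * B + 1) * ((p^2 + q^2) + (d^2 + e^2))"
proof -
 have B: "B >= 0" using assms(1) by linarith
 have 1: "v * p^2 <= B * p^2" "- v * q^2 <= B * q^2" using assms(1) by (intro mrm; simp)+
 have 2: "2 * (p * d * - w) <= B * (p^2 + d^2)" "2 * (p * q * 1) <= 1 * (p^2 + q^2)" "2 * (q * e * - r) <= B * (q^2 + e^2)" "2 * (q * d * - r1) <= B * (q^2 + d^2)"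
 by (intro young_product; use assms in simp)+
 have "(v * p^2 + 2 * p * (- d * w + q)) + (v * q^2 + 2 * q * (- v * q - e * r - d * r1)) =
 v * p^2 + - v * q^2 + 2 * (p * d * - w) + 2 * (p * q * 1) + 2 * (q * e * - r) + 2 * (q * d * - r1)"
 by (simp add: als p2q)
 also have "... <= B * p^2 + B * q^2 + B * (p^2 + d^2) + 1 * (p^2 + q^2) + B * (q^2 + e^2) + B * (q^2 + d^2)"
 using 1 2 by linarith
 also have "... = (3 * B + 1) * ((p^2 + q^2) + (d^2 + e^2)) - (B * (p^2 + d^2 + 2 * e^2) + (d^2 + e^2))" by (simp add: als)
 also have "... <= (3 * B + 1) * ((p^2 + q^2) + (d^2 + e^2))"
 proof -
 have "0 <= p^2 + d^2 + 2 * e^2" by simp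
 from mnn[OF B this] have "0 <= B * (p^2 + d^2 + 2 * e^2) + (d^2 + e^2)" by simp
 thus ?thesis by linarith
 qed
 finally show ?thesis .
qed

context circle begin

lemma parseval_compare:
 assumes c: "wsum 0 c" "hermitian c" and d: "wsum 0 d" "hermitian d" and B: "B >= 0" "!!k. norm (c k) <= B * norm (d k)"
 shows "in0 L (%x. (fs c x)\<^sup>2) <= B^2 * in0 L (%x. (fs d x)\<^sup>2)"
proof -
 have "(ISUM k. (norm (c k))\<^sup>2) <= (ISUM k. B\<^sup>2 * (norm (d k))^2)"
 proof (rule infsum_mono[OF parseval_square(2)[OF c] scr[OF parseval_square(2)[OF d]]])
 show "(norm (c k))^2 <= B^2 * (norm (d k))^2" for k
 using power_mono[OF B(2)[of k], of 2] by (simp add: pmd)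
 qed
 hence "L * (ISUM k. (norm (c k))\<^sup>2) <= L * (B^2 * (ISUM k. (norm (d k))\<^sup>2))"
 using L_pos by (simp add: infsum_cmult_right')
 thus ?thesis
 unfolding integral_unique[OF parseval_square(1)[OF c]] integral_unique[OF parseval_square(1)[OF d]] by (simp only: mult_ac)
qed

text \<open>A classical solution on a closed time interval, with the index shifted to j = m - 1: by
  \<open>sd_jc\<close>, \<omega> has j and \<theta> has j + 1 continuous space derivatives, and j >=
  1 provides every derivative that the uniqueness estimate takes.\<close>

definition cl_on :: "real => real => (real => real => real) => (real => real => real) => bool" where
 "cl_on a s w h \<longleftrightarrow> (\<exists>j\<ge>1. continuous_into_sobolev L (Suc j) {0..s} w & continuous_into_sobolev L (Suc (Suc j)) {0..s} h) &
 (ALL t:{0..s}. \<forall>x. (%y. w y t) differentiable (at x) & (%y. h y t) differentiable (at x) &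
 ((%r. w x r) hrd deriv (%y. h y t) x - velocity L a (%y. w y t) x * deriv (%y. w y t) x) (wi t s) &
 ((%r. h x r) hrd - velocity L a (%y. w y t) x * deriv (%y. h y t) x) (wi t s))"

lemma continuous_into_sobolev_subset: "continuous_into_sobolev L m I f ==> J \<subseteq> I ==> continuous_into_sobolev L m J f"
 unfolding continuous_into_sobolev_def by (meson subsetD tendsto_within_subset)

lemma cl_on_subset: "cl_on a s w h ==> r <= s ==> cl_on a r w h"
proof -
 assume cl: "cl_on a s w h" and r: "r <= s"
 have sub: "{0..r} \<subseteq> {0..s}" using r by auto
 show ?thesis using cl unfolding cl_on_def
 by (meson sub continuous_into_sobolev_subset subsetD has_field_derivative_subset)
qed

lemma classical_cl_on:
 assumes "classical_solution L a m w0 h0 T w h" "m >= 2" "ereal s < T"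
 shows "cl_on a s w h"
proof -
 have sub: "{0..s} \<subseteq> time_interval T" using assms(3) by (auto simp: time_interval_def intro: le_less_trans[of _ "ereal s"])
 have "continuous_into_sobolev L (Suc (m - 1)) {0..s} w" "continuous_into_sobolev L (Suc (Suc (m - 1))) {0..s} h" "m - 1 >= 1"
 using assms continuous_into_sobolev_subset[OF _ sub] by (auto simp: classical_solution_def)
 moreover have "ALL t:{0..s}. \<forall>x. (%y. w y t) differentiable (at x) & (%y. h y t) differentiable (at x) &
 ((%r. w x r) hrd deriv (%y. h y t) x - velocity L a (%y. w y t) x * deriv (%y. w y t) x) (wi t s) &
 ((%r. h x r) hrd - velocity L a (%y. w y t) x * deriv (%y. h y t) x) (wi t s)"
 using assms(1) unfolding classical_solution_def by (meson sub subsetD has_field_derivative_subset)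
 ultimately show ?thesis unfolding cl_on_def by blast
qed

abbreviation "o1 \<equiv> (%k::int. 1 :: real)"

lemma sd_periodic: "sd q i f (x + L) t = sd q i f x t"
 by (simp add: sd_def fs_periodic)

text \<open>For \<theta> only the undifferentiated equation is given in this class. The equation for
  \<theta>_x is obtained by writing \<theta> as a time integral and differentiating under that
  integral in x.\<close>

lemma cl_fields:
 assumes a: "a > 0" and cl: "cl_on a s w h"
 shows "jc UNIV {0..s} w" "jc UNIV {0..s} (sd o1 1 w)" "jc UNIV {0..s} (sd (vm a) 0 w)" "jc UNIV {0..s} (sd (vm a) 1 w)"
 "jc UNIV {0..s} (sd o1 1 h)" "jc UNIV {0..s} (sd o1 2 h)"
 "!!t x. t : {0..s} ==> ((%x. w x t) hrd sd o1 1 w x t) (at x)"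
 "!!t x. t : {0..s} ==> ((%x. h x t) hrd sd o1 1 h x t) (at x)"
 "!!t x. t : {0..s} ==> ((%x. sd (vm a) 0 w x t) hrd sd (vm a) 1 w x t) (at x)"
 "!!t x. t : {0..s} ==> ((%x. sd o1 1 h x t) hrd sd o1 2 h x t) (at x)"
 "!!t x. t : {0..s} ==> velocity L a (%y. w y t) x = sd (vm a) 0 w x t"
 "!!t x. t : {0..s} ==> ((%t. w x t) hrd - sd (vm a) 0 w x t * sd o1 1 w x t + sd o1 1 h x t) (wi t s)"
 "!!t x. t : {0..s} ==> ((%t. h x t) hrd - sd (vm a) 0 w x t * sd o1 1 h x t) (wi t s)"
 "!!t x. t : {0..s} ==> ((%t. sd o1 1 h x t) hrd - sd (vm a) 0 w x t * sd o1 2 h x t - sd (vm a) 1 w x t * sd o1 1 h x t) (wi t s)"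
 "!!t. t : {0..s} ==> wsum 1 (fcoef (%x. w x t))" "!!t x. t : {0..s} ==> w x t = fs (fcoef (%x. w x t)) x"
proof -
 obtain j where j: "j >= 1" and cs: "continuous_into_sobolev L (Suc j) {0..s} w" "continuous_into_sobolev L (Suc (Suc j)) {0..s} h"
 using cl by (auto simp: cl_on_def)
 obtain B where B: "!!k. |vm a k| <= B" using vm_bounded[OF a] by blast
 have one: "|o1 k| <= 1" for k by simp
 have df: "(%y. w y t) differentiable (at x)" "(%y. h y t) differentiable (at x)" if "t : {0..s}" for t x
 using cl that by (auto simp: cl_on_def)
 hence ct: "co UNIV (%y. w y t)" "co UNIV (%y. h y t)" if "t : {0..s}" for t
 using that by (auto intro!: differentiable_imp_continuous_on simp: differentiable_on_def)
 have wr: "w x t = sd o1 0 w x t" and hr: "h x t = sd o1 0 h x t" if "t : {0..s}" for x t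
 using sd_representation[OF cs(1) one that ct(1)[OF that]] sd_representation[OF cs(2) one that ct(2)[OF that]] by blast+
 note J1 = sd_jc[where q=o1, OF cs(1) one] and J2 = sd_jc[where q="vm a", OF cs(1) B] and J3 = sd_jc[where q=o1, OF cs(2) one]
 have "jc UNIV {0..s} (sd o1 0 w)" by (rule J1) simp
 thus "jc UNIV {0..s} w" unfolding jc_def by (rule continuous_on_eq) (use wr in auto)
 show J: "jc UNIV {0..s} (sd o1 1 w)" "jc UNIV {0..s} (sd (vm a) 0 w)" "jc UNIV {0..s} (sd (vm a) 1 w)"
 "jc UNIV {0..s} (sd o1 1 h)" "jc UNIV {0..s} (sd o1 2 h)" using j J1 J2 J3 by auto
 fix t assume t: "t : {0..s}"
 show dw: "((%x. w x t) hrd sd o1 1 w x t) (at x)" for x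
 using sd_deriv[where q=o1 and i=0 and x=x, OF cs(1) one _ t] j wr[OF t] by simp
 show dh: "((%x. h x t) hrd sd o1 1 h x t) (at x)" if "t : {0..s}" for x t
 using sd_deriv[where q=o1 and i=0 and x=x, OF cs(2) one _ that] j hr[OF that] by simp
 show dU: "((%x. sd (vm a) 0 w x t) hrd sd (vm a) 1 w x t) (at x)" if "t : {0..s}" for x t
 using sd_deriv[where q="vm a" and i=0 and x=x, OF cs(1) B _ that] j by simp
 show dR: "((%x. sd o1 1 h x t) hrd sd o1 2 h x t) (at x)" if "t : {0..s}" for x t
 using sd_deriv[where q=o1 and i=1 and x=x, OF cs(2) one _ that] j by (simp add: numeral_2_eq_2)
 show w1: "wsum 1 (fcoef (%x. w x t))" if "t : {0..s}" for t by (rule wsum_mono[OF sd_wsum[OF cs(1) B that] j])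
 show wf: "w x t = fs (fcoef (%x. w x t)) x" if "t : {0..s}" for x t
 by (rule trans[OF wr[OF that]]) (simp add: sd_def)
 show vel: "velocity L a (%y. w y t) x = sd (vm a) 0 w x t" if "t : {0..s}" for x t
 proof -
 have e: "(%y. w y t) = fs (fcoef (%x. w x t))" by (rule ext) (rule wf[OF that])
 have "velocity L a (fs (fcoef (%x. w x t))) x = sd (vm a) 0 w x t"
 using velocity_fs[OF a wsum_mono[OF w1[OF that]] hermitian_fcoef, of x] by (simp add: sd_def)
 thus ?thesis by (simp only: e[symmetric])
 qed
 have td: "((%r. w x r) hrd deriv (%y. h y t) x - velocity L a (%y. w y t) x * deriv (%y. w y t) x) (wi t s)"
 "((%r. h x r) hrd - velocity L a (%y. w y t) x * deriv (%y. h y t) x) (wi t s)" if "t : {0..s}" for x t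
 using cl that by (auto simp: cl_on_def)
 show "((%t. w x t) hrd - sd (vm a) 0 w x t * sd o1 1 w x t + sd o1 1 h x t) (wi t s)" for x
 using td(1)[OF t, of x] by (simp add: vel[OF t] DERIV_imp_deriv[OF dw] DERIV_imp_deriv[OF dh[OF t]] als)
 show th: "((%t. h x t) hrd - sd (vm a) 0 w x t * sd o1 1 h x t) (wi t s)" if "t : {0..s}" for x t
 using td(2)[OF that, of x] by (simp add: vel[OF that] DERIV_imp_deriv[OF dh[OF that]])
 define g where "g = (%x t. - sd (vm a) 0 w x t * sd o1 1 h x t)"
 define g1 where "g1 = (%x t. - sd (vm a) 0 w x t * sd o1 2 h x t - sd (vm a) 1 w x t * sd o1 1 h x t)"
 have jg: "jc UNIV {0..s} g" "jc UNIV {0..s} g1" unfolding g_def g1_def using J by (auto simp: jc_def intro!: cin)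
 \<comment> \<open>Two expressions for the x-derivative of \<theta> at time t are compared: the
   Fourier series, and the derivative of the time integral of \<open>g\<close>.\<close>
 have rep: "sd o1 1 h x t = sd o1 1 h x 0 + in0 t (g1 x)" if t: "t : {0..s}" for x t
 proof (rule DERIV_unique[OF dh[OF t]])
 have 0: "0 : {0..s}" using t by auto
 have e: "h x t = h x 0 + in0 t (g x)" for x
 proof -
 have "(g x has_integral h x t - h x 0) {0..t}"
 proof (rule fundamental_theorem_of_calculus)
 fix r assume "r : {0..t}"
 thus "((%t. h x t) has_vector_derivative g x r) (wi r t)"
 using th[of r x] t by (auto simp: g_def hrv[symmetric] intro: has_field_derivative_subset)
 qed (use t in simp)
 thus ?thesis by (simp add: integral_unique)
 qed
 have jt: "jc UNIV {0..t} g" "jc UNIV {0..t} g1" using t by (auto intro: jc_subset jg)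
 have "((%x. integral (cbox 0 t) (g x)) hrd integral (cbox 0 t) (g1 x)) (at x within UNIV)"
 proof (rule leibniz_rule_field_derivative)
 show "((%x. g x r) hrd g1 x r) (at x within UNIV)" if "r : cbox 0 t" for x r
 proof -
 have r: "r : {0..s}" using that t by auto
 show ?thesis unfolding g_def g1_def by (rule DERIV_cong[OF DERIV_mult[OF DERIV_minus[OF dU[OF r]] dR[OF r]]]) (simp add: als)
 qed
 show "g x integrable_on cbox 0 t" for x unfolding cbox_interval by (rule icr[OF jc_slice_t[OF jt(1)]]) simp
 show "co (UNIV \<times> cbox 0 t) (%(x, t). g1 x t)" using jt(2) by (simp add: jc_case cbox_interval)
 qed auto
 hence "((%x. h x 0 + in0 t (g x)) hrd sd o1 1 h x 0 + in0 t (g1 x)) (at x)"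
 by (auto intro!: dei dh 0 simp: cbox_interval)
 thus "((%x. h x t) hrd sd o1 1 h x 0 + in0 t (g1 x)) (at x)" by (simp only: e[symmetric])
 qed
 have "((%t. sd o1 1 h x 0 + in0 t (g1 x)) hrd g1 x t) (wi t s)" for x
 using integral_has_real_derivative[OF jc_slice_t[OF jg(2), of x] t] by (auto intro!: dei)
 note d1 = this
 have "((%t. sd o1 1 h x t) hrd g1 x t) (wi t s)" for x
 by (rule has_field_derivative_transform_within[OF d1 zero_less_one t]) (rule rep[symmetric])
 thus "((%t. sd o1 1 h x t) hrd - sd (vm a) 0 w x t * sd o1 2 h x t - sd (vm a) 1 w x t * sd o1 1 h x t) (wi t s)" for x
 by (simp add: g1_def)
qed

text \<open>Gronwall for the squared L2 norms of the differences of \<omega> and \<rho>. The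
  velocity differences do not belong to this energy; Parseval bounds them by the difference of
  \<omega>, since \<open>vm a\<close> is bounded and \<open>K * of_int k * vm a k\<close> is at most
  2 in size.\<close>

lemma cl_unique_endpoint:
 assumes a: "a > 0" and s: "s >= 0" and cl: "cl_on a s w h" "cl_on a s w' h'"
 and init: "!!x. w' x 0 = w x 0" "!!x. h' x 0 = h x 0"
 shows "w' x s = w x s" "sd o1 1 h' x s = sd o1 1 h x s"
proof -
 note F = cl_fields[OF a cl(1)] and F' = cl_fields[OF a cl(2)]
 let ?U = "sd (vm a) 0 w" and ?U1 = "sd (vm a) 1 w" and ?W1 = "sd o1 1 w" and ?R = "sd o1 1 h" and ?R1 = "sd o1 2 h"
 let ?U' = "sd (vm a) 0 w'" and ?U1' = "sd (vm a) 1 w'" and ?W1' = "sd o1 1 w'" and ?R' = "sd o1 1 h'" and ?R1' = "sd o1 2 h'"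
 define p where "p = (%x t. w' x t - w x t)"
 define q where "q = (%x t. ?R' x t - ?R x t)"
 define d where "d = (%x t. ?U' x t - ?U x t)"
 define e where "e = (%x t. ?U1' x t - ?U1 x t)"
 define G where "G = (%x t. - d x t * ?W1 x t + q x t)"
 define H where "H = (%x t. - ?U1' x t * q x t - e x t * ?R x t - d x t * ?R1 x t)"
 have sub: "jc UNIV {0..s} f ==> jc {0..L} {0..s} f" for f by (erule jc_subset) auto
 note J = F(1-6)[THEN sub] F'(1-6)[THEN sub]
 have JD: "jc {0..L} {0..s} p" "jc {0..L} {0..s} q" "jc {0..L} {0..s} d" "jc {0..L} {0..s} e"
 unfolding p_def q_def d_def e_def by (intro jc_diff J)+
 have JG: "jc {0..L} {0..s} G" "jc {0..L} {0..s} H" unfolding G_def H_def by (intro jc_add jc_diff jc_mult jc_minus JD J)+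
 have Lp: "0 <= L" using L_pos by simp
 have sq: "((%y::real. y\<^sup>2) hrd 2 * y) (at y)" for y by (auto intro!: dei)
 have per: "?U' 0 t = ?U' L t" "?R' 0 t = ?R' L t" "?R 0 t = ?R L t" for t
 using sd_periodic[of _ _ _ 0 t] by simp_all
 have perw: "w 0 t = w L t" "w' 0 t = w' L t" if "t : {0..s}" for t
 using F(16)[OF that, of 0] F(16)[OF that, of L] F'(16)[OF that, of 0] F'(16)[OF that, of L] fs_periodic[of _ 0] by (simp_all)
 have E1: "((%t. in0 L (%x. (p x t)\<^sup>2)) hrd in0 L (%x. ?U1' x t * (p x t)^2 + 2 * p x t * G x t)) (wi t s)" if t: "t : {0..s}" for t
 proof (rule transport_integral[where u="?U'" and fx="%x t. ?W1' x t - ?W1 x t", OF Lp])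
 show "((%x. p x t) hrd ?W1' x t - ?W1 x t) (at x)" if "t : {0..s}" for x t
 unfolding p_def by (intro DERIV_diff F(7) F'(7) that)
 show "((%t. p x t) hrd - ?U' x t * (?W1' x t - ?W1 x t) + G x t) (wi t s)" if "t : {0..s}" for x t
 unfolding p_def G_def d_def q_def by (rule DERIV_cong[OF DERIV_diff[OF F'(12)[OF that] F(12)[OF that]]]) (simp add: als)
 show "?U' 0 t * (p 0 t)^2 = ?U' L t * (p L t)^2" using per perw[OF t] by (simp add: p_def)
 qed (use F'(9) sq JD JG J t in "auto intro!: jc_diff cin")
 have E2: "((%t. in0 L (%x. (q x t)\<^sup>2)) hrd in0 L (%x. ?U1' x t * (q x t)^2 + 2 * q x t * H x t)) (wi t s)" if t: "t : {0..s}" for t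
 proof (rule transport_integral[where u="?U'" and fx="%x t. ?R1' x t - ?R1 x t", OF Lp])
 show "((%x. q x t) hrd ?R1' x t - ?R1 x t) (at x)" if "t : {0..s}" for x t
 unfolding q_def by (intro DERIV_diff F(10) F'(10) that)
 show "((%t. q x t) hrd - ?U' x t * (?R1' x t - ?R1 x t) + H x t) (wi t s)" if "t : {0..s}" for x t
 unfolding q_def H_def d_def e_def by (rule DERIV_cong[OF DERIV_diff[OF F'(14)[OF that] F(14)[OF that]]]) (simp add: als)
 show "?U' 0 t * (q 0 t)^2 = ?U' L t * (q L t)^2" using per by (simp add: q_def)
 qed (use F'(9) sq JD JG J t in "auto intro!: jc_diff cin")
 obtain B1 where B1: "B1 >= 0" "!!x t. x : {0..L} ==> t : {0..s} ==> | ?U1' x t| <= B1" by (rule jc_bounded[OF J(10) compact_Icc compact_Icc]) (rule that)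
 obtain B2 where B2: "B2 >= 0" "!!x t. x : {0..L} ==> t : {0..s} ==> | ?W1 x t| <= B2" by (rule jc_bounded[OF J(2) compact_Icc compact_Icc]) (rule that)
 obtain B3 where B3: "B3 >= 0" "!!x t. x : {0..L} ==> t : {0..s} ==> | ?R x t| <= B3" by (rule jc_bounded[OF J(5) compact_Icc compact_Icc]) (rule that)
 obtain B4 where B4: "B4 >= 0" "!!x t. x : {0..L} ==> t : {0..s} ==> | ?R1 x t| <= B4" by (rule jc_bounded[OF J(6) compact_Icc compact_Icc]) (rule that)
 define B where "B = B1 + B2 + B3 + B4"
 have B0: "B >= 0" using B1 B2 B3 B4 by (simp add: B_def)
 obtain Bv where Bv: "!!k. |vm a k| <= Bv" using vm_bounded[OF a] by blast
 have Bv0: "Bv >= 0" using order_trans[OF abs_ge_zero Bv] .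
 \<comment> \<open>\<open>Bv^2\<close> and \<open>2^2\<close> are the Parseval constants for
   \<open>d\<close> and \<open>e\<close>.\<close>
 define A where "A = (3 * B + 1) * (1 + (Bv^2 + 2^2))"
 define E where "E = (%t. in0 L (%x. (p x t)\<^sup>2) + in0 L (%x. (q x t)\<^sup>2))"
 define E' where "E' = (%t. in0 L (%x. ?U1' x t * (p x t)^2 + 2 * p x t * G x t) + in0 L (%x. ?U1' x t * (q x t)^2 + 2 * q x t * H x t))"
 have dE: "(E hrd E' t) (wi t s)" if "t : {0..s}" for t
 unfolding E_def E'_def by (rule DERIV_add[OF E1[OF that] E2[OF that]])
 have le: "E' t <= A * E t" if t: "t : {0..s}" for t
 proof -
 note S = JD[THEN jc_slice, OF t] JG[THEN jc_slice, OF t] J(10)[THEN jc_slice, OF t]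
 note int = icr
 have ip: "(%x. (p x t)\<^sup>2) integrable_on {0..L}" "(%x. (q x t)\<^sup>2) integrable_on {0..L}" "(%x. (d x t)\<^sup>2) integrable_on {0..L}" "(%x. (e x t)\<^sup>2) integrable_on {0..L}"
 by (intro int cin S)+
 have "E' t = in0 L (%x. (?U1' x t * (p x t)^2 + 2 * p x t * G x t) + (?U1' x t * (q x t)^2 + 2 * q x t * H x t))"
 unfolding E'_def by (rule hk_add[symmetric]) (intro int cin S)+
 also have "... <= in0 L (%x. (3 * B + 1) * (((p x t)^2 + (q x t)^2) + ((d x t)^2 + (e x t)^2)))"
 proof (rule integral_le)
 fix x assume x: "x : {0..L}"
 show "(?U1' x t * (p x t)^2 + 2 * p x t * G x t) + (?U1' x t * (q x t)^2 + 2 * q x t * H x t) <= (3 * B + 1) * (((p x t)^2 + (q x t)^2) + ((d x t)^2 + (e x t)^2))"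
 unfolding G_def H_def
 by (rule difference_energy_pointwise) (use B1(2)[OF x t] B2(2)[OF x t] B3(2)[OF x t] B4(2)[OF x t] B1(1) B2(1) B3(1) B4(1) in "auto simp: B_def")
 qed (intro int cin S)+
 also have "... = (3 * B + 1) * (E t + (in0 L (%x. (d x t)\<^sup>2) + in0 L (%x. (e x t)\<^sup>2)))"
 unfolding E_def using ip by (simp add: hk_add integrable_add)
 also have "... <= (3 * B + 1) * (E t + (Bv^2 * E t + 2^2 * E t))"
 proof (intro mlm add_mono order_refl)
 define c where "c = (%k. fcoef (%x. w' x t) k - fcoef (%x. w x t) k)"
 have wc: "wsum 1 c" unfolding c_def by (rule wsum_diff[OF F'(15)[OF t] F(15)[OF t]])
 have w0: "wsum 0 (fcoef (%x. w' x t))" "wsum 0 (fcoef (%x. w x t))" using F'(15)[OF t] F(15)[OF t] wsum_mono by auto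
 have hc: "hermitian c" using hermitian_fcoef by (simp add: c_def hermitian_def)
 have pc: "p x t = fs c x" for x unfolding p_def c_def fs_diff[OF w0]
 by (rule arg_cong2[where f="(-)", OF F'(16)[OF t] F(16)[OF t]])
 have wv: "wsum 1 (%k. of_real (vm a k) * f k)" if "wsum 1 f" for f by (rule wsum_real_mult[OF that Bv])
 have hv: "hermitian (%k. of_real (vm a k) * c k)" by (rule hermitian_vm[OF hc])
 have dc: "d x t = fs (%k. of_real (vm a k) * c k) x" for x
 unfolding d_def sd_def funpow.simps id_apply c_def right_diff_distrib
 by (rule fs_diff[symmetric, OF wsum_mono[OF wv[OF F'(15)[OF t]]] wsum_mono[OF wv[OF F(15)[OF t]]]]) simp_all
 have "((%x. d x t) hrd fs (D (%k. of_real (vm a k) * c k)) x) (at x)" for x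
 unfolding dc by (rule fs_deriv[OF wv[OF wc]])
 moreover have "((%x. d x t) hrd e x t) (at x)" for x unfolding d_def e_def by (rule DERIV_diff[OF F'(9)[OF t] F(9)[OF t]])
 ultimately have ec: "e x t = fs (D (%k. of_real (vm a k) * c k)) x" for x by (rule DERIV_unique[rotated])
 have wc0: "wsum 0 c" "wsum 0 (%k. of_real (vm a k) * c k)" "wsum 0 (D (%k. of_real (vm a k) * c k))"
 using wsum_mono[OF wc] wsum_mono[OF wv[OF wc]] wsum_D[of 0] wv[OF wc] by auto
 have pE: "in0 L (%x. (fs c x)\<^sup>2) <= E t"
 unfolding E_def pc[symmetric] by (simp add: hk_nonneg ip)
 have "in0 L (%x. (d x t)\<^sup>2) <= Bv^2 * in0 L (%x. (fs c x)\<^sup>2)"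
 unfolding dc by (rule parseval_compare[OF wc0(2) hv wc0(1) hc Bv0]) (simp add: norm_mult mrm Bv)
 also have "... <= Bv^2 * E t" by (rule mlm[OF pE]) simp
 finally show "in0 L (%x. (d x t)\<^sup>2) <= Bv^2 * E t" .
 have "in0 L (%x. (e x t)\<^sup>2) <= 2^2 * in0 L (%x. (fs c x)\<^sup>2)"
 unfolding ec
 proof (rule parseval_compare[OF wc0(3) hermitian_D[OF hv] wc0(1) hc])
 fix k
 have "norm (D (%k. of_real (vm a k) * c k) k) = |K * of_int k * vm a k| * norm (c k)" by (simp add: D_def norm_mult abs_mult)
 thus "norm (D (%k. of_real (vm a k) * c k) k) <= 2 * norm (c k)" using alpha_props(4)[OF a, of k] by (simp add: mrm)
 qed simp
 also have "... <= 2^2 * E t" by (rule mlm[OF pE]) simp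
 finally show "in0 L (%x. (e x t)\<^sup>2) <= 2^2 * E t" .
 qed (use B0 in auto)
 also have "... = A * E t" by (simp add: A_def als)
 finally show ?thesis .
 qed
 have "E s <= E 0 * exp (A * s - A * 0)"
 by (rule gronwall_within[OF s dE _ le]) (auto intro!: dei)
 moreover have "E 0 = 0"
 proof -
 have "?R' x 0 = ?R x 0" for x
 proof (rule DERIV_unique)
 have 0: "0 : {0..s}" using s by simp
 show "((%x. h' x 0) hrd ?R' x 0) (at x)" by (rule F'(8)[OF 0])
 show "((%x. h' x 0) hrd ?R x 0) (at x)" unfolding init(2) by (rule F(8)[OF 0])
 qed
 thus ?thesis by (simp add: E_def p_def q_def init(1))
 qed
 ultimately have Es: "E s <= 0" by simp
 have ss: "s : {0..s}" using s by simp
 have c: "co {0..L} (%x. (p x s)\<^sup>2)" "co {0..L} (%x. (q x s)\<^sup>2)" by (intro cin jc_slice[OF JD(1) ss] jc_slice[OF JD(2) ss])+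
 have nn: "0 <= in0 L (%x. (p x s)\<^sup>2)" "0 <= in0 L (%x. (q x s)\<^sup>2)"
 by (intro hk_nonneg icr c; simp)+
 have z: "in0 L (%x. (p x s)\<^sup>2) = 0" "in0 L (%x. (q x s)\<^sup>2) = 0" using nn Es unfolding E_def by linarith+
 have pq: "p y s = 0" "q y s = 0" if "y : {0..L}" for y
 using integral_eq_0_iff[OF c(1) L_pos] integral_eq_0_iff[OF c(2) L_pos] z that by auto
 obtain n :: int where n: "x + of_int n * L : {0..L}"
 proof
 show "x + of_int (- \<lfloor>x / L\<rfloor>) * L : {0..L}"
 using pos_le_divide_eq[OF L_pos, of "of_int \<lfloor>x / L\<rfloor>" x] pos_divide_less_eq[OF L_pos, of x "of_int \<lfloor>x / L\<rfloor> + 1"] floor_correct[of "x / L"]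
 by (simp add: als)
 qed
 have perZ: "f (x + of_int n * L) = f x" if p: "!!x. f (x + L) = f x" for f :: "real => real" and n
 proof (induction n rule: int_induct[of _ 0])
 case (step1 i)
 thus ?case using p[of "x + of_int i * L"] by (simp add: als)
 next
 case (step2 i)
 thus ?case using p[of "x + of_int (i - 1) * L"] by (simp add: als)
 qed simp
 have "w (x + L) s = w x s" "w' (x + L) s = w' x s" for x
 by (rule trans[OF F(16)[OF ss] trans[OF fs_periodic F(16)[OF ss, symmetric]]], rule trans[OF F'(16)[OF ss] trans[OF fs_periodic F'(16)[OF ss, symmetric]]])
 note pw = this
 have "p (x + of_int n * L) s = p x s" unfolding p_def by (rule perZ[where f="%x. w' x s - w x s", OF arg_cong2[where f="(-)", OF pw(2,1)]])
 thus "w' x s = w x s" using pq(1)[OF n] by (simp add: p_def)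
 have "q (x + of_int n * L) s = q x s" unfolding q_def by (rule perZ[where f="%x. ?R' x s - ?R x s"]) (simp add: sd_periodic)
 thus "?R' x s = ?R x s" using pq(2)[OF n] by (simp add: q_def)
qed

text \<open>The endpoint result is applied on every shorter interval. Equal \<omega> and equal
  \<theta>_x give equal time derivatives of \<theta>, and equal data then give equal
  \<theta>.\<close>

theorem cl_unique:
 assumes a: "a > 0" and s: "s >= 0" and cl: "cl_on a s w h" "cl_on a s w' h'"
 and init: "!!x. w' x 0 = w x 0" "!!x. h' x 0 = h x 0"
 shows "w' x s = w x s" "h' x s = h x s"
proof -
 have e: "w' x t = w x t" "sd o1 1 h' x t = sd o1 1 h x t" if "t : {0..s}" for x t
 using cl_unique_endpoint[of a t w h w' h', OF a _ cl_on_subset[OF cl(1)] cl_on_subset[OF cl(2)]] init that by auto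
 thus "w' x s = w x s" using s by simp
 have u: "sd (vm a) 0 w' x t = sd (vm a) 0 w x t" if "t : {0..s}" for x t unfolding sd_def by (simp only: e(1)[OF that])
 have "((%t. h' x t - h x t) hrd 0) (wi t s)" if t: "t : {0..s}" for t
 by (rule DERIV_cong[OF DERIV_diff[OF cl_fields(13)[OF a cl(2) t] cl_fields(13)[OF a cl(1) t]]]) (unfold e(2)[OF t] u[OF t], simp)
 from has_field_derivative_zero_constant[OF convex_real_interval(5) this] obtain c where "!!t. t : {0..s} ==> h' x t - h x t = c" by blast
 from this[of 0] this[of s] show "h' x s = h x s" using s init(2) by simp
qed

end

section \<open>Energy estimates and continuation\<close>

lemma max_square_deriv: "((%y::real. (max y 0)\<^sup>2) hrd 2 * max y 0) (at y)"
proof -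
 consider "y > 0" | "y < 0" | "y = 0" by linarith
 thus ?thesis
 proof cases
 case 1
 have "((%y::real. y\<^sup>2) hrd 2 * max y 0) (at y)" using 1 by (auto intro!: dei)
 thus ?thesis by (rule has_field_derivative_transform_within_open[of _ _ _ "{0<..}"]) (use 1 in auto)
 next
 case 2
 have "((%y::real. 0) hrd 2 * max y 0) (at y)" using 2 by (auto intro!: dei)
 thus ?thesis by (rule has_field_derivative_transform_within_open[of _ _ _ "{..<0}"]) (use 2 in auto)
 next
 case 3
 have "((%h::real. ((max (0 + h) 0)^2 - (max 0 0)\<^sup>2) / h) \<longlongrightarrow> 0) (at 0)"
 proof (rule Lim_null_comparison)
 show "\<forall>\<^sub>F h::real in at 0. norm (((max (0 + h) 0)^2 - (max 0 0)\<^sup>2) / h) <= |h|"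
 by (rule always_eventually) (auto simp: max_def p2q)
 show "((%h::real. |h| ) \<longlongrightarrow> 0) (at 0)" by (rule tendsto_rabs_zero) (rule tendsto_ident_at)
 qed
 thus ?thesis using 3 by (simp add: DERIV_def)
 qed
qed

text \<open>Stampacchia's truncation: the integral of the squared positive part of \<open>f\<close>
  obeys a Gronwall inequality and starts at 0. Signs are propagated in this way without following
  characteristics.\<close>

lemma transport_nonpositive:
 fixes f fx u ux G :: "real => real => real"
 assumes ab: "al < be" and s: "s >= 0"
 and dx: "!!x t. x : {al..be} ==> t : {0..s} ==> ((%x. f x t) hrd fx x t) (at x)"
 and du: "!!x t. x : {al..be} ==> t : {0..s} ==> ((%x. u x t) hrd ux x t) (at x)"
 and dt: "!!x t. x : {al..be} ==> t : {0..s} ==> ((%t. f x t) hrd - u x t * fx x t + G x t) (wi t s)"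
 and c: "jc {al..be} {0..s} f" "jc {al..be} {0..s} fx" "jc {al..be} {0..s} u" "jc {al..be} {0..s} ux" "jc {al..be} {0..s} G"
 and bd: "!!t. t : {0..s} ==> u al t * (max (f al t) 0)^2 = u be t * (max (f be t) 0)^2"
 and G: "!!x t. x : {al..be} ==> t : {0..s} ==> f x t > 0 ==> G x t <= M * f x t"
 and init: "!!x. x : {al..be} ==> f x 0 <= 0" and x: "x : {al..be}"
 shows "f x s <= 0"
proof -
 obtain B where B: "B >= 0" "!!x t. x : {al..be} ==> t : {0..s} ==> |ux x t| <= B" by (rule jc_bounded[OF c(4) compact_Icc compact_Icc]) (rule that)
 define E where "E = (%t. integral {al..be} (%x. (max (f x t) 0)\<^sup>2))"
 define E' where "E' = (%t. integral {al..be} (%x. ux x t * (max (f x t) 0)^2 + (2 * max (f x t) 0) * G x t))"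
 have cm: "co UNIV (%y::real. 2 * max y 0)" by (intro cin)
 have dE: "(E hrd E' t) (wi t s)" if t: "t : {0..s}" for t
 unfolding E_def E'_def
 by (rule transport_integral[where ph="%y. (max y 0)\<^sup>2" and ph'="%y. 2 * max y 0", OF less_imp_le[OF ab] dx du dt c max_square_deriv cm bd[OF t] t])
 have le: "E' t <= (B + 2 * M) * E t" if t: "t : {0..s}" for t
 proof -
 note S = c[THEN jc_slice, OF t]
 have "E' t <= integral {al..be} (%x. (B + 2 * M) * (max (f x t) 0)^2)"
 unfolding E'_def
 proof (rule integral_le)
 fix x assume x: "x : {al..be}"
 have "ux x t * (max (f x t) 0)^2 <= B * (max (f x t) 0)^2" using B(2)[OF x t] by (intro mrm) auto
 moreover have "(2 * max (f x t) 0) * G x t <= (2 * M) * (max (f x t) 0)^2"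
 proof (cases "f x t > 0")
 case True
 hence "(2 * f x t) * G x t <= (2 * f x t) * (M * f x t)" by (intro mlm G x t) auto
 thus ?thesis using True by (simp add: p2q mult_ac)
 qed simp
 ultimately show "ux x t * (max (f x t) 0)^2 + (2 * max (f x t) 0) * G x t <= (B + 2 * M) * (max (f x t) 0)^2"
 by (simp add: distrib_right)
 qed (intro icr cin S)+
 thus ?thesis by (simp add: E_def)
 qed
 have "E s <= E 0 * exp ((B + 2 * M) * s - (B + 2 * M) * 0)"
 by (rule gronwall_within[OF s dE _ le]) (auto intro!: dei)
 moreover have "E 0 = integral {al..be} (%x. 0)"
 unfolding E_def by (rule integral_cong) (use init in "auto simp: max_def not_le")
 ultimately have le0: "E s <= 0" by simp
 have ss: "s : {0..s}" using s by simp
 have cs: "co {al..be} (%x. (max (f x s) 0)\<^sup>2)" by (intro cin jc_slice[OF c(1) ss])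
 have "0 <= E s" unfolding E_def by (rule hk_nonneg[OF icr[OF cs]]) simp
 hence "integral {al..be} (%x. (max (f x s) 0)\<^sup>2) = 0" using le0 by (simp add: E_def)
 hence "(max (f x s) 0)^2 = 0" using integral_eq_0_iff[OF cs ab] x by auto
 thus ?thesis by (simp add: max_def split: if_splits)
qed

text \<open>Expand the integral of (f - m)^2, where m is the mean of f.\<close>

lemma integral_cauchy_schwarz:
 fixes f :: "real => real"
 assumes ab: "a < b" and f: "co {a..b} f"
 shows "(integral {a..b} f)^2 <= (b - a) * integral {a..b} (%x. (f x)\<^sup>2)"
proof -
 define m where "m = integral {a..b} f / (b - a)"
 have I: "integral {a..b} f = m * (b - a)" using ab by (simp add: m_def)
 have i: "f integrable_on {a..b}" "(%x. (f x)\<^sup>2) integrable_on {a..b}" by (intro icr cin f)+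
 have "0 <= integral {a..b} (%x. (f x - m)\<^sup>2)" by (intro hk_nonneg icr cin f) simp
 also have "integral {a..b} (%x. (f x - m)\<^sup>2) = integral {a..b} (%x. ((f x)^2 - (2 * m) * f x) + m^2)"
 by (simp add: power2_diff als)
 also have "... = integral {a..b} (%x. (f x)\<^sup>2) - 2 * m * integral {a..b} f + m^2 * (b - a)"
 using integral_unique[OF has_integral_add[OF has_integral_diff[OF integrable_integral[OF i(2)] has_integral_mult_right[OF integrable_integral[OF i(1)], of "2 * m"]] has_integral_const_real[of "m^2" a b]]] ab
 by (simp add: mult.commute)
 finally have "m^2 * (b - a) <= integral {a..b} (%x. (f x)\<^sup>2)" unfolding I by (simp add: p2q als)
 hence "(b - a) * (m^2 * (b - a)) <= (b - a) * integral {a..b} (%x. (f x)\<^sup>2)" using ab by (intro mlm) auto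
 thus ?thesis unfolding I by (simp add: p2q mult_ac)
qed

section \<open>Sup norms and differentiated equations\<close>

context circle begin

definition supn :: "(real => real => real) => real => real" where
 "supn f t = (SUP x\<in>{0..L}. |f x t| )"

lemma supn_upper:
 assumes "co {0..L} (%x. f x t)" "x : {0..L}"
 shows "|f x t| <= supn f t"
 unfolding supn_def
proof (rule cSUP_upper[OF assms(2)])
 have "compact ((%x. |f x t| ) ` {0..L})" by (intro compact_continuous_image cin assms(1)) simp
 thus "bdd_above ((%x. |f x t| ) ` {0..L})" by (intro bounded_imp_bdd_above compact_imp_bounded)
qed

lemma supn_jc: "jc {0..L} I f ==> t : I ==> x : {0..L} ==> |f x t| <= supn f t"
 by (rule supn_upper, rule jc_slice[where f=f and t=t and I=I], assumption+)

lemma supn_least: "(!!x. x : {0..L} ==> |f x t| <= M) ==> supn f t <= M"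
 unfolding supn_def by (rule cSUP_least) (use L_pos in auto)

lemma supn_continuous:
 assumes j: "jc {0..L} {0..s} f"
 shows "co {0..s} (supn f)"
 unfolding continuous_on_iff
proof (intro ballI allI impI)
 fix t e :: real assume t: "t : {0..s}" and e: "e > 0"
 have "uniformly_continuous_on ({0..L} \<times> {0..s}) (%p. f (fst p) (snd p))"
 using j unfolding jc_def by (intro compact_uniformly_continuous compact_Times) auto
 then obtain d where d: "d > 0" "!!p q. p : {0..L} \<times> {0..s} ==> q : {0..L} \<times> {0..s} ==> dist p q < d ==> dist (f (fst p) (snd p)) (f (fst q) (snd q)) < e / 2"
 unfolding uniformly_continuous_on_def using half_gt_zero[OF e] by blast
 have half: "supn f r <= supn f r' + e / 2" if "r : {0..s}" "r' : {0..s}" "dist r r' < d" for r r'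
 proof (rule supn_least)
 fix x assume x: "x : {0..L}"
 have "dist (f x r) (f x r') < e / 2" using d(2)[of "(x, r)" "(x, r')"] x that by (simp add: dist_Pair_Pair)
 moreover have "|f x r' | <= supn f r'" by (rule supn_jc[OF j that(2) x])
 ultimately show "|f x r| <= supn f r' + e / 2" unfolding dist_real_def by linarith
 qed
 have "dist (supn f r) (supn f t) < e" if "r : {0..s}" "dist r t < d" for r
 using half[OF that(1) t that(2)] half[OF t that(1)] that(2) e by (simp add: dist_real_def abs_minus_commute)
 thus "\<exists>d>0. \<forall>x'\<in>{0..s}. dist x' t < d --> dist (supn f x') (supn f t) < e" using d(1) by blast
qed

lemma sr_jc:
 assumes sol: "csol a s b p"
 shows "jc UNIV {0..s} (sr b n)" "jc UNIV {0..s} (sr p n)"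
 unfolding jc_case
 by (rule sr_continuous[OF csol_rapid(1)[OF sol] csol_continuous(1)[OF sol]], rule sr_continuous[OF csol_rapid(2)[OF sol] csol_continuous(2)[OF sol]])

lemma us_jc:
 assumes a: "a > 0" and sol: "csol a s b p"
 shows "jc UNIV {0..s} (us a b n)"
 unfolding jc_case by (rule us_continuous[OF a csol_rapid(1)[OF sol] csol_continuous(1)[OF sol]])

text \<open>The time derivatives of the higher fields are again series; differentiating the equation
  of the previous order in x and comparing derivatives gives their explicit form.\<close>

lemma csol_fields:
 assumes a: "a > 0" and sol: "csol a s b p" and t: "t : {0..s}"
 shows "!!n x. ((%x. sr b n x t) hrd sr b (Suc n) x t) (at x)"
 "!!n x. ((%x. sr p n x t) hrd sr p (Suc n) x t) (at x)"
 "!!n x. ((%x. us a b n x t) hrd us a b (Suc n) x t) (at x)"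
 "!!x. ((%t. sr b 0 x t) hrd - us a b 0 x t * sr b 1 x t + sr p 0 x t) (wi t s)"
 "!!x. ((%t. sr p 0 x t) hrd - us a b 0 x t * sr p 1 x t + - us a b 1 x t * sr p 0 x t) (wi t s)"
 "!!x. ((%t. sr b 1 x t) hrd - us a b 0 x t * sr b 2 x t + (- us a b 1 x t * sr b 1 x t + sr p 1 x t)) (wi t s)"
 "!!x. ((%t. sr p 1 x t) hrd - us a b 0 x t * sr p 2 x t + (- 2 * us a b 1 x t * sr p 1 x t - us a b 2 x t * sr p 0 x t)) (wi t s)"
 "!!x. ((%t. sr b 2 x t) hrd - us a b 0 x t * sr b 3 x t + (- 2 * us a b 1 x t * sr b 2 x t - us a b 2 x t * sr b 1 x t + sr p 2 x t)) (wi t s)"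
 "!!x. ((%t. sr p 2 x t) hrd - us a b 0 x t * sr p 3 x t + (- 3 * us a b 1 x t * sr p 2 x t - 3 * us a b 2 x t * sr p 1 x t - us a b 3 x t * sr p 0 x t)) (wi t s)"
proof -
 note r = csol_rapid[OF sol]
 note rr = rapid_on_rhs[OF alpha_props(2)[OF a] r]
 show D: "((%x. sr b n x t) hrd sr b (Suc n) x t) (at x)"
 "((%x. sr p n x t) hrd sr p (Suc n) x t) (at x)"
 "((%x. us a b n x t) hrd us a b (Suc n) x t) (at x)" for n x
 by (rule sr_deriv[OF r(1) t], rule sr_deriv[OF r(2) t], rule us_deriv[OF a r(1) t])
 have s2: "Suc 1 = 2" "Suc 2 = 3" "Suc 0 = 1" by simp_all
 have D': "((%x. sr b 1 x t) hrd sr b 2 x t) (at x)" "((%x. sr p 1 x t) hrd sr p 2 x t) (at x)"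
 "((%x. sr b 2 x t) hrd sr b 3 x t) (at x)" "((%x. sr p 2 x t) hrd sr p 3 x t) (at x)"
 "((%x. us a b 1 x t) hrd us a b 2 x t) (at x)" "((%x. us a b 2 x t) hrd us a b 3 x t) (at x)"
 "((%x. us a b 0 x t) hrd us a b 1 x t) (at x)" "((%x. sr p 0 x t) hrd sr p 1 x t) (at x)" for x
 by (rule D(1)[of 1, unfolded s2], rule D(2)[of 1, unfolded s2], rule D(1)[of 2, unfolded s2], rule D(2)[of 2, unfolded s2],
 rule D(3)[of 1, unfolded s2], rule D(3)[of 2, unfolded s2], rule D(3)[of 0, unfolded s2], rule D(2)[of 0, unfolded s2])
 note Ds = D'[unfolded One_nat_def]
 define X where "X = sr (%k t. rhs_b (alpha a) (%j. b j t) (%j. p j t) k)"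
 define Y where "Y = sr (%k t. rhs_p (alpha a) (%j. b j t) (%j. p j t) k)"
 have DX: "((%x. X n x t) hrd X (Suc n) x t) (at x)" and DY: "((%x. Y n x t) hrd Y (Suc n) x t) (at x)" for n x
 unfolding X_def Y_def by (rule sr_deriv[OF rr(1) t], rule sr_deriv[OF rr(2) t])
 have X0: "X 0 x t = - us a b 0 x t * sr b 1 x t + sr p 0 x t" for x using csol_pde(4)[OF a sol t, of x] by (simp add: X_def)
 have Y0: "Y 0 x t = - us a b 0 x t * sr p 1 x t + - us a b 1 x t * sr p 0 x t" for x using csol_pde(5)[OF a sol t, of x] by (simp add: Y_def)
 have X1: "X (Suc 0) x t = - us a b 0 x t * sr b 2 x t + (- us a b 1 x t * sr b 1 x t + sr p 1 x t)" for x
 by (rule DERIV_unique[OF DX[of 0, unfolded X0]]) (auto intro!: dei Ds simp: als)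
 have Y1: "Y (Suc 0) x t = - us a b 0 x t * sr p 2 x t + (- 2 * us a b 1 x t * sr p 1 x t - us a b 2 x t * sr p 0 x t)" for x
 by (rule DERIV_unique[OF DY[of 0, unfolded Y0]]) (auto intro!: dei Ds simp: als)
 have X2: "X (Suc (Suc 0)) x t = - us a b 0 x t * sr b 3 x t + (- 2 * us a b 1 x t * sr b 2 x t - us a b 2 x t * sr b 1 x t + sr p 2 x t)" for x
 by (rule DERIV_unique[OF DX[of "Suc 0", unfolded X1]]) (auto intro!: dei Ds simp: als)
 have Y2: "Y (Suc (Suc 0)) x t = - us a b 0 x t * sr p 3 x t + (- 3 * us a b 1 x t * sr p 2 x t - 3 * us a b 2 x t * sr p 1 x t - us a b 3 x t * sr p 0 x t)" for x
 by (rule DERIV_unique[OF DY[of "Suc 0", unfolded Y1]]) (auto intro!: dei Ds simp: als)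
 note TX = csol_pde(2)[OF a sol t, folded X_def] and TY = csol_pde(3)[OF a sol t, folded Y_def]
 fix x
 show "((%t. sr b 0 x t) hrd - us a b 0 x t * sr b 1 x t + sr p 0 x t) (wi t s)"
 "((%t. sr p 0 x t) hrd - us a b 0 x t * sr p 1 x t + - us a b 1 x t * sr p 0 x t) (wi t s)"
 using TX[of 0 x] TY[of 0 x] by (simp_all only: X0 Y0)
 show "((%t. sr b 1 x t) hrd - us a b 0 x t * sr b 2 x t + (- us a b 1 x t * sr b 1 x t + sr p 1 x t)) (wi t s)"
 "((%t. sr p 1 x t) hrd - us a b 0 x t * sr p 2 x t + (- 2 * us a b 1 x t * sr p 1 x t - us a b 2 x t * sr p 0 x t)) (wi t s)"
 using TX[of "Suc 0" x] TY[of "Suc 0" x] by (simp_all only: X1 Y1 One_nat_def)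
 show "((%t. sr b 2 x t) hrd - us a b 0 x t * sr b 3 x t + (- 2 * us a b 1 x t * sr b 2 x t - us a b 2 x t * sr b 1 x t + sr p 2 x t)) (wi t s)"
 "((%t. sr p 2 x t) hrd - us a b 0 x t * sr p 3 x t + (- 3 * us a b 1 x t * sr p 2 x t - 3 * us a b 2 x t * sr p 1 x t - us a b 3 x t * sr p 0 x t)) (wi t s)"
 using TX[of "Suc (Suc 0)" x] TY[of "Suc (Suc 0)" x] by (simp_all only: X2 Y2 numeral_2_eq_2)
qed

lemma periodic_ends: "sr b n 0 t = sr b n L t" "us a b n 0 t = us a b n L t"
 using sr_periodic(1)[of b n 0 t] sr_periodic(2)[of a b n 0 t] by simp_all

text \<open>By Rolle a periodic function has a critical point; its derivative can be integrated from
  there, and Cauchy-Schwarz does the rest.\<close>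

lemma sup_by_derivative:
 assumes r: "rapid_on S b" "t : S" and x: "x : {0..L}"
 shows "(sr b (Suc n) x t)^2 <= L * in0 L (%x. (sr b (Suc (Suc n)) x t)\<^sup>2)"
proof -
 let ?g = "%x. sr b (Suc (Suc n)) x t"
 have d: "((%x. sr b n x t) hrd sr b (Suc n) x t) (at x)" for n x by (rule sr_deriv[OF r])
 have c: "co S' (%x. sr b n x t)" for S' n by (rule DERIV_continuous_on[OF d[THEN has_field_derivative_at_within]])
 have "\<exists>z>0. z < L & ((%x. sr b n x t) hrd 0) (at z)"
 by (rule Rolle[OF L_pos periodic_ends(1) c]) (use d in "auto simp: real_differentiable_def")
 then obtain z where z: "0 < z" "z < L" "sr b (Suc n) z t = 0" using DERIV_unique[OF d] by blast
 have ic: "(%x. | ?g x| ) integrable_on {0..L}" by (intro icr cin c)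
 have part: "|sr b (Suc n) v t - sr b (Suc n) u t| <= in0 L (%x. | ?g x| )" if "u <= v" "0 <= u" "v <= L" for u v
 proof -
 have "(?g has_integral sr b (Suc n) v t - sr b (Suc n) u t) {u..v}"
 by (rule fundamental_theorem_of_calculus[OF that(1)])
 (use d in "auto simp: hrv[symmetric] has_field_derivative_at_within")
 hence "|sr b (Suc n) v t - sr b (Suc n) u t| = norm (integral {u..v} ?g)" by (simp add: integral_unique)
 also have "... <= integral {u..v} (%x. | ?g x| )" by (rule integral_norm_bound_integral) (auto intro!: icr cin c)
 also have "... <= in0 L (%x. | ?g x| )" by (rule integral_subset_le) (use that ic in "auto intro!: icr cin c")
 finally show ?thesis .
 qed
 have "|sr b (Suc n) x t| <= in0 L (%x. | ?g x| )"
 using part[of x z] part[of z x] z x by (cases "x <= z") auto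
 from power_mono[OF this, of 2] have "(sr b (Suc n) x t)^2 <= (in0 L (%x. | ?g x| ))^2" by simp
 also have "... <= (L - 0) * in0 L (%x. | ?g x| \<^sup>2)" by (rule integral_cauchy_schwarz[OF L_pos]) (intro cin c)
 finally show ?thesis by simp
qed

text \<open>The multiplier \<open>K * of_int k * vm a k\<close> is at most 2 in size, so the
  velocity gains one full derivative over \<omega>.\<close>

lemma us_L2:
 assumes a: "a > 0" and sol: "csol a s b p" and t: "t : {0..s}"
 shows "in0 L (%x. (us a b (Suc n) x t)\<^sup>2) <= 4 * in0 L (%x. (sr b n x t)\<^sup>2)"
proof -
 have aw: "allw (%k. cc (b k t))" by (rule rapid_allw[OF csol_rapid(1)[OF sol] t])
 have h: "hermitian (%k. cc (b k t))" by (rule hermitian_cc[where b="%k. b k t", OF csol_odd(1)[OF sol t]])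
 have "in0 L (%x. (us a b (Suc n) x t)\<^sup>2) <= 2^2 * in0 L (%x. (sr b n x t)\<^sup>2)"
 unfolding us_def sr_def
 proof (rule parseval_compare)
 show "wsum 0 ((D ^^ Suc n) (%k. of_real (vm a k) * cc (b k t)))" "wsum 0 ((D ^^ n) (%k. cc (b k t)))"
 using allw_D[OF allw_vm[OF a aw]] allw_D[OF aw] by (auto simp: allw_def simp del: funpow.simps)
 show "hermitian ((D ^^ Suc n) (%k. of_real (vm a k) * cc (b k t)))" "hermitian ((D ^^ n) (%k. cc (b k t)))"
 by (intro hermitian_Dn hermitian_vm h)+
 fix k
 have "norm ((D ^^ Suc n) (%k. of_real (vm a k) * cc (b k t)) k) = |K * of_int k * vm a k| * norm ((D ^^ n) (%k. cc (b k t)) k)"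
 unfolding Dn_eq by (simp add: norm_mult norm_power abs_mult)
 thus "norm ((D ^^ Suc n) (%k. of_real (vm a k) * cc (b k t)) k) <= 2 * norm ((D ^^ n) (%k. cc (b k t)) k)"
 using alpha_props(4)[OF a, of k] by (simp add: mrm)
 qed simp
 thus ?thesis by simp
qed

end

section \<open>Energy estimates of first and second order\<close>

lemma young_quotient:
 fixes x z N :: real
 assumes "N > 0"
 shows "2 * (x * z) <= N * x^2 + z^2 / N"
proof -
 have "0 <= (N * x - z)^2 / N" using assms by simp
 also have "... = N * x^2 - 2 * (x * z) + z^2 / N" using assms by (simp add: p2q fsi)
 finally show ?thesis by simp
qed

text \<open>\<open>u\<close>, \<open>v\<close> are the first and second space derivative of the
  velocity, \<open>w\<close>, \<open>r\<close> are \<omega>_x and \<rho>_x, and \<open>ro0\<close>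
  is \<rho>. The square of \<open>v\<close> stays separate, to be absorbed through
  \<open>us_L2\<close>.\<close>

lemma first_order_pointwise:
 fixes u w r v ro0 mm ro :: real
 assumes "|u| <= mm" "|ro0| <= ro"
 shows "(u * w^2 + 2 * w * (- u * w + r)) + (u * r^2 + 2 * r * (- 2 * u * r - v * ro0)) <= (3 * mm + 1 + ro) * (w^2 + r^2) + ro * v^2"
proof -
 have mm: "mm >= 0" "ro >= 0" using assms by linarith+
 have 1: "- u * w^2 <= mm * w^2" "- u * r^2 <= mm * r^2" using assms(1) by (intro mrm; simp)+
 have 2: "2 * (w * r * 1) <= 1 * (w^2 + r^2)" "2 * (r * v * - ro0) <= ro * (r^2 + v^2)" by (intro young_product; use assms in simp)+
 have 3: "0 <= mm * w^2" "0 <= ro * w^2" using mm by simp_all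
 have "(u * w^2 + 2 * w * (- u * w + r)) + (u * r^2 + 2 * r * (- 2 * u * r - v * ro0)) = - u * w^2 + 3 * (- u * r^2) + 2 * (w * r * 1) + 2 * (r * v * - ro0)"
 by (simp add: p2q als)
 also have "... <= (mm * w^2 + 2 * (mm * w^2) + ro * w^2) + 3 * (mm * r^2) + 1 * (w^2 + r^2) + ro * (r^2 + v^2)" using 1 2 3 by linarith
 also have "... = (3 * mm + 1 + ro) * (w^2 + r^2) + ro * v^2" by (simp add: als)
 finally show ?thesis .
qed

text \<open>The dangerous terms pair a second order factor with \<open>u2 * w1\<close> or
  \<open>u2 * r1\<close>. Young's inequality with a free parameter \<open>N\<close> splits them into
  N times an energy density and a multiple of \<open>S / N * u2^2\<close>; the choice of
  \<open>N\<close> in \<open>csol_energy_bound\<close> keeps the result linear in the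
  energy.\<close>

lemma second_order_pointwise:
 fixes u w1 w2 r0 r1 r2 u2 u3 mm ro N S :: real
 assumes "|u| <= mm" "|r0| <= ro" and N: "N > 0" and S: "w1^2 <= S" "r1^2 <= S"
 shows "(u * w2^2 + 2 * w2 * (- 2 * u * w2 - u2 * w1 + r2)) + (u * r2^2 + 2 * r2 * (- 3 * u * r2 - 3 * u2 * r1 - u3 * r0))
 <= (5 * mm + 1 + 3 * N + ro) * (w2^2 + r2^2) + (4 * S / N) * u2^2 + ro * u3^2"
proof -
 have mm: "mm >= 0" "ro >= 0" using assms by linarith+
 have 1: "- u * w2^2 <= mm * w2^2" "- u * r2^2 <= mm * r2^2" using assms(1) by (intro mrm; simp)+
 have 2: "2 * (w2 * r2 * 1) <= 1 * (w2^2 + r2^2)" "2 * (r2 * u3 * - r0) <= ro * (r2^2 + u3^2)" by (intro young_product; use assms in simp)+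
 have q: "(- (u2 * v))^2 / N <= S / N * u2^2" if "v^2 <= S" for v
 using mlm[OF that, of "u2^2 / N"] N by (simp add: pmd mult_ac)
 have 3: "2 * (w2 * - (u2 * w1)) <= N * w2^2 + S / N * u2^2" "2 * (r2 * - (u2 * r1)) <= N * r2^2 + S / N * u2^2"
 using young_quotient[OF N, of w2 "- (u2 * w1)"] young_quotient[OF N, of r2 "- (u2 * r1)"] q[OF S(1)] q[OF S(2)] by linarith+
 have 4: "0 <= mm * w2^2" "0 <= N * w2^2" "0 <= ro * w2^2" using mm N by simp_all
 have "(u * w2^2 + 2 * w2 * (- 2 * u * w2 - u2 * w1 + r2)) + (u * r2^2 + 2 * r2 * (- 3 * u * r2 - 3 * u2 * r1 - u3 * r0))
 = 3 * (- u * w2^2) + 5 * (- u * r2^2) + 2 * (w2 * r2 * 1) + 2 * (w2 * - (u2 * w1)) + 3 * (2 * (r2 * - (u2 * r1))) + 2 * (r2 * u3 * - r0)"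
 by (simp add: p2q als)
 also have "... <= 5 * (mm * w2^2) + 5 * (mm * r2^2) + 1 * (w2^2 + r2^2) + (3 * (N * w2^2) + S / N * u2^2) + 3 * (N * r2^2 + S / N * u2^2) + (ro * w2^2 + ro * (r2^2 + u3^2))"
 proof (rule add_mono[OF add_mono[OF add_mono[OF add_mono[OF add_mono]]]])
 show "3 * (- u * w2^2) <= 5 * (mm * w2^2)" using 1(1) 4(1) by linarith
 show "5 * (- u * r2^2) <= 5 * (mm * r2^2)" using 1(2) by linarith
 show "2 * (w2 * r2 * 1) <= 1 * (w2^2 + r2^2)" by (rule 2(1))
 show "2 * (w2 * - (u2 * w1)) <= 3 * (N * w2^2) + S / N * u2^2" using 3(1) 4(2) by linarith
 show "3 * (2 * (r2 * - (u2 * r1))) <= 3 * (N * r2^2 + S / N * u2^2)" by (rule mlm[OF 3(2)]) simp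
 show "2 * (r2 * u3 * - r0) <= ro * w2^2 + ro * (r2^2 + u3^2)" using 2(2) 4(3) by linarith
 qed
 also have "... = (5 * mm + 1 + 3 * N + ro) * (w2^2 + r2^2) + (4 * S / N) * u2^2 + ro * u3^2" by (simp add: als)
 finally show ?thesis .
qed

context circle begin

abbreviation Vint :: "real => (int => real => real) => real => real" where
 "Vint a b t \<equiv> in0 t (supn (us a b 1))"

lemma jcL: "jc UNIV {0..s} f ==> jc {0..L} {0..s} f"
 by (erule jc_subset) auto

lemma Vint_deriv:
 assumes a: "a > 0" and sol: "csol a s b p" and t: "t : {0..s}"
 shows "(Vint a b hrd supn (us a b 1) t) (wi t s)"
 by (rule integral_has_real_derivative[OF supn_continuous[OF jcL[OF us_jc[OF a sol]]] t])

lemma supn_nonneg: "jc UNIV {0..s} f ==> t : {0..s} ==> 0 <= supn f t"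
 using supn_jc[OF jcL, of s f t 0] L_pos by fastforce

lemma us_sup:
 assumes "a > 0" "csol a s b p" "t : {0..s}" "x : {0..L}"
 shows "|us a b 1 x t| <= supn (us a b 1) t"
 by (rule supn_jc[OF jcL[OF us_jc[OF assms(1,2)]] assms(3,4)])

text \<open>\<rho> is transported with source - u_x \<rho>, so it grows at most like
  \<open>exp (Vint a b s)\<close>. \<open>transport_nonpositive\<close> is applied to both signs of
  \<rho>, damped by \<open>exp (- Vint a b t)\<close> and lowered by the initial maximum.\<close>

lemma csol_rho_bound:
 assumes a: "a > 0" and sol: "csol a s b p" and x: "x : {0..L}"
 shows "|sr p 0 x s| <= supn (sr p 0) 0 * exp (Vint a b s)"
proof -
 let ?U = "us a b 0" and ?U1 = "us a b 1" and ?R = "sr p 0" and ?R1 = "sr p 1"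
 let ?V = "Vint a b" and ?r = "supn (sr p 0) 0"
 have s: "s > 0" using sol by (simp add: csol_def)
 have sg: "sg * ?R x s * exp (- ?V s) - ?r <= 0" if sg: "sg = 1 \<or> sg = - 1" for sg :: real
 proof (rule transport_nonpositive[where f="%x t. sg * ?R x t * exp (- ?V t) - ?r" and fx="%x t. sg * ?R1 x t * exp (- ?V t)"
 and u="?U" and ux="?U1" and G="%x t. (- ?U1 x t - supn ?U1 t) * (sg * ?R x t * exp (- ?V t))" and M=0, OF L_pos less_imp_le[OF s]])
 have cV: "co {0..s} ?V" by (rule DERIV_continuous_on[OF Vint_deriv[OF a sol]])
 have cE: "co {0..s} (%t. exp (- ?V t))" by (intro cin cV)
 note J = jcL[OF sr_jc(2)[OF sol]] jcL[OF us_jc[OF a sol]] jc_time[OF cE] jc_time[OF supn_continuous[OF jcL[OF us_jc[OF a sol]]]]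
 show "jc {0..L} {0..s} (%x t. sg * ?R x t * exp (- ?V t) - ?r)" "jc {0..L} {0..s} (%x t. sg * ?R1 x t * exp (- ?V t))"
 "jc {0..L} {0..s} ?U" "jc {0..L} {0..s} ?U1" "jc {0..L} {0..s} (%x t. (- ?U1 x t - supn ?U1 t) * (sg * ?R x t * exp (- ?V t)))"
 by (intro J | rule jc_diff jc_mult jc_minus jc_const)+
 fix x t assume xt: "x : {0..L}" "t : {0..s}"
 note F = csol_fields[OF a sol xt(2)]
 show "((%x. sg * ?R x t * exp (- ?V t) - ?r) hrd sg * ?R1 x t * exp (- ?V t)) (at x)"
 using F(2)[of 0 x] by (auto intro!: dei)
 show "((%x. ?U x t) hrd ?U1 x t) (at x)" using F(3)[of 0 x] by simp
 show "((%t. sg * ?R x t * exp (- ?V t) - ?r) hrd - ?U x t * (sg * ?R1 x t * exp (- ?V t)) + (- ?U1 x t - supn ?U1 t) * (sg * ?R x t * exp (- ?V t))) (wi t s)"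
 by (rule dei F(5)[of x] Vint_deriv[OF a sol xt(2)] refl)+ (simp add: als)
 assume pos: "0 < sg * ?R x t * exp (- ?V t) - ?r"
 have "0 <= ?r" by (rule supn_nonneg[OF sr_jc(2)[OF sol]]) (use s in simp)
 moreover have "- ?U1 x t - supn ?U1 t <= 0" using us_sup[OF a sol xt(2,1)] by linarith
 ultimately show "(- ?U1 x t - supn ?U1 t) * (sg * ?R x t * exp (- ?V t)) <= 0 * (sg * ?R x t * exp (- ?V t) - ?r)"
 using pos by (simp add: mult_le_0_iff)
 next
 fix x assume x: "x : {0..L}"
 have 0: "0 : {0..s}" using s by simp
 have "| ?R x 0| <= ?r" by (rule supn_jc[OF jcL[OF sr_jc(2)[OF sol]] 0 x])
 thus "sg * ?R x 0 * exp (- ?V 0) - ?r <= 0" using sg by auto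
 next
 fix t assume t: "t : {0..s}"
 show "?U 0 t * (max (sg * ?R 0 t * exp (- ?V t) - ?r) 0)^2 = ?U L t * (max (sg * ?R L t * exp (- ?V t) - ?r) 0)^2"
 using periodic_ends(1)[of p 0 t] periodic_ends(2)[of a b 0 t] by simp
 qed (rule x)
 have "| ?R x s| * exp (- ?V s) <= ?r" using sg[of 1] sg[of "- 1"] by (cases "?R x s >= 0") auto
 hence "| ?R x s| * exp (- ?V s) * exp (?V s) <= ?r * exp (?V s)" by (rule mrm) simp
 thus ?thesis by (simp add: mult.assoc flip: exp_add)
qed

text \<open>Both fields are transported by the same velocity, so two instances of
  \<open>transport_integral\<close> with the square as \<open>ph\<close> add up; what remains is the
  estimate of the sources in \<open>le\<close>.\<close>

lemma energy_pair_growth: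
 assumes a: "a > 0" and sol: "csol a s b p"
 and dt: "!!x t. t : {0..s} ==> ((%t. sr b n x t) hrd - us a b 0 x t * sr b (Suc n) x t + G x t) (wi t s)"
 "!!x t. t : {0..s} ==> ((%t. sr p n x t) hrd - us a b 0 x t * sr p (Suc n) x t + H x t) (wi t s)"
 and j: "jc UNIV {0..s} G" "jc UNIV {0..s} H"
 and le: "!!t. t : {0..s} ==> in0 L (%x. (us a b 1 x t * (sr b n x t)^2 + 2 * sr b n x t * G x t) + (us a b 1 x t * (sr p n x t)^2 + 2 * sr p n x t * H x t))
 <= (c1 * supn (us a b 1) t + c2) * in0 L (%x. (sr b n x t)\<^sup>2 + (sr p n x t)^2)"
 shows "in0 L (%x. (sr b n x s)\<^sup>2 + (sr p n x s)^2) <= in0 L (%x. (sr b n x 0)\<^sup>2 + (sr p n x 0)^2) * exp (c1 * Vint a b s + c2 * s)"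
proof -
 have s: "0 <= s" using sol by (simp add: csol_def)
 define E where "E = (%t. in0 L (%x. (sr b n x t)\<^sup>2 + (sr p n x t)^2))"
 have sq: "((%y::real. y\<^sup>2) hrd 2 * y) (at y)" for y by (auto intro!: dei)
 note J = jcL[OF sr_jc(1)[OF sol]] jcL[OF sr_jc(2)[OF sol]] jcL[OF us_jc[OF a sol]] jcL[OF j(1)] jcL[OF j(2)]
 have Lp: "0 <= L" using L_pos by simp
 have cm: "co UNIV (%y::real. 2 * y)" by (intro cin)
 have 1: "((%t. in0 L (%x. (sr b n x t)\<^sup>2)) hrd in0 L (%x. us a b 1 x t * (sr b n x t)^2 + 2 * sr b n x t * G x t)) (wi t s)" if t: "t : {0..s}" for t
 by (rule transport_integral[where u="us a b 0" and ph="%y. y\<^sup>2" and ph'="%y. 2 * y", OF Lp csol_fields(1)[OF a sol] _ dt(1) J(1) J(1) J(3) J(3) J(4) sq cm _ t])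
 (use csol_fields(3)[OF a sol, of _ 0] periodic_ends in auto)
 have 2: "((%t. in0 L (%x. (sr p n x t)\<^sup>2)) hrd in0 L (%x. us a b 1 x t * (sr p n x t)^2 + 2 * sr p n x t * H x t)) (wi t s)" if t: "t : {0..s}" for t
 by (rule transport_integral[where u="us a b 0" and ph="%y. y\<^sup>2" and ph'="%y. 2 * y", OF Lp csol_fields(2)[OF a sol] _ dt(2) J(2) J(2) J(3) J(3) J(5) sq cm _ t])
 (use csol_fields(3)[OF a sol, of _ 0] periodic_ends in auto)
 have split: "E t = in0 L (%x. (sr b n x t)\<^sup>2) + in0 L (%x. (sr p n x t)\<^sup>2)" if t: "t : {0..s}" for t
 unfolding E_def by (rule hk_add)
 (intro icr cin jc_slice[OF J(1) t] jc_slice[OF J(2) t])+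
 have dE: "(E hrd in0 L (%x. (us a b 1 x t * (sr b n x t)^2 + 2 * sr b n x t * G x t) + (us a b 1 x t * (sr p n x t)^2 + 2 * sr p n x t * H x t))) (wi t s)" if t: "t : {0..s}" for t
 proof -
 have e: "in0 L (%x. (us a b 1 x t * (sr b n x t)^2 + 2 * sr b n x t * G x t) + (us a b 1 x t * (sr p n x t)^2 + 2 * sr p n x t * H x t))
 = in0 L (%x. us a b 1 x t * (sr b n x t)^2 + 2 * sr b n x t * G x t) + in0 L (%x. us a b 1 x t * (sr p n x t)^2 + 2 * sr p n x t * H x t)"
 by (rule hk_add)
 (intro icr cin jc_slice[OF J(1) t] jc_slice[OF J(2) t] jc_slice[OF J(3) t] jc_slice[OF J(4) t] jc_slice[OF J(5) t])+
 show ?thesis unfolding e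
 by (rule has_field_derivative_transform_within[OF DERIV_add[OF 1[OF t] 2[OF t]], of 1]) (use t split in auto)
 qed
 have dV: "((%t. c1 * Vint a b t + c2 * t) hrd c1 * supn (us a b 1) t + c2) (wi t s)" if "t : {0..s}" for t
 by (rule DERIV_cong[OF DERIV_add[OF DERIV_cmult[OF Vint_deriv[OF a sol that]] DERIV_cmult[OF DERIV_ident]]]) simp
 have "E s <= E 0 * exp ((c1 * Vint a b s + c2 * s) - (c1 * Vint a b 0 + c2 * 0))"
 by (rule gronwall_within[OF s dE dV]; (assumption | (unfold E_def, rule le, assumption)))
 thus ?thesis by (simp add: E_def)
qed

text \<open>A hierarchy driven by \<open>Vint\<close>: the maximum of \<rho>, then first
  derivatives, then second ones, each by a linear Gronwall inequality. It ends at second order, the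
  energy on which \<open>lifespan\<close> depends.\<close>

lemma csol_energy_bound:
 assumes a: "a > 0" and T: "T > 0" and sol: "!!s. 0 < s ==> s < T ==> csol a s b p"
 and Q: "!!s. 0 < s ==> s < T ==> Vint a b s <= Q"
 obtains M where "M >= 0" "!!s N. 0 < s ==> s < T ==> energy 2 N (%k. b k s) (%k. p k s) <= M"
proof -
 let ?W = "sr b" and ?R = "sr p" and ?U = "us a b"
 define E where "E = (%n t. in0 L (%x. (?W n x t)\<^sup>2 + (?R n x t)^2))"
 define Q' where "Q' = max Q 0"
 define P where "P = supn (?R 0) 0 * exp Q'"
 have V: "Vint a b s <= Q'" "0 <= Q'" if "0 <= s" "s < T" for s
 using Q[of s] that by (cases "s = 0"; auto simp: Q'_def)+
 have r0: "0 <= supn (?R 0) 0" using sol[of "T / 2"] T by (intro supn_nonneg[OF sr_jc(2), of a "T / 2" b p]) auto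
 have P0: "P >= 0" using r0 by (simp add: P_def)
 have R: "| ?R 0 x t| <= P" if t: "0 <= t" "t < T" and x: "x : {0..L}" for x t
 proof (cases "t = 0")
 case True
 have sh: "csol a (T / 2) b p" using T by (intro sol) auto
 have "| ?R 0 x 0| <= supn (?R 0) 0" by (rule supn_jc[OF jcL[OF sr_jc(2)[OF sh]] _ x]) (use T in simp)
 also have "... <= P" unfolding P_def using r0 V(2)[of 0] T by (simp add: mult_le_cancel_left1)
 finally show ?thesis using True by simp
 next
 case False
 hence "| ?R 0 x t| <= supn (?R 0) 0 * exp (Vint a b t)" using csol_rho_bound[OF a sol x] t by simp
 also have "... <= P" unfolding P_def using r0 V(1)[OF t] by (intro mlm) auto
 finally show ?thesis .
 qed
 define A1 where "A1 = E 1 0 * exp (3 * Q' + (1 + 5 * P) * T)"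
 have Enn: "0 <= E n t" if "0 <= t" "t < T" for n t
 proof -
 have sh: "csol a ((t + T) / 2) b p" using that T by (intro sol) auto
 have t': "t : {0..(t + T) / 2}" using that by auto
 show ?thesis unfolding E_def
 by (intro hk_nonneg icr cin jc_slice[OF jcL[OF sr_jc(1)[OF sh]] t'] jc_slice[OF jcL[OF sr_jc(2)[OF sh]] t']) simp
 qed
 have each: "in0 L (%x. (?W n x t)\<^sup>2) <= E n t" "in0 L (%x. (?R n x t)\<^sup>2) <= E n t"
 and cont: "co {0..L} (%x. ?W n x t)" "co {0..L} (%x. ?R n x t)" "co {0..L} (%x. ?U n x t)" if "csol a s b p" "t : {0..s}" for n t s
 proof -
 show c: "co {0..L} (%x. ?W n x t)" "co {0..L} (%x. ?R n x t)" "co {0..L} (%x. ?U n x t)"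
 by (rule jc_slice[OF jcL[OF sr_jc(1)[OF that(1)]] that(2)], rule jc_slice[OF jcL[OF sr_jc(2)[OF that(1)]] that(2)], rule jc_slice[OF jcL[OF us_jc[OF a that(1)]] that(2)])
 show "in0 L (%x. (?W n x t)\<^sup>2) <= E n t" "in0 L (%x. (?R n x t)\<^sup>2) <= E n t"
 unfolding E_def by (intro integral_le icr cin c; simp)+
 qed
 have E1: "E 1 s <= A1" if s: "0 <= s" "s < T" for s
 proof (cases "s = 0")
 case True
 have "1 <= exp (3 * Q' + (1 + 5 * P) * T)" using V(2)[of 0] P0 T by simp
 thus ?thesis unfolding True A1_def using Enn[of 0 1] T by (simp add: mult_le_cancel_left1)
 next
 case False
 hence cs: "csol a s b p" using s by (intro sol) auto
 have "E 1 s <= E 1 0 * exp (3 * Vint a b s + (1 + 5 * P) * s)"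
 unfolding E_def
 proof (rule energy_pair_growth[OF a cs])
 show "jc UNIV {0..s} (%x t. - ?U 1 x t * ?W 1 x t + ?R 1 x t)" "jc UNIV {0..s} (%x t. - 2 * ?U 1 x t * ?R 1 x t - ?U 2 x t * ?R 0 x t)"
 by (intro sr_jc[OF cs] us_jc[OF a cs] | rule jc_add jc_diff jc_mult jc_minus jc_const)+
 fix x t assume t: "t : {0..s}"
 show "((%t. ?W 1 x t) hrd - ?U 0 x t * ?W (Suc 1) x t + (- ?U 1 x t * ?W 1 x t + ?R 1 x t)) (wi t s)"
 "((%t. ?R 1 x t) hrd - ?U 0 x t * ?R (Suc 1) x t + (- 2 * ?U 1 x t * ?R 1 x t - ?U 2 x t * ?R 0 x t)) (wi t s)"
 using csol_fields(6,7)[OF a cs t, of x] by (simp_all add: numeral_2_eq_2)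
 let ?m = "supn (?U 1) t"
 note c = cont[OF cs t]
 have "in0 L (%x. (?U 1 x t * (?W 1 x t)^2 + 2 * ?W 1 x t * (- ?U 1 x t * ?W 1 x t + ?R 1 x t)) + (?U 1 x t * (?R 1 x t)^2 + 2 * ?R 1 x t * (- 2 * ?U 1 x t * ?R 1 x t - ?U 2 x t * ?R 0 x t)))
 <= in0 L (%x. (3 * ?m + 1 + P) * ((?W 1 x t)^2 + (?R 1 x t)^2) + P * (?U 2 x t)^2)"
 by (rule integral_le) (intro icr cin c, intro icr cin c,
 rule first_order_pointwise[OF us_sup[OF a cs t] R], use t s in auto)
 also have "... = (3 * ?m + 1 + P) * E 1 t + P * in0 L (%x. (?U 2 x t)\<^sup>2)"
 unfolding E_def integral_mult_right[symmetric] by (rule hk_add) (intro icr cin c)+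
 also have "in0 L (%x. (?U 2 x t)\<^sup>2) <= 4 * E 1 t"
 using us_L2[OF a cs t, of 1] each(1)[OF cs t, of 1] by (simp add: numeral_2_eq_2)
 hence "(3 * ?m + 1 + P) * E 1 t + P * in0 L (%x. (?U 2 x t)\<^sup>2) <= (3 * ?m + 1 + P) * E 1 t + P * (4 * E 1 t)"
 using P0 by (intro add_left_mono mlm)
 also have "... = (3 * ?m + (1 + 5 * P)) * E 1 t" by (simp add: als)
 finally show "in0 L (%x. (?U 1 x t * (?W 1 x t)^2 + 2 * ?W 1 x t * (- ?U 1 x t * ?W 1 x t + ?R 1 x t)) + (?U 1 x t * (?R 1 x t)^2 + 2 * ?R 1 x t * (- 2 * ?U 1 x t * ?R 1 x t - ?U 2 x t * ?R 0 x t)))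
 <= (3 * ?m + (1 + 5 * P)) * in0 L (%x. (?W 1 x t)\<^sup>2 + (?R 1 x t)^2)" by (simp only: E_def)
 qed
 also have "... <= A1" unfolding A1_def using V(1)[OF s] P0 s Enn[of 0 1] T by (intro mlm) (auto intro!: add_mono mlm)
 finally show ?thesis .
 qed
 \<comment> \<open>With the first order energy at most N^2, the square of u_xx integrates to at most
   4 N^2, while the squares of \<omega>_x and \<rho>_x are at most L E2, with E2 the second order
   energy. The weight N in Young's inequality then gives (4 L E2 / N) (4 N^2) = 16 L N E2, which is
   linear in E2.\<close>
 define N where "N = sqrt |A1| + 1"
 have N: "N > 0" "N >= 1" "A1 <= N^2"
 proof -
 show "N > 0" "N >= 1" by (auto simp: N_def add_nonneg_pos)
 have "|A1| = (sqrt |A1| )^2" by simp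
 also have "... <= N^2" unfolding N_def by (intro power_mono) auto
 finally show "A1 <= N^2" by linarith
 qed
 define c2 where "c2 = 1 + 3 * N + 5 * P + 16 * L * N"
 define A2 where "A2 = E 2 0 * exp (5 * Q' + c2 * T)"
 have c20: "c2 >= 0" using N P0 L_pos by (simp add: c2_def)
 have E2: "E 2 s <= A2" if s: "0 < s" "s < T" for s
 proof -
 have cs: "csol a s b p" using s by (intro sol) auto
 have "E 2 s <= E 2 0 * exp (5 * Vint a b s + c2 * s)"
 unfolding E_def
 proof (rule energy_pair_growth[OF a cs])
 show "jc UNIV {0..s} (%x t. - 2 * ?U 1 x t * ?W 2 x t - ?U 2 x t * ?W 1 x t + ?R 2 x t)" "jc UNIV {0..s} (%x t. - 3 * ?U 1 x t * ?R 2 x t - 3 * ?U 2 x t * ?R 1 x t - ?U 3 x t * ?R 0 x t)"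
 by (intro sr_jc[OF cs] us_jc[OF a cs] | rule jc_add jc_diff jc_mult jc_minus jc_const)+
 fix x t assume t: "t : {0..s}"
 show "((%t. ?W 2 x t) hrd - ?U 0 x t * ?W (Suc 2) x t + (- 2 * ?U 1 x t * ?W 2 x t - ?U 2 x t * ?W 1 x t + ?R 2 x t)) (wi t s)"
 "((%t. ?R 2 x t) hrd - ?U 0 x t * ?R (Suc 2) x t + (- 3 * ?U 1 x t * ?R 2 x t - 3 * ?U 2 x t * ?R 1 x t - ?U 3 x t * ?R 0 x t)) (wi t s)"
 using csol_fields(8,9)[OF a cs t, of x] by (simp_all add: numeral_3_eq_3 numeral_2_eq_2)
 let ?m = "supn (?U 1) t" and ?S = "L * E 2 t"
 note c = cont[OF cs t]
 have s2: "Suc 0 = 1" "Suc 1 = 2" by simp_all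
 have sup1: "(?W 1 x t)^2 <= ?S" "(?R 1 x t)^2 <= ?S" if "x : {0..L}" for x
 by (rule order_trans[OF sup_by_derivative[where n=0, OF csol_rapid(1)[OF cs] t that, unfolded s2] mlm[OF each(1)[OF cs t] less_imp_le[OF L_pos]]],
 rule order_trans[OF sup_by_derivative[where n=0, OF csol_rapid(2)[OF cs] t that, unfolded s2] mlm[OF each(2)[OF cs t] less_imp_le[OF L_pos]]])
 have "in0 L (%x. (?U 1 x t * (?W 2 x t)^2 + 2 * ?W 2 x t * (- 2 * ?U 1 x t * ?W 2 x t - ?U 2 x t * ?W 1 x t + ?R 2 x t)) + (?U 1 x t * (?R 2 x t)^2 + 2 * ?R 2 x t * (- 3 * ?U 1 x t * ?R 2 x t - 3 * ?U 2 x t * ?R 1 x t - ?U 3 x t * ?R 0 x t)))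
 <= in0 L (%x. (5 * ?m + 1 + 3 * N + P) * ((?W 2 x t)^2 + (?R 2 x t)^2) + (4 * ?S / N) * (?U 2 x t)^2 + P * (?U 3 x t)^2)"
 by (rule integral_le) (intro icr cin c, intro icr cin c,
 rule second_order_pointwise[OF us_sup[OF a cs t] R N(1) sup1], use t s in auto)
 also have "... = (5 * ?m + 1 + 3 * N + P) * E 2 t + (4 * ?S / N) * in0 L (%x. (?U 2 x t)\<^sup>2) + P * in0 L (%x. (?U 3 x t)\<^sup>2)"
 unfolding E_def integral_mult_right[symmetric]
 by (subst hk_add[symmetric], (intro icr cin c)+,
 subst hk_add[symmetric], (intro icr cin c)+, rule refl)
 also have "... <= (5 * ?m + 1 + 3 * N + P) * E 2 t + (4 * ?S / N) * (4 * N^2) + P * (4 * E 2 t)"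
 proof (intro add_mono mlm order_refl)
 have "in0 L (%x. (?U 2 x t)\<^sup>2) <= 4 * E 1 t"
 using us_L2[OF a cs t, of 1] each(1)[OF cs t, of 1] by (simp add: numeral_2_eq_2)
 also have "... <= 4 * N^2" using E1[of t] t s N(3) by simp
 finally show "in0 L (%x. (?U 2 x t)\<^sup>2) <= 4 * N^2" .
 show "in0 L (%x. (?U 3 x t)\<^sup>2) <= 4 * E 2 t"
 using us_L2[OF a cs t, of 2] each(1)[OF cs t, of 2] by (simp add: numeral_3_eq_3 numeral_2_eq_2)
 show "0 <= 4 * ?S / N" using Enn[of t 2] t s L_pos N(1) by simp
 qed (use P0 N(1) supn_nonneg[OF us_jc[OF a cs, of 1] t] in auto)
 also have "(4 * ?S / N) * (4 * N^2) = 16 * L * N * E 2 t" using N(1) by (simp add: p2q)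
 also have "(5 * ?m + 1 + 3 * N + P) * E 2 t + 16 * L * N * E 2 t + P * (4 * E 2 t) = (5 * ?m + c2) * E 2 t" by (simp add: c2_def als)
 finally show "in0 L (%x. (?U 1 x t * (?W 2 x t)^2 + 2 * ?W 2 x t * (- 2 * ?U 1 x t * ?W 2 x t - ?U 2 x t * ?W 1 x t + ?R 2 x t)) + (?U 1 x t * (?R 2 x t)^2 + 2 * ?R 2 x t * (- 3 * ?U 1 x t * ?R 2 x t - 3 * ?U 2 x t * ?R 1 x t - ?U 3 x t * ?R 0 x t)))
 <= (5 * ?m + c2) * in0 L (%x. (?W 2 x t)\<^sup>2 + (?R 2 x t)^2)" by (simp only: E_def)
 qed
 also have "... <= A2" unfolding A2_def using V(1)[of s] c20 s Enn[of 0 2] T by (intro mlm) (auto intro!: add_mono mlm)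
 finally show ?thesis .
 qed
 have A20: "A2 >= 0" using Enn[of 0 2] T by (simp add: A2_def)
 \<comment> \<open>Parseval leads from the energy in physical space back to the coefficient energy
   of the local theory; the second derivative of a sine mode has squared coefficient K^4 / 4 times
   k^4 d^2.\<close>
 have coef: "(SUM k:{-N..N}. of_int k ^ 4 * (d k t)^2) <= 4 / (L * K ^ 4) * in0 L (%x. (sr d 2 x t)\<^sup>2)"
 if r: "rapid_on {0..s} d" and t: "t : {0..s}" and o: "!!k. d (- k) t = - d k t" for d :: "int => real => real" and s t and N :: int
 proof -
 let ?c = "(D ^^ 2) (%k. cc (d k t))"
 have w: "wsum 0 ?c" using allw_D[OF rapid_allw[OF r t], of 2] by (simp add: allw_def)
 have hc: "hermitian ?c" by (rule hermitian_Dn[OF hermitian_cc[where b="%k. d k t", OF o]])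
 have "(SUM k:{-N..N}. (norm (?c k))\<^sup>2) <= (ISUM k. (norm (?c k))\<^sup>2)"
 by (rule finite_sum_le_infsum[OF parseval_square(2)[OF w hc]]) auto
 moreover have "(norm (?c k))^2 = K ^ 4 / 4 * (of_int k ^ 4 * (d k t)^2)" for k
 proof -
 have p4: "(y^2)^2 = y ^ 4" for y :: real by (simp flip: power_mult)
 have "norm (?c k) = (K * |of_int k| )^2 * ( |d k t| / 2)" unfolding Dn_eq using K_pos by (simp add: norm_mult norm_power cc_simps abs_mult)
 hence "(norm (?c k))^2 = ((K * |of_int k| )^2 * ( |d k t| / 2))^2" by (simp only:)
 also have "... = ((K^2)^2 * ((of_int k)^2)^2) * ((d k t)^2 / 4)" by (simp add: pmd power_divide)
 also have "... = K ^ 4 / 4 * (of_int k ^ 4 * (d k t)^2)" unfolding p4 by simp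
 finally show ?thesis .
 qed
 ultimately have "K ^ 4 / 4 * (SUM k:{-N..N}. of_int k ^ 4 * (d k t)^2) <= (ISUM k. (norm (?c k))\<^sup>2)" by (simp only: sum_distrib_left)
 moreover have "in0 L (%x. (sr d 2 x t)\<^sup>2) = L * (ISUM k. (norm (?c k))\<^sup>2)"
 unfolding sr_def by (rule integral_unique[OF parseval_square(1)[OF w hc]])
 ultimately show ?thesis using L_pos K_pos by (simp add: fsi)
 qed
 show ?thesis
 proof (rule that[of "4 / (L * K ^ 4) * (2 * A2)"])
 show "0 <= 4 / (L * K ^ 4) * (2 * A2)" using A20 L_pos K_pos by simp
 fix s N assume s: "0 < s" "s < T"
 have cs: "csol a s b p" using s by (intro sol) auto
 have ss: "s : {0..s}" using s by simp
 have "energy 2 N (%k. b k s) (%k. p k s) = (SUM k:{-N..N}. of_int k ^ 4 * (b k s)^2) + (SUM k:{-N..N}. of_int k ^ 4 * (p k s)^2)"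
 by (simp add: energy_def distrib_left sum.distrib)
 also have "... <= 4 / (L * K ^ 4) * A2 + 4 / (L * K ^ 4) * A2"
 proof (rule add_mono)
 have f: "0 <= 4 / (L * K ^ 4)" using L_pos K_pos by simp
 show "(SUM k:{-N..N}. of_int k ^ 4 * (b k s)^2) <= 4 / (L * K ^ 4) * A2"
 by (rule order_trans[OF coef[OF csol_rapid(1)[OF cs] ss csol_odd(1)[OF cs ss]] mlm[OF order_trans[OF each(1)[OF cs ss] E2[OF s]] f]])
 show "(SUM k:{-N..N}. of_int k ^ 4 * (p k s)^2) <= 4 / (L * K ^ 4) * A2"
 by (rule order_trans[OF coef[OF csol_rapid(2)[OF cs] ss csol_odd(2)[OF cs ss]] mlm[OF order_trans[OF each(2)[OF cs ss] E2[OF s]] f]])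
 qed
 finally show "energy 2 N (%k. b k s) (%k. p k s) <= 4 / (L * K ^ 4) * (2 * A2)" by simp
 qed
qed

end

section \<open>The weight cot\<close>

text \<open>The difference of logarithms is ln r for a cross ratio r, and ln r >= 1 - 1 / r is
  rational. It is used with s and p the squared sines of x - y and x + y.\<close>

lemma log_ratio_lower:
 fixes s p e a :: real
 assumes "0 <= s" "s <= p" "0 < e" "e <= a"
 shows "(a - e) * (p - s) / ((p + e) * (s + a)) <= (ln (p + e) - ln (p + a)) - (ln (s + e) - ln (s + a))"
proof -
 define r where "r = ((p + e) * (s + a)) / ((s + e) * (p + a))"
 have pos: "p + e > 0" "s + a > 0" "s + e > 0" "p + a > 0" using assms by auto
 have r: "r > 0" unfolding r_def using pos by simp
 have "(ln (p + e) - ln (p + a)) - (ln (s + e) - ln (s + a)) = ln r"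
 unfolding r_def using pos by (simp add: ln_div ln_mult)
 moreover have "1 - 1 / r <= ln r" using ln_le_minus_one[of "1 / r"] r by (simp add: ln_div)
 moreover have "1 - 1 / r = (a - e) * (p - s) / ((p + e) * (s + a))"
 unfolding r_def using pos by (simp add: divide_simps) (simp add: als)
 ultimately show ?thesis by simp
qed

lemma symmetric_factorization:
 fixes tx ty wx wy k sx sy n1 n2 q :: real
 shows "tx * wx * (wy * (k * sx * sy * n1 / q)) + ty * wy * (wx * (k * sy * sx * n2 / q)) = (wx * wy * (k * (sx * sy))) / q * (tx * n1 + ty * n2)"
 by (simp add: als add_divide_distrib)

text \<open>p and q stand for cos (K x) and cos (K y). If p <= q, then tx >= ty and the first
  bracket is nonnegative, so tx may be lowered to ty. This leaves ty times the sum of the brackets,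
  in which all terms free of e cancel.\<close>

lemma symmetrized_kernel_nonneg:
 fixes p q e tx ty :: real
 assumes e: "e > 0" and pq: "|p| <= 1" "|q| <= 1" and t: "tx >= 0" "ty >= 0"
 and mono: "p <= q ==> ty <= tx" "q <= p ==> tx <= ty"
 shows "0 <= tx * ((p - q)^2 / 4 + e * (1 + q) + e^2 + (1 + p) * (q - p) / 2) + ty * ((q - p)^2 / 4 + e * (1 + p) + e^2 + (1 + q) * (p - q) / 2)"
proof -
 have main: "0 <= tx * ((p - q)^2 / 4 + e * (1 + q) + e^2 + (1 + p) * (q - p) / 2) + ty * ((q - p)^2 / 4 + e * (1 + p) + e^2 + (1 + q) * (p - q) / 2)"
 if "p <= q" "ty <= tx" "ty >= 0" "|p| <= 1" "|q| <= 1" for p q tx ty :: real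
 proof -
 let ?n = "%p q. (p - q)\<^sup>2 / 4 + e * (1 + q) + e^2 + (1 + p) * (q - p) / 2"
 have "0 <= e * (1 + q)" "0 <= (1 + p) * (q - p)" using e that by (auto intro!: mnn)
 hence "0 <= ?n p q" by (intro add_nonneg_nonneg) auto
 hence "ty * ?n p q <= tx * ?n p q" using that by (intro mrm)
 moreover have "?n p q + ?n q p = e * (2 + p + q) + 2 * e^2" by (simp add: p2q fsi)
 moreover have "0 <= ty * (e * (2 + p + q) + 2 * e^2)"
 proof -
 have "0 <= 2 + p + q" using that(4,5) by linarith
 hence "0 <= e * (2 + p + q)" using e by simp
 thus ?thesis using that(3) by simp
 qed
 ultimately have "0 <= ty * ?n p q + ty * ?n q p" by (simp only: distrib_left[symmetric])
 thus ?thesis using \<open>ty * ?n p q <= tx * ?n p q\<close> by linarith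
 qed
 show ?thesis
 proof (cases "p <= q")
 case True
 show ?thesis by (rule main[OF True mono(1)[OF True] t(2) pq])
 next
 case False
 hence "q <= p" by simp
 from main[OF this mono(2)[OF this] t(1) pq(2,1)] show ?thesis by (simp only: add.commute)
 qed
qed

context circle begin

definition h :: real where "h = L / 2"
definition mu :: real where "mu = pi / L"

lemma h_pos: "h > 0" and mu_pos: "mu > 0" and mu_h: "mu * h = pi / 2" and K_mu: "K = 2 * mu" and h_le: "h <= L" and hh: "h + h = L"
 using L_pos by (auto simp: h_def mu_def K_def)

text \<open>\<open>ct 0 = 0\<close> by division by zero. Where continuity up to 0 matters, the
  weighted functions are O(x^2), so that this is their limit value as well; see
  \<open>cot_weight_jc\<close>.\<close>

definition ct :: "real => real" where "ct x = cot (mu * x)"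

lemma angle:
 assumes "0 <= x" "x <= h"
 shows "0 <= mu * x" "mu * x <= pi / 2"
 using assms mu_pos mlm[of x h mu] by (auto simp: mu_h)

lemma trig_nonneg:
 assumes "0 <= x" "x <= h"
 shows "0 <= sin (mu * x)" "0 <= cos (mu * x)" "0 <= sin (K * x)" "0 <= ct x"
proof -
 note an = angle[OF assms]
 show s: "0 <= sin (mu * x)" using an pi_gt_zero by (intro sin_ge_zero) linarith+
 show c: "0 <= cos (mu * x)" using an by (intro cos_ge_zero) auto
 have "sin (K * x) = 2 * sin (mu * x) * cos (mu * x)" using sin_double[of "mu * x"] by (simp add: K_mu mult_ac)
 thus "0 <= sin (K * x)" using s c by simp
 show "0 <= ct x" unfolding ct_def cot_def using s c by simp
qed

lemma sin_pos: "0 < x ==> x <= h ==> 0 < sin (mu * x)"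
 using angle[of x] mu_pos pi_gt_zero by (intro sin_gt_zero) (auto intro: le_less_trans[of _ "pi / 2"])

lemma s2_mu: "s2 z = (sin (mu * z))^2" by (simp add: s2_def mu_def)

lemma s2_prod:
 "s2 (x + y) = (sin (mu * x) * cos (mu * y) + cos (mu * x) * sin (mu * y))^2"
 "s2 (x - y) = (sin (mu * x) * cos (mu * y) - cos (mu * x) * sin (mu * y))^2"
 by (simp_all add: s2_mu distrib_left right_diff_distrib sin_add sin_diff)

lemma s2_even: "s2 (- z) = s2 z" and s2_periodic: "s2 (z + L) = s2 z"
 using KL by (simp_all add: s2_cos distrib_left)

lemma s2_diff: "s2 (x + y) - s2 (x - y) = sin (K * x) * sin (K * y)"
 using cos_add[of "K * x" "K * y"] cos_diff[of "K * x" "K * y"] by (simp add: s2_cos distrib_left right_diff_distrib fsi)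

lemma s2_mono: "0 <= x ==> x <= h ==> 0 <= y ==> y <= h ==> s2 (x - y) <= s2 (x + y)"
 using s2_diff[of x y] mnn[OF trig_nonneg(3) trig_nonneg(3), of x y] by linarith

text \<open>The reflection of y to L - y folds the second half of the circle onto the first and
  changes the sign of the odd factor.\<close>

lemma half_circle_integral:
 assumes w: "co UNIV w" "!!y. w (- y) = - w y" "!!y. w (y + L) = w y"
 and k: "co UNIV k" "!!y. k (- y) = k y" "!!y. k (y + L) = k y"
 shows "ci L (%y. w y * k (x - y)) = in0 h (%y. w y * (k (x - y) - k (x + y)))"
proof -
 let ?g = "%y. w y * k (x - y)"
 have cw: "co A w" and ck: "co A (%y. k (x - y))" "co A (%y. k (x + y))" for A
 by (rule continuous_on_subset[OF w(1)], simp) (auto intro!: coc[OF k(1)] cin)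
 have cg: "co A ?g" for A by (intro cin cw ck)
 have "(?g has_integral integral {h..L} ?g) (cbox h L)"
 unfolding cbox_interval by (rule integrable_integral[OF icr[OF cg]])
 from has_integral_affinity[OF this, of "-1" L]
 have "((%y. ?g (L - y)) has_integral integral {h..L} ?g) ((%y. L - y) ` {h..L})" by (simp add: cbox_interval)
 moreover have "(%y. L - y) ` {h..L} = {0..h}" using hh by (auto simp: image_iff intro!: bexI[of _ "L - z" for z])
 moreover have "?g (L - y) = - (w y * k (x + y))" for y
 proof -
 have "w (L - y) = - w y" using w(3)[of "- y"] w(2)[of y] by (simp add: add.commute)
 moreover have "k (x - (L - y)) = k (x + y)" using k(3)[of "x - (L - y)"] by (simp add: als)
 ultimately show ?thesis by simp
 qed
 ultimately have r: "((%y. - (w y * k (x + y))) has_integral integral {h..L} ?g) {0..h}"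
 by (simp only:)
 have "ci L ?g = in0 L ?g" by (rule circle_integral_eq[OF cg])
 also have "... = in0 h ?g + integral {h..L} ?g"
 by (rule hk_combine[symmetric]) (use h_pos h_le in "auto intro!: icr cg")
 also have "integral {h..L} ?g = in0 h (%y. - (w y * k (x + y)))" by (rule integral_unique[OF r, symmetric])
 also have "in0 h ?g + in0 h (%y. - (w y * k (x + y))) = in0 h (%y. ?g y + - (w y * k (x + y)))"
 by (rule hk_add[symmetric]) (intro icr cin cw ck)+
 also have "(%y. ?g y + - (w y * k (x + y))) = (%y. w y * (k (x - y) - k (x + y)))" by (simp add: right_diff_distrib)
 finally show ?thesis .
qed

definition kr :: "real => real => real => real" where "kr e a z = ln (s2 z + e) - ln (s2 z + a)"

lemma kr_props:
 assumes "e > 0" "a > 0"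
 shows "co UNIV (kr e a)" "kr e a (- y) = kr e a y" "kr e a (y + L) = kr e a y"
proof -
 have "s2 z + e ~= 0" if "e > 0" for e z using s2_nonneg[of z] that by linarith
 moreover have "co UNIV s2" unfolding s2_def[abs_def] by (intro cin)
 ultimately show "co UNIV (kr e a)" unfolding kr_def[abs_def] using assms by (intro cin) auto
qed (simp_all add: kr_def s2_even s2_periodic)

lemma velocity_reg_half:
 assumes a: "a > 0" and w: "co UNIV w" "!!y. w (- y) = - w y" "!!y. w (y + L) = w y"
 shows "- (2 * pi) * velocity_reg n a w x = in0 h (%y. w y * (kr (ep (rs n)) a (x + y) - kr (ep (rs n)) a (x - y)))"
proof -
 have "2 * pi * velocity_reg n a w x = ci L (%y. w y * kr (ep (rs n)) a (x - y))"
 by (simp add: velocity_reg_def kr_def)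
 also have "... = in0 h (%y. w y * (kr (ep (rs n)) a (x - y) - kr (ep (rs n)) a (x + y)))"
 by (rule half_circle_integral[OF w kr_props[OF ep_rs(1) a]])
 finally have "- (2 * pi) * velocity_reg n a w x = - in0 h (%y. w y * (kr (ep (rs n)) a (x - y) - kr (ep (rs n)) a (x + y)))" by simp
 also have "... = in0 h (%y. w y * (kr (ep (rs n)) a (x + y) - kr (ep (rs n)) a (x - y)))"
 unfolding integral_neg[symmetric] by (intro integral_cong) (simp add: als)
 finally show ?thesis .
qed

text \<open>For y >= x one has sin (mu x) cos (mu y) <= cos (mu x) sin (mu y), hence
  \<open>s2 (x + y)\<close> is at most 4 cos^2 (mu x) sin^2 (mu y). The numerator of
  \<open>log_ratio_lower\<close>, divided by this, leaves tan (mu x) cot (mu y), and the weight cot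
  (mu x) cancels the tangent.\<close>

lemma kernel_lower:
 assumes e: "0 < e" "e <= a" and x: "0 < x" "x < h" and y: "x <= y" "y <= h"
 shows "(a - e) / ((1 + a) * (1 + e / (4 * (cos (mu * x))^2 * (sin (mu * x))^2))) * ct y <= (kr e a (x + y) - kr e a (x - y)) * ct x"
proof -
 let ?S = "sin (mu * x)" and ?C = "cos (mu * x)" and ?S' = "sin (mu * y)" and ?C' = "cos (mu * y)"
 \<comment> \<open>The bound 4 cos^2 (mu x) sin^2 (mu y) at y = x, where it is smallest on y >= x.
   The correction e / d is thus independent of y and tends to 0 with e.\<close>
 define d where "d = 4 * ?C^2 * ?S^2"
 have S: "?S > 0" "?S' > 0" using sin_pos x y by auto
 have C': "?C' >= 0" using trig_nonneg(2)[of y] x y by auto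
 have mx: "mu * x < pi / 2" using mult_strict_left_mono[OF x(2) mu_pos] by (simp add: mu_h)
 have C: "?C > 0" using mx angle[of x] x by (intro cos_gt_zero_pi) auto
 have my: "mu * x <= mu * y" "mu * y <= pi / 2" using y mu_pos angle[of y] x by auto
 have SS: "?S <= ?S'" using my angle[of x] x pi_gt_zero by (intro sin_monotone_2pi_le) linarith+
 have cross: "?S * ?C' <= ?C * ?S'"
 proof -
 have "0 <= sin (mu * y - mu * x)" using my angle[of x] x pi_gt_zero by (intro sin_ge_zero) linarith+
 thus ?thesis by (simp add: sin_diff mult.commute)
 qed
 have d: "d > 0" using S C by (simp add: d_def)
 have dle: "d <= 4 * ?C^2 * ?S'^2" unfolding d_def using SS S by (intro mlm power_mono) auto
 have "s2 (x + y) <= (2 * (?C * ?S'))^2" unfolding s2_prod using cross S C C' by (intro power_mono add_nonneg_nonneg mnn) auto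
 hence sp: "s2 (x + y) <= 4 * ?C^2 * ?S'^2" by (simp add: pmd)
 have "e <= (4 * ?C^2 * ?S'^2) * (e / d)" using mrm[OF dle, of "e / d"] e d by simp
 hence den1: "s2 (x + y) + e <= (4 * ?C^2 * ?S'^2) * (1 + e / d)" using sp by (simp add: distrib_left)
 have den2: "s2 (x - y) + a <= 1 + a" using s2_le_1[of "x - y"] by simp
 have num: "s2 (x + y) - s2 (x - y) = 4 * ?S * ?C * ?S' * ?C'" unfolding s2_prod by (simp add: p2q als)
 have pos: "0 < s2 (x + y) + e" "0 < s2 (x - y) + a" using s2_nonneg[of "x + y"] s2_nonneg[of "x - y"] e by linarith+
 have n0: "0 <= (a - e) * (s2 (x + y) - s2 (x - y))" unfolding num using e S C C' by (intro mnn) auto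
 have ctx: "ct x = ?C / ?S" "ct y = ?C' / ?S'" by (simp_all add: ct_def cot_def)
 have "(a - e) * (s2 (x + y) - s2 (x - y)) / (((4 * ?C^2 * ?S'^2) * (1 + e / d)) * (1 + a)) <= (a - e) * (s2 (x + y) - s2 (x - y)) / ((s2 (x + y) + e) * (s2 (x - y) + a))"
 by (intro divide_left_mono mult_mono den1 den2 n0 mult_pos_pos pos) (use e d S C pos in "auto intro!: mult_pos_pos add_pos_pos mnn")
 also have "... <= kr e a (x + y) - kr e a (x - y)"
 unfolding kr_def by (rule log_ratio_lower[OF s2_nonneg s2_mono]) (use x y e in auto)
 finally have "(a - e) * (s2 (x + y) - s2 (x - y)) / (((4 * ?C^2 * ?S'^2) * (1 + e / d)) * (1 + a)) * ct x <= (kr e a (x + y) - kr e a (x - y)) * ct x"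
 by (rule mrm) (use trig_nonneg(4)[of x] x in simp)
 moreover have "(a - e) * (s2 (x + y) - s2 (x - y)) / (((4 * ?C^2 * ?S'^2) * (1 + e / d)) * (1 + a)) * ct x = (a - e) / ((1 + a) * (1 + e / d)) * ct y"
 proof -
 have "1 + e / d > 0" "1 + a > 0" using e d by (auto intro: add_pos_pos)
 thus ?thesis unfolding num ctx using S C by (simp add: p2q)
 qed
 ultimately show ?thesis by (simp add: d_def)
qed

lemma ct_continuous: "0 < x ==> co {x..h} ct"
 unfolding ct_def[abs_def] cot_def using sin_pos by (intro cin) (metis atLeastAtMost_iff less_irrefl less_le_trans)

text \<open>The values y < x contribute nonnegatively and are dropped; on y >= x
  \<open>kernel_lower\<close> applies, and the limit in n removes the regularisation.\<close>

lemma velocity_cot_lower: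
 assumes a: "a > 0" and w: "co UNIV w" "!!y. w (- y) = - w y" "!!y. w (y + L) = w y" "!!y. y : {0..h} ==> w y >= 0"
 and x: "0 < x" "x < h"
 shows "a / (1 + a) * integral {x..h} (%y. w y * ct y) <= - (2 * pi) * (velocity L a w x * ct x)"
proof -
 let ?d = "4 * (cos (mu * x))^2 * (sin (mu * x))^2"
 let ?I = "integral {x..h} (%y. w y * ct y)"
 have cw: "co A w" for A by (rule continuous_on_subset[OF w(1)]) simp
 have ck: "co A (%y. kr (ep (rs n)) a (x - y))" "co A (%y. kr (ep (rs n)) a (x + y))" for n A
 by (auto intro!: coc[OF kr_props(1)[OF ep_rs(1) a]] cin)
 have step: "(a - ep (rs n)) / ((1 + a) * (1 + ep (rs n) / ?d)) * ?I <= - (2 * pi) * velocity_reg n a w x * ct x" if n: "ep (rs n) <= a" for n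
 proof -
 let ?e = "ep (rs n)"
 have "(a - ?e) / ((1 + a) * (1 + ?e / ?d)) * ?I = integral {x..h} (%y. (a - ?e) / ((1 + a) * (1 + ?e / ?d)) * (w y * ct y))" by simp
 also have "... <= integral {x..h} (%y. w y * (kr ?e a (x + y) - kr ?e a (x - y)) * ct x)"
 proof (rule integral_le)
 fix y assume y: "y : {x..h}"
 have "w y * ((a - ?e) / ((1 + a) * (1 + ?e / ?d)) * ct y) <= w y * ((kr ?e a (x + y) - kr ?e a (x - y)) * ct x)"
 by (intro mlm kernel_lower ep_rs(1) n x) (use y x w(4) in auto)
 thus "(a - ?e) / ((1 + a) * (1 + ?e / ?d)) * (w y * ct y) <= w y * (kr ?e a (x + y) - kr ?e a (x - y)) * ct x" by (simp add: mult_ac)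
 qed (intro icr cin cw ck ct_continuous x)+
 also have "... <= in0 h (%y. w y * (kr ?e a (x + y) - kr ?e a (x - y)) * ct x)"
 proof -
 have nn: "0 <= w y * (kr ?e a (x + y) - kr ?e a (x - y)) * ct x" if y: "y : {0..h}" for y
 proof -
 have "0 <= (a - ?e) * (s2 (x + y) - s2 (x - y)) / ((s2 (x + y) + ?e) * (s2 (x - y) + a))"
 using s2_mono[of x y] x y n a s2_nonneg ep_rs(1)[of n] by (intro divide_nonneg_nonneg mnn add_nonneg_nonneg) (auto simp: less_imp_le)
 also have "... <= kr ?e a (x + y) - kr ?e a (x - y)" unfolding kr_def
 by (rule log_ratio_lower[OF s2_nonneg s2_mono ep_rs(1) n]) (use x y in auto)
 finally show ?thesis using w(4)[OF y] trig_nonneg(4)[of x] x by (intro mnn) auto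
 qed
 show ?thesis by (rule integral_subset_le) (use nn x in "auto intro!: icr cin cw ck")
 qed
 also have "... = - (2 * pi) * velocity_reg n a w x * ct x"
 unfolding velocity_reg_half[OF a w(1-3)] by simp
 finally show ?thesis .
 qed
 have ev: "\<forall>\<^sub>F n in sequentially. ep (rs n) <= a"
 using order_tendstoD(2)[OF ep_rs_lim a] by (rule eventually_mono) simp
 have l1: "(%n. a - ep (rs n)) \<longlonglongrightarrow> a - 0" by (intro tendsto_intros ep_rs_lim)
 have l2: "(%n. ep (rs n) / ?d) \<longlonglongrightarrow> 0 / ?d" unfolding divide_inverse by (rule tendsto_mult[OF ep_rs_lim tendsto_const])
 have nz: "(1 + a) * (1 + 0 / ?d) ~= 0" using a by simp
 have l3: "(%n. (a - ep (rs n)) / ((1 + a) * (1 + ep (rs n) / ?d)) * ?I) \<longlonglongrightarrow> (a - 0) / ((1 + a) * (1 + 0 / ?d)) * ?I"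
 by (rule tendsto_mult[OF tendsto_divide[OF l1 tendsto_mult[OF tendsto_const tendsto_add[OF tendsto_const l2]] nz] tendsto_const])
 have l4: "(%n. - (2 * pi) * velocity_reg n a w x * ct x) \<longlonglongrightarrow> - (2 * pi) * velocity L a w x * ct x"
 by (rule tendsto_mult[OF tendsto_mult[OF tendsto_const velocity_reg_lim[OF a cw]] tendsto_const])
 have "(a - 0) / ((1 + a) * (1 + 0 / ?d)) * ?I <= - (2 * pi) * velocity L a w x * ct x"
 by (rule tendsto_le[OF sequentially_bot l4 l3 eventually_mono[OF ev step]])
 thus ?thesis by (simp add: mult.assoc)
qed

section \<open>The derivative of the kernel in the regularisation parameter\<close>

definition Qe :: "real => real => real => real" where
 "Qe e p q = (p - q)^2 / 4 + e * (1 - p * q) + e^2"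

text \<open>The weight \<open>ct x\<close> times the e-derivative of ln (s2 (x - y) + e) - ln (s2 (x
  + y) + e). Since ct x sin (K x) = 1 + cos (K x), the singularity of the weight disappears.\<close>

definition Psi :: "real => real => real => real" where
 "Psi e x y = (1 + cos (K * x)) * sin (K * y) / Qe e (cos (K * x)) (cos (K * y))"

text \<open>Minus the x-derivative of \<open>Psi\<close>, with the numerator arranged for
  \<open>symmetrized_kernel_nonneg\<close>.\<close>

definition Ne :: "real => real => real => real" where
 "Ne e x y = K * sin (K * x) * sin (K * y) *
 ((cos (K * x) - cos (K * y))^2 / 4 + e * (1 + cos (K * y)) + e^2 + (1 + cos (K * x)) * (cos (K * y) - cos (K * x)) / 2) / (Qe e (cos (K * x)) (cos (K * y)))^2"

lemma Qe_pos:
 assumes "e > 0" "|p| <= 1" "|q| <= 1"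
 shows "Qe e p q > 0"
proof -
 have "|p * q| <= 1" using mult_mono[OF assms(2,3)] by (simp add: abs_mult)
 hence "0 <= e * (1 - p * q)" using assms(1) by (intro mnn) auto
 thus ?thesis unfolding Qe_def using assms(1) by (intro add_nonneg_pos add_nonneg_nonneg) auto
qed

lemma Qe_sym: "Qe e p q = Qe e q p"
 by (simp add: Qe_def power2_commute mult.commute)

lemma Qe_s2: "(s2 (x + y) + e) * (s2 (x - y) + e) = Qe e (cos (K * x)) (cos (K * y))"
proof -
 let ?p = "cos (K * x)" and ?q = "cos (K * y)" and ?S = "sin (K * x) * sin (K * y)"
 have S: "?S^2 = (1 - ?p\<^sup>2) * (1 - ?q\<^sup>2)" by (simp add: pmd sin_squared_eq)
 have "s2 (x + y) = (1 - (?p * ?q - ?S)) / 2" "s2 (x - y) = (1 - (?p * ?q + ?S)) / 2"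
 by (simp_all add: s2_cos distrib_left right_diff_distrib cos_add cos_diff)
 hence "(s2 (x + y) + e) * (s2 (x - y) + e) = ((1 - ?p * ?q)^2 - ?S\<^sup>2) / 4 + e * (1 - ?p * ?q) + e^2"
 by (simp only:) (simp add: p2q fsi)
 also have "(1 - ?p * ?q)^2 - ?S\<^sup>2 = (?p - ?q)^2" unfolding S by (simp add: p2q als)
 finally show ?thesis by (simp add: Qe_def)
qed

lemma Psi_deriv:
 assumes e: "e > 0"
 shows "((%x. Psi e x y) hrd - Ne e x y) (at x)"
proof -
 let ?p = "cos (K * x)" and ?q = "cos (K * y)" and ?s = "sin (K * x)" and ?sy = "sin (K * y)"
 define Q where "Q = Qe e ?p ?q"
 have Q: "Q > 0" unfolding Q_def by (rule Qe_pos[OF e]) simp_all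
 have dp: "((%x. cos (K * x)) hrd - K * ?s) (at x)" by (auto intro!: dei)
 have "((%p. Qe e p ?q) hrd (?p - ?q) / 2 - e * ?q) (at ?p)"
 unfolding Qe_def by (auto intro!: dei simp: fsi)
 from DERIV_chain2[OF this dp] have dQ: "((%x. Qe e (cos (K * x)) ?q) hrd ((?p - ?q) / 2 - e * ?q) * (- K * ?s)) (at x)" .
 have dn: "((%x. (1 + cos (K * x)) * ?sy) hrd (- K * ?s) * ?sy) (at x)"
 by (auto intro!: dei dp)
 have "((%x. Psi e x y) hrd (((- K * ?s) * ?sy) * Q - ((1 + ?p) * ?sy) * (((?p - ?q) / 2 - e * ?q) * (- K * ?s))) / (Q * Q)) (at x)"
 unfolding Psi_def using DERIV_divide[OF dn dQ] Q by (simp add: Q_def)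
 moreover have eq: "(?p - ?q)^2 / 4 + e * (1 + ?q) + e^2 + (1 + ?p) * (?q - ?p) / 2 = Q - (1 + ?p) * ((?p - ?q) / 2 - e * ?q)"
 by (simp add: Q_def Qe_def p2q fsi)
 have num: "((- K * ?s) * ?sy) * Q - ((1 + ?p) * ?sy) * (Y * (- K * ?s)) = - (K * ?s * ?sy * (Q - (1 + ?p) * Y))" for Y by (simp add: als)
 have "- Ne e x y = (((- K * ?s) * ?sy) * Q - ((1 + ?p) * ?sy) * (((?p - ?q) / 2 - e * ?q) * (- K * ?s))) / (Q * Q)"
 unfolding Ne_def Q_def[symmetric] eq num by (simp add: p2q)
 ultimately show ?thesis by (simp only:)
qed

lemma Psi_continuous:
 assumes e: "e > 0"
 shows "co A (%p. Psi e (fst p) (snd p))" "co A (%p. Ne e (fst p) (snd p))"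
 "co A (%p. Psi e (snd p) (fst p))" "co A (%p. Ne e (snd p) (fst p))"
proof -
 have "Qe e (cos u) (cos v) ~= 0" for u v using Qe_pos[OF e, of "cos u" "cos v"] by simp
 hence Q: "((cos u - cos v)^2 / 4 + e * (1 - cos u * cos v) + e^2) ~= 0" for u v by (simp add: Qe_def)
 show "co A (%p. Psi e (fst p) (snd p))" "co A (%p. Ne e (fst p) (snd p))"
 "co A (%p. Psi e (snd p) (fst p))" "co A (%p. Ne e (snd p) (fst p))"
 unfolding Psi_def Ne_def Qe_def by (intro cin; simp add: Q)+
qed

lemma cos_le_iff: "0 <= x ==> x <= h ==> 0 <= y ==> y <= h ==> cos (K * x) <= cos (K * y) \<longleftrightarrow> y <= x"
 using cos_mono_le_eq[of "K * x" "K * y"] K_pos angle[of x] angle[of y] by (simp add: K_mu)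

text \<open>Integration by parts moves the derivative onto \<open>Psi\<close>, without boundary
  terms because w vanishes at 0 and h. The resulting double integral is half of its symmetrised
  version, where monotonicity of \<open>th\<close> meets that of the cosine.\<close>

lemma weighted_kernel_nonneg:
 assumes e: "e > 0" and w: "co {0..h} w" "!!x. x : {0..h} ==> w x >= 0" "w 0 = 0" "w h = 0"
 and th: "co {0..h} th" "!!x. x : {0..h} ==> th x >= 0" "!!x y. 0 <= x ==> x <= y ==> y <= h ==> th x <= th y"
 and F: "!!x. x : {0..h} ==> ((%x. th x * w x) hrd F' x) (at x)" "co {0..h} F'"
 shows "0 <= in0 h (%x. F' x * in0 h (%y. w y * Psi e x y))"
proof -
 let ?R = "%x. in0 h (%y. w y * Psi e x y)" and ?R' = "%x. in0 h (%y. w y * - Ne e x y)"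
 define T where "T = (%x y. th x * w x * (w y * Ne e x y))"
 note P = Psi_continuous[OF e]
 have j: "jc {0..h} {0..h} (%y x. w y * Psi e x y)" "jc {0..h} {0..h} (%y x. w y * - Ne e x y)"
 by (intro jc_mult jc_minus jc_space w; simp add: jc_def P)+
 have dR: "(?R hrd ?R' x) (wi x h)" if x: "x : {0..h}" for x
 by (rule integral_time_deriv[OF _ j x]) (auto intro!: dei DERIV_subset[OF Psi_deriv[OF e]])
 have cR: "co {0..h} ?R" "co {0..h} ?R'" by (rule jc_integral[OF j(1)], rule jc_integral[OF j(2)])
 have tw: "co {0..h} (%x. th x * w x)" by (intro cin w th)
 have "((%x. F' x * ?R x + ?R' x * (th x * w x)) has_integral (th h * w h) * ?R h - (th 0 * w 0) * ?R 0) {0..h}"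
 proof (rule fundamental_theorem_of_calculus)
 fix x assume x: "x : {0..h}"
 show "((%x. (th x * w x) * ?R x) has_vector_derivative F' x * ?R x + ?R' x * (th x * w x)) (wi x h)"
 unfolding hrv[symmetric]
 by (rule DERIV_mult[OF DERIV_subset[OF F(1)[OF x]] dR[OF x]]) simp
 qed (use h_pos in simp)
 hence "in0 h (%x. F' x * ?R x + ?R' x * (th x * w x)) = 0" using w(3,4) by (simp add: integral_unique)
 moreover have "in0 h (%x. F' x * ?R x + ?R' x * (th x * w x)) = in0 h (%x. F' x * ?R x) + in0 h (%x. ?R' x * (th x * w x))"
 by (rule hk_add) (intro icr cin F(2) cR tw)+
 moreover have "in0 h (%x. ?R' x * (th x * w x)) = - in0 h (%x. in0 h (%y. T x y))"
 unfolding T_def by (simp add: mult.commute)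
 ultimately have eq: "in0 h (%x. F' x * ?R x) = in0 h (%x. in0 h (%y. T x y))" by linarith
 have jT: "jc {0..h} {0..h} T" "jc {0..h} {0..h} (%x y. T y x)"
 unfolding T_def by (intro jc_mult jc_space jc_time w th; simp add: jc_def P)+
 have cT: "co (cbox (0, 0) (h, h)) (%(x, y). T x y)" by (subst cbox_Pair_eq) (use jT(1) in "simp add: jc_case cbox_interval")
 have sw: "in0 h (%x. in0 h (%y. T x y)) = in0 h (%x. in0 h (%y. T y x))"
 using integral_swap_continuous[OF cT] by (simp add: cbox_interval)
 have sl: "co {0..h} (%y. T x y)" "co {0..h} (%y. T y x)" if "x : {0..h}" for x
 using jc_slice_t[OF jT(1) that] jc_slice_t[OF jT(2) that] by auto
 have ci: "co {0..h} (%x. in0 h (%y. T x y))" "co {0..h} (%x. in0 h (%y. T y x))"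
 using jc_integral[OF jT(2)] jc_integral[OF jT(1)] by auto
 have "0 <= in0 h (%x. in0 h (%y. T x y) + in0 h (%y. T y x))"
 proof (rule hk_nonneg)
 show "(%x. in0 h (%y. T x y) + in0 h (%y. T y x)) integrable_on {0..h}"
 by (intro icr cin ci)
 fix x assume x: "x : {0..h}"
 have "in0 h (%y. T x y) + in0 h (%y. T y x) = in0 h (%y. T x y + T y x)"
 by (rule hk_add[symmetric]) (intro icr sl x)+
 also have "0 <= ..."
 proof (rule hk_nonneg)
 fix y assume y: "y : {0..h}"
 let ?p = "cos (K * x)" and ?q = "cos (K * y)"
 have sym: "Qe e ?q ?p = Qe e ?p ?q" by (rule Qe_sym)
 have "T x y + T y x = (w x * w y * (K * (sin (K * x) * sin (K * y)))) / (Qe e ?p ?q)^2 *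
 (th x * ((?p - ?q)^2 / 4 + e * (1 + ?q) + e^2 + (1 + ?p) * (?q - ?p) / 2) + th y * ((?q - ?p)^2 / 4 + e * (1 + ?p) + e^2 + (1 + ?q) * (?p - ?q) / 2))"
 unfolding T_def Ne_def sym by (rule symmetric_factorization)
 also have "0 <= ..."
 proof (rule mnn)
 show "0 <= (w x * w y * (K * (sin (K * x) * sin (K * y)))) / (Qe e ?p ?q)^2"
 using w(2) x y trig_nonneg(3) K_pos by (intro divide_nonneg_nonneg mnn) auto
 show "0 <= th x * ((?p - ?q)^2 / 4 + e * (1 + ?q) + e^2 + (1 + ?p) * (?q - ?p) / 2) + th y * ((?q - ?p)^2 / 4 + e * (1 + ?p) + e^2 + (1 + ?q) * (?p - ?q) / 2)"
 by (rule symmetrized_kernel_nonneg[OF e]) (use x y th(2)[of x] th(2)[of y] th(3)[of x y] th(3)[of y x] cos_le_iff[of x y] cos_le_iff[of y x] in auto)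
 qed
 finally show "0 <= T x y + T y x" .
 qed (intro icr cin sl x)
 finally show "0 <= in0 h (%y. T x y) + in0 h (%y. T y x)" .
 qed
 also have "... = 2 * in0 h (%x. in0 h (%y. T x y))"
 by (subst hk_add) (intro icr ci, intro icr ci, simp add: sw)
 finally show ?thesis unfolding eq by simp
qed

text \<open>The regularised velocity is, up to 2 pi, a difference of folded logarithms with
  parameters \<open>ep (rs n)\<close> and \<open>a\<close>. The weighted integral \<open>Z e\<close>
  of such a logarithm is nondecreasing in e, its derivative being the quantity of
  \<open>weighted_kernel_nonneg\<close>; hence Z (ep (rs n)) - Z a <= 0 once ep (rs n) <= a.\<close>

lemma velocity_cot_upper:
 assumes a: "a > 0" and c: "wsum 0 c" "hermitian c" and odd: "!!y. fs c (- y) = - fs c y"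
 and w: "!!x. x : {0..h} ==> fs c x >= 0"
 and th: "co {0..h} th" "!!x. x : {0..h} ==> th x >= 0" "!!x y. 0 <= x ==> x <= y ==> y <= h ==> th x <= th y"
 and F: "!!x. x : {0..h} ==> ((%x. th x * fs c x) hrd F' x) (at x)" "co {0..h} F'"
 "F' 0 = 0" "co {0..h} (%x. F' x * ct x)"
 and vel: "co {0..h} (velocity L a (fs c))"
 shows "in0 h (%x. F' x * ct x * velocity L a (fs c) x) <= 0"
proof -
 let ?w = "fs c" and ?g = "%x. F' x * ct x"
 have cw: "co A ?w" for A by (rule fs_continuous[OF c(1)])
 have w0: "?w 0 = 0" "?w h = 0" using odd[of 0] odd[of h] fs_periodic[of c "- h"] hh by (auto simp: h_def)
 define v where "v = (%e x. in0 h (%y. ?w y * (ln (s2 (x - y) + e) - ln (s2 (x + y) + e))))"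
 define P where "P = (%e x. in0 h (%y. ?w y * (1 / (s2 (x - y) + e) - 1 / (s2 (x + y) + e))))"
 define Z where "Z = (%e. in0 h (%x. ?g x * v e x))"
 have cs2: "co UNIV s2" unfolding s2_def[abs_def] by (intro cin)
 have s2pos: "s2 z + e > 0" if "e > 0" for e z using s2_nonneg[of z] that by linarith
 have s2ne: "s2 z + e ~= 0" if "e > 0" for e z using s2pos[OF that, of z] by simp
 have mono: "Z e <= Z a" if e: "0 < e" "e <= a" for e
 proof -
 let ?I = "{e..a}"
 have ne: "s2 z + r ~= 0" if "r : ?I" for r z using s2pos[of r z] that e by auto
 have ic: "co A (%p. s2 (f p))" if "co A f" for f :: "'b::topological_space => real" and A
 by (rule coc[OF cs2 that]) simp
 have jv: "jc {0..h} ?I (%x r. v r x)" "jc {0..h} ?I (%x r. P r x)"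
 proof -
 have "co (({0..h} \<times> ?I) \<times> cbox 0 h) (%(p, y). ?w y * (ln (s2 (fst p - y) + snd p) - ln (s2 (fst p + y) + snd p)))"
 "co (({0..h} \<times> ?I) \<times> cbox 0 h) (%(p, y). ?w y * (1 / (s2 (fst p - y) + snd p) - 1 / (s2 (fst p + y) + snd p)))"
 unfolding case_prod_unfold by (intro cin ic coc[OF cw[of UNIV], of _ snd]; auto simp: ne)+
 from this[THEN integral_continuous_on_param] show "jc {0..h} ?I (%x r. v r x)" "jc {0..h} ?I (%x r. P r x)"
 unfolding jc_def v_def P_def cbox_interval by auto
 qed
 have dv: "((%r. v r x) hrd P r x) (at r within ?I)" if r: "r : ?I" for r x
 unfolding v_def P_def
 proof (rule integral_time_deriv[OF _ _ _ r])
 show "((%r. ?w y * (ln (s2 (x - y) + r) - ln (s2 (x + y) + r))) hrd ?w y * (1 / (s2 (x - y) + r) - 1 / (s2 (x + y) + r))) (at r within ?I)" if "r : ?I" for y r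
 using s2pos[of r] that e by (auto intro!: dei simp: divide_inverse)
 show "jc {0..h} ?I (%y r. ?w y * (ln (s2 (x - y) + r) - ln (s2 (x + y) + r)))" "jc {0..h} ?I (%y r. ?w y * (1 / (s2 (x - y) + r) - 1 / (s2 (x + y) + r)))"
 unfolding jc_def by (intro cin ic coc[OF cw[of UNIV], of _ fst]; auto simp: ne)+
 qed simp
 have jg: "jc {0..h} ?I (%x r. ?g x)" by (rule jc_space[OF F(4)])
 have dZ: "(Z hrd in0 h (%x. ?g x * P r x)) (at r within ?I)" if r: "r : ?I" for r
 unfolding Z_def by (rule integral_time_deriv[OF _ jc_mult[OF jg jv(1)] jc_mult[OF jg jv(2)] r]) (auto intro!: dei dv)
 have sgn: "0 <= in0 h (%x. ?g x * P r x)" if r: "r : ?I" for r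
 proof -
 have r0: "r > 0" using r e by auto
 have "?g x * P r x = F' x * in0 h (%y. ?w y * Psi r x y)" if x: "x : {0..h}" for x
 proof (cases "x = 0")
 case False
 have "ct x * P r x = in0 h (%y. ct x * (?w y * (1 / (s2 (x - y) + r) - 1 / (s2 (x + y) + r))))" by (simp add: P_def)
 also have "... = in0 h (%y. ?w y * Psi r x y)"
 proof (rule integral_cong)
 fix y assume "y : {0..h}"
 have sn: "sin (mu * x) ~= 0" using sin_pos[of x] x False by auto
 have "ct x * sin (K * x) = 2 * (cos (mu * x))^2" using sn sin_double[of "mu * x"] by (simp add: ct_def cot_def K_mu p2q mult_ac)
 also have "... = 1 + cos (K * x)" using cos_double_cos[of "mu * x"] by (simp add: K_mu mult_ac)
 finally have c1: "ct x * sin (K * x) = 1 + cos (K * x)" .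
 have "1 / (s2 (x - y) + r) - 1 / (s2 (x + y) + r) = (s2 (x + y) - s2 (x - y)) / ((s2 (x + y) + r) * (s2 (x - y) + r))"
 using s2pos[OF r0, of "x - y"] s2pos[OF r0, of "x + y"] by (simp add: divide_simps)
 also have "... = sin (K * x) * sin (K * y) / Qe r (cos (K * x)) (cos (K * y))" by (simp only: s2_diff Qe_s2)
 finally have d: "1 / (s2 (x - y) + r) - 1 / (s2 (x + y) + r) = sin (K * x) * sin (K * y) / Qe r (cos (K * x)) (cos (K * y))" .
 show "ct x * (?w y * (1 / (s2 (x - y) + r) - 1 / (s2 (x + y) + r))) = ?w y * Psi r x y"
 unfolding d Psi_def c1[symmetric] by simp
 qed
 finally show ?thesis by (simp add: mult.assoc)
 qed (use F(3) in simp)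
 hence "in0 h (%x. ?g x * P r x) = in0 h (%x. F' x * in0 h (%y. ?w y * Psi r x y))" by (rule integral_cong)
 also have "0 <= ..." by (rule weighted_kernel_nonneg[OF r0 cw w w0 th F(1,2)])
 finally show ?thesis .
 qed
 show ?thesis
 proof (rule DERIV_nonneg_imp_increasing_open[OF e(2)])
 show "\<exists>y. (Z hrd y) (at r) & 0 <= y" if "e < r" "r < a" for r
 using dZ[of r] sgn[of r] that by (intro exI[of _ "in0 h (%x. ?g x * P r x)"]) (simp add: at_within_Icc_at)
 show "co {e..a} Z" by (rule DERIV_continuous_on[OF dZ])
 qed
 qed
 have un: "2 * pi * velocity_reg n a ?w x = v (ep (rs n)) x - v a x" for n x
 proof -
 have i: "(%y. ?w y * (ln (s2 (x - y) + e) - ln (s2 (x + y) + e))) integrable_on {0..h}" if "e > 0" for e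
 by (intro icr cin cw coc[OF cs2, of _ "%y. x - y"] coc[OF cs2, of _ "%y. x + y"]) (auto simp: s2ne[OF that])
 have "2 * pi * velocity_reg n a ?w x = - in0 h (%y. ?w y * (kr (ep (rs n)) a (x + y) - kr (ep (rs n)) a (x - y)))"
 using velocity_reg_half[OF a cw odd fs_periodic, of n x] by simp
 also have "... = in0 h (%y. ?w y * (ln (s2 (x - y) + ep (rs n)) - ln (s2 (x + y) + ep (rs n))) - ?w y * (ln (s2 (x - y) + a) - ln (s2 (x + y) + a)))"
 unfolding integral_neg[symmetric] by (intro integral_cong) (simp add: kr_def als)
 also have "... = v (ep (rs n)) x - v a x" unfolding v_def by (rule hk_diff[OF i[OF ep_rs(1)] i[OF a]])
 finally show ?thesis .
 qed
 have cv: "co {0..h} (v e)" if "e > 0" for e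
 proof -
 have "co ({0..h} \<times> cbox 0 h) (%(x, y). ?w y * (ln (s2 (x - y) + e) - ln (s2 (x + y) + e)))"
 unfolding case_prod_unfold
 by (intro cin coc[OF cw[of UNIV], of _ snd] coc[OF cs2, of _ "%p. fst p - snd p"] coc[OF cs2, of _ "%p. fst p + snd p"]) (auto simp: s2ne[OF that])
 from integral_continuous_on_param[OF this] show ?thesis unfolding v_def cbox_interval .
 qed
 have vn: "velocity_reg n a ?w x = (v (ep (rs n)) x - v a x) / (2 * pi)" for n x using un[of n x] by (simp add: fsi)
 have cn: "co {0..h} (velocity_reg n a ?w)" for n unfolding vn using cv[OF ep_rs(1)] cv[OF a] by (intro cin) auto
 have neg: "in0 h (%x. ?g x * velocity_reg n a ?w x) <= 0" if n: "ep (rs n) <= a" for n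
 proof -
 have "2 * pi * in0 h (%x. ?g x * velocity_reg n a ?w x) = in0 h (%x. ?g x * v (ep (rs n)) x - ?g x * v a x)"
 unfolding integral_mult_right[symmetric] by (intro integral_cong) (simp only: mult.left_commute[of "2 * pi"] un right_diff_distrib)
 also have "... = Z (ep (rs n)) - Z a" unfolding Z_def
 by (rule hk_diff) (intro icr cin F(4) cv ep_rs a)+
 also have "... <= 0" using mono[OF ep_rs(1) n] by simp
 finally have "2 * pi * in0 h (%x. ?g x * velocity_reg n a ?w x) <= 2 * pi * 0" by simp
 thus ?thesis by (rule mult_left_le_imp_le) simp
 qed
 \<comment> \<open>The dominating function for the limit in n comes from the Fourier side: the
   multipliers \<open>vme n a\<close> are bounded uniformly in n, hence so are the regularised
   velocities.\<close>
 obtain Bv where Bv: "!!n k. |vme n a k| <= Bv"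
 proof
 fix n k
 have "|lc (rs n) k - lc (rr a) k| <= 2 + ( |ln (4 * rr a) | + 1)"
 using lc_abs_le[of "rs n" k] rs[of n] lc_bounded[of "rr a" k] ep_rr[OF a] by auto
 thus "|vme n a k| <= (2 + ( |ln (4 * rr a) | + 1)) / K" using K_pos by (simp add: vme_def divide_right_mono)
 qed
 define B where "B = K ^ 0 * Bv * (ISUM k. (wt k) ^ 0 * norm (c k))"
 have ub: "|velocity_reg n a ?w x| <= B" for n x
 unfolding velocity_reg_fs[OF a c] B_def
 using order_trans[OF fs_abs_le[OF wsum_Dn_le(1)[of 0 c 0 "vme n a", OF c(1) _ Bv]] wsum_Dn_le(2)[of 0 c 0 "vme n a", OF c(1) _ Bv]] by simp
 have lim: "(%n. in0 h (%x. ?g x * velocity_reg n a ?w x)) \<longlonglongrightarrow> in0 h (%x. ?g x * velocity L a ?w x)"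
 proof (rule dominated_convergence(2)[where h="%x. | ?g x| * B"])
 show "norm (?g x * velocity_reg n a ?w x) <= | ?g x| * B" for n x
 using mlm[OF ub[of n x], of "| ?g x|"] by (simp add: abs_mult)
 show "(%n. ?g x * velocity_reg n a ?w x) \<longlonglongrightarrow> ?g x * velocity L a ?w x" for x
 by (rule tendsto_mult[OF tendsto_const velocity_reg_lim[OF a cw]])
 qed (intro icr cin F(4) cn)+
 have "\<forall>\<^sub>F n in sequentially. in0 h (%x. ?g x * velocity_reg n a ?w x) <= 0"
 using order_tendstoD(2)[OF ep_rs_lim a] by (rule eventually_mono) (use neg in simp)
 from tendsto_upperbound[OF lim this] show ?thesis by simp
qed

end

section \<open>Differential inequalities with finite lifetime\<close>

lemma nondecreasing_within:
 fixes f :: "real => real"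
 assumes d: "!!t. t : {0..s} ==> (f hrd f' t) (wi t s)"
 and nn: "!!t. u < t ==> t < v ==> 0 <= f' t" and uv: "0 <= u" "u <= v" "v <= s"
 shows "f u <= f v"
proof (rule DERIV_nonneg_imp_increasing_open[OF uv(2)])
 fix x assume x: "u < x" "x < v"
 have "(f hrd f' x) (at x)" by (rule within_imp_at[OF d]) (use x uv in auto)
 thus "\<exists>y. (f hrd y) (at x) & 0 <= y" using nn[OF x] by blast
next
 show "co {u..v} f" by (rule continuous_on_subset[OF DERIV_continuous_on[OF d]]) (use uv in auto)
qed

text \<open>The product y = I J satisfies y' >= k (J^2 + I^3), which dominates k y^(6/5); so
  \<open>y t powr (- 1 / 5)\<close> decreases at least at rate k / 5 while staying nonnegative.
  Since J may start at 0, the argument begins at time 1.\<close>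

lemma blowup_time_bound:
 fixes I J :: "real => real"
 assumes s: "s >= 1" and c: "c1 > 0" "c2 > 0" and i0: "I 0 = i0" "i0 > 0" and j0: "J 0 >= 0"
 and dI: "!!t. t : {0..s} ==> (I hrd I' t) (wi t s)" "!!t. t : {0..s} ==> I' t >= c1 * J t"
 and dJ: "!!t. t : {0..s} ==> (J hrd J' t) (wi t s)" "!!t. t : {0..s} ==> J' t >= c2 * (I t)^2"
 shows "s <= 1 + 5 / min c1 c2 * (i0 * (c2 * i0^2)) powr (- 1 / 5)"
proof -
 note mono = nondecreasing_within
 have J'0: "0 <= J' u" if "u : {0..s}" for u
 using order_trans[OF mnn[OF less_imp_le[OF c(2)] zero_le_power2] dJ(2)[OF that]] .
 have J0: "J t >= 0" if t: "t : {0..s}" for t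
 proof -
 have "J 0 <= J t" by (rule mono[OF dJ(1)]) (use t J'0 in auto)
 thus ?thesis using j0 by simp
 qed
 have Ii: "i0 <= I t" if t: "t : {0..s}" for t
 proof -
 have "0 <= I' u" if "u : {0..s}" for u using order_trans[OF mnn[OF less_imp_le[OF c(1)] J0[OF that]] dI(2)[OF that]] .
 note I'0 = this
 have "I 0 <= I t" by (rule mono[OF dI(1)]) (use t I'0 in auto)
 thus ?thesis using i0 by simp
 qed
 \<comment> \<open>One unit of time makes J positive: its derivative is at least c2 i0^2 because I
   never falls below i0.\<close>
 have "c2 * i0^2 <= J 1"
 proof -
 have "J 0 - c2 * i0^2 * 0 <= J 1 - c2 * i0^2 * 1"
 proof (rule mono[where f="%t. J t - c2 * i0^2 * t" and f'="%t. J' t - c2 * i0^2"])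
 show "((%t. J t - c2 * i0^2 * t) hrd J' t - c2 * i0^2) (wi t s)" if "t : {0..s}" for t
 by (rule DERIV_cong[OF DERIV_diff[OF dJ(1)[OF that] DERIV_cmult[OF DERIV_ident]]]) simp
 fix t :: real assume t: "0 < t" "t < 1"
 hence ts: "t : {0..s}" using s by auto
 have "c2 * i0^2 <= c2 * (I t)^2" using c i0 Ii[OF ts] by (intro mlm power_mono) auto
 thus "0 <= J' t - c2 * i0^2" using dJ(2)[OF ts] by simp
 qed (use s in auto)
 thus ?thesis using j0 by simp
 qed
 define k where "k = min c1 c2"
 define y where "y = (%t. I t * J t)"
 have k: "k > 0" "k <= c1" "k <= c2" using c by (auto simp: k_def)
 have J1: "c2 * i0^2 <= J t" if t: "t : {1..s}" for t
 proof -
 have "J 1 <= J t" by (rule mono[OF dJ(1)]) (use t J'0 in auto)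
 thus ?thesis using \<open>c2 * i0^2 <= J 1\<close> by simp
 qed
 have c2i: "c2 * i0^2 > 0" using c i0 by simp
 have ypos: "y t > 0" "I t > 0" "J t > 0" if "t : {1..s}" for t
 using Ii[of t] J1[OF that] that i0 c2i by (auto simp: y_def intro!: mult_pos_pos)
 have key: "k * y t powr (6 / 5) <= I' t * J t + I t * J' t" if t: "t : {1..s}" for t
 proof -
 have ts: "t : {0..s}" using t by auto
 note p = ypos[OF t]
 have i3: "(I t) ^ 3 = I t powr 3" and j2: "(J t)^2 = J t powr 2" using p by simp_all
 have pw: "y t powr (6 / 5) <= (J t)^2 + (I t) ^ 3"
 \<comment> \<open>If I <= J^(2/3) then y <= J^(5/3), otherwise y <= I^(5/2); the exponent 6/5 turns
   these into J^2 and I^3.\<close>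
 proof (cases "(I t) ^ 3 <= (J t)^2")
 case True
 have "I t = ((I t) ^ 3) powr (1 / 3)" unfolding i3 powr_powr using p by simp
 also have "... <= ((J t)^2) powr (1 / 3)" using True p by (intro powr_mono2) auto
 also have "... = J t powr (2 / 3)" unfolding j2 powr_powr by simp
 finally have "I t * J t <= J t powr (2 / 3) * J t" using p by (intro mrm) auto
 moreover have "J t powr (2 / 3) * J t powr 1 = J t powr (5 / 3)" unfolding powr_add[symmetric] by simp
 hence "J t powr (2 / 3) * J t = J t powr (5 / 3)" using p by simp
 ultimately have "y t <= J t powr (5 / 3)" by (simp add: y_def)
 hence "y t powr (6 / 5) <= (J t powr (5 / 3)) powr (6 / 5)" using p by (intro powr_mono2) auto
 also have "... = (J t)^2" unfolding j2 powr_powr by simp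
 also have "... <= (J t)^2 + (I t) ^ 3" using p by simp
 finally show ?thesis .
 next
 case False
 have "J t = ((J t)^2) powr (1 / 2)" unfolding j2 powr_powr using p by simp
 also have "... <= ((I t) ^ 3) powr (1 / 2)" using False p by (intro powr_mono2) auto
 also have "... = I t powr (3 / 2)" unfolding i3 powr_powr by simp
 finally have "I t * J t <= I t * I t powr (3 / 2)" using p by (intro mlm) auto
 moreover have "I t powr 1 * I t powr (3 / 2) = I t powr (5 / 2)" unfolding powr_add[symmetric] by simp
 hence "I t * I t powr (3 / 2) = I t powr (5 / 2)" using p by simp
 ultimately have "y t <= I t powr (5 / 2)" by (simp add: y_def)
 hence "y t powr (6 / 5) <= (I t powr (5 / 2)) powr (6 / 5)" using p by (intro powr_mono2) auto
 also have "... = (I t) ^ 3" unfolding i3 powr_powr by simp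
 also have "... <= (J t)^2 + (I t) ^ 3" by simp
 finally show ?thesis .
 qed
 have "k * y t powr (6 / 5) <= k * ((J t)^2 + (I t) ^ 3)" using pw k by (intro mlm) auto
 also have "... = k * (J t)^2 + k * (I t) ^ 3" by (rule distrib_left)
 also have "... <= c1 * (J t)^2 + c2 * (I t) ^ 3" using k p by (intro add_mono mrm) auto
 also have "... = (c1 * J t) * J t + I t * (c2 * (I t)^2)" by (simp add: p2q power3_eq_cube)
 also have "... <= I' t * J t + I t * J' t" using dI(2)[OF ts] dJ(2)[OF ts] p by (intro add_mono mlm mrm) auto
 finally show ?thesis .
 qed
 define z where "z = (%t. y t powr (- 1 / 5) + k / 5 * t)"
 have "z s <= z 1"
 proof (rule DERIV_nonpos_imp_decreasing_open[OF s])
 have dy: "(y hrd I' t * J t + J' t * I t) (wi t s)" if "t : {0..s}" for t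
 unfolding y_def by (rule DERIV_mult[OF dI(1)[OF that] dJ(1)[OF that]])
 show "co {1..s} z" unfolding z_def
 using continuous_on_subset[OF DERIV_continuous_on[OF dy], of "{1..s}"] ypos(1) by (intro cin) (auto simp: less_imp_neq[symmetric])
 fix t assume t: "1 < t" "t < s"
 hence t1: "t : {1..s}" by simp
 have d: "(y hrd I' t * J t + J' t * I t) (at t)" by (rule within_imp_at[OF dy]) (use t in auto)
 have "((%t. y t powr (- 1 / 5)) hrd (- 1 / 5) * y t powr (- 1 / 5 - 1) * (I' t * J t + J' t * I t)) (at t)"
 using DERIV_fun_powr[OF d ypos(1)[OF t1], of "- 1 / 5"] by simp
 from DERIV_add[OF this DERIV_cmult[OF DERIV_ident, of "k / 5"]]
 have dz: "(z hrd (- 1 / 5) * y t powr (- 1 / 5 - 1) * (I' t * J t + J' t * I t) + k / 5 * 1) (at t)"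
 unfolding z_def .
 have one: "y t powr (6 / 5) * y t powr (- 1 / 5 - 1) = 1" unfolding powr_add[symmetric] using ypos(1)[OF t1] by simp
 have "k * (y t powr (6 / 5) * y t powr (- 1 / 5 - 1)) <= (I' t * J t + I t * J' t) * y t powr (- 1 / 5 - 1)"
 unfolding mult.assoc[symmetric] by (rule mrm[OF key[OF t1]]) simp
 hence "k <= y t powr (- 1 / 5 - 1) * (I' t * J t + J' t * I t)" unfolding one by (simp only: mult.commute mult_1 mult_1_right)
 hence "(- 1 / 5) * y t powr (- 1 / 5 - 1) * (I' t * J t + J' t * I t) + k / 5 * 1 <= 0" unfolding mult.assoc by linarith
 thus "\<exists>w. (z hrd w) (at t) & w <= 0" using dz by blast
 qed
 hence "y s powr (- 1 / 5) + k / 5 * s <= y 1 powr (- 1 / 5) + k / 5 * 1" unfolding z_def .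
 moreover have "k / 5 * (s - 1) = k / 5 * s - k / 5 * 1" by (rule right_diff_distrib)
 ultimately have "k / 5 * (s - 1) <= y 1 powr (- 1 / 5)" using powr_ge_zero[of "y s" "- 1 / 5"] by linarith
 also have "... <= (i0 * (c2 * i0^2)) powr (- 1 / 5)"
 proof (rule powr_mono2')
 show "i0 * (c2 * i0^2) <= y 1" unfolding y_def using Ii[of 1] J1[of 1] s i0 c2i by (intro mult_mono) auto
 qed (use i0 c2i in auto)
 finally have "s - 1 <= 5 / k * (i0 * (c2 * i0^2)) powr (- 1 / 5)" using k by (simp add: fsi)
 thus ?thesis by (simp add: k_def)
qed

section \<open>The functionals I and J along a solution\<close>

context circle begin

text \<open>sin z - z cos z has derivative z sin z, which is nonnegative on the range in
  question.\<close>

lemma ct_le: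
 assumes x: "0 < x" "x <= h"
 shows "ct x <= 1 / (mu * x)"
proof -
 have y: "0 < mu * x" "mu * x <= pi / 2" using angle[of x] x mu_pos by auto
 have "sin 0 - 0 * cos 0 <= sin (mu * x) - (mu * x) * cos (mu * x)"
 proof (rule DERIV_nonneg_imp_nondecreasing[of 0 "mu * x" "%z. sin z - z * cos z"])
 fix z assume z: "0 <= z" "z <= mu * x"
 have "((%z. sin z - z * cos z) hrd z * sin z) (at z)" by (auto intro!: dei)
 moreover have "0 <= z * sin z" using z y by (intro mnn sin_ge_zero) auto
 ultimately show "\<exists>w. ((%z. sin z - z * cos z) hrd w) (at z) & 0 <= w" by blast
 qed (use y in simp)
 thus ?thesis using y sin_pos[OF x] x mu_pos by (simp add: ct_def cot_def divide_simps mult_ac)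
qed

lemma ct_isCont: "0 < x ==> x <= h ==> isCont ct x"
 unfolding ct_def[abs_def] cot_def using sin_pos[of x] by (intro cin) auto

lemma ct_deriv:
 assumes "0 < x" "x <= h"
 shows "(ct hrd - mu * (1 + (ct x)^2)) (at x)"
proof -
 have s: "sin (mu * x) ~= 0" using sin_pos[OF assms] by simp
 have gen: "((- (S * mu)) * S - C * (C * mu)) / (S * S) = - mu * (1 + (C / S)^2)" if "S ~= 0" for S C :: real
 using that by (simp add: fsi p2q)
 have dc: "((%x. cos (mu * x)) hrd - (sin (mu * x) * mu)) (at x)" by (auto intro!: dei)
 have ds: "((%x. sin (mu * x)) hrd cos (mu * x) * mu) (at x)" by (auto intro!: dei)
 show ?thesis using DERIV_divide[OF dc ds s] unfolding gen[OF s] by (simp add: ct_def[abs_def] cot_def)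
qed

text \<open>The weight is at most 1 / (mu x), so a quadratic zero at x = 0 leaves a product of size
  x, continuous with the value 0 that \<open>ct 0\<close> produces.\<close>

lemma cot_weight_jc:
 assumes j: "jc {0..h} S F" and q: "!!x t. x : {0..h} ==> t : S ==> |F x t| <= C * (x * x)"
 shows "jc {0..h} S (%x t. F x t * ct x)"
 unfolding jc_def continuous_on_def
proof
 fix p0 assume p0: "p0 : {0..h} \<times> S"
 let ?W = "at p0 within {0..h} \<times> S"
 have lF: "((%p. F (fst p) (snd p)) \<longlongrightarrow> F (fst p0) (snd p0)) ?W" using j p0 by (auto simp: jc_def continuous_on_def)
 show "((%p. F (fst p) (snd p) * ct (fst p)) \<longlongrightarrow> F (fst p0) (snd p0) * ct (fst p0)) ?W"
 proof (cases "fst p0 = 0")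
 case False
 hence "isCont ct (fst p0)" using p0 by (intro ct_isCont) auto
 hence "((%p. ct (fst p)) \<longlongrightarrow> ct (fst p0)) ?W"
 by (rule isCont_tendsto_compose) (intro tendsto_intros)
 with lF show ?thesis by (rule tendsto_mult)
 next
 case True
 have C0: "0 <= C * (h * h)" using order_trans[OF abs_ge_zero q[of h "snd p0"]] p0 h_pos by auto
 have C: "0 <= C"
 proof (rule ccontr)
 assume "\<not> 0 <= C"
 hence "C * (h * h) < 0" using h_pos by (intro mult_neg_pos) auto
 thus False using C0 by simp
 qed
 have "((%p. F (fst p) (snd p) * ct (fst p)) \<longlongrightarrow> 0) ?W"
 proof (rule Lim_null_comparison)
 show "\<forall>\<^sub>F p in ?W. norm (F (fst p) (snd p) * ct (fst p)) <= C / mu * fst p"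
 unfolding eventually_at_filter
 proof (rule always_eventually, intro allI impI)
 fix p assume p: "p : {0..h} \<times> S"
 show "norm (F (fst p) (snd p) * ct (fst p)) <= C / mu * fst p"
 proof (cases "fst p = 0")
 case False
 hence x: "0 < fst p" "fst p <= h" using p by auto
 have "norm (F (fst p) (snd p) * ct (fst p)) = |F (fst p) (snd p) | * ct (fst p)" using trig_nonneg(4)[of "fst p"] x by (simp add: abs_mult)
 also have "... <= (C * (fst p * fst p)) * (1 / (mu * fst p))"
 using q[of "fst p" "snd p"] p C x trig_nonneg(4)[of "fst p"] by (intro mult_mono ct_le) (auto intro!: mnn)
 also have "... = C / mu * fst p" using x mu_pos by simp
 finally show ?thesis .
 qed (simp add: ct_def cot_def)
 qed
 have "((%p. C / mu * fst p) \<longlongrightarrow> C / mu * fst p0) ?W" by (intro tendsto_intros)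
 thus "((%p. C / mu * fst p) \<longlongrightarrow> 0) ?W" using True by simp
 qed
 thus ?thesis using True by (simp add: ct_def cot_def)
 qed
qed

lemma linear_bound:
 assumes d: "!!x t. t : S ==> ((%x. f x t) hrd fx x t) (at x)" and j: "jc UNIV S fx" and S: "compact S"
 and z: "!!t. t : S ==> f 0 t = 0"
 obtains C where "C >= 0" "!!x t. x : {0..h} ==> t : S ==> |f x t| <= C * x"
proof -
 obtain C where C: "C >= 0" "!!x t. x : {0..h} ==> t : S ==> |fx x t| <= C"
 by (rule jc_bounded[of "{0..h}" S fx, OF jc_subset[OF j]]) (use S that in auto)
 have "|f x t| <= C * x" if "x : {0..h}" "t : S" for x t
 proof -
 have "norm (f x t - f 0 t) <= C * norm (x - 0)"
 by (rule field_differentiable_bound[of "{0..h}" "%x. f x t" "%x. fx x t"])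
 (use d that C h_pos in "auto intro: has_field_derivative_at_within")
 thus ?thesis using z that by simp
 qed
 thus ?thesis using C(1) that by blast
qed

text \<open>Joint continuity is taken from the Sobolev side, through \<open>csol_sobolev\<close> and
  \<open>sd_jc\<close>.\<close>

lemma theta_jc:
 assumes sol: "csol a s b p"
 shows "jc UNIV {0..s} (theta p)"
proof -
 have cs: "continuous_into_sobolev L (Suc 0) {0..s} (theta p)" by (rule csol_sobolev(2)[OF sol])
 have one: "|o1 k| <= 1" for k by simp
 have J: "jc UNIV {0..s} (sd o1 0 (theta p))" by (rule sd_jc[where q=o1, OF cs one]) simp
 have e: "theta p x t = sd o1 0 (theta p) x t" if t: "t : {0..s}" for x t
 by (rule sd_representation[OF cs one t DERIV_continuous_on[OF has_field_derivative_at_within[OF theta_deriv[OF csol_rapid(2)[OF sol] t csol_odd(4)[OF sol t]]]]])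
 show ?thesis using J unfolding jc_def by (rule continuous_on_eq) (simp add: e[symmetric] mem_Times_iff)
qed

text \<open>Nonnegative \<rho> and \<omega> let the kernel bounds pass under the integral, and
  quadratic zeros at 0 let I and J be differentiated in time despite the singular weight. The bound
  involves the data alone, so it limits every existence time at once.\<close>

theorem csol_time_bound:
 assumes a: "a > 0" and sol: "csol a s b p" and s: "s >= 1"
 and init: "!!x. sr b 0 x 0 = 0" "!!x. sr p 0 x 0 = sin (K * x)"
 shows "s <= 1 + 5 / min (a / (1 + a) / (2 * pi)) (mu / (2 * h)) *
 (in0 h (%x. theta p x 0 * ct x) * (mu / (2 * h) * (in0 h (%x. theta p x 0 * ct x))^2)) powr (- 1 / 5)"
proof -
 let ?W = "sr b 0" and ?W1 = "sr b 1" and ?R = "sr p 0" and ?R1 = "sr p 1" and ?U = "us a b 0" and ?U1 = "us a b 1" and ?th = "theta p"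
 let ?S = "{0..s}"
 have s0: "0 <= s" using s by simp
 have F: "((%x. ?W x t) hrd ?W1 x t) (at x)" "((%x. ?R x t) hrd ?R1 x t) (at x)"
 "((%x. ?U x t) hrd ?U1 x t) (at x)" "((%x. ?th x t) hrd ?R x t) (at x)" if t: "t : ?S" for x t
 using csol_fields(1,2,3)[OF a sol t, of 0 x] theta_deriv[OF csol_rapid(2)[OF sol] t csol_odd(4)[OF sol t]] by simp_all
 have odd: "b (- k) t = - b k t" "p (- k) t = - p k t" if "t : ?S" for k t using csol_odd[OF sol that] by auto
 have van: "?W 0 t = 0" "?W h t = 0" "?R 0 t = 0" "?R h t = 0" "?U 0 t = 0" "?U h t = 0" if t: "t : ?S" for t
 using sr_vanish[where b=b and t=t, OF odd(1)[OF t]] sr_vanish(1,2)[where b=p and t=t, OF odd(2)[OF t]] by (auto simp: h_def)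
 have th0: "?th 0 t = 0" if "t : ?S" for t by (rule theta_0[OF csol_rapid(2)[OF sol] that])
 note JU = sr_jc(1)[OF sol] sr_jc(2)[OF sol] us_jc[OF a sol] theta_jc[OF sol]
 have sub: "jc UNIV ?S f ==> jc {0..h} ?S f" for f by (erule jc_subset) auto
 note J = JU[THEN sub]
 \<comment> \<open>The maximum principle for - \<rho>: its source u_x \<rho> is at most B times -
   \<rho> wherever - \<rho> is positive, and the velocity vanishes at both ends of the half
   period.\<close>
 have R: "?R x r >= 0" if x: "x : {0..h}" and r: "r : ?S" for x r
 proof -
 obtain B where B: "!!x t. x : {0..h} ==> t : ?S ==> | ?U1 x t| <= B" by (rule jc_bounded[OF J(3)[of 1] compact_Icc compact_Icc]) (rule that)
 have rs: "{0..r} \<subseteq> ?S" using r by auto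
 have "- ?R x r <= 0"
 proof (rule transport_nonpositive[where f="%x t. - ?R x t" and fx="%x t. - ?R1 x t" and u="?U" and ux="?U1" and G="%x t. ?U1 x t * ?R x t" and M=B, OF h_pos])
 show "jc {0..h} {0..r} (%x t. - ?R x t)" "jc {0..h} {0..r} (%x t. - ?R1 x t)" "jc {0..h} {0..r} ?U" "jc {0..h} {0..r} ?U1" "jc {0..h} {0..r} (%x t. ?U1 x t * ?R x t)"
 using rs by (auto intro!: jc_minus jc_mult jc_subset[OF J(2)] jc_subset[OF J(3)])
 fix x t assume xt: "x : {0..h}" "t : {0..r}"
 hence t: "t : ?S" using rs by auto
 show "((%x. - ?R x t) hrd - ?R1 x t) (at x)" by (rule DERIV_minus[OF F(2)[OF t]])
 show "((%x. ?U x t) hrd ?U1 x t) (at x)" by (rule F(3)[OF t])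
 show "((%t. - ?R x t) hrd - ?U x t * - ?R1 x t + ?U1 x t * ?R x t) (wi t r)"
 by (rule DERIV_cong[OF DERIV_minus[OF DERIV_subset[OF csol_fields(5)[OF a sol t] rs]]]) simp
 assume pos: "0 < - ?R x t"
 have "- ?U1 x t * - ?R x t <= B * - ?R x t" using B[OF xt(1) t] pos by (intro mrm) auto
 thus "?U1 x t * ?R x t <= B * - ?R x t" by simp
 next
 show "- ?R x 0 <= 0" if "x : {0..h}" for x using trig_nonneg(3)[of x] that init(2) by simp
 qed (use r x van rs in auto)
 thus ?thesis by simp
 qed
 have W: "?W x r >= 0" if x: "x : {0..h}" and r: "r : ?S" for x r
 proof -
 have rs: "{0..r} \<subseteq> ?S" using r by auto
 have "- ?W x r <= 0"
 proof (rule transport_nonpositive[where f="%x t. - ?W x t" and fx="%x t. - ?W1 x t" and u="?U" and ux="?U1" and G="%x t. - ?R x t" and M=0, OF h_pos])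
 show "jc {0..h} {0..r} (%x t. - ?W x t)" "jc {0..h} {0..r} (%x t. - ?W1 x t)" "jc {0..h} {0..r} ?U" "jc {0..h} {0..r} ?U1" "jc {0..h} {0..r} (%x t. - ?R x t)"
 using rs by (auto intro!: jc_minus jc_mult jc_subset[OF J(2)] jc_subset[OF J(3)] jc_subset[OF J(1)])
 fix x t assume xt: "x : {0..h}" "t : {0..r}"
 hence t: "t : ?S" using rs by auto
 show "((%x. - ?W x t) hrd - ?W1 x t) (at x)" by (rule DERIV_minus[OF F(1)[OF t]])
 show "((%x. ?U x t) hrd ?U1 x t) (at x)" by (rule F(3)[OF t])
 show "((%t. - ?W x t) hrd - ?U x t * - ?W1 x t + - ?R x t) (wi t r)"
 by (rule DERIV_cong[OF DERIV_minus[OF DERIV_subset[OF csol_fields(4)[OF a sol t] rs]]]) simp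
 show "- ?R x t <= 0 * - ?W x t" using R[OF xt(1) t] by simp
 next
 show "- ?W x 0 <= 0" if "x : {0..h}" for x using init(1) by simp
 qed (use r x van rs in auto)
 thus ?thesis by simp
 qed
 obtain CW where CW: "CW >= 0" "!!x t. x : {0..h} ==> t : ?S ==> | ?W x t| <= CW * x" by (rule linear_bound[OF F(1) JU(1) compact_Icc van(1)]; (assumption | rule that))
 obtain CR where CR: "CR >= 0" "!!x t. x : {0..h} ==> t : ?S ==> | ?R x t| <= CR * x" by (rule linear_bound[OF F(2) JU(2) compact_Icc van(3)]; (assumption | rule that))
 obtain CU where CU: "CU >= 0" "!!x t. x : {0..h} ==> t : ?S ==> | ?U x t| <= CU * x" by (rule linear_bound[OF F(3) JU(3) compact_Icc van(5)]; (assumption | rule that))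
 \<comment> \<open>\<rho> vanishes linearly at 0 and \<theta> is its integral from 0, so \<theta>
   vanishes quadratically.\<close>
 have Cth: "| ?th x t| <= CR * (x * x)" if x: "x : {0..h}" and t: "t : ?S" for x t
 proof -
 have "norm (?th x t - ?th 0 t) <= (CR * x) * norm (x - 0)"
 proof (rule field_differentiable_bound[of "{0..x}" "%x. ?th x t" "%x. ?R x t"])
 show "norm (?R y t) <= CR * x" if "y : {0..x}" for y
 using CR(2)[of y t] mlm[of y x CR] CR(1) that x t by auto
 qed (use F(4)[OF t] x in "auto intro: has_field_derivative_at_within")
 thus ?thesis using th0[OF t] x by (simp add: mult.assoc)
 qed
 obtain B1 where B1: "B1 >= 0" "!!x t. x : {0..h} ==> t : ?S ==> | ?W x t| <= B1" by (rule jc_bounded[OF J(1)[of 0] compact_Icc compact_Icc]) (rule that)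
 obtain B2 where B2: "B2 >= 0" "!!x t. x : {0..h} ==> t : ?S ==> | ?W1 x t| <= B2" by (rule jc_bounded[OF J(1)[of 1] compact_Icc compact_Icc]) (rule that)
 obtain B3 where B3: "B3 >= 0" "!!x t. x : {0..h} ==> t : ?S ==> | ?R x t| <= B3" by (rule jc_bounded[OF J(2)[of 0] compact_Icc compact_Icc]) (rule that)
 obtain B4 where B4: "B4 >= 0" "!!x t. x : {0..h} ==> t : ?S ==> | ?th x t| <= B4" by (rule jc_bounded[OF J(4) compact_Icc compact_Icc]) (rule that)
 have prod: "|f * g| <= C * B * (x * x)" if "|f| <= C * (x * x)" "|g| <= B" "0 <= C" for f g C B x :: real
 using mult_mono[OF that(1,2)] that(3) by (simp add: abs_mult mult_ac)
 have prod2: "|f * g| <= C * C' * (x * x)" if "|f| <= C * x" "|g| <= C' * x" "0 <= C" "0 <= x" for f g C C' x :: real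
 using mult_mono[OF that(1,2)] that(3,4) by (simp add: abs_mult mult_ac)
 let ?cj = "%F. jc {0..h} ?S (%x t. F x t * ct x)"
 have uR: "| ?U x t * ?R x t| <= CU * CR * (x * x)" if "x : {0..h}" "t : ?S" for x t
 by (rule prod2[OF CU(2)[OF that] CR(2)[OF that] CU(1)]) (use that in simp)
 have uW: "| ?U x t * ?W x t| <= CU * CW * (x * x)" if "x : {0..h}" "t : ?S" for x t
 by (rule prod2[OF CU(2)[OF that] CW(2)[OF that] CU(1)]) (use that in simp)
 have RW: "| ?R x t * ?W x t| <= CR * CW * (x * x)" if "x : {0..h}" "t : ?S" for x t
 by (rule prod2[OF CR(2)[OF that] CW(2)[OF that] CR(1)]) (use that in simp)
 have w1: "?cj ?th" by (rule cot_weight_jc[OF J(4) Cth])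
 have w2: "?cj (%x t. - (?U x t * ?R x t))" by (rule cot_weight_jc[where C="CU * CR", OF jc_minus[OF jc_mult[OF J(3) J(2)]]]) (simp add: uR)
 have w3: "?cj (%x t. ?th x t * ?W x t)" by (rule cot_weight_jc[OF jc_mult[OF J(4) J(1)] prod[OF Cth B1(2) CR(1)]])
 have w4: "?cj (%x t. ?th x t * ?R x t)" by (rule cot_weight_jc[OF jc_mult[OF J(4) J(2)] prod[OF Cth B3(2) CR(1)]])
 have w5: "?cj (%x t. ?R x t * ?W x t + ?th x t * ?W1 x t)"
 proof (rule cot_weight_jc[where C="CR * CW + CR * B2", OF jc_add[OF jc_mult[OF J(2) J(1)] jc_mult[OF J(4) J(1)]]])
 fix x t assume xt: "x : {0..h}" "t : ?S"
 show "| ?R x t * ?W x t + ?th x t * ?W1 x t| <= (CR * CW + CR * B2) * (x * x)"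
 using RW[OF xt] prod[OF Cth[OF xt] B2(2)[OF xt] CR(1)] abs_triangle_ineq[of "?R x t * ?W x t" "?th x t * ?W1 x t"] by (simp add: distrib_right)
 qed
 have w6: "?cj (%x t. ?th x t * ?th x t)" by (rule cot_weight_jc[OF jc_mult[OF J(4) J(4)] prod[OF Cth B4(2) CR(1)]])
 define I where "I = (%t. in0 h (%x. ?th x t * ct x))"
 define JJ where "JJ = (%t. in0 h (%x. ?th x t * ?W x t * ct x))"
 define I' where "I' = (%t. in0 h (%x. - (?U x t * ?R x t) * ct x))"
 define JJ' where "JJ' = (%t. in0 h (%x. ?th x t * ?R x t * ct x - ?U x t * ((?R x t * ?W x t + ?th x t * ?W1 x t) * ct x)))"
 have dth: "((%t. ?th x t) hrd - ?U x t * ?R x t) (at t within ?S)" if "t : ?S" for x t by (rule csol_theta[OF a sol that])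
 have dI: "(I hrd I' t) (at t within ?S)" if t: "t : ?S" for t
 unfolding I_def I'_def
 proof (rule integral_time_deriv[OF _ w1 w2 t])
 show "((%t. ?th x t * ct x) hrd - (?U x t * ?R x t) * ct x) (at t within ?S)" if "t : ?S" for x t
 by (rule DERIV_cong[OF DERIV_cmult_right[OF dth[OF that]]]) simp
 qed simp
 have dJ: "(JJ hrd JJ' t) (at t within ?S)" if t: "t : ?S" for t
 unfolding JJ_def JJ'_def
 proof (rule integral_time_deriv[OF _ w3 _ t])
 show "jc {0..h} ?S (%x t. ?th x t * ?R x t * ct x - ?U x t * ((?R x t * ?W x t + ?th x t * ?W1 x t) * ct x))"
 by (rule jc_diff[OF w4 jc_mult[OF J(3) w5]])
 show "((%t. ?th x t * ?W x t * ct x) hrd ?th x t * ?R x t * ct x - ?U x t * ((?R x t * ?W x t + ?th x t * ?W1 x t) * ct x)) (at t within ?S)" if "t : ?S" for x t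
 by (rule DERIV_cong[OF DERIV_cmult_right[OF DERIV_mult[OF dth[OF that] csol_fields(4)[OF a sol that]]]]) (simp add: als)
 qed simp
 let ?c1 = "a / (1 + a) / (2 * pi)" and ?c2 = "mu / (2 * h)"
 have c1: "?c1 > 0" using a by simp
 have c2: "?c2 > 0" using mu_pos h_pos by simp
 have vel: "velocity L a (%y. ?W y t) x = ?U x t" if "t : ?S" for x t by (rule csol_pde(1)[OF a sol that])
 have I'ge: "I' t >= ?c1 * JJ t" if t: "t : ?S" for t
 proof -
 \<comment> \<open>H' = - \<omega> cot and \<theta>_x = \<rho>, so integrating (\<theta> H)' over
   the half period identifies the integral of \<rho> H with J. It is H that appears in
   \<open>velocity_cot_lower\<close>.\<close>
 define H where "H = (%x. integral {x..h} (%y. ?W y t * ct y))"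
 \<comment> \<open>Near 0 only the boundedness of \<open>H\<close> is used; the quadratic zero of
   \<theta> makes the product continuous there with value 0.\<close>
 define f where "f = (%x. if x = 0 then 0 else ?th x t * H x)"
 have cW: "co A (%y. ?W y t)" for A by (rule continuous_on_subset[OF jc_slice[OF JU(1) t]]) simp
 have cWc: "co {d..h} (%y. ?W y t * ct y)" if "d > 0" for d by (intro cin cW ct_continuous that)
 have dH: "(H hrd - (?W x t * ct x)) (at x)" if x: "0 < x" "x < h" for x
 proof -
 let ?d = "x / 2"
 have "((%v. integral {?d..v} (%y. ?W y t * ct y)) hrd ?W x t * ct x) (at x within {?d..h})"
 by (rule integral_has_real_derivative[OF cWc]) (use x in auto)
 hence "((%v. integral {?d..h} (%y. ?W y t * ct y) - integral {?d..v} (%y. ?W y t * ct y)) hrd 0 - ?W x t * ct x) (at x)"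
 using x by (intro DERIV_diff DERIV_const) (simp add: at_within_Icc_at)
 thus ?thesis
 proof (rule has_field_derivative_transform_within_open[of _ _ _ "{?d<..<h}", THEN DERIV_cong])
 fix v assume v: "v : {?d<..<h}"
 have "integral {?d..v} (%y. ?W y t * ct y) + integral {v..h} (%y. ?W y t * ct y) = integral {?d..h} (%y. ?W y t * ct y)"
 by (rule hk_combine) (use v x in "auto intro!: icr cWc")
 thus "integral {?d..h} (%y. ?W y t * ct y) - integral {?d..v} (%y. ?W y t * ct y) = H v" by (simp add: H_def)
 qed (use x in auto)
 qed
 have Hb: "|H x| <= CW / mu * h" if x: "0 < x" "x <= h" for x
 proof -
 have "norm (H x) <= CW / mu * (h - x)"
 unfolding H_def
 proof (rule integral_bound[OF x(2) cWc[OF x(1)]])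
 fix y assume y: "y : {x..h}"
 have y0: "0 < y" "y <= h" "y : {0..h}" using x y by auto
 have "norm (?W y t * ct y) = | ?W y t| * ct y" using trig_nonneg(4)[of y] y0 by (simp add: abs_mult)
 also have "... <= (CW * y) * (1 / (mu * y))" using CW(1) y0 trig_nonneg(4)[of y] by (intro mult_mono CW(2) ct_le t) auto
 also have "... = CW / mu" using y0 mu_pos by simp
 finally show "norm (?W y t * ct y) <= CW / mu" .
 qed
 also have "... <= CW / mu * h" using CW(1) mu_pos x by (intro mlm) auto
 finally show ?thesis by simp
 qed
 have cf: "co {0..h} f"
 unfolding continuous_on_def
 proof
 fix x assume x: "x : {0..h}"
 show "(f \<longlongrightarrow> f x) (wi x h)"
 proof (cases "x = 0")
 case True
 have "(f \<longlongrightarrow> 0) (wi x h)"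
 proof (rule Lim_null_comparison)
 show "\<forall>\<^sub>F y in at x within {0..h}. norm (f y) <= (CR * (CW / mu * h)) * (y * y)"
 unfolding eventually_at_filter
 proof (rule always_eventually, intro allI impI)
 fix y assume y: "y ~= x" "y : {0..h}"
 have "norm (f y) = | ?th y t * H y|" using y True by (simp add: f_def)
 also have "... <= CR * (CW / mu * h) * (y * y)" by (rule prod[OF Cth Hb CR(1)]) (use y True t in auto)
 finally show "norm (f y) <= (CR * (CW / mu * h)) * (y * y)" .
 qed
 have "((%y. (CR * (CW / mu * h)) * (y * y)) \<longlongrightarrow> (CR * (CW / mu * h)) * (x * x)) (wi x h)" by (intro tendsto_intros)
 thus "((%y. (CR * (CW / mu * h)) * (y * y)) \<longlongrightarrow> 0) (wi x h)" using True by simp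
 qed
 thus ?thesis using True by (simp add: f_def)
 next
 case False
 let ?d = "x / 2"
 have d: "0 < ?d" "?d < x" using x False by auto
 have cH: "co {?d..h} H"
 proof -
 have "co {?d..h} (%v. integral {?d..h} (%y. ?W y t * ct y) - integral {?d..v} (%y. ?W y t * ct y))"
 by (intro cin indefinite_integral_continuous_1 icr cWc d)
 thus ?thesis
 proof (rule continuous_on_eq)
 fix v assume v: "v : {?d..h}"
 have "integral {?d..v} (%y. ?W y t * ct y) + integral {v..h} (%y. ?W y t * ct y) = integral {?d..h} (%y. ?W y t * ct y)"
 by (rule hk_combine) (use v d in "auto intro!: icr cWc")
 thus "integral {?d..h} (%y. ?W y t * ct y) - integral {?d..v} (%y. ?W y t * ct y) = H v" by (simp add: H_def)
 qed
 qed
 have "co {?d..h} (%v. ?th v t * H v)" by (intro cin cH continuous_on_subset[OF jc_slice[OF JU(4) t]]) simp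
 hence "co {?d..h} f" by (rule continuous_on_eq) (use d in "auto simp: f_def")
 hence "(f \<longlongrightarrow> f x) (at x within {?d..h})" using x d by (auto simp: continuous_on_def)
 moreover have "at x within {0..h} = at x within {?d..h}" by (rule at_within_nhd[of _ "{?d<..}"]) (use d in auto)
 ultimately show ?thesis by simp
 qed
 qed
 have "((%x. ?R x t * H x - ?th x t * ?W x t * ct x) has_integral f h - f 0) {0..h}"
 proof (rule fundamental_theorem_of_calculus_interior[OF less_imp_le[OF h_pos] cf])
 fix x assume x: "x : {0<..<h}"
 have "((%x. ?th x t * H x) hrd ?R x t * H x - ?th x t * ?W x t * ct x) (at x)"
 by (rule DERIV_cong[OF DERIV_mult[OF F(4)[OF t] dH]]) (use x in "auto simp: als")
 hence "(f hrd ?R x t * H x - ?th x t * ?W x t * ct x) (at x)"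
 by (rule has_field_derivative_transform_within_open[of _ _ _ "{0<..<h}"]) (use x in "auto simp: f_def")
 thus "(f has_vector_derivative ?R x t * H x - ?th x t * ?W x t * ct x) (at x)" by (simp add: hrv)
 qed
 moreover have "f h - f 0 = 0" by (simp add: f_def H_def)
 ultimately have z: "((%x. ?R x t * H x - ?th x t * ?W x t * ct x) has_integral 0) {0..h}" by simp
 have jj: "((%x. ?th x t * ?W x t * ct x) has_integral JJ t) {0..h}"
 unfolding JJ_def by (rule integrable_integral[OF icr[OF jc_slice[OF w3 t]]])
 from has_integral_add[OF z jj] have RH: "((%x. ?R x t * H x) has_integral JJ t) {0..h}" by simp
 have Ih: "((%x. - (?U x t * ?R x t) * ct x) has_integral I' t) {0..h}"
 unfolding I'_def by (rule integrable_integral[OF icr[OF jc_slice[OF w2 t]]])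
 show ?thesis
 proof (rule has_integral_le[OF has_integral_mult_right[OF RH, of ?c1] Ih])
 fix x assume x: "x : {0..h}"
 show "?c1 * (?R x t * H x) <= - (?U x t * ?R x t) * ct x"
 proof (cases "x = 0 \<or> x = h")
 case True
 thus ?thesis using van[OF t] by auto
 next
 case False
 hence x': "0 < x" "x < h" using x by auto
 have "a / (1 + a) * H x <= - (2 * pi) * (velocity L a (%y. ?W y t) x * ct x)"
 unfolding H_def
 by (rule velocity_cot_lower[OF a cW _ _ W[OF _ t] x']) (auto simp: sr_periodic sr_odd(1)[where b=b and t=t, OF odd(1)[OF t]])
 hence "(a / (1 + a) * H x) / (2 * pi) <= (- (2 * pi) * (?U x t * ct x)) / (2 * pi)" unfolding vel[OF t] by (rule divide_right_mono) simp
 moreover have "(- (2 * pi) * (?U x t * ct x)) / (2 * pi) = - (?U x t * ct x)" by simp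
 moreover have "?c1 * H x = (a / (1 + a) * H x) / (2 * pi)" by simp
 ultimately have "?c1 * H x <= - (?U x t * ct x)" by (simp only:)
 from mlm[OF this R[OF x t]] show ?thesis by (simp add: mult_ac)
 qed
 qed
 qed
 have J'ge: "JJ' t >= ?c2 * (I t)^2" if t: "t : ?S" for t
 proof -
 have c: "co {0..h} (%x. ?th x t)" by (rule jc_slice[OF J(4) t])
 have th_mono: "?th x t <= ?th y t" if "0 <= x" "x <= y" "y <= h" for x y
 by (rule DERIV_nonneg_imp_nondecreasing[OF that(2)]) (use F(4)[OF t] R[OF _ t] that in "auto intro!: exI")
 have thn: "?th x t >= 0" if "x : {0..h}" for x using th_mono[of 0 x] th0[OF t] that by auto
 let ?c = "%k. cc (b k t)"
 have fsW: "fs ?c = (%x. ?W x t)" by (auto simp: sr_def)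
 have aw: "wsum 0 ?c" using rapid_allw[OF csol_rapid(1)[OF sol] t] by (simp add: allw_def)
 let ?F' = "%x. ?R x t * ?W x t + ?th x t * ?W1 x t"
 have up: "in0 h (%x. ?F' x * ct x * velocity L a (fs ?c) x) <= 0"
 proof (rule velocity_cot_upper[OF a aw hermitian_cc[where b="%k. b k t", OF odd(1)[OF t]], where th="%x. ?th x t"])
 show "fs ?c (- y) = - fs ?c y" for y unfolding fsW by (rule sr_odd(1)[where b=b and t=t, OF odd(1)[OF t]])
 show "0 <= fs ?c x" if "x : {0..h}" for x unfolding fsW by (rule W[OF that t])
 show "((%x. ?th x t * fs ?c x) hrd ?F' x) (at x)" for x
 unfolding fsW by (rule DERIV_cong[OF DERIV_mult[OF F(4)[OF t] F(1)[OF t]]]) (simp add: mult.commute)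
 show "co {0..h} ?F'" by (intro cin jc_slice[OF J(1) t] jc_slice[OF J(2) t] c)
 show "?F' 0 = 0" using van[OF t] th0[OF t] by simp
 show "co {0..h} (%x. ?F' x * ct x)" by (rule jc_slice[OF w5 t])
 show "co {0..h} (velocity L a (fs ?c))" unfolding fsW vel[OF t, abs_def] by (rule jc_slice[OF J(3) t])
 show "?th x t <= ?th y t" if "0 <= x" "x <= y" "y <= h" for x y by (rule th_mono[OF that])
 qed (use c thn in auto)
 \<comment> \<open>The derivative of \<theta>^2 cot integrates to 0, so 2 M is mu times the integral
   of \<theta>^2 + (\<theta> cot)^2. Dropping \<theta>^2 and applying Cauchy-Schwarz to I yields the
   constant mu / (2 h).\<close>
 define M where "M = in0 h (%x. ?th x t * ?R x t * ct x)"
 have "JJ' t = M - in0 h (%x. ?U x t * (?F' x * ct x))"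
 unfolding JJ'_def M_def by (rule hk_diff) (intro icr cin jc_slice[OF w4 t] jc_slice[OF w5 t] jc_slice[OF J(3) t])+
 moreover have "in0 h (%x. ?U x t * (?F' x * ct x)) <= 0" using up unfolding fsW vel[OF t] by (simp only: mult.commute)
 ultimately have 1: "M <= JJ' t" by simp
 have cg: "co {0..h} (%x. ?th x t * ?th x t * ct x)" by (rule jc_slice[OF w6 t])
 have g: "((%x. 2 * (?th x t * ?R x t * ct x) - mu * ((?th x t)^2 + (?th x t * ct x)^2)) has_integral ?th h t * ?th h t * ct h - ?th 0 t * ?th 0 t * ct 0) {0..h}"
 proof (rule fundamental_theorem_of_calculus_interior[OF less_imp_le[OF h_pos] cg])
 fix x assume x: "x : {0<..<h}"
 have "((%x. ?th x t * ?th x t * ct x) hrd 2 * (?th x t * ?R x t * ct x) - mu * ((?th x t)^2 + (?th x t * ct x)^2)) (at x)"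
 by (rule DERIV_cong[OF DERIV_mult[OF DERIV_mult[OF F(4)[OF t] F(4)[OF t]] ct_deriv]]) (use x in "auto simp: als p2q")
 thus "((%x. ?th x t * ?th x t * ct x) has_vector_derivative 2 * (?th x t * ?R x t * ct x) - mu * ((?th x t)^2 + (?th x t * ct x)^2)) (at x)"
 by (simp add: hrv)
 qed
 have "ct h = 0" by (simp add: ct_def cot_def mu_h)
 hence z: "in0 h (%x. 2 * (?th x t * ?R x t * ct x) - mu * ((?th x t)^2 + (?th x t * ct x)^2)) = 0"
 using integral_unique[OF g] th0[OF t] by simp
 have i: "(%x. ?th x t * ?R x t * ct x) integrable_on {0..h}" "(%x. (?th x t * ct x)\<^sup>2) integrable_on {0..h}" "(%x. (?th x t)\<^sup>2) integrable_on {0..h}"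
 by (intro icr cin jc_slice[OF w4 t] jc_slice[OF w1 t] c)+
 have "in0 h (%x. mu * (?th x t * ct x)^2) <= in0 h (%x. 2 * (?th x t * ?R x t * ct x) - (2 * (?th x t * ?R x t * ct x) - mu * ((?th x t)^2 + (?th x t * ct x)^2)))"
 by (rule integral_le) (use mu_pos in "auto intro!: icr cin jc_slice[OF w1 t] jc_slice[OF w4 t] c")
 also have "... = 2 * M - 0" unfolding M_def
 by (subst hk_diff) (use i z has_integral_integrable[OF g] in "auto intro!: integrable_on_cmult_left")
 finally have 2: "mu * in0 h (%x. (?th x t * ct x)\<^sup>2) <= 2 * M" by simp
 have "(I t)^2 <= (h - 0) * in0 h (%x. (?th x t * ct x)\<^sup>2)"
 unfolding I_def by (rule integral_cauchy_schwarz[OF h_pos jc_slice[OF w1 t]])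
 from mlm[OF this, of "mu / (2 * h)"] have "?c2 * (I t)^2 <= mu * in0 h (%x. (?th x t * ct x)\<^sup>2) / 2" using mu_pos h_pos by simp
 thus ?thesis using 1 2 by linarith
 qed
 have 0: "0 : ?S" using s0 by simp
 \<comment> \<open>The integrand is continuous and nonnegative, so one point where it is positive
   suffices; h / 2 gives the angles pi / 2 and pi / 4.\<close>
 have "I 0 > 0"
 proof -
 have thd: "?th x 0 = (1 - cos (K * x)) / K" for x
 proof -
 have "((%x. ?th x 0 - (1 - cos (K * x)) / K) hrd 0) (at x)" for x
 using F(4)[OF 0, of x] K_pos by (auto intro!: dei simp: init(2))
 hence "?th x 0 - (1 - cos (K * x)) / K = ?th 0 0 - (1 - cos (K * 0)) / K" by (intro DERIV_isconst_all) auto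
 thus ?thesis using th0[OF 0] by simp
 qed
 have ci: "co {0..h} (%x. ?th x 0 * ct x)" by (rule jc_slice[OF w1 0])
 have nn: "0 <= ?th x 0 * ct x" if "x : {0..h}" for x
 unfolding thd using K_pos trig_nonneg(4)[of x] that by (intro mnn divide_nonneg_nonneg) auto
 have "0 < ?th (h / 2) 0 * ct (h / 2)"
 proof (rule mult_pos_pos)
 have K4: "K * (h / 2) = pi / 2" using KL by (simp add: h_def)
 show "0 < ?th (h / 2) 0" unfolding thd K4 using K_pos by simp
 have "mu * (h / 2) = (mu * h) / 2" by simp
 hence m4: "mu * (h / 2) = pi / 4" unfolding mu_h by simp
 show "0 < ct (h / 2)" unfolding ct_def m4 by (simp add: cot_def sin_45 cos_45)
 qed
 have iff: "in0 h (%x. ?th x 0 * ct x) = 0 \<longleftrightarrow> (ALL x:{0..h}. ?th x 0 * ct x = 0)"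
 by (rule integral_eq_0_iff[OF ci h_pos nn])
 have mem: "h / 2 : {0..h}" using h_pos by simp
 have "in0 h (%x. ?th x 0 * ct x) ~= 0"
 proof
 assume "in0 h (%x. ?th x 0 * ct x) = 0"
 hence "ALL x:{0..h}. ?th x 0 * ct x = 0" by (rule iff[THEN iffD1])
 hence z: "?th (h / 2) 0 * ct (h / 2) = 0" using mem by (rule bspec)
 show False using \<open>0 < ?th (h / 2) 0 * ct (h / 2)\<close> unfolding z by simp
 qed
 moreover have "0 <= in0 h (%x. ?th x 0 * ct x)" by (rule hk_nonneg[OF icr[OF ci] nn])
 ultimately show ?thesis by (simp add: I_def)
 qed
 moreover have "JJ 0 >= 0" by (simp add: JJ_def init(1))
 ultimately show ?thesis
 using blowup_time_bound[OF s c1 c2 refl, of I JJ I' JJ', OF _ _ dI I'ge dJ J'ge] by (simp add: I_def)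
qed

end

section \<open>The maximal solution\<close>

text \<open>The set where |g| exceeds the essential supremum is null and, by continuity, open, hence
  empty.\<close>

lemma Linf_norm_ge:
 assumes g: "co UNIV g"
 shows "ennreal |g x| <= Linf_norm g"
proof -
 let ?M = "esssup lebesgue (%x. ereal |g x| )"
 have "\<not> ?M < ereal |g x|"
 proof
 assume lt: "?M < ereal |g x|"
 have "AE y in lebesgue. ereal |g y| <= ?M" by (rule esssup_AE)
 hence "AE y in lebesgue. y \<notin> {y. ?M < ereal |g y| }" by (simp add: not_less)
 moreover have o: "open {y. ?M < ereal |g y| }"
 by (intro open_Collect_less cin g continuous_on_ereal)
 moreover have "{y. ?M < ereal |g y| } : sets lebesgue" by (rule sets_completionI_sets) (simp add: borel_open[OF o])
 ultimately have "{y. ?M < ereal |g y| } : null_sets lebesgue" by (simp add: AE_iff_null_sets)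
 hence "negligible {y. ?M < ereal |g y| }" by (simp add: negligible_iff_null_sets)
 thus False using open_not_negligible[OF o] lt by blast
 qed
 hence "ereal |g x| <= ?M" by simp
 from e2ennreal_mono[OF this] show ?thesis by (simp add: Linf_norm_def)
qed

section \<open>Restriction, uniqueness and gluing of coefficient solutions\<close>

context circle begin

lemma csol_restrict:
 assumes "csol a s b p" "0 < r" "r <= s"
 shows "csol a r b p"
proof -
 have sub: "{0..r} \<subseteq> {0..s}" using assms by auto
 have c: "coef_solution (alpha a) {0..s} b p" using assms(1) by (simp add: csol_def)
 have "coef_solution (alpha a) {0..r} b p"
 unfolding coef_solution_def
 proof (intro conjI allI ballI)
 fix k t assume t: "t : {0..r}"
 hence t': "t : {0..s}" using sub by blast
 show "b (- k) t = - b k t" "p (- k) t = - p k t" using c t' unfolding coef_solution_def by blast+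
 show "(b k hrd rhs_b (alpha a) (%j. b j t) (%j. p j t) k) (wi t r)"
 "(p k hrd rhs_p (alpha a) (%j. b j t) (%j. p j t) k) (wi t r)"
 using c t' unfolding coef_solution_def by (blast intro: has_field_derivative_subset[OF _ sub])+
 qed
 thus ?thesis using assms sub by (auto simp: csol_def intro: rapid_on_subset)
qed

lemma csol_cong:
 assumes sol: "csol a s b p" and e: "!!k t. t : {0..s} ==> b' k t = b k t" "!!k t. t : {0..s} ==> p' k t = p k t"
 shows "csol a s b' p'"
proof -
 have c: "coef_solution (alpha a) {0..s} b p" using sol by (simp add: csol_def)
 have "coef_solution (alpha a) {0..s} b' p'"
 unfolding coef_solution_def
 proof (intro conjI allI ballI)
 fix k t assume t: "t : {0..s}"
 have o: "b (- k) t = - b k t" "p (- k) t = - p k t" using c t unfolding coef_solution_def by blast+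
 show "b' (- k) t = - b' k t" "p' (- k) t = - p' k t" unfolding e[OF t] by (rule o)+
 have d: "(b k hrd rhs_b (alpha a) (%j. b j t) (%j. p j t) k) (wi t s)"
 "(p k hrd rhs_p (alpha a) (%j. b j t) (%j. p j t) k) (wi t s)"
 using c t unfolding coef_solution_def by blast+
 show "(b' k hrd rhs_b (alpha a) (%j. b' j t) (%j. p' j t) k) (wi t s)"
 unfolding e[OF t] by (rule has_field_derivative_transform_within[OF d(1) zero_less_one t]) (rule e(1)[symmetric])
 show "(p' k hrd rhs_p (alpha a) (%j. b' j t) (%j. p' j t) k) (wi t s)"
 unfolding e[OF t] by (rule has_field_derivative_transform_within[OF d(2) zero_less_one t]) (rule e(2)[symmetric])
 qed
 moreover have "rapid_on {0..s} b'" "rapid_on {0..s} p'" using csol_rapid[OF sol] by (simp_all add: rapid_on_def e)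
 ultimately show ?thesis using sol by (simp add: csol_def)
qed

lemma csol_cl_on:
 assumes a: "a > 0" and sol: "csol a s b p"
 shows "cl_on a s (sr b 0) (theta p)"
 unfolding cl_on_def
proof (intro conjI ballI allI)
 show "\<exists>j\<ge>1. continuous_into_sobolev L (Suc j) {0..s} (sr b 0) & continuous_into_sobolev L (Suc (Suc j)) {0..s} (theta p)"
 using csol_sobolev[OF sol] by blast
 note r = csol_rapid[OF sol]
 fix t x assume t: "t : {0..s}"
 have dw: "((%y. sr b 0 y t) hrd sr b 1 x t) (at x)" using sr_deriv[OF r(1) t, of 0] by simp
 have dt: "((%y. theta p y t) hrd sr p 0 x t) (at x)" by (rule theta_deriv[OF r(2) t csol_odd(4)[OF sol t]])
 show "(%y. sr b 0 y t) differentiable (at x)" "(%y. theta p y t) differentiable (at x)"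
 using dw dt by (auto simp: real_differentiable_def)
 note v = csol_pde(1)[OF a sol t]
 show "((%s. sr b 0 x s) has_real_derivative
 deriv (%y. theta p y t) x - velocity L a (%y. sr b 0 y t) x * deriv (%y. sr b 0 y t) x) (wi t s)"
 unfolding v DERIV_imp_deriv[OF dw] DERIV_imp_deriv[OF dt] csol_pde(4)[OF a sol t, symmetric] by (rule csol_pde(2)[OF a sol t])
 show "((%s. theta p x s) hrd - velocity L a (%y. sr b 0 y t) x * deriv (%y. theta p y t) x) (wi t s)"
 unfolding v DERIV_imp_deriv[OF dt] by (rule csol_theta[OF a sol t])
qed

lemma sr_inject:
 assumes r: "rapid_on S b" "rapid_on S' b'" "t : S" "t : S'" and o: "!!k. b (- k) t = - b k t" "!!k. b' (- k) t = - b' k t"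
 and eq: "!!x. sr b 0 x t = sr b' 0 x t"
 shows "b k t = b' k t"
proof -
 have w: "wsum 0 (%k. cc (b k t))" "wsum 0 (%k. cc (b' k t))"
 using rapid_allw[OF r(1,3)] rapid_allw[OF r(2,4)] by (auto simp: allw_def)
 have h: "hermitian (%k. cc (b k t))" "hermitian (%k. cc (b' k t))"
 by (rule hermitian_cc[where b="%k. b k t", OF o(1)], rule hermitian_cc[where b="%k. b' k t", OF o(2)])
 have "fs (%k. cc (b k t)) = fs (%k. cc (b' k t))" using eq by (auto simp: sr_def)
 hence "cc (b k t) = cc (b' k t)" using fcoef_fs[OF w(1) h(1), of k] fcoef_fs[OF w(2) h(2), of k] by simp
 thus ?thesis by (simp add: cc_def)
qed

text \<open>Uniqueness is transferred from the fields, whose Fourier coefficients determine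
  \<open>b\<close> and \<open>p\<close> by \<open>sr_inject\<close>.\<close>

lemma csol_unique:
 assumes a: "a > 0" and sol: "csol a s b p" "csol a s b' p'" and init: "!!k. b' k 0 = b k 0" "!!k. p' k 0 = p k 0" and t: "t : {0..s}"
 shows "b' k t = b k t" "p' k t = p k t"
proof -
 have i: "sr b' 0 x 0 = sr b 0 x 0" "theta p' x 0 = theta p x 0" for x
 unfolding sr_def theta_def cth_def init by (rule refl)+
 have ts: "t <= s" "0 <= t" using t by auto
 have e: "sr b' 0 x t = sr b 0 x t" "theta p' x t = theta p x t" for x
 using cl_unique[OF a ts(2) cl_on_subset[OF csol_cl_on[OF a sol(1)] ts(1)] cl_on_subset[OF csol_cl_on[OF a sol(2)] ts(1)] i] by auto
 note r = csol_rapid[OF sol(1)] and r' = csol_rapid[OF sol(2)] and o = csol_odd[OF sol(1) t] and o' = csol_odd[OF sol(2) t]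
 show "b' k t = b k t" by (rule sr_inject[OF r'(1) r(1) t t o'(1) o(1) e(1)])
 have "sr p' 0 x t = sr p 0 x t" for x
 proof (rule DERIV_unique)
 show "((%x. theta p' x t) hrd sr p' 0 x t) (at x)" by (rule theta_deriv[OF r'(2) t o'(4)])
 show "((%x. theta p' x t) hrd sr p 0 x t) (at x)" unfolding e(2) by (rule theta_deriv[OF r(2) t o(4)])
 qed
 thus "p' k t = p k t" by (rule sr_inject[OF r'(2) r(2) t t o'(2) o(2)])
qed

lemma rapid_on_glue:
 assumes "rapid_on {0..t0} b" "rapid_on {0..l} b1"
 shows "rapid_on {0..t0 + l} (%k t. if t : {0..t0} then b k t else b1 k (t - t0))"
 unfolding rapid_on_def
proof
 fix s
 obtain C1 where C1: "C1 >= 0" "!!k t. t : {0..t0} ==> (wt k) ^ s * |b k t| <= C1" by (rule rapid_onD[where s=s, OF assms(1)]) (rule that)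
 obtain C2 where C2: "C2 >= 0" "!!k t. t : {0..l} ==> (wt k) ^ s * |b1 k t| <= C2" by (rule rapid_onD[where s=s, OF assms(2)]) (rule that)
 have "(wt k) ^ s * |if t : {0..t0} then b k t else b1 k (t - t0) | <= C1 + C2" if "t : {0..t0 + l}" for k t
 proof (cases "t : {0..t0}")
 case True
 thus ?thesis using C1(2)[OF True, of k] C2(1) by simp
 next
 case False
 hence "t - t0 : {0..l}" using that by auto
 from C2(2)[OF this, of k] have "(wt k) ^ s * |b1 k (t - t0) | <= C1 + C2" using C1(1) by linarith
 thus ?thesis using False by (simp only: if_False)
 qed
 thus "\<exists>C. \<forall>k. ALL t:{0..t0 + l}. (wt k) ^ s * |if t : {0..t0} then b k t else b1 k (t - t0) | <= C" by blast
qed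

lemma derivative_glue:
 fixes f g f' g' :: "real => real"
 assumes t0: "0 <= t0" "0 <= l"
 and f: "!!t. t : {0..t0} ==> (f hrd f' t) (wi t t0)"
 and g: "!!t. t : {0..l} ==> (g hrd g' t) (wi t l)"
 and eq: "f t0 = g 0" "f' t0 = g' 0" and t: "t : {0..t0 + l}"
 shows "((%t. if t : {0..t0} then f t else g (t - t0)) hrd (if t : {0..t0} then f' t else g' (t - t0))) (at t within {0..t0 + l})"
 unfolding hrv
proof (rule has_vector_derivative_If_within_closures[where T="{t0..t0 + l}"])
 show "t : {0..t0} \<union> {t0..t0 + l}" "{0..t0 + l} = {0..t0} \<union> {t0..t0 + l}" using t t0 by auto
 have S: "{0..t0} \<union> (closure {0..t0} \<inter> closure {t0..t0 + l}) = {0..t0}" and T: "{t0..t0 + l} \<union> (closure {0..t0} \<inter> closure {t0..t0 + l}) = {t0..t0 + l}"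
 using t0 by auto
 show "(f has_vector_derivative f' t) (at t within {0..t0} \<union> (closure {0..t0} \<inter> closure {t0..t0 + l}))"
 if "t : {0..t0} \<union> (closure {0..t0} \<inter> closure {t0..t0 + l})"
 using f that unfolding S hrv by blast
 show "((%t. g (t - t0)) has_vector_derivative g' (t - t0)) (at t within {t0..t0 + l} \<union> (closure {0..t0} \<inter> closure {t0..t0 + l}))"
 if "t : {t0..t0 + l} \<union> (closure {0..t0} \<inter> closure {t0..t0 + l})"
 proof -
 have tt: "t - t0 : {0..l}" using that unfolding T by auto
 have im: "(%t. t - t0) ` {t0..t0 + l} \<subseteq> {0..l}" by auto
 have "((%t. t - t0) hrd 1) (at t within {t0..t0 + l})" by (auto intro!: dei)
 from DERIV_image_chain[OF has_field_derivative_subset[OF g[OF tt] im] this]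
 show ?thesis unfolding T hrv[symmetric] by (simp add: o_def)
 qed
 show "f t = g (t - t0)" "f' t = g' (t - t0)" if "t : closure {0..t0}" "t : closure {t0..t0 + l}"
 proof -
 have "t = t0" using that by simp
 thus "f t = g (t - t0)" "f' t = g' (t - t0)" using eq by simp_all
 qed
qed

text \<open>The local solution is restarted from the values at t0. At the joint the one-sided
  derivatives agree because the right-hand sides depend on the coefficients alone.\<close>

lemma csol_extend:
 assumes a: "a > 0" and sol: "csol a t0 b p" and M: "M >= 0" "!!N. energy 2 N (%k. b k t0) (%k. p k t0) <= M"
 obtains b' p' where "csol a (t0 + lifespan M) b' p'" "!!k. b' k 0 = b k 0" "!!k. p' k 0 = p k 0"
proof -
 have t0: "0 < t0" "t0 : {0..t0}" using sol by (auto simp: csol_def)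
 note r = csol_rapid[OF sol] and o = csol_odd[OF sol t0(2)]
 have rap: "\<exists>C. \<forall>k. (wt k) ^ s * |d k t0| <= C" if "rapid_on {0..t0} d" for d s
 using that t0(2) unfolding rapid_on_def by blast
 obtain b1 p1 where s1: "coef_solution (alpha a) {0..lifespan M} b1 p1" "rapid_on {0..lifespan M} b1" "rapid_on {0..lifespan M} p1"
 "!!k. b1 k 0 = b k t0" "!!k. p1 k 0 = p k t0"
 by (rule coef_local_existence[OF alpha_props(1)[OF a] alpha_props(2)[OF a] alpha_props(3)[OF a] M(1), of "%k. b k t0" "%k. p k t0", OF o(1,2) rap[OF r(1)] rap[OF r(2)] M(2)]) (rule that)
 define l where "l = lifespan M"
 have l: "l > 0" unfolding l_def by (rule lifespan_pos[OF M(1)])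
 note s1 = s1[folded l_def]
 define b' where "b' = (%k t. if t : {0..t0} then b k t else b1 k (t - t0))"
 define p' where "p' = (%k t. if t : {0..t0} then p k t else p1 k (t - t0))"
 have c: "coef_solution (alpha a) {0..t0} b p" using sol by (simp add: csol_def)
 have "coef_solution (alpha a) {0..t0 + l} b' p'"
 unfolding coef_solution_def
 proof (intro conjI allI ballI)
 fix k t assume t: "t : {0..t0 + l}"
 have t': "t \<notin> {0..t0} ==> t - t0 : {0..l}" using t by auto
 have oc: "b (- k) t = - b k t" "p (- k) t = - p k t" if "t : {0..t0}" using c that unfolding coef_solution_def by blast+
 have o1: "b1 (- k) (t - t0) = - b1 k (t - t0)" "p1 (- k) (t - t0) = - p1 k (t - t0)" if "t \<notin> {0..t0}"
 using s1(1) t'[OF that] unfolding coef_solution_def by blast+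
 show "b' (- k) t = - b' k t" "p' (- k) t = - p' k t"
 unfolding b'_def p'_def using oc o1 by (cases "t : {0..t0}"; simp only: if_True if_False)+
 let ?B = "%t. rhs_b (alpha a) (%j. b j t) (%j. p j t) k" and ?B1 = "%t. rhs_b (alpha a) (%j. b1 j t) (%j. p1 j t) k"
 let ?P = "%t. rhs_p (alpha a) (%j. b j t) (%j. p j t) k" and ?P1 = "%t. rhs_p (alpha a) (%j. b1 j t) (%j. p1 j t) k"
 have d: "(b k hrd ?B t) (wi t t0)" "(p k hrd ?P t) (wi t t0)" if "t : {0..t0}" for t
 using c that unfolding coef_solution_def by blast+
 have d1: "(b1 k hrd ?B1 t) (wi t l)" "(p1 k hrd ?P1 t) (wi t l)" if "t : {0..l}" for t
 using s1(1) that unfolding coef_solution_def by blast+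
 have "(b' k hrd (if t : {0..t0} then ?B t else ?B1 (t - t0))) (at t within {0..t0 + l})"
 unfolding b'_def by (rule derivative_glue[OF _ _ d(1) d1(1) _ _ t]) (use t0 l s1(4,5) in auto)
 moreover have "(if t : {0..t0} then ?B t else ?B1 (t - t0)) = rhs_b (alpha a) (%j. b' j t) (%j. p' j t) k"
 by (cases "t : {0..t0}"; simp only: b'_def p'_def if_True if_False)
 ultimately show "(b' k hrd rhs_b (alpha a) (%j. b' j t) (%j. p' j t) k) (at t within {0..t0 + l})" by (simp only:)
 have "(p' k hrd (if t : {0..t0} then ?P t else ?P1 (t - t0))) (at t within {0..t0 + l})"
 unfolding p'_def by (rule derivative_glue[OF _ _ d(2) d1(2) _ _ t]) (use t0 l s1(4,5) in auto)
 moreover have "(if t : {0..t0} then ?P t else ?P1 (t - t0)) = rhs_p (alpha a) (%j. b' j t) (%j. p' j t) k"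
 by (cases "t : {0..t0}"; simp only: b'_def p'_def if_True if_False)
 ultimately show "(p' k hrd rhs_p (alpha a) (%j. b' j t) (%j. p' j t) k) (at t within {0..t0 + l})" by (simp only:)
 qed
 moreover have "rapid_on {0..t0 + l} b'" "rapid_on {0..t0 + l} p'"
 unfolding b'_def p'_def by (rule rapid_on_glue[OF r(1) s1(2)], rule rapid_on_glue[OF r(2) s1(3)])
 ultimately have "csol a (t0 + l) b' p'" using t0 l by (simp add: csol_def)
 thus ?thesis by (rule that[unfolded l_def[symmetric]]) (use t0 in "simp_all add: b'_def p'_def")
qed

section \<open>The data, the maximal time and blow-up\<close>

definition p_init :: "int => real" where
 "p_init k = (if k = 1 then 1 else if k = - 1 then - 1 else 0)"

definition good :: "real => real => (int => real => real) => (int => real => real) => bool" where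
 "good a s b p \<longleftrightarrow> csol a s b p & (\<forall>k. b k 0 = 0) & (\<forall>k. p k 0 = p_init k)"

lemma good_init:
 assumes "good a s b p"
 shows "sr b 0 x 0 = 0" "sr p 0 x 0 = sin (K * x)"
proof -
 show "sr b 0 x 0 = 0" using assms by (simp add: good_def sr_def fs_def cc_def)
 have "sr p 0 x 0 = (ISUM k. p_init k * sin (K * of_int k * x) / 2)"
 using assms by (simp add: good_def sr_def fs_def cc_def)
 also have "... = (\<Sum>\<^sub>\<infinity>k\<in>{1, - 1}. p_init k * sin (K * of_int k * x) / 2)"
 by (rule infsum_cong_neutral) (auto simp: p_init_def)
 also have "... = sin (K * x)" by (simp add: p_init_def)
 finally show "sr p 0 x 0 = sin (K * x)" .
qed

lemma good_exists:
 assumes a: "a > 0"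
 obtains s b p where "s > 0" "good a s b p"
proof -
 have E: "energy 2 N (%k. 0) p_init <= 2" for N
 proof -
 have "energy 2 N (%k. 0) p_init = (SUM k:{-N..N}. if k = 1 \<or> k = - 1 then 1 else 0)"
 unfolding energy_def by (intro sum.cong) (auto simp: p_init_def)
 also have "... = (SUM k:{-N..N} \<inter> {1, - 1}. 1)" by (rule sum.mono_neutral_cong_right) auto
 also have "... <= (SUM k:{1, - 1 :: int}. 1 :: real)" by (rule sum_mono2) auto
 finally show ?thesis by simp
 qed
 have R: "\<exists>C. \<forall>k. (wt k) ^ s * |p_init k| <= C" for s
 by (rule exI[of _ "2 ^ s"]) (auto simp: p_init_def)
 obtain b p where bp: "coef_solution (alpha a) {0..lifespan 2} b p" "rapid_on {0..lifespan 2} b" "rapid_on {0..lifespan 2} p"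
 "!!k. b k 0 = 0" "!!k. p k 0 = p_init k"
 by (rule coef_local_existence[OF alpha_props(1)[OF a] alpha_props(2)[OF a] alpha_props(3)[OF a], of 2 "%k. 0" p_init, OF _ _ _ _ R E])
 (use that in "auto simp: p_init_def")
 have "good a (lifespan 2) b p" using bp lifespan_pos[of 2] by (simp add: good_def csol_def)
 thus ?thesis by (rule that[rotated]) (rule lifespan_pos, simp)
qed

text \<open>T is the supremum of the existence times, finite by \<open>csol_time_bound\<close>. If
  \<open>Vint\<close> stayed bounded up to T, then so would the second order energy, and one
  lifespan would serve all restarting times; restarting close to T would lead beyond T.\<close>

theorem blowup_solution:
 assumes a: "a > 0"
 obtains T b p where "T > 0" "!!s. 0 < s ==> s < T ==> good a s b p" "!!Q. \<exists>s. 0 < s & s < T & Q < Vint a b s"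
proof -
 define A where "A = {s. s > 0 & (\<exists>b p. good a s b p)}"
 obtain s1 b1 p1 where g1: "s1 > 0" "good a s1 b1 p1" by (rule good_exists[OF a]) (rule that)
 hence s1: "s1 : A" unfolding A_def by blast
 define B where "B = 1 + 5 / min (a / (1 + a) / (2 * pi)) (mu / (2 * h)) *
 (in0 h (%x. (1 - cos (K * x)) / K * ct x) * (mu / (2 * h) * (in0 h (%x. (1 - cos (K * x)) / K * ct x))^2)) powr (- 1 / 5)"
 have up: "s <= max 1 B" if "s : A" for s
 proof (cases "s >= 1")
 case True
 obtain b p where g: "good a s b p" using \<open>s : A\<close> by (auto simp: A_def)
 have cs: "csol a s b p" using g by (simp add: good_def)
 have 0: "0 : {0..s}" using True by simp
 have th: "theta p x 0 = (1 - cos (K * x)) / K" for x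
 proof -
 have "((%x. theta p x 0 - (1 - cos (K * x)) / K) hrd 0) (at x)" for x
 using theta_deriv[OF csol_rapid(2)[OF cs] 0 csol_odd(4)[OF cs 0], of x] K_pos by (auto intro!: dei simp: good_init(2)[OF g])
 hence "theta p x 0 - (1 - cos (K * x)) / K = theta p 0 0 - (1 - cos (K * 0)) / K" by (intro DERIV_isconst_all) auto
 thus ?thesis using theta_0[OF csol_rapid(2)[OF cs] 0] by simp
 qed
 have "s <= B" using csol_time_bound[OF a cs True good_init[OF g]] unfolding th B_def .
 thus ?thesis by simp
 qed simp
 have bdd: "bdd_above A" using up by (rule bdd_aboveI)
 define T where "T = Sup A"
 have T0: "T > 0" using cSup_upper[OF s1 bdd] g1(1) by (simp add: T_def)
 have ex: "\<exists>q. \<exists>s>t. good a s (fst q) (snd q)" if t: "t < T" for t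
 proof -
 have "A ~= {}" using s1 by blast
 from less_cSup_iff[OF this bdd, of t] t obtain s where s: "s : A" "t < s" unfolding T_def by blast
 then obtain b p where "good a s b p" unfolding A_def by blast
 thus ?thesis using s(2) by (intro exI[of _ "(b, p)"] exI[of _ s]) simp
 qed
 \<comment> \<open>For each t a solution living past t is chosen separately. Uniqueness makes the
   choices agree, so reading each of them at its own time gives one solution on all of [0,
   T).\<close>
 define q where "q = (%t. SOME q. \<exists>s>t. good a s (fst q) (snd q))"
 have qg: "\<exists>s>t. good a s (fst (q t)) (snd (q t))" if "t < T" for t
 unfolding q_def by (rule someI_ex[OF ex[OF that]])
 define b where "b = (%k t. fst (q t) k t)"
 define p where "p = (%k t. snd (q t) k t)"
 have G: "good a s b p" if s: "0 < s" "s < T" for s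
 proof -
 obtain r where r: "r > s" "good a r (fst (q s)) (snd (q s))" using qg[OF s(2)] by blast
 let ?b = "fst (q s)" and ?p = "snd (q s)"
 have cr: "csol a s ?b ?p" using csol_restrict[of a r ?b ?p s] r s by (simp add: good_def)
 have e: "b k t = ?b k t & p k t = ?p k t" if t: "t : {0..s}" for k t
 proof (cases "t = s")
 case False
 hence ts: "t < s" "0 <= t" using t by auto
 obtain r' where r': "r' > t" "good a r' (fst (q t)) (snd (q t))" using qg[of t] ts s by auto
 define m where "m = min r' s"
 have m: "0 < m" "t : {0..m}" "m <= s" "m <= r'" using ts r' s by (auto simp: m_def)
 have c1: "csol a m ?b ?p" by (rule csol_restrict[OF cr m(1,3)])
 have c2: "csol a m (fst (q t)) (snd (q t))" by (rule csol_restrict[OF _ m(1,4)]) (use r' in "simp add: good_def")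
 have "fst (q t) k 0 = ?b k 0" "snd (q t) k 0 = ?p k 0" for k using r(2) r'(2) by (simp_all add: good_def)
 from csol_unique[OF a c1 c2 this m(2)] show ?thesis by (simp add: b_def p_def)
 qed (simp add: b_def p_def)
 have cs: "csol a s b p" by (rule csol_cong[OF cr]) (use e in auto)
 have 0: "0 : {0..s}" using s by simp
 show ?thesis using cs r(2) e[OF 0] by (simp add: good_def)
 qed
 have unb: "\<exists>s. 0 < s & s < T & Q < Vint a b s" for Q
 proof (rule ccontr)
 assume "\<not> (\<exists>s. 0 < s & s < T & Q < Vint a b s)"
 hence Q: "Vint a b s <= Q" if "0 < s" "s < T" for s using that by (meson not_le)
 have G': "csol a s b p" if "0 < s" "s < T" for s using G[OF that] by (simp add: good_def)
 obtain M where M: "M >= 0" "!!s N. 0 < s ==> s < T ==> energy 2 N (%k. b k s) (%k. p k s) <= M"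
 by (rule csol_energy_bound[OF a T0 G' Q]; (assumption | rule that; assumption))
 \<comment> \<open>Within half a lifespan of T, so that the restarted solution passes T; the maximum
   with T / 2 keeps t0 positive.\<close>
 define t0 where "t0 = max (T / 2) (T - lifespan M / 2)"
 have t0: "0 < t0" "t0 < T" "T < t0 + lifespan M" using T0 lifespan_pos[OF M(1)] by (auto simp: t0_def max_def)
 obtain b' p' where x: "csol a (t0 + lifespan M) b' p'" "!!k. b' k 0 = b k 0" "!!k. p' k 0 = p k 0"
 by (rule csol_extend[OF a G'[OF t0(1,2)] M(1) M(2)[OF t0(1,2)]]) (rule that)
 have "good a (t0 + lifespan M) b' p'" using x G[OF t0(1,2)] by (simp add: good_def)
 moreover have "0 < t0 + lifespan M" using t0 T0 by linarith
 ultimately have "t0 + lifespan M : A" unfolding A_def by blast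
 from cSup_upper[OF this bdd] show False using t0 by (simp add: T_def)
 qed
 show ?thesis by (rule that[OF T0 G unb])
qed

lemma integral_lower_bound:
 assumes a: "a > 0" and sol: "csol a r b p" and rt: "r <= t"
 and F: "!!ta. ta : {0..r} ==> ennreal (supn (us a b 1) ta) <= F ta"
 shows "ennreal (Vint a b r) <= (\<integral>\<^sup>+ ta\<in>{0..t}. F ta \<partial>lborel)"
proof -
 have c: "co {0..r} (supn (us a b 1))" by (rule supn_continuous[OF jcL[OF us_jc[OF a sol]]])
 have nn: "0 <= supn (us a b 1) ta" if "ta : {0..r}" for ta by (rule supn_nonneg[OF us_jc[OF a sol] that])
 have "integral\<^sup>N lborel (%ta. ennreal (indicator {0..r} ta * supn (us a b 1) ta)) = ennreal (Vint a b r)"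
 by (rule nn_integral_has_integral_lebesgue[OF nn integrable_integral[OF icr[OF c]]])
 moreover have "integral\<^sup>N lborel (%ta. ennreal (indicator {0..r} ta * supn (us a b 1) ta)) <= (\<integral>\<^sup>+ ta\<in>{0..t}. F ta \<partial>lborel)"
 by (rule nn_integral_mono) (use F rt in "auto simp: indicator_def")
 ultimately show ?thesis by simp
qed

theorem finite_time_blowup:
 assumes a: "a > 0" and m: "m >= 2"
 shows "\<exists>\<omega>0 \<theta>0. smooth_periodic L \<omega>0 & smooth_periodic L \<theta>0 & ci L \<omega>0 = 0 &
 (\<exists>(T :: real) \<omega> \<theta>. maximal_solution L a m \<omega>0 \<theta>0 (ereal T) \<omega> \<theta> &
 ((%t. \<integral>\<^sup>+ ta\<in>{0..t}. Linf_norm (deriv (%x. velocity L a (%y. \<omega> y ta) x)) \<partial>lborel) \<longlongrightarrow> \<infinity>) (at_left T))"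
proof -
 obtain T b p where T: "T > 0" and G: "!!s. 0 < s ==> s < T ==> good a s b p" and unb: "!!Q. \<exists>s. 0 < s & s < T & Q < Vint a b s"
 by (rule blowup_solution[OF a]) (rule that)
 have cs: "csol a s b p" if "0 < s" "s < T" for s using G[OF that] by (simp add: good_def)
 let ?w = "sr b 0" and ?th = "theta p"
 have cls: "classical_solution L a m (%x. ?w x 0) (%x. ?th x 0) (ereal T) ?w ?th" by (rule csol_classical[OF a T cs])
 have half: "0 < T / 2" "T / 2 < T" "0 : {0..T / 2}" using T by auto
 have w0: "(%x. ?w x 0) = (%x. 0)" using good_init(1)[OF G[OF half(1,2)]] by auto
 have sp: "smooth_periodic L (%x. ?th x 0)" unfolding theta_def by (rule smooth_periodic_fs[OF theta_eq(2)[OF csol_rapid(2)[OF cs[OF half(1,2)]] half(3)]])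
 have sw: "smooth_periodic L (%x. ?w x 0)"
 using smooth_periodic_fs[OF rapid_allw[OF csol_rapid(1)[OF cs[OF half(1,2)]] half(3)]] by (simp add: sr_def)
 have vel: "deriv (%x. velocity L a (%y. ?w y t) x) = (%x. us a b 1 x t)" if t: "0 <= t" "t < T" for t
 proof
 fix x
 define s where "s = (t + T) / 2"
 have s: "0 < s" "s < T" "t : {0..s}" using t T by (auto simp: s_def)
 show "deriv (%x. velocity L a (%y. ?w y t) x) x = us a b 1 x t"
 unfolding csol_pde(1)[OF a cs[OF s(1,2)] s(3)]
 by (rule DERIV_imp_deriv) (use csol_fields(3)[OF a cs[OF s(1,2)] s(3), of 0 x] in simp)
 qed
 have uniq: "w' x t = ?w x t & h' x t = ?th x t" if c: "classical_solution L a m (%x. ?w x 0) (%x. ?th x 0) T' w' h'" and t: "0 <= t" "ereal t < T'" "t < T" for T' w' h' t x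
 proof -
 have i: "w' x 0 = ?w x 0" "h' x 0 = ?th x 0" for x using c by (simp_all add: classical_solution_def)
 have c1: "cl_on a t w' h'" by (rule classical_cl_on[OF c m t(2)])
 have c2: "cl_on a t ?w ?th" by (rule classical_cl_on[OF cls m]) (use t in simp)
 from cl_unique[OF a t(1) c2 c1 i] show ?thesis by simp
 qed
 have max: "T' <= ereal T" if c: "classical_solution L a m (%x. ?w x 0) (%x. ?th x 0) T' w' h'" for T' w' h'
 proof (rule ccontr)
 assume "\<not> T' <= ereal T"
 hence lt: "ereal T < T'" by simp
 \<comment> \<open>A competitor living past T has a velocity gradient bounded on the closed interval
   [0, T]. It coincides with the constructed solution before T, so \<open>Vint\<close> would be at
   most B T, against its unboundedness.\<close>
 have cl: "cl_on a T w' h'" by (rule classical_cl_on[OF c m lt])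
 note F = cl_fields[OF a cl]
 have jT: "jc {0..L} {0..T} (sd (vm a) 1 w')" by (rule jc_subset[OF F(4)]) auto
 obtain B where B: "B >= 0" "!!x t. x : {0..L} ==> t : {0..T} ==> |sd (vm a) 1 w' x t| <= B"
 by (rule jc_bounded[OF jT compact_Icc compact_Icc]) (rule that)
 have sup: "supn (us a b 1) t <= B" if t: "0 <= t" "t < T" for t
 proof (rule supn_least)
 fix x assume x: "x : {0..L}"
 have tT: "t : {0..T}" using t by simp
 have e: "(%y. ?w y t) = (%y. w' y t)" using uniq[OF c t(1) le_less_trans[OF _ lt] t(2)] t by auto
 have "sd (vm a) 1 w' x t = deriv (%x. velocity L a (%y. w' y t) x) x"
 unfolding F(11)[OF tT] by (rule DERIV_imp_deriv[symmetric, OF F(9)[OF tT]])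
 also have "... = us a b 1 x t" unfolding e[symmetric] vel[OF t] ..
 finally show "|us a b 1 x t| <= B" using B(2)[OF x tT] by simp
 qed
 obtain s where s: "0 < s" "s < T" "B * T < Vint a b s" using unb by blast
 have "Vint a b s <= in0 s (%t. B)"
 by (rule integral_le) (use s sup in "auto intro!: icr supn_continuous[OF jcL[OF us_jc[OF a cs[OF s(1,2)]]]]")
 also have "... = B * s" using s by simp
 also have "... <= B * T" using s B(1) by (intro mlm) auto
 finally show False using s by simp
 qed
 have msol: "maximal_solution L a m (%x. ?w x 0) (%x. ?th x 0) (ereal T) ?w ?th"
 unfolding maximal_solution_def
 proof (intro conjI allI impI ballI)
 show "classical_solution L a m (%x. ?w x 0) (%x. ?th x 0) (ereal T) ?w ?th" by (rule cls)
 fix T' w' h' assume c: "classical_solution L a m (%x. ?w x 0) (%x. ?th x 0) T' w' h'"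
 show "T' <= ereal T" by (rule max[OF c])
 fix t x assume "t : time_interval T'"
 hence t: "0 <= t" "ereal t < T'" by (auto simp: time_interval_def)
 hence "t < T" using less_le_trans[OF t(2) max[OF c]] by simp
 from uniq[OF c t this] show "w' x t = ?w x t" "h' x t = ?th x t" by auto
 qed
 let ?F = "%t. \<integral>\<^sup>+ ta\<in>{0..t}. Linf_norm (deriv (%x. velocity L a (%y. ?w y ta) x)) \<partial>lborel"
 have "(?F \<longlongrightarrow> top) (at_left T)"
 proof (rule order_tendstoI)
 fix y :: ennreal assume y: "y < top"
 obtain Q where Q: "Q >= 0" "y = ennreal Q" using y by (cases y) auto
 obtain r where r: "0 < r" "r < T" "Q < Vint a b r" using unb by blast
 \<comment> \<open>Continuity in x makes every pointwise value, hence also the maximum over a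
   period, a lower bound for the essential supremum.\<close>
 have low: "ennreal (supn (us a b 1) ta) <= Linf_norm (deriv (%x. velocity L a (%y. ?w y ta) x))" if ta: "ta : {0..r}" for ta
 proof -
 have c: "co UNIV (%x. us a b 1 x ta)" by (rule jc_slice[OF us_jc[OF a cs[OF r(1,2)]] ta])
 have le: "ennreal |us a b 1 x ta| <= Linf_norm (%x. us a b 1 x ta)" for x by (rule Linf_norm_ge[OF c])
 have "ennreal (supn (us a b 1) ta) <= Linf_norm (%x. us a b 1 x ta)"
 proof (cases "Linf_norm (%x. us a b 1 x ta)")
 case (real z)
 have "supn (us a b 1) ta <= z"
 by (rule supn_least) (use le real in "simp add: ennreal_le_iff")
 thus ?thesis using real by (simp add: ennreal_leI)
 qed simp
 thus ?thesis using vel[of ta] ta r by simp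
 qed
 have "y < ?F t" if t: "t : {r<..<T}" for t
 proof -
 have "ennreal (Vint a b r) <= ?F t" by (rule integral_lower_bound[OF a cs[OF r(1,2)] _ low]) (use t in auto)
 moreover have "y < ennreal (Vint a b r)" using Q r by (simp add: ennreal_less_iff)
 ultimately show ?thesis by (rule less_le_trans[rotated])
 qed
 thus "\<forall>\<^sub>F t in at_left T. y < ?F t" using eventually_at_left_real[OF r(2)] by (rule eventually_mono[rotated])
 qed simp
 hence lim: "(?F \<longlongrightarrow> \<infinity>) (at_left T)" by (simp add: infinity_ennreal_def)
 have z: "ci L (%x. ?w x 0) = 0" unfolding w0 by simp
 show ?thesis using sw sp z msol lim by blast
qed

end

theorem theorem3p1:
  fixes L a :: real and m :: nat
  assumes "L > 0" and "a > 0" and "m \<ge> 2"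
  shows "\<exists>\<omega>0 \<theta>0. smooth_periodic L \<omega>0 \<and> smooth_periodic L \<theta>0 \<and>
           circle_integral L \<omega>0 = 0 \<and>
           (\<exists>(T :: real) \<omega> \<theta>.
              maximal_solution L a m \<omega>0 \<theta>0 (ereal T) \<omega> \<theta> \<and>
              ((\<lambda>t. \<integral>\<^sup>+ \<tau>\<in>{0..t}.
                   Linf_norm (deriv (\<lambda>x. velocity L a (\<lambda>y. \<omega> y \<tau>) x)) \<partial>lborel)
                 \<longlongrightarrow> \<infinity>) (at_left T))"
proof -
  interpret circle L by standard (rule assms(1))
  show ?thesis by (rule finite_time_blowup[OF assms(2,3)])
qed

end
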